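(* Let $s\in(0,1)$, $m>0$, $2^*_s=6/(3-2s)$ and $p\in(2,2^*_s)$. Suppose that $A:\mathbb{R}^3\to\mathbb{R}^3$ satisfies one of the following: (i) $A(x)=Ax$ for $x\in\mathbb{R}^3$, where (on the right) $A$ is a $3\times3$ real symmetric constant matrix; or (ii) $A$ is a (continuous) vector field with locally bounded gradient, $A$ satisfies assumption $(\mathcal{A}_b)$, and $\mathcal{M}_A<\inf_{\Xi}\mathcal{M}_{A_\Xi}$, where the infimum is over all unbounded sequences $\Xi\subset\mathbb{R}^3$ and $A_\Xi$ is the field associated with $\Xi$ by $(\mathcal{A}_b)$. Then there exists a nontrivial (weak) solution $u\in H^s_A(\mathbb{R}^3,\mathbb{C})$ to $$(-\Delta+m^2)^s_A u=|u|^{p-2}u\quad\text{in }\mathbb{R}^3.$$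
   Context: $C_s:=\dfrac{s\,2^{\frac{2s-1}{2}}}{\pi^{3/2}\,\Gamma(1-s)}$, where $\Gamma$ is the Gamma function. $\mathcal{K}_\nu$ is the modified Bessel function (also called MacDonald function) of order $\nu$: $\mathcal{K}_\nu(\zeta)=\frac12\left(\frac{\zeta}{2}\right)^\nu\int_0^{+\infty}e^{-\frac{\zeta^2}{4t}-t}t^{-1-\nu}\,dt$ for $\zeta>0$. For a field $A:\mathbb{R}^3\to\mathbb{R}^3$ and measurable $u,v:\mathbb{R}^3\to\mathbb{C}$ put $$\langle u,v\rangle_{A,s}:=\Re\int_{\mathbb{R}^3\times\mathbb{R}^3}\frac{\left(e^{-i(x-y)\cdot A\left(\frac{x+y}{2}\right)}u(x)-u(y)\right)\overline{\left(e^{-i(x-y)\cdot A\left(\frac{x+y}{2}\right)}v(x)-v(y)\right)}}{|x-y|^{\frac{3+2s}{2}}}\,\mathcal{K}_{\frac{3+2s}{2}}(m|x-y|)\,dx\,dy,$$ $(u,v)_{A,s}:=\frac{C_s}{2}m^{\frac{3+2s}{2}}\langle u,v\rangle_{A,s}+m^{2s}\Re\int_{\mathbb{R}^3}u\overline{v}\,dx$ and $\|u\|_{A,s}:=\sqrt{(u,u)_{A,s}}$. $H^s_A(\mathbb{R}^3,\mathbb{C})$ is the closure of $C^\infty_c(\mathbb{R}^3,\mathbb{C})$ in $\mathcal{H}:=\{u:\mathbb{R}^3\to\mathbb{C}: (u,u)_{A,s}<+\infty\}$ with respect to $\|\cdot\|_{A,s}$. Set $$\mathcal{M}_A:=\inf\{\|u\|_{A,s}^2: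 u\in H^s_A(\mathbb{R}^3,\mathbb{C}),\ \|u\|_{L^p(\mathbb{R}^3,\mathbb{C})}=1\},$$ and $\mathcal{M}_{A_\Xi}$ is defined in the same way with $A_\Xi$ in place of $A$. Assumption $(\mathcal{A}_b)$: for any unbounded sequence $\Xi=\{\xi_n\}_n\subset\mathbb{R}^3$ there exist a sequence $\{H_n\}_n\subset\mathbb{R}^3$ and a function $A_\Xi:\mathbb{R}^3\to\mathbb{R}^3$ such that, for a subsequence of $\Xi$, still denoted $\{\xi_n\}_n$, with $|\xi_n|\to+\infty$, setting $A_n(x):=A(x+\xi_n)+H_n$: (1) $\lim_nA_n(x)=A_\Xi(x)$ for all $x\in\mathbb{R}^3$; (2) $\sup_{n}\|A_n\|_{L^\infty(K,\mathbb{R}^3)}<+\infty$ for every compact set $K$. $u\in H^s_A(\mathbb{R}^3,\mathbb{C})$ is a weak solution of $(-\Delta+m^2)^s_Au=|u|^{p-2}u$ in $\mathbb{R}^3$ if $(u,v)_{A,s}=\Re\int_{\mathbb{R}^3}|u|^{p-2}u\,\overline{v}\,dx$ for every $v\in H^s_A(\mathbb{R}^3,\mathbb{C})$. "Locally bounded gradient" means that $\nabla A$ exists and is bounded on every compact set. *)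

theory Defs
  imports "HOL-Analysis.Analysis" "HOL-Probability.Essential_Supremum"
begin

text \<open>
  Functions are not identified almost everywhere. Measurable means Borel measurable; since every
  Lebesgue measurable function agrees almost everywhere with a Borel one, this does not change
  the function spaces up to almost-everywhere equality.
\<close>

definition bessel_K :: "real \<Rightarrow> real \<Rightarrow> real" where
  "bessel_K \<nu> \<zeta> = 1 / 2 * (\<zeta> / 2) powr \<nu>
     * (LINT t:{0<..}|lborel. exp (- (\<zeta>\<^sup>2 / (4 * t)) - t) * t powr (- 1 - \<nu>))"

definition C_const :: "real \<Rightarrow> real" where
  "C_const s = s * 2 powr ((2 * s - 1) / 2) / (pi powr (3 / 2) * Gamma (1 - s))"

definition mag_diff :: "(real^3 \<Rightarrow> real^3) \<Rightarrow> (real^3 \<Rightarrow> complex) \<Rightarrow> real^3 \<Rightarrow> real^3 \<Rightarrow> complex"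
  where "mag_diff A u x y =
     exp (- (\<i> * of_real ((x - y) \<bullet> A ((x + y) /\<^sub>R 2)))) * u x - u y"

definition form_density ::
  "real \<Rightarrow> real \<Rightarrow> (real^3 \<Rightarrow> real^3) \<Rightarrow> (real^3 \<Rightarrow> complex) \<Rightarrow> (real^3 \<Rightarrow> complex)
    \<Rightarrow> (real^3) \<times> (real^3) \<Rightarrow> complex"
  where "form_density s m A u v = (\<lambda>(x, y).
     mag_diff A u x y * cnj (mag_diff A v x y)
       / of_real (norm (x - y) powr ((3 + 2 * s) / 2))
       * of_real (bessel_K ((3 + 2 * s) / 2) (m * norm (x - y))))"

definition mag_form ::
  "real \<Rightarrow> real \<Rightarrow> (real^3 \<Rightarrow> real^3) \<Rightarrow> (real^3 \<Rightarrow> complex) \<Rightarrow> (real^3 \<Rightarrow> complex) \<Rightarrow> real"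
  where "mag_form s m A u v = Re (LINT z|lborel. form_density s m A u v z)"

definition mag_inner ::
  "real \<Rightarrow> real \<Rightarrow> (real^3 \<Rightarrow> real^3) \<Rightarrow> (real^3 \<Rightarrow> complex) \<Rightarrow> (real^3 \<Rightarrow> complex) \<Rightarrow> real"
  where "mag_inner s m A u v =
     C_const s / 2 * m powr ((3 + 2 * s) / 2) * mag_form s m A u v
       + m powr (2 * s) * Re (LINT x|lborel. u x * cnj (v x))"

definition mag_norm ::
  "real \<Rightarrow> real \<Rightarrow> (real^3 \<Rightarrow> real^3) \<Rightarrow> (real^3 \<Rightarrow> complex) \<Rightarrow> real"
  where "mag_norm s m A u = sqrt (mag_inner s m A u u)"

text \<open>
  The Bochner integral of a non-integrable function is 0, so finiteness of the energy
  \<^term>\<open>mag_inner s m A u u\<close> has to be stated as integrability of its two densities; for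
  \<open>v = u\<close> both are nonnegative, so this says exactly that both integrals are finite.
\<close>

definition energy_space :: "real \<Rightarrow> real \<Rightarrow> (real^3 \<Rightarrow> real^3) \<Rightarrow> (real^3 \<Rightarrow> complex) set"
  where "energy_space s m A =
     {u. u \<in> borel_measurable lborel
         \<and> integrable lborel (form_density s m A u u)
         \<and> integrable lborel (\<lambda>x. u x * cnj (u x))}"

text \<open>
  The class \<open>C\<^sup>k\<close>: everywhere differentiable, with all partial derivatives
  of class \<open>C\<^bsup>k-1\<^esup>\<close>.
\<close>

primrec C_k :: "nat \<Rightarrow> (real^3 \<Rightarrow> complex) \<Rightarrow> bool" where
  "C_k 0 f \<longleftrightarrow> continuous_on UNIV f"
| "C_k (Suc k) f \<longleftrightarrow> (\<forall>x. f differentiable at x)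
     \<and> (\<forall>b\<in>Basis. C_k k (\<lambda>x. frechet_derivative f (at x) b))"

definition test_functions :: "(real^3 \<Rightarrow> complex) set" where
  "test_functions = {\<phi>. (\<forall>k. C_k k \<phi>) \<and> compact (closure {x. \<phi> x \<noteq> 0})}"

text \<open>
  Closure of the test functions with respect to the seminorm. The intersection with the energy
  space is no restriction for locally bounded measurable \<open>A\<close>, where every test
  function has finite energy.
\<close>

definition mag_sobolev :: "real \<Rightarrow> real \<Rightarrow> (real^3 \<Rightarrow> real^3) \<Rightarrow> (real^3 \<Rightarrow> complex) set"
  where "mag_sobolev s m A =
     {u \<in> energy_space s m A. \<forall>\<epsilon>>0. \<exists>\<phi>\<in>test_functions \<inter> energy_space s m A.
        mag_norm s m A (\<lambda>x. u x - \<phi> x) < \<epsilon>}"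

definition Lp_norm :: "real \<Rightarrow> (real^3 \<Rightarrow> complex) \<Rightarrow> real" where
  "Lp_norm p u = (LINT x|lborel. norm (u x) powr p) powr (1 / p)"

text \<open>
  The condition \<open>Lp_norm p u = 1\<close> entails that \<open>u\<close> is in \<open>L\<^sup>p\<close>: otherwise the Bochner integral,
  and hence \<^term>\<open>Lp_norm p u\<close>, is 0.
\<close>

definition min_level :: "real \<Rightarrow> real \<Rightarrow> real \<Rightarrow> (real^3 \<Rightarrow> real^3) \<Rightarrow> real" where
  "min_level s m p A = Inf {(mag_norm s m A u)\<^sup>2 | u. u \<in> mag_sobolev s m A \<and> Lp_norm p u = 1}"

definition unbounded_seqs :: "(nat \<Rightarrow> real^3) set" where
  "unbounded_seqs = {\<Xi>. \<not> bounded (range \<Xi>)}"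

text \<open>
  \<open>limit_field A \<Xi> B\<close>: the field \<open>B\<close> is an admissible choice of the field associated with \<open>\<Xi>\<close>.
  The subsequence is \<open>\<Xi> \<circ> r\<close>. On a compact set of measure zero the library's essential supremum
  is \<open>-\<infinity>\<close> rather than 0, which does not affect the finiteness condition.
\<close>

definition limit_field ::
  "(real^3 \<Rightarrow> real^3) \<Rightarrow> (nat \<Rightarrow> real^3) \<Rightarrow> (real^3 \<Rightarrow> real^3) \<Rightarrow> bool"
  where "limit_field A \<Xi> B \<longleftrightarrow>
     (\<exists>(H :: nat \<Rightarrow> real^3) (r :: nat \<Rightarrow> nat). strict_mono r
        \<and> filterlim (\<lambda>n. norm (\<Xi> (r n))) at_top sequentially
        \<and> (\<forall>x. (\<lambda>n. A (x + \<Xi> (r n)) + H n) \<longlonglongrightarrow> B x)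
        \<and> (\<forall>K. compact K \<longrightarrow>
             (SUP n. esssup (restrict_space lborel K)
                       (\<lambda>x. ereal (norm (A (x + \<Xi> (r n)) + H n)))) < \<infinity>))"

definition assumption_Ab :: "(real^3 \<Rightarrow> real^3) \<Rightarrow> bool" where
  "assumption_Ab A \<longleftrightarrow> (\<forall>\<Xi>\<in>unbounded_seqs. \<exists>B. limit_field A \<Xi> B)"

definition locally_bounded_gradient :: "(real^3 \<Rightarrow> real^3) \<Rightarrow> bool" where
  "locally_bounded_gradient A \<longleftrightarrow> (\<forall>x. A differentiable at x)
     \<and> (\<forall>K. compact K \<longrightarrow> bounded ((\<lambda>x. jacobian A (at x)) ` K))"

definition weak_solution ::
  "real \<Rightarrow> real \<Rightarrow> real \<Rightarrow> (real^3 \<Rightarrow> real^3) \<Rightarrow> (real^3 \<Rightarrow> complex) \<Rightarrow> bool"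
  where "weak_solution s m p A u \<longleftrightarrow> u \<in> mag_sobolev s m A
     \<and> (\<forall>v\<in>mag_sobolev s m A. mag_inner s m A u v =
          Re (LINT x|lborel. of_real (norm (u x) powr (p - 2)) * u x * cnj (v x)))"

end

theory Submission
  imports Defs "HOL-Library.Diagonal_Subsequence" "HOL-Probability.Probability_Measure"
begin

text \<open>
  The solution is a multiple of a minimizer. Write \<open>M\<close> for the infimum of the energy
  \<open>\<parallel>u\<parallel>\<^bsub>A,s\<^esub>\<^sup>2\<close> under the constraint \<open>\<integral>|u|\<^sup>p = 1\<close>. It is positive, because \<open>p\<close> is subcritical
  and the diamagnetic inequality reduces the Sobolev inequality to the case without a field.
  If \<open>U\<close> attains it, the energy of \<open>U + t v\<close> is bounded below by \<open>M\<close> times the power \<open>2/p\<close> of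
  \<open>\<integral>|U + t v|\<^sup>p\<close>; comparing first order terms in \<open>t\<close> gives
  \<open>(U, v)\<^bsub>A,s\<^esub> = M Re \<integral>|U|\<^bsup>p-2\<^esup> U cnj v\<close>, and \<open>M\<^bsup>1/(p-2)\<^esup> U\<close> is a weak solution
  (\<open>minimizer_gives_weak_solution\<close>). What has to be excluded is that a minimizing sequence
  loses mass.

  It cannot spread out. If a sequence of bounded energy has small \<open>L\<^sup>2\<close> mass in every unit
  ball, then it has small \<open>L\<^sup>p\<close> norm (\<open>vanishing\<close>). The reason is local: where \<open>|u|\<close> is large
  at \<open>x\<close>, either \<open>|u|\<close> is comparably large on half of a small ball about \<open>x\<close>, or the kernel,
  which is at least \<open>c|z|\<^bsup>-(3+2s)\<^esup>\<close> near \<open>0\<close>, sees a large difference quotient. Hence almost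
  minimizers carry a fixed amount of mass in a unit ball about some point \<open>\<xi>\<^sub>n\<close>.

  It cannot split. Some dyadic annulus about \<open>\<xi>\<^sub>n\<close> contains little \<open>L\<^sup>p\<close> mass. Cutting there
  with \<open>\<theta>\<^sup>2 + \<eta>\<^sup>2 = 1\<close>, the energies of the two pieces add up to nearly the whole energy
  (\<open>energy_localization\<close>), whereas \<open>t\<^bsup>2/p\<^esup>\<close> is strictly concave, so two pieces with \<open>L\<^sup>p\<close>
  masses \<open>a\<close> and \<open>b\<close> bounded away from \<open>0\<close> cost at least \<open>M (a\<^bsup>2/p\<^esup> + b\<^bsup>2/p\<^esup>)\<close>, which exceeds
  \<open>M\<close> by a fixed amount. So all but \<open>\<epsilon>\<close> of the \<open>L\<^sup>p\<close> mass stays within distance \<open>R(\<epsilon>)\<close> of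
  \<open>\<xi>\<^sub>n\<close> (\<open>energy_tight\<close>).

  If the \<open>\<xi>\<^sub>n\<close> can be taken to be \<open>0\<close>, a minimizer exists (\<open>tight_minimizing_sequence\<close>): a
  subsequence converges in \<open>L\<^sup>2\<close> on every ball and there is little mass far out, so
  differences of late members have small \<open>L\<^sup>2\<close> mass in every unit ball, and by \<open>vanishing\<close> the
  subsequence is Cauchy in \<open>L\<^sup>p\<close>. The parallelogram identity then makes it Cauchy in energy,
  since the midpoint of two almost minimizers that are close in \<open>L\<^sup>p\<close> has energy at least
  nearly \<open>M\<close>. The energy space is complete.

  It remains to control the centres. A translation by \<open>\<xi>\<close> together with the phase \<open>e\<^bsup>i x \<bullet> h\<^esup>\<close>
  turns the energy for \<open>A\<close> into the energy for the field \<open>x \<mapsto> A(x + \<xi>) + h\<close> (\<open>energy_gauge\<close>).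
  For a linear field \<open>h = -A \<xi>\<close> gives back \<open>A\<close>, so all centres may be moved to \<open>0\<close>
  (\<open>translation_covariant_minimizer\<close>). In the second case, an unbounded sequence of centres
  would yield almost minimizers for \<open>A\<close> that, after this transformation and a cutoff, are
  competitors for the limit field \<open>A\<^sub>\<Xi>\<close> of almost the same energy; then the level of \<open>A\<^sub>\<Xi>\<close>
  would not exceed that of \<open>A\<close> (\<open>level_le_of_escaping_sequence\<close>), against the assumed gap. So
  the centres stay bounded (\<open>energy_gap_minimizer\<close>).

  Energies and masses are integrals with values in the extended nonnegative reals, so that
  sums and limits need no integrability conditions. Instead of the triangle inequality for
  norms, the weighted inequality \<open>(a + b)\<^sup>q \<le> (1 - l)\<^bsup>1-q\<^esup> a\<^sup>q + l\<^bsup>1-q\<^esup> b\<^sup>q\<close> is integrated and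
  \<open>l\<close> is sent to \<open>0\<close>.
\<close>

section \<open>Bounds for the Macdonald function\<close>

lemma powr_le_exp:
  fixes x b :: real
  assumes "0 < b" "0 \<le> x"
  shows "x powr b \<le> b powr b * exp x"
proof (cases "x = 0")
  case False
  then have x: "x > 0" using assms by simp
  have "ln (x / b) \<le> x / b" using ln_bound[of "x / b"] x assms by simp
  then have "b * ln (x / b) \<le> x" using assms by (simp add: field_simps)
  then have "(x / b) powr b \<le> exp x" using x assms by (simp add: powr_def)
  then show ?thesis using x assms by (simp add: powr_divide field_simps)
qed (use assms in auto)

definition bessel_integrand :: "real \<Rightarrow> real \<Rightarrow> real \<Rightarrow> real" where
  "bessel_integrand \<nu> \<zeta> t = indicator {0<..} t * (exp (- (\<zeta>\<^sup>2 / (4 * t)) - t) * t powr (- 1 - \<nu>))"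

lemma bessel_integrand_measurable [measurable]:
  "(\<lambda>x. bessel_integrand \<nu> (fst x) (snd x)) \<in> borel_measurable (borel \<Otimes>\<^sub>M borel)"
  unfolding bessel_integrand_def by measurable

lemma bessel_integrand_measurable' [measurable]:
  "bessel_integrand \<nu> \<zeta> \<in> borel_measurable borel"
  unfolding bessel_integrand_def by measurable

lemma bessel_integrand_nonneg: "0 \<le> bessel_integrand \<nu> \<zeta> t"
  unfolding bessel_integrand_def by (auto simp: indicator_def)

lemma bessel_K_alt: "bessel_K \<nu> \<zeta> = 1 / 2 * (\<zeta> / 2) powr \<nu> * (LINT t|lborel. bessel_integrand \<nu> \<zeta> t)"
  unfolding bessel_K_def set_lebesgue_integral_def bessel_integrand_def by simp

text \<open>
  For every \<open>\<beta> > \<nu>\<close> the factor \<open>exp (- \<zeta>\<^sup>2 / (4 * t))\<close> is at most a multiple of \<open>(t / \<zeta>\<^sup>2)\<^sup>\<beta>\<close>;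
  what remains is the integral for \<open>Gamma (\<beta> - \<nu>)\<close>. The free parameter \<open>\<beta>\<close> trades decay at
  infinity against growth at \<open>0\<close>.
\<close>

lemma bessel_nn_upper:
  assumes "0 < \<nu>" "\<nu> < \<beta>" "0 < \<zeta>"
  shows "(\<integral>\<^sup>+t. ennreal (bessel_integrand \<nu> \<zeta> t) \<partial>lborel)
    \<le> ennreal ((4 * \<beta>) powr \<beta> * \<zeta> powr (- 2 * \<beta>) * Gamma (\<beta> - \<nu>))"
proof -
  define C where "C = (4 * \<beta>) powr \<beta> * \<zeta> powr (- 2 * \<beta>)"
  have C0: "C \<ge> 0" by (simp add: C_def)
  have pt: "bessel_integrand \<nu> \<zeta> t \<le> C * (indicator {0..} t * t powr (\<beta> - \<nu> - 1) / exp t)" for t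
  proof (cases "t > 0")
    case True
    have b0: "\<beta> > 0" using assms by simp
    let ?x = "\<zeta>\<^sup>2 / (4 * t)"
    have x0: "?x > 0" using True assms by simp
    have "?x powr \<beta> \<le> \<beta> powr \<beta> * exp ?x" using powr_le_exp[OF b0, of ?x] x0 by simp
    then have "exp (- ?x) \<le> \<beta> powr \<beta> / ?x powr \<beta>"
      by (subst pos_le_divide_eq) (use x0 in \<open>auto simp: exp_minus divide_inverse[symmetric] field_simps\<close>)
    also have "\<dots> = C * t powr \<beta>"
      using assms True b0
      by (simp add: C_def powr_divide powr_mult powr_minus field_simps powr_powr flip: powr_numeral)
    finally have 1: "exp (- ?x) \<le> C * t powr \<beta>" .
    have "bessel_integrand \<nu> \<zeta> t = exp (- ?x) * (exp (- t) * t powr (-1-\<nu>))"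
      using True by (simp add: bessel_integrand_def flip: exp_add)
    also have "\<dots> \<le> (C * t powr \<beta>) * (exp (- t) * t powr (-1-\<nu>))"
      by (rule mult_right_mono[OF 1]) simp
    also have "\<dots> = C * (t powr (\<beta> - \<nu> - 1) / exp t)"
      using True by (simp add: exp_minus field_simps flip: powr_add)
    finally show ?thesis using True by simp
  qed (use C0 in \<open>auto simp: bessel_integrand_def indicator_def\<close>)
  have "(\<integral>\<^sup>+t. ennreal (bessel_integrand \<nu> \<zeta> t) \<partial>lborel)
      \<le> (\<integral>\<^sup>+t. ennreal C * ennreal (indicator {0..} t * t powr (\<beta> - \<nu> - 1) / exp t) \<partial>lborel)"
    using pt by (intro nn_integral_mono) (auto simp: C0 simp flip: ennreal_mult')
  also have "\<dots> = ennreal C * ennreal (Gamma (\<beta> - \<nu>))"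
    using Gamma_conv_nn_integral_real[of "\<beta> - \<nu>"] assms
    by (subst nn_integral_cmult) auto
  finally show ?thesis using C0 Gamma_real_pos[of "\<beta> - \<nu>"] assms
    by (simp add: C_def ennreal_mult)
qed

lemma bessel_integrable:
  assumes "0 < \<nu>" "0 < \<zeta>"
  shows "integrable lborel (bessel_integrand \<nu> \<zeta>)"
  using bessel_nn_upper[of \<nu> "\<nu> + 1" \<zeta>] assms
  by (intro integrableI_nonneg) (auto simp: bessel_integrand_nonneg intro: le_less_trans)

lemma bessel_nn_eq:
  assumes "0 < \<nu>" "0 < \<zeta>"
  shows "(\<integral>\<^sup>+t. ennreal (bessel_integrand \<nu> \<zeta> t) \<partial>lborel) = ennreal (LINT t|lborel. bessel_integrand \<nu> \<zeta> t)"
  by (rule nn_integral_eq_integral) (use assms bessel_integrable bessel_integrand_nonneg in auto)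

lemma bessel_K_upper:
  assumes "0 < \<nu>" "\<nu> < \<beta>" "0 < \<zeta>"
  shows "bessel_K \<nu> \<zeta> \<le> (4 * \<beta>) powr \<beta> * Gamma (\<beta> - \<nu>) * \<zeta> powr (\<nu> - 2 * \<beta>)"
proof -
  have G: "Gamma (\<beta> - \<nu>) > 0" using assms by (intro Gamma_real_pos) simp
  have "(LINT t|lborel. bessel_integrand \<nu> \<zeta> t) \<le> (4 * \<beta>) powr \<beta> * \<zeta> powr (- 2 * \<beta>) * Gamma (\<beta> - \<nu>)"
    using bessel_nn_upper[OF assms] bessel_nn_eq[of \<nu> \<zeta>] assms G by (simp add: ennreal_le_iff)
  then have "bessel_K \<nu> \<zeta> \<le> 1 / 2 * (\<zeta> / 2) powr \<nu> * ((4 * \<beta>) powr \<beta> * \<zeta> powr (- 2 * \<beta>) * Gamma (\<beta> - \<nu>))"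
    unfolding bessel_K_alt by (intro mult_left_mono) auto
  also have "\<dots> \<le> \<zeta> powr \<nu> * ((4 * \<beta>) powr \<beta> * \<zeta> powr (- 2 * \<beta>) * Gamma (\<beta> - \<nu>))"
  proof (rule mult_right_mono)
    have "(\<zeta> / 2) powr \<nu> \<le> \<zeta> powr \<nu>" using assms by (intro powr_mono2) auto
    moreover have "0 \<le> (\<zeta> / 2) powr \<nu>" by simp
    ultimately show "1 / 2 * (\<zeta> / 2) powr \<nu> \<le> \<zeta> powr \<nu>" by linarith
  qed (use G in auto)
  also have "\<dots> = (4 * \<beta>) powr \<beta> * Gamma (\<beta> - \<nu>) * (\<zeta> powr \<nu> * \<zeta> powr (- 2 * \<beta>))" by simp
  also have "\<zeta> powr \<nu> * \<zeta> powr (- 2 * \<beta>) = \<zeta> powr (\<nu> - 2 * \<beta>)" by (simp flip: powr_add)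
  finally show ?thesis .
qed

lemma bessel_K_nonneg: "0 \<le> bessel_K \<nu> \<zeta>"
  unfolding bessel_K_alt by (intro mult_nonneg_nonneg integral_nonneg_AE) (auto simp: bessel_integrand_nonneg)

text \<open>
  The interval from \<open>\<zeta>\<^sup>2\<close> to \<open>2 * \<zeta>\<^sup>2\<close> alone, where \<open>\<zeta>\<^sup>2 / (4 * t)\<close> is at most \<open>1/4\<close>,
  contributes the right power of \<open>\<zeta>\<close>.
\<close>

lemma bessel_K_lower:
  assumes "0 < \<nu>" "0 < \<zeta>"
  shows "exp (- 1 / 4 - 2 * \<zeta>\<^sup>2) * 2 powr (- 2 - 2 * \<nu>) * \<zeta> powr (- \<nu>) \<le> bessel_K \<nu> \<zeta>"
proof -
  define c where "c = exp (- 1 / 4 - 2 * \<zeta>\<^sup>2) * (2 * \<zeta>\<^sup>2) powr (- 1 - \<nu>)"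
  have c0: "c \<ge> 0" by (simp add: c_def)
  have pt: "c * indicator {\<zeta>\<^sup>2..2 * \<zeta>\<^sup>2} t \<le> bessel_integrand \<nu> \<zeta> t" for t
  proof (cases "t \<in> {\<zeta>\<^sup>2..2 * \<zeta>\<^sup>2}")
    case True
    have z2: "\<zeta>\<^sup>2 > 0" using assms by simp
    have t: "t \<ge> \<zeta>\<^sup>2" "t \<le> 2 * \<zeta>\<^sup>2" using True by auto
    then have "t > 0" using z2 by linarith
    note t = this t
    have "\<zeta>\<^sup>2 / (4 * t) \<le> 1 / 4" using t by (simp add: field_simps)
    then have "- 1 / 4 - 2 * \<zeta>\<^sup>2 \<le> - (\<zeta>\<^sup>2 / (4 * t)) - t" using t by linarith
    then have "exp (- 1 / 4 - 2 * \<zeta>\<^sup>2) \<le> exp (- (\<zeta>\<^sup>2 / (4 * t)) - t)" by (subst exp_le_cancel_iff)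
    moreover have "(2 * \<zeta>\<^sup>2) powr (- 1 - \<nu>) \<le> t powr (- 1 - \<nu>)"
      using t assms by (intro powr_mono2') auto
    ultimately show ?thesis using True t unfolding c_def bessel_integrand_def
      by (auto intro!: mult_mono)
  qed (auto simp: bessel_integrand_nonneg)
  have "c * \<zeta>\<^sup>2 = (LINT t|lborel. c * indicator {\<zeta>\<^sup>2..2 * \<zeta>\<^sup>2} t)" by simp
  also have "\<dots> \<le> (LINT t|lborel. bessel_integrand \<nu> \<zeta> t)"
    using pt bessel_integrable[OF assms] by (intro integral_mono) auto
  finally have "1 / 2 * (\<zeta> / 2) powr \<nu> * (c * \<zeta>\<^sup>2) \<le> bessel_K \<nu> \<zeta>"
    unfolding bessel_K_alt by (intro mult_left_mono) auto
  also have "1 / 2 * (\<zeta> / 2) powr \<nu> * (c * \<zeta>\<^sup>2) =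
      exp (- 1 / 4 - 2 * \<zeta>\<^sup>2) * (2 powr (- 1) * (\<zeta> powr \<nu> * 2 powr (- \<nu>)) * (2 powr (-1 - \<nu>) * (\<zeta> powr 2) powr (-1-\<nu>)) * \<zeta> powr 2)"
  proof -
    have 1: "(\<zeta> / 2) powr \<nu> = \<zeta> powr \<nu> * 2 powr (- \<nu>)"
      using assms by (simp add: powr_divide powr_minus_divide)
    have 2: "\<zeta>\<^sup>2 = \<zeta> powr 2" using assms by simp
    have 3: "(2 * \<zeta>\<^sup>2) powr (- 1 - \<nu>) = 2 powr (-1 - \<nu>) * (\<zeta> powr 2) powr (-1-\<nu>)"
      unfolding 2 by (rule powr_mult)
    have 4: "1 / 2 = (2::real) powr (- 1)" by (simp add: powr_minus)
    show ?thesis unfolding c_def 1 3 4 using 2 by simp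
  qed
  also have "\<dots> = exp (- 1 / 4 - 2 * \<zeta>\<^sup>2) * ((2 powr (- 1) * 2 powr (- \<nu>) * 2 powr (-1 - \<nu>)) * (\<zeta> powr \<nu> * \<zeta> powr (2 * (-1-\<nu>)) * \<zeta> powr 2))"
    by (simp only: powr_powr mult_ac)
  also have "(2 powr (- 1) * 2 powr (- \<nu>) * 2 powr (-1 - \<nu>)) = (2::real) powr (-2 - 2 * \<nu>)"
    by (simp only: powr_add[symmetric]) simp
  also have "\<zeta> powr \<nu> * \<zeta> powr (2 * (-1-\<nu>)) * \<zeta> powr 2 = \<zeta> powr (- \<nu>)"
    by (simp only: flip: powr_add) (simp add: algebra_simps)
  finally show ?thesis by simp
qed

lemma bessel_K_measurable [measurable]: "bessel_K \<nu> \<in> borel_measurable borel"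
proof -
  have "(\<lambda>\<zeta>. LINT t|lborel. bessel_integrand \<nu> \<zeta> t) \<in> borel_measurable borel"
    by measurable
  then show ?thesis unfolding bessel_K_alt[abs_def] by measurable
qed

section \<open>Translations, convolutions and truncated powers\<close>

lemma nn_integral_reflect_translate:
  fixes f :: "'a::euclidean_space \<Rightarrow> ennreal"
  assumes [measurable]: "f \<in> borel_measurable borel"
  shows "(\<integral>\<^sup>+y. f (x - y) \<partial>lborel) = (\<integral>\<^sup>+y. f y \<partial>lborel)"
proof -
  have "(lborel :: 'a measure) = density (distr lborel borel (\<lambda>y. x + (- 1) *\<^sub>R y)) (\<lambda>_. 1)"
    using lborel_affine[of "-1" x] by simp
  also have "\<dots> = distr lborel borel (\<lambda>y. x - y)" by (simp add: density_1)
  finally have "(\<integral>\<^sup>+y. f y \<partial>lborel) = (\<integral>\<^sup>+y. f y \<partial>(distr lborel borel (\<lambda>y. x - y)))" by simp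
  also have "\<dots> = (\<integral>\<^sup>+y. f (x - y) \<partial>lborel)" by (subst nn_integral_distr) auto
  finally show ?thesis by simp
qed

lemma nn_integral_translate:
  fixes f :: "'a::euclidean_space \<Rightarrow> ennreal"
  assumes [measurable]: "f \<in> borel_measurable borel"
  shows "(\<integral>\<^sup>+y. f (y + x) \<partial>lborel) = (\<integral>\<^sup>+y. f y \<partial>lborel)"
proof -
  have "(\<integral>\<^sup>+y. f y \<partial>lborel) = (\<integral>\<^sup>+y. f y \<partial>(distr lborel borel ((+) x)))" by (simp add: lborel_distr_plus)
  also have "\<dots> = (\<integral>\<^sup>+y. f (x + y) \<partial>lborel)" by (subst nn_integral_distr) auto
  finally show ?thesis by (simp add: add.commute)
qed

lemma borel_measurable_fst_borel [measurable]:
  "fst \<in> borel_measurable (borel :: ('a::second_countable_topology \<times> 'b::second_countable_topology) measure)"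
  by (intro borel_measurable_continuous_onI continuous_intros)

lemma borel_measurable_snd_borel [measurable]:
  "snd \<in> borel_measurable (borel :: ('a::second_countable_topology \<times> 'b::second_countable_topology) measure)"
  by (intro borel_measurable_continuous_onI continuous_intros)

lemma nn_integral_pair_lborel:
  fixes f :: "'a::euclidean_space \<times> 'a \<Rightarrow> ennreal"
  assumes [measurable]: "f \<in> borel_measurable borel"
  shows "(\<integral>\<^sup>+z. f z \<partial>lborel) = (\<integral>\<^sup>+x. \<integral>\<^sup>+y. f (x, y) \<partial>lborel \<partial>lborel)"
  using lborel.nn_integral_fst[of f "lborel"] assms by (simp add: lborel_prod flip: borel_prod)

lemma nn_integral_pair_lborel':
  fixes f :: "'a::euclidean_space \<times> 'a \<Rightarrow> ennreal"
  assumes [measurable]: "f \<in> borel_measurable borel"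
  shows "(\<integral>\<^sup>+z. f z \<partial>lborel) = (\<integral>\<^sup>+y. \<integral>\<^sup>+x. f (x, y) \<partial>lborel \<partial>lborel)"
  using lborel_pair.nn_integral_snd[of f] assms by (simp add: lborel_prod flip: borel_prod)

lemma nn_integral_convolution_fst:
  fixes f g :: "'a::euclidean_space \<Rightarrow> ennreal"
  assumes [measurable]: "f \<in> borel_measurable borel" "g \<in> borel_measurable borel"
  shows "(\<integral>\<^sup>+z. f (fst z) * g (fst z - snd z) \<partial>lborel) = (\<integral>\<^sup>+x. f x \<partial>lborel) * (\<integral>\<^sup>+x. g x \<partial>lborel)"
  by (subst nn_integral_pair_lborel) (auto simp: nn_integral_cmult nn_integral_multc nn_integral_reflect_translate)

lemma nn_integral_convolution_snd:
  fixes f g :: "'a::euclidean_space \<Rightarrow> ennreal"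
  assumes [measurable]: "f \<in> borel_measurable borel" "g \<in> borel_measurable borel"
  shows "(\<integral>\<^sup>+z. f (snd z) * g (fst z - snd z) \<partial>lborel) = (\<integral>\<^sup>+x. f x \<partial>lborel) * (\<integral>\<^sup>+x. g x \<partial>lborel)"
proof -
  have "(\<integral>\<^sup>+x. g (x - y) \<partial>lborel) = (\<integral>\<^sup>+x. g x \<partial>lborel)" for y
    using nn_integral_translate[of g "- y"] by simp
  then show ?thesis
    by (subst nn_integral_pair_lborel') (auto simp: nn_integral_cmult nn_integral_multc)
qed

text \<open>
  Fubini, with the volume of the ball of radius \<open>t\<close>: a substitute for polar coordinates, for
  radial functions written as tails of one-dimensional integrals.
\<close>

lemma nn_integral_norm_le:
  fixes f :: "real \<Rightarrow> ennreal"
  assumes [measurable]: "f \<in> borel_measurable borel"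
  shows "(\<integral>\<^sup>+z. \<integral>\<^sup>+t. f t * indicator {norm (z::real^3)..} t \<partial>lborel \<partial>lborel)
    = ennreal (4 / 3 * pi) * (\<integral>\<^sup>+t. f t * ennreal (t ^ 3) * indicator {0..} t \<partial>lborel)"
proof -
  have "(\<integral>\<^sup>+z. \<integral>\<^sup>+t. f t * indicator {norm (z::real^3)..} t \<partial>lborel \<partial>lborel)
     = (\<integral>\<^sup>+z. \<integral>\<^sup>+t. f t * indicator {x. norm (fst x) \<le> snd x} (z::real^3, t) \<partial>lborel \<partial>lborel)"
    by (intro nn_integral_cong) (auto simp: indicator_def)
  also have "\<dots> = (\<integral>\<^sup>+t. \<integral>\<^sup>+z. f t * indicator {x. norm (fst x) \<le> snd x} (z::real^3, t) \<partial>lborel \<partial>lborel)"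
    by (subst lborel_pair.Fubini') auto
  also have "\<dots> = (\<integral>\<^sup>+t. f t * (ennreal (4 / 3 * pi * t ^ 3) * indicator {0..} t) \<partial>lborel)"
  proof (intro nn_integral_cong)
    fix t :: real
    have "(\<integral>\<^sup>+z. f t * indicator {x. norm (fst x) \<le> snd x} (z::real^3, t) \<partial>lborel)
      = (\<integral>\<^sup>+z. f t * indicator (cball (0::real^3) t) z \<partial>lborel)"
      by (intro nn_integral_cong) (auto simp: indicator_def)
    also have "\<dots> = f t * emeasure lborel (cball (0::real^3) t)"
      by (subst nn_integral_cmult_indicator) auto
    also have "emeasure lborel (cball (0::real^3) t) = ennreal (4 / 3 * pi * t ^ 3) * indicator {0..} t"
    proof (cases "t \<ge> 0")
      case True
      then show ?thesis using emeasure_cball[of t "0::real^3"] by (simp add: unit_ball_vol_3)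
    qed auto
    finally show "(\<integral>\<^sup>+z. f t * indicator {x. norm (fst x) \<le> snd x} (z::real^3, t) \<partial>lborel)
      = f t * (ennreal (4 / 3 * pi * t ^ 3) * indicator {0..} t)" .
  qed
  also have "\<dots> = (\<integral>\<^sup>+t. ennreal (4 / 3 * pi) * (f t * ennreal (t ^ 3) * indicator {0..} t) \<partial>lborel)"
  proof (intro nn_integral_cong)
    fix t :: real
    have "ennreal (4 / 3 * pi * t ^ 3) = ennreal (4 / 3 * pi) * ennreal (t ^ 3)" by (rule ennreal_mult') simp
    then show "f t * (ennreal (4 / 3 * pi * t ^ 3) * indicator {0..} t)
       = ennreal (4 / 3 * pi) * (f t * ennreal (t ^ 3) * indicator {0..} t)" by (simp only: mult_ac)
  qed
  also have "\<dots> = ennreal (4 / 3 * pi) * (\<integral>\<^sup>+t. f t * ennreal (t ^ 3) * indicator {0..} t \<partial>lborel)"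
    by (subst nn_integral_cmult) auto
  finally show ?thesis .
qed

lemma nn_integral_powr_tail_finite:
  fixes e a :: real
  assumes "0 < a" "e < -1"
  shows "(\<integral>\<^sup>+t. ennreal (t powr e * indicator {a..} t) \<partial>lborel) < \<infinity>"
proof -
  have "(\<integral>\<^sup>+t. ennreal (indicator {a..} t * t powr e) \<partial>lborel) = ennreal (- (a powr (e + 1)) / (e + 1))"
    using nn_integral_has_integral_lebesgue[OF _ has_integral_powr_to_inf[of e a]] assms by simp
  then show ?thesis by (simp add: mult.commute)
qed

lemma nn_integral_powr_origin_finite:
  fixes e :: real
  assumes "-1 < e"
  shows "(\<integral>\<^sup>+t. ennreal (t powr e * indicator {0..1} t) \<partial>lborel) < \<infinity>"
proof -
  have "(\<integral>\<^sup>+t. ennreal (indicator {0..1} t * t powr e) \<partial>lborel) = ennreal (1 powr (e + 1) / (e + 1))"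
    using nn_integral_has_integral_lebesgue[OF _ has_integral_powr_from_0[of e 1]] assms by simp
  then show ?thesis by (simp add: mult.commute)
qed

text \<open>
  Up to a constant \<open>|z|\<^bsup>-a\<^esup>\<close> is at most the tail integral from \<open>|z|\<close> of \<open>t\<^bsup>-a-1\<^esup>\<close>, so the
  integral reduces to one over the radius, with \<open>t\<^bsup>4-a\<^esup>\<close> near \<open>0\<close> and \<open>t\<^bsup>2-a\<^esup>\<close> at infinity.
\<close>

lemma truncated_power_integrable:
  fixes a :: real
  assumes "3 < a" "a < 5"
  shows "(\<integral>\<^sup>+z. ennreal (min 1 ((norm (z::real^3))\<^sup>2) * norm z powr (- a)) \<partial>lborel) < \<infinity>"
proof -
  define h where "h t = min 1 (t\<^sup>2) * t powr (- a - 1)" for t :: real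
  define C where "C = 2 powr (a + 1)"
  have [measurable]: "h \<in> borel_measurable borel" unfolding h_def by measurable
  have h0: "h t \<ge> 0" for t by (simp add: h_def)
  have pt: "ennreal (min 1 ((norm z)\<^sup>2) * norm z powr (- a))
      \<le> ennreal C * (\<integral>\<^sup>+t. ennreal (h t) * indicator {norm z..} t \<partial>lborel)" for z :: "real^3"
  proof (cases "z = 0")
    case False
    define r where "r = norm z"
    have r: "r > 0" using False by (simp add: r_def)
    have "min 1 (r\<^sup>2) * (2 * r) powr (- a - 1) \<le> h t" if "t \<in> {r..2 * r}" for t
      unfolding h_def using that r assms by (intro mult_mono powr_mono2' min.mono power_mono) auto
    then have le: "(\<integral>\<^sup>+t. ennreal (min 1 (r\<^sup>2) * (2 * r) powr (- a - 1)) * indicator {r..2 * r} t \<partial>lborel)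
       \<le> (\<integral>\<^sup>+t. ennreal (h t) * indicator {r..} t \<partial>lborel)"
      by (intro nn_integral_mono) (auto simp: indicator_def ennreal_leI)
    have "(\<integral>\<^sup>+t. ennreal (min 1 (r\<^sup>2) * (2 * r) powr (- a - 1)) * indicator {r..2 * r} t \<partial>lborel)
       = ennreal (min 1 (r\<^sup>2) * (2 * r) powr (- a - 1) * r)"
      using r by (subst nn_integral_cmult_indicator) (auto simp: ennreal_mult')
    with le have le: "ennreal (min 1 (r\<^sup>2) * (2 * r) powr (- a - 1) * r)
         \<le> (\<integral>\<^sup>+t. ennreal (h t) * indicator {r..} t \<partial>lborel)" by simp
    have "C * ((2 * r) powr (- a - 1) * r) = (2 powr (a+1) * 2 powr (-a-1)) * (r powr (-a-1) * r powr 1)"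
      using r by (simp add: C_def powr_mult)
    also have "\<dots> = r powr (- a)" by (simp only: powr_add[symmetric]) simp
    finally have "min 1 (r\<^sup>2) * r powr (- a) = C * (min 1 (r\<^sup>2) * (2 * r) powr (- a - 1) * r)"
      by (simp add: mult_ac)
    then have "ennreal (min 1 (r\<^sup>2) * r powr (- a)) = ennreal (C * (min 1 (r\<^sup>2) * (2 * r) powr (- a - 1) * r))"
      by (rule arg_cong)
    also have "\<dots> = ennreal C * ennreal (min 1 (r\<^sup>2) * (2 * r) powr (- a - 1) * r)"
      by (rule ennreal_mult') (simp add: C_def)
    also have "\<dots> \<le> ennreal C * (\<integral>\<^sup>+t. ennreal (h t) * indicator {r..} t \<partial>lborel)"
      by (rule mult_left_mono[OF le]) simp
    finally show ?thesis by (simp add: r_def)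
  qed auto
  have "(\<integral>\<^sup>+z. ennreal (min 1 ((norm (z::real^3))\<^sup>2) * norm z powr (- a)) \<partial>lborel)
     \<le> (\<integral>\<^sup>+z. ennreal C * (\<integral>\<^sup>+t. ennreal (h t) * indicator {norm (z::real^3)..} t \<partial>lborel) \<partial>lborel)"
    by (intro nn_integral_mono pt)
  also have "\<dots> = ennreal C * (\<integral>\<^sup>+z. (\<integral>\<^sup>+t. ennreal (h t) * indicator {norm (z::real^3)..} t \<partial>lborel) \<partial>lborel)"
  proof (rule nn_integral_cmult)
    have "(\<lambda>z. (\<integral>\<^sup>+t. ennreal (h t) * indicator {x. norm (fst x) \<le> snd x} (z::real^3, t) \<partial>lborel)) \<in> borel_measurable lborel"
      by measurable
    moreover have "indicator {x. norm (fst x) \<le> snd x} (z::real^3, t) = (indicator {norm z..} t :: ennreal)" for z t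
      by (auto simp: indicator_def)
    ultimately show "(\<lambda>z. (\<integral>\<^sup>+t. ennreal (h t) * indicator {norm (z::real^3)..} t \<partial>lborel)) \<in> borel_measurable lborel"
      by simp
  qed
  also have "(\<integral>\<^sup>+z. (\<integral>\<^sup>+t. ennreal (h t) * indicator {norm (z::real^3)..} t \<partial>lborel) \<partial>lborel)
     = ennreal (4 / 3 * pi) * (\<integral>\<^sup>+t. ennreal (h t) * ennreal (t ^ 3) * indicator {0..} t \<partial>lborel)"
    by (rule nn_integral_norm_le) measurable
  finally have le: "(\<integral>\<^sup>+z. ennreal (min 1 ((norm (z::real^3))\<^sup>2) * norm z powr (- a)) \<partial>lborel)
    \<le> ennreal C * (ennreal (4 / 3 * pi) * (\<integral>\<^sup>+t. ennreal (h t) * ennreal (t ^ 3) * indicator {0..} t \<partial>lborel))" .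
  have "(\<integral>\<^sup>+t. ennreal (h t) * ennreal (t ^ 3) * indicator {0..} t \<partial>lborel)
    \<le> (\<integral>\<^sup>+t. ennreal (t powr (4 - a) * indicator {0..1} t) + ennreal (t powr (2 - a) * indicator {1..} t) \<partial>lborel)"
  proof (intro nn_integral_mono)
    fix t :: real
    consider "t \<le> 0" | "0 < t" "t \<le> 1" | "t > 1" by linarith
    then show "ennreal (h t) * ennreal (t ^ 3) * indicator {0..} t
       \<le> ennreal (t powr (4 - a) * indicator {0..1} t) + ennreal (t powr (2 - a) * indicator {1..} t)"
    proof cases
      case 2
      have "h t * t ^ 3 \<le> t\<^sup>2 * t powr (- a - 1) * t ^ 3"
        unfolding h_def using 2 by (intro mult_right_mono) auto
      also have "\<dots> = t powr 2 * t powr (- a - 1) * t powr 3" using 2 by (simp add: powr_numeral)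
      also have "\<dots> = t powr (4 - a)" by (simp flip: powr_add)
      finally have "ennreal (h t * t ^ 3) \<le> ennreal (t powr (4 - a))" by (rule ennreal_leI)
      then show ?thesis using 2 h0[of t] by (simp add: indicator_def ennreal_mult add_increasing2)
    next
      case 3
      have "h t * t ^ 3 \<le> 1 * t powr (- a - 1) * t ^ 3"
        unfolding h_def using 3 by (intro mult_right_mono) auto
      also have "\<dots> = t powr (- a - 1) * t powr 3" using 3 by (simp add: powr_numeral)
      also have "\<dots> = t powr (2 - a)" by (simp flip: powr_add)
      finally have "ennreal (h t * t ^ 3) \<le> ennreal (t powr (2 - a))" by (rule ennreal_leI)
      then show ?thesis using 3 h0[of t] by (simp add: indicator_def ennreal_mult add_increasing)
    qed (cases "t = 0"; simp add: indicator_def)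
  qed
  also have "\<dots> = (\<integral>\<^sup>+t. ennreal (t powr (4 - a) * indicator {0..1} t) \<partial>lborel)
     + (\<integral>\<^sup>+t. ennreal (t powr (2 - a) * indicator {1..} t) \<partial>lborel)"
    by (subst nn_integral_add) auto
  also have "\<dots> < \<infinity>" using nn_integral_powr_tail_finite[of 1 "2 - a"] nn_integral_powr_origin_finite[of "4 - a"] assms by simp
  finally show ?thesis by (intro le_less_trans[OF le]) (simp add: ennreal_mult_less_top)
qed

section \<open>The interaction kernel\<close>

locale mag_setting =
  fixes s m p :: real
  assumes s_pos: "0 < s" and s_less: "s < 1" and m_pos: "0 < m"
    and p_gt: "2 < p" and p_less: "p < 6 / (3 - 2 * s)"
begin

definition kern :: "real^3 \<Rightarrow> real" where
  "kern z = bessel_K ((3 + 2 * s) / 2) (m * norm z) / norm z powr ((3 + 2 * s) / 2)"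

lemma kern_measurable [measurable]: "kern \<in> borel_measurable borel"
  unfolding kern_def by measurable

lemma kern_nonneg [simp]: "0 \<le> kern z"
  unfolding kern_def by (simp add: bessel_K_nonneg)

lemma kern_0 [simp]: "kern 0 = 0" by (simp add: kern_def)

text \<open>
  The exponent \<open>4 + s\<close> lies strictly between \<open>3 + 2 * s\<close>, the order of the singularity at \<open>0\<close>,
  and \<open>5\<close>: one power that suffices both for decay at infinity and for integrability of \<open>|z|\<^sup>2\<close>
  times the kernel at \<open>0\<close>.
\<close>

lemma kern_upper: "\<exists>C\<ge>0. \<forall>z. kern z \<le> C * norm z powr (- (4 + s))"
proof -
  define \<nu> where "\<nu> = (3 + 2 * s) / 2"
  define \<beta> where "\<beta> = (4 + s) / 2"
  have b: "0 < \<nu>" "\<nu> < \<beta>" using s_pos s_less by (auto simp: \<nu>_def \<beta>_def)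
  define D where "D = (4 * \<beta>) powr \<beta> * Gamma (\<beta> - \<nu>)"
  have D0: "D \<ge> 0" using Gamma_real_pos[of "\<beta> - \<nu>"] b by (simp add: D_def)
  have "kern z \<le> D * m powr (\<nu> - 2 * \<beta>) * norm z powr (- (4 + s))" for z
  proof (cases "z = 0")
    case False
    then have z: "norm z > 0" by simp
    have "bessel_K \<nu> (m * norm z) \<le> D * (m * norm z) powr (\<nu> - 2 * \<beta>)"
      unfolding D_def using bessel_K_upper[OF b, of "m * norm z"] z m_pos by simp
    then have "kern z \<le> D * (m * norm z) powr (\<nu> - 2 * \<beta>) / norm z powr \<nu>"
      unfolding kern_def \<nu>_def by (intro divide_right_mono) auto
    also have "\<dots> = D * m powr (\<nu> - 2 * \<beta>) * (norm z powr (\<nu> - 2 * \<beta>) * norm z powr (- \<nu>))"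
      using z m_pos by (simp add: powr_mult powr_minus divide_inverse)
    also have "norm z powr (\<nu> - 2 * \<beta>) * norm z powr (- \<nu>) = norm z powr (- (4 + s))"
      unfolding powr_add[symmetric] by (rule arg_cong[where f = "\<lambda>e. norm z powr e"]) (simp add: \<beta>_def field_simps)
    finally show ?thesis .
  qed auto
  then show ?thesis using D0 by (intro exI[of _ "D * m powr (\<nu> - 2 * \<beta>)"]) auto
qed

lemma kern_lower: "\<exists>c>0. \<forall>z. z \<noteq> 0 \<longrightarrow> norm z \<le> 1 \<longrightarrow> c * norm z powr (- (3 + 2 * s)) \<le> kern z"
proof -
  define \<nu> where "\<nu> = (3 + 2 * s) / 2"
  have b: "0 < \<nu>" using s_pos by (auto simp: \<nu>_def)
  define c where "c = exp (- 1 / 4 - 2 * m\<^sup>2) * 2 powr (- 2 - 2 * \<nu>)"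
  have c0: "c > 0" by (simp add: c_def)
  have "c * m powr (- \<nu>) * norm z powr (- (3 + 2 * s)) \<le> kern z" if "z \<noteq> 0" "norm z \<le> 1" for z
  proof -
    have z: "norm z > 0" using that by simp
    have "(m * norm z)\<^sup>2 \<le> m\<^sup>2" using that m_pos by (intro power_mono) (auto simp: mult_left_le)
    then have "c \<le> exp (- 1 / 4 - 2 * (m * norm z)\<^sup>2) * 2 powr (- 2 - 2 * \<nu>)"
      unfolding c_def by (intro mult_right_mono) auto
    then have "c * (m * norm z) powr (- \<nu>) \<le> exp (- 1 / 4 - 2 * (m * norm z)\<^sup>2) * 2 powr (- 2 - 2 * \<nu>) * (m * norm z) powr (- \<nu>)"
      by (intro mult_right_mono) auto
    also have "\<dots> \<le> bessel_K \<nu> (m * norm z)" using z m_pos b by (intro bessel_K_lower) auto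
    finally have "c * (m * norm z) powr (- \<nu>) / norm z powr \<nu> \<le> kern z"
      unfolding kern_def \<nu>_def by (intro divide_right_mono) auto
    also have "c * (m * norm z) powr (- \<nu>) / norm z powr \<nu> = c * m powr (- \<nu>) * (norm z powr (- \<nu>) * norm z powr (- \<nu>))"
      using z m_pos by (simp add: powr_mult powr_minus divide_inverse)
    also have "norm z powr (- \<nu>) * norm z powr (- \<nu>) = norm z powr (- (3 + 2 * s))"
      by (simp add: \<nu>_def flip: powr_add)
    finally show ?thesis .
  qed
  then show ?thesis using c0 m_pos by (intro exI[of _ "c * m powr (- \<nu>)"]) auto
qed

text \<open>
  This bounds the interaction of a function that oscillates by at most \<open>L\<close> per unit length and
  by at most \<open>1\<close> altogether, for example a cutoff.
\<close>

definition truncated_kern :: "real \<Rightarrow> ennreal" where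
  "truncated_kern L = (\<integral>\<^sup>+z. ennreal (min 1 ((L * norm z)\<^sup>2) * kern z) \<partial>lborel)"

lemma truncated_kern_finite: "truncated_kern 1 < \<infinity>"
proof -
  obtain C where C: "C \<ge> 0" "\<And>z. kern z \<le> C * norm z powr (- (4 + s))" using kern_upper by auto
  have "truncated_kern 1 \<le> (\<integral>\<^sup>+z. ennreal C * ennreal (min 1 ((norm (z::real^3))\<^sup>2) * norm z powr (- (4 + s))) \<partial>lborel)"
    unfolding truncated_kern_def
  proof (intro nn_integral_mono)
    fix z :: "real^3"
    have "min 1 ((norm z)\<^sup>2) * kern z \<le> C * (min 1 ((norm z)\<^sup>2) * norm z powr (- (4 + s)))"
      using mult_left_mono[OF C(2)[of z], of "min 1 ((norm z)\<^sup>2)"] by (simp add: mult_ac)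
    then show "ennreal (min 1 ((1 * norm z)\<^sup>2) * kern z)
       \<le> ennreal C * ennreal (min 1 ((norm z)\<^sup>2) * norm z powr (- (4 + s)))"
      using C(1) by (simp add: ennreal_leI flip: ennreal_mult')
  qed
  also have "\<dots> = ennreal C * (\<integral>\<^sup>+z. ennreal (min 1 ((norm (z::real^3))\<^sup>2) * norm z powr (- (4 + s))) \<partial>lborel)"
    by (rule nn_integral_cmult) measurable
  also have "\<dots> < \<infinity>" using truncated_power_integrable[of "4 + s"] s_pos s_less
    by (simp add: ennreal_mult_less_top)
  finally show ?thesis .
qed

text \<open>
  Flat cutoffs cost little energy: dominated convergence as \<open>L\<close> tends to \<open>0\<close>.
\<close>

lemma truncated_kern_small:
  assumes "0 < \<epsilon>"
  shows "\<exists>L>0. L \<le> 1 \<and> truncated_kern L \<le> ennreal \<epsilon>"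
proof -
  have "(\<lambda>n. truncated_kern (1 / real (Suc n))) \<longlonglongrightarrow> (\<integral>\<^sup>+z. (0::ennreal) \<partial>(lborel :: (real^3) measure))"
    unfolding truncated_kern_def
  proof (rule nn_integral_dominated_convergence[where w = "\<lambda>z. ennreal (min 1 ((1 * norm z)\<^sup>2) * kern z)"])
    show "AE z in (lborel :: (real^3) measure). ennreal (min 1 ((1 / real (Suc n) * norm z)\<^sup>2) * kern z)
        \<le> ennreal (min 1 ((1 * norm z)\<^sup>2) * kern z)" for n
      by (intro AE_I2 ennreal_leI mult_right_mono min.mono power_mono) auto
    show "AE z in (lborel :: (real^3) measure). (\<lambda>n. ennreal (min 1 ((1 / real (Suc n) * norm z)\<^sup>2) * kern z)) \<longlonglongrightarrow> 0"
    proof (rule AE_I2)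
      fix z :: "real^3"
      have "(\<lambda>n. 1 / real (Suc n)) \<longlonglongrightarrow> 0" using LIMSEQ_inverse_real_of_nat by (simp add: inverse_eq_divide)
      then have "(\<lambda>n. min 1 ((1 / real (Suc n) * norm z)\<^sup>2) * kern z) \<longlonglongrightarrow> min 1 ((0 * norm z)\<^sup>2) * kern z"
        by (intro tendsto_intros)
      then show "(\<lambda>n. ennreal (min 1 ((1 / real (Suc n) * norm z)\<^sup>2) * kern z)) \<longlonglongrightarrow> 0"
        by (auto dest: tendsto_ennrealI)
    qed
  qed (use truncated_kern_finite in \<open>auto simp: truncated_kern_def\<close>)
  then have "(\<lambda>n. truncated_kern (1 / real (Suc n))) \<longlonglongrightarrow> 0" by simp
  from order_tendstoD(2)[OF this, of "ennreal \<epsilon>"] assms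
  obtain n where "truncated_kern (1 / real (Suc n)) < ennreal \<epsilon>" by (auto simp: eventually_sequentially)
  then show ?thesis by (intro exI[of _ "1 / real (Suc n)"]) auto
qed

end

section \<open>Energies and masses\<close>

lemma borel_measurable_cnj [measurable]: "cnj \<in> borel_measurable borel"
  by (intro borel_measurable_continuous_onI continuous_intros)

text \<open>
  Convexity of \<open>t\<^sup>q\<close>, applied to the combination of \<open>a / (1 - l)\<close> and \<open>b / l\<close> with weights
  \<open>1 - l\<close> and \<open>l\<close>. For small \<open>l\<close> the factor of \<open>a\<close> is close to \<open>1\<close>, so the inequality
  integrates to a perturbation bound.
\<close>

lemma powr_add_le_weighted:
  fixes a b q l :: real
  assumes "0 \<le> a" "0 \<le> b" "1 \<le> q" "0 < l" "l < 1"
  shows "(a + b) powr q \<le> (1 - l) powr (1 - q) * a powr q + l powr (1 - q) * b powr q"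
proof -
  have pos: "(a + b) powr q \<le> (1 - l) powr (1 - q) * a powr q + l powr (1 - q) * b powr q"
    if "0 < a" "0 < b"
  proof -
    have "((1 - l) *\<^sub>R (a / (1 - l)) + l *\<^sub>R (b / l)) powr q \<le> (1 - l) * (a / (1 - l)) powr q + l * (b / l) powr q"
      by (rule convex_onD[OF powr_convex]) (use assms that in auto)
    moreover have "(1 - l) * (a / (1 - l)) powr q = (1 - l) powr (1 - q) * a powr q"
      using assms that by (simp add: powr_divide powr_diff)
    moreover have "l * (b / l) powr q = l powr (1 - q) * b powr q"
      using assms that by (simp add: powr_divide powr_diff)
    ultimately show ?thesis using assms by simp
  qed
  have one: "1 \<le> x powr (1 - q)" if "0 < x" "x < 1" for x
    using powr_mono'[of "1 - q" 0 x] that assms by simp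
  consider "a = 0" | "b = 0" | "0 < a" "0 < b" using assms by linarith
  then show ?thesis
  proof cases
    case 1 then show ?thesis using mult_right_mono[OF one[of l], of "b powr q"] assms by simp
  next
    case 2 then show ?thesis using mult_right_mono[OF one[of "1 - l"], of "a powr q"] assms by simp
  qed (use pos in auto)
qed

lemma square_add_le_weighted:
  fixes a b l :: real
  assumes "0 < l" "l < 1"
  shows "(a + b)\<^sup>2 \<le> a\<^sup>2 / (1 - l) + b\<^sup>2 / l"
proof -
  have "a\<^sup>2 / (1 - l) + b\<^sup>2 / l - (a + b)\<^sup>2 = (l * a - (1 - l) * b)\<^sup>2 / (l * (1 - l))"
    using assms by (simp add: field_simps power2_eq_square)
  also have "\<dots> \<ge> 0" using assms by simp
  finally show ?thesis by simp
qed

lemma cmod_add_square_le_weighted: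
  assumes "0 < l" "l < 1"
  shows "(cmod (a + b))\<^sup>2 \<le> (cmod a)\<^sup>2 / (1 - l) + (cmod b)\<^sup>2 / l"
proof -
  have "(cmod (a + b))\<^sup>2 \<le> (cmod a + cmod b)\<^sup>2" by (intro power_mono norm_triangle_ineq) auto
  with square_add_le_weighted[OF assms, of "cmod a" "cmod b"] show ?thesis by linarith
qed

text \<open>
  The factor by which the field changes \<open>u x\<close> before it is compared with \<open>u y\<close>.
\<close>

abbreviation phase :: "(real^3 \<Rightarrow> real^3) \<Rightarrow> real^3 \<Rightarrow> real^3 \<Rightarrow> complex" where
  "phase A x y \<equiv> exp (- (\<i> * of_real ((x - y) \<bullet> A ((x + y) /\<^sub>R 2))))"

context mag_setting begin

definition c1 :: real where "c1 = C_const s / 2 * m powr ((3 + 2 * s) / 2)"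
definition c2 :: real where "c2 = m powr (2 * s)"

lemma c1_pos: "0 < c1"
proof -
  have "Gamma (1 - s) > 0" using s_less by (intro Gamma_real_pos) simp
  then show ?thesis using s_pos m_pos by (simp add: c1_def C_const_def)
qed

lemma c2_pos: "0 < c2" using m_pos by (simp add: c2_def)

abbreviation edens :: "(real^3 \<Rightarrow> real^3) \<Rightarrow> (real^3 \<Rightarrow> complex) \<Rightarrow> (real^3) \<times> (real^3) \<Rightarrow> real" where
  "edens A u z \<equiv> (cmod (mag_diff A u (fst z) (snd z)))\<^sup>2 * kern (fst z - snd z)"

abbreviation mass2 :: "(real^3) set \<Rightarrow> (real^3 \<Rightarrow> complex) \<Rightarrow> ennreal" where
  "mass2 S u \<equiv> \<integral>\<^sup>+x. ennreal ((cmod (u x))\<^sup>2) * indicator S x \<partial>lborel"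

abbreviation massp :: "(real^3) set \<Rightarrow> (real^3 \<Rightarrow> complex) \<Rightarrow> ennreal" where
  "massp S u \<equiv> \<integral>\<^sup>+x. ennreal (cmod (u x) powr p) * indicator S x \<partial>lborel"

text \<open>
  The magnetic Gagliardo seminorm squared.
\<close>

definition kinetic :: "(real^3 \<Rightarrow> real^3) \<Rightarrow> (real^3 \<Rightarrow> complex) \<Rightarrow> ennreal" where
  "kinetic A u = (\<integral>\<^sup>+z. ennreal (edens A u z) \<partial>lborel)"

definition sqmass :: "(real^3 \<Rightarrow> complex) \<Rightarrow> ennreal" where
  "sqmass u = (\<integral>\<^sup>+x. ennreal ((cmod (u x))\<^sup>2) \<partial>lborel)"

text \<open>
  \<open>\<parallel>u\<parallel>\<^bsub>A,s\<^esub>\<^sup>2\<close> as an extended nonnegative number; for measurable \<open>A\<close> and \<open>u\<close> it is finite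
  exactly on the energy space.
\<close>

definition energy :: "(real^3 \<Rightarrow> real^3) \<Rightarrow> (real^3 \<Rightarrow> complex) \<Rightarrow> ennreal" where
  "energy A u = ennreal c1 * kinetic A u + ennreal c2 * sqmass u"

definition pmass :: "(real^3 \<Rightarrow> complex) \<Rightarrow> ennreal" where
  "pmass u = (\<integral>\<^sup>+x. ennreal (cmod (u x) powr p) \<partial>lborel)"

lemma mag_diff_measurable [measurable]:
  assumes [measurable]: "A \<in> borel_measurable borel" "u \<in> borel_measurable borel"
  shows "(\<lambda>z. mag_diff A u (fst z) (snd z)) \<in> borel_measurable borel"
  unfolding mag_diff_def by measurable

lemma form_density_alt:
  "form_density s m A u v z = mag_diff A u (fst z) (snd z) * cnj (mag_diff A v (fst z) (snd z))
     * of_real (kern (fst z - snd z))"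
  by (simp add: form_density_def kern_def case_prod_unfold)

lemma form_density_measurable [measurable]:
  assumes [measurable]: "A \<in> borel_measurable borel" "u \<in> borel_measurable borel" "v \<in> borel_measurable borel"
  shows "form_density s m A u v \<in> borel_measurable borel"
  unfolding form_density_alt[abs_def] by measurable

lemma norm_form_density:
  "norm (form_density s m A u v z) = cmod (mag_diff A u (fst z) (snd z)) * cmod (mag_diff A v (fst z) (snd z)) * kern (fst z - snd z)"
  unfolding form_density_alt by (simp add: norm_mult)

lemma form_density_self:
  "form_density s m A u u z = of_real (edens A u z)"
  unfolding form_density_alt by (simp flip: complex_norm_square)

lemma energy_space_iff:
  assumes [measurable]: "A \<in> borel_measurable borel"
  shows "u \<in> energy_space s m A \<longleftrightarrow> u \<in> borel_measurable borel \<and> energy A u < \<infinity>"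
proof (cases "u \<in> borel_measurable borel")
  case True
  note [measurable] = this
  have 1: "integrable lborel (form_density s m A u u) \<longleftrightarrow> kinetic A u < \<infinity>"
    unfolding integrable_iff_bounded kinetic_def norm_form_density by (simp add: power2_eq_square)
  have 2: "integrable lborel (\<lambda>x. u x * cnj (u x)) \<longleftrightarrow> sqmass u < \<infinity>"
  proof -
    have "(\<lambda>x. u x * cnj (u x)) \<in> borel_measurable borel" by measurable
    then show ?thesis unfolding integrable_iff_bounded sqmass_def by (simp add: norm_mult power2_eq_square)
  qed
  have "energy A u < \<infinity> \<longleftrightarrow> kinetic A u < \<infinity> \<and> sqmass u < \<infinity>"
    using c1_pos c2_pos by (auto simp: energy_def ennreal_mult_less_top)
  then show ?thesis using True 1 2 by (simp add: energy_space_def)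
qed (simp add: energy_space_def)

lemma mag_inner_self:
  assumes [measurable]: "A \<in> borel_measurable borel" and u: "u \<in> energy_space s m A"
  shows "0 \<le> mag_inner s m A u u" "ennreal (mag_inner s m A u u) = energy A u"
proof -
  have [measurable]: "u \<in> borel_measurable borel" using u by (simp add: energy_space_def)
  have i1: "integrable lborel (form_density s m A u u)" and i2: "integrable lborel (\<lambda>x. u x * cnj (u x))"
    using u by (auto simp: energy_space_def)
  let ?e = "\<lambda>z. edens A u z"
  have i1': "integrable lborel ?e"
    using integrable_Re[OF i1] unfolding form_density_self by simp
  have i2': "integrable lborel (\<lambda>x. (cmod (u x))\<^sup>2)"
    using integrable_Re[OF i2] by (simp add: complex_norm_square[symmetric] del: of_real_power flip: of_real_power)
  have f: "mag_form s m A u u = (LINT z|lborel. ?e z)"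
  proof -
    have "form_density s m A u u = (\<lambda>z. of_real (?e z))" using form_density_self by blast
    then show ?thesis unfolding mag_form_def by (simp only: integral_complex_of_real Re_complex_of_real)
  qed
  have l: "Re (LINT x|lborel. u x * cnj (u x)) = (LINT x|lborel. (cmod (u x))\<^sup>2)"
    by (simp only: complex_norm_square[symmetric] integral_complex_of_real Re_complex_of_real flip: of_real_power)
  have f0: "0 \<le> (LINT z|lborel. ?e z)" by (intro integral_nonneg_AE) auto
  have l0: "0 \<le> (LINT x|lborel. (cmod (u x))\<^sup>2)" by (intro integral_nonneg_AE) auto
  have E: "kinetic A u = ennreal (LINT z|lborel. ?e z)" unfolding kinetic_def
    by (rule nn_integral_eq_integral[OF i1']) auto
  have L: "sqmass u = ennreal (LINT x|lborel. (cmod (u x))\<^sup>2)" unfolding sqmass_def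
    by (rule nn_integral_eq_integral[OF i2']) auto
  have eq: "mag_inner s m A u u = c1 * (LINT z|lborel. ?e z) + c2 * (LINT x|lborel. (cmod (u x))\<^sup>2)"
    unfolding mag_inner_def f l c1_def c2_def by simp
  show "0 \<le> mag_inner s m A u u" unfolding eq using f0 l0 c1_pos c2_pos by simp
  show "ennreal (mag_inner s m A u u) = energy A u" unfolding eq energy_def E L using f0 l0 c1_pos c2_pos
    by (simp add: ennreal_mult')
qed

lemma mag_norm_square:
  assumes "A \<in> borel_measurable borel" "u \<in> energy_space s m A"
  shows "(mag_norm s m A u)\<^sup>2 = mag_inner s m A u u"
  using mag_inner_self[OF assms] by (simp add: mag_norm_def)

lemma mag_diff_add: "mag_diff A (\<lambda>x. u x + v x) x y = mag_diff A u x y + mag_diff A v x y"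
  by (simp add: mag_diff_def algebra_simps)

lemma mag_diff_diff: "mag_diff A (\<lambda>x. u x - v x) x y = mag_diff A u x y - mag_diff A v x y"
  by (simp add: mag_diff_def algebra_simps)

lemma mag_diff_scale: "mag_diff A (\<lambda>x. c * u x) x y = c * mag_diff A u x y"
  by (simp add: mag_diff_def algebra_simps)

lemma sqmass_le_energy: "ennreal c2 * sqmass u \<le> energy A u"
  by (simp add: energy_def)

lemma energy_parts_le:
  assumes "energy A u \<le> ennreal B" "0 \<le> B"
  shows "sqmass u \<le> ennreal (B / c2)" "kinetic A u \<le> ennreal (B / c1)"
proof -
  have div: "X \<le> ennreal (B / c)" if "ennreal c * X \<le> ennreal B" "c > 0" for X c
  proof -
    have "ennreal c * X \<le> ennreal c * ennreal (B / c)" using that by (simp flip: ennreal_mult')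
    then show ?thesis using that by (subst (asm) ennreal_mult_le_mult_iff) auto
  qed
  show "sqmass u \<le> ennreal (B / c2)" using c2_pos assms sqmass_le_energy by (intro div) (auto intro: order_trans)
  have "ennreal c1 * kinetic A u \<le> energy A u" by (simp add: energy_def)
  then show "kinetic A u \<le> ennreal (B / c1)" using c1_pos assms by (intro div) (auto intro: order_trans)
qed

lemma energy_add_le:
  assumes [measurable]: "A \<in> borel_measurable borel" "u \<in> borel_measurable borel" "v \<in> borel_measurable borel"
    and l: "0 < l" "l < 1"
  shows "energy A (\<lambda>x. u x + v x) \<le> ennreal (1 / (1 - l)) * energy A u + ennreal (1 / l) * energy A v"
proof -
  have "kinetic A (\<lambda>x. u x + v x) \<le> (\<integral>\<^sup>+z. ennreal (1 / (1 - l)) * ennreal (edens A u z)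
      + ennreal (1 / l) * ennreal (edens A v z) \<partial>lborel)"
    unfolding kinetic_def
  proof (intro nn_integral_mono)
    fix z :: "(real^3) \<times> (real^3)"
    have "edens A (\<lambda>x. u x + v x) z
       \<le> ((cmod (mag_diff A u (fst z) (snd z)))\<^sup>2 / (1 - l) + (cmod (mag_diff A v (fst z) (snd z)))\<^sup>2 / l) * kern (fst z - snd z)"
      unfolding mag_diff_add by (intro mult_right_mono cmod_add_square_le_weighted l) simp
    also have "\<dots> = 1 / (1 - l) * (edens A u z)
        + 1 / l * (edens A v z)" by (simp add: algebra_simps)
    finally show "ennreal (edens A (\<lambda>x. u x + v x) z)
      \<le> ennreal (1 / (1 - l)) * ennreal (edens A u z)
      + ennreal (1 / l) * ennreal (edens A v z)"
      using l by (simp add: ennreal_leI flip: ennreal_mult' ennreal_plus)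
  qed
  also have "\<dots> = ennreal (1 / (1 - l)) * kinetic A u + ennreal (1 / l) * kinetic A v"
    unfolding kinetic_def by (subst nn_integral_add) (auto simp: nn_integral_cmult)
  finally have E: "kinetic A (\<lambda>x. u x + v x) \<le> ennreal (1 / (1 - l)) * kinetic A u + ennreal (1 / l) * kinetic A v" .
  have "sqmass (\<lambda>x. u x + v x) \<le> (\<integral>\<^sup>+x. ennreal (1 / (1 - l)) * ennreal ((cmod (u x))\<^sup>2)
      + ennreal (1 / l) * ennreal ((cmod (v x))\<^sup>2) \<partial>lborel)"
    unfolding sqmass_def
  proof (intro nn_integral_mono)
    fix x :: "real^3"
    have "(cmod (u x + v x))\<^sup>2 \<le> 1 / (1 - l) * (cmod (u x))\<^sup>2 + 1 / l * (cmod (v x))\<^sup>2"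
      using cmod_add_square_le_weighted[OF l, of "u x" "v x"] by simp
    then show "ennreal ((cmod (u x + v x))\<^sup>2) \<le> ennreal (1 / (1 - l)) * ennreal ((cmod (u x))\<^sup>2)
      + ennreal (1 / l) * ennreal ((cmod (v x))\<^sup>2)"
      using l by (simp add: ennreal_leI flip: ennreal_mult' ennreal_plus)
  qed
  also have "\<dots> = ennreal (1 / (1 - l)) * sqmass u + ennreal (1 / l) * sqmass v"
    unfolding sqmass_def by (subst nn_integral_add) (auto simp: nn_integral_cmult)
  finally have L: "sqmass (\<lambda>x. u x + v x) \<le> ennreal (1 / (1 - l)) * sqmass u + ennreal (1 / l) * sqmass v" .
  have "energy A (\<lambda>x. u x + v x) \<le> ennreal c1 * (ennreal (1 / (1 - l)) * kinetic A u + ennreal (1 / l) * kinetic A v)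
     + ennreal c2 * (ennreal (1 / (1 - l)) * sqmass u + ennreal (1 / l) * sqmass v)"
    unfolding energy_def by (intro add_mono mult_left_mono E L) auto
  also have "\<dots> = ennreal (1 / (1 - l)) * energy A u + ennreal (1 / l) * energy A v"
    unfolding energy_def by (simp add: algebra_simps)
  finally show ?thesis .
qed

lemma kinetic_scale:
  assumes [measurable]: "A \<in> borel_measurable borel" "u \<in> borel_measurable borel"
  shows "kinetic A (\<lambda>x. c * u x) = ennreal ((cmod c)\<^sup>2) * kinetic A u"
  unfolding kinetic_def by (subst nn_integral_cmult[symmetric])
    (auto simp: mag_diff_scale norm_mult power_mult_distrib mult.assoc simp flip: ennreal_mult' intro!: nn_integral_cong)

lemma sqmass_scale:
  assumes [measurable]: "u \<in> borel_measurable borel"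
  shows "sqmass (\<lambda>x. c * u x) = ennreal ((cmod c)\<^sup>2) * sqmass u"
  unfolding sqmass_def by (subst nn_integral_cmult[symmetric])
    (auto simp: norm_mult power_mult_distrib simp flip: ennreal_mult' intro!: nn_integral_cong)

lemma energy_scale:
  assumes [measurable]: "A \<in> borel_measurable borel" "u \<in> borel_measurable borel"
  shows "energy A (\<lambda>x. c * u x) = ennreal ((cmod c)\<^sup>2) * energy A u"
  unfolding energy_def kinetic_scale[OF assms] sqmass_scale[OF assms(2)] by (simp add: algebra_simps)

lemma pmass_scale:
  assumes [measurable]: "u \<in> borel_measurable borel"
  shows "pmass (\<lambda>x. c * u x) = ennreal (cmod c powr p) * pmass u"
  unfolding pmass_def by (subst nn_integral_cmult[symmetric])
    (auto simp: norm_mult powr_mult simp flip: ennreal_mult' intro!: nn_integral_cong)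

lemma energy_parallelogram:
  assumes [measurable]: "A \<in> borel_measurable borel" "u \<in> borel_measurable borel" "v \<in> borel_measurable borel"
  shows "energy A (\<lambda>x. u x + v x) + energy A (\<lambda>x. u x - v x) = 2 * energy A u + 2 * energy A v"
proof -
  have par: "ennreal ((cmod (a + b))\<^sup>2 * k) + ennreal ((cmod (a - b))\<^sup>2 * k)
     = 2 * ennreal ((cmod a)\<^sup>2 * k) + 2 * ennreal ((cmod b)\<^sup>2 * k)" if "k \<ge> 0" for a b :: complex and k
  proof -
    have "(cmod (a + b))\<^sup>2 * k + (cmod (a - b))\<^sup>2 * k = 2 * ((cmod a)\<^sup>2 * k) + 2 * ((cmod b)\<^sup>2 * k)"
      unfolding cmod_power2 by (simp add: algebra_simps power2_eq_square)
    then have "ennreal ((cmod (a + b))\<^sup>2 * k + (cmod (a - b))\<^sup>2 * k) = ennreal (2 * ((cmod a)\<^sup>2 * k) + 2 * ((cmod b)\<^sup>2 * k))"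
      by simp
    then show ?thesis using that by (simp add: ennreal_mult')
  qed
  have E: "kinetic A (\<lambda>x. u x + v x) + kinetic A (\<lambda>x. u x - v x) = 2 * kinetic A u + 2 * kinetic A v"
    unfolding kinetic_def by (subst nn_integral_cmult[symmetric] nn_integral_add[symmetric], measurable)+
      (auto intro!: nn_integral_cong simp: mag_diff_add mag_diff_diff par)
  have L: "sqmass (\<lambda>x. u x + v x) + sqmass (\<lambda>x. u x - v x) = 2 * sqmass u + 2 * sqmass v"
    unfolding sqmass_def by (subst nn_integral_cmult[symmetric] nn_integral_add[symmetric], measurable)+
      (auto intro!: nn_integral_cong simp: par[of 1, simplified])
  have "energy A (\<lambda>x. u x + v x) + energy A (\<lambda>x. u x - v x)
     = ennreal c1 * (kinetic A (\<lambda>x. u x + v x) + kinetic A (\<lambda>x. u x - v x)) + ennreal c2 * (sqmass (\<lambda>x. u x + v x) + sqmass (\<lambda>x. u x - v x))"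
    unfolding energy_def by (simp add: algebra_simps)
  also have "\<dots> = 2 * energy A u + 2 * energy A v" unfolding E L energy_def by (simp add: algebra_simps)
  finally show ?thesis .
qed

lemma pmass_add_le:
  assumes [measurable]: "u \<in> borel_measurable borel" "v \<in> borel_measurable borel"
    and l: "0 < l" "l < 1"
  shows "pmass (\<lambda>x. u x + v x) \<le> ennreal ((1 - l) powr (1 - p)) * pmass u + ennreal (l powr (1 - p)) * pmass v"
proof -
  have "pmass (\<lambda>x. u x + v x) \<le> (\<integral>\<^sup>+x. ennreal ((1 - l) powr (1 - p)) * ennreal (cmod (u x) powr p)
      + ennreal (l powr (1 - p)) * ennreal (cmod (v x) powr p) \<partial>lborel)"
    unfolding pmass_def
  proof (intro nn_integral_mono)
    fix x :: "real^3"
    have "cmod (u x + v x) powr p \<le> (cmod (u x) + cmod (v x)) powr p"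
      using p_gt by (intro powr_mono2 norm_triangle_ineq) auto
    also have "\<dots> \<le> (1 - l) powr (1 - p) * cmod (u x) powr p + l powr (1 - p) * cmod (v x) powr p"
      using p_gt l by (intro powr_add_le_weighted) auto
    finally show "ennreal (cmod (u x + v x) powr p) \<le> ennreal ((1 - l) powr (1 - p)) * ennreal (cmod (u x) powr p)
      + ennreal (l powr (1 - p)) * ennreal (cmod (v x) powr p)"
      by (simp add: ennreal_leI flip: ennreal_mult' ennreal_plus)
  qed
  also have "\<dots> = ennreal ((1 - l) powr (1 - p)) * pmass u + ennreal (l powr (1 - p)) * pmass v"
    unfolding pmass_def by (subst nn_integral_add) (auto simp: nn_integral_cmult)
  finally show ?thesis .
qed

end

section \<open>Vanishing and the subcritical Sobolev inequality\<close>

context mag_setting begin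

definition kinetic0 :: "(real^3 \<Rightarrow> real) \<Rightarrow> ennreal" where
  "kinetic0 w = (\<integral>\<^sup>+z. ennreal ((w (fst z) - w (snd z))\<^sup>2 * kern (fst z - snd z)) \<partial>lborel)"

text \<open>
  On a ball of radius \<open>r\<close> about \<open>x\<close> one has \<open>1 \<le> (2 * w y / w x)\<^sup>q\<close> where \<open>w y\<close> is at least
  half of \<open>w x\<close>, and \<open>1 \<le> 4 * (w x - w y)\<^sup>2 / (w x)\<^sup>2\<close> elsewhere. Integrating over the ball,
  the radius is chosen so that the first term accounts for half of the volume at most. The
  second term then bounds the other half, and since the kernel is at least a multiple of
  \<open>r\<^bsup>-3-2s\<^esup>\<close> there, this bounds a higher power of \<open>w x\<close> by the density of the Gagliardo
  seminorm.
\<close>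

lemma higher_power_pointwise:
  assumes q: "2 \<le> q"
  shows "\<exists>C>0. \<forall>w \<sigma>. w \<in> borel_measurable borel \<longrightarrow> (\<forall>x. 0 \<le> w x) \<longrightarrow> 0 < \<sigma> \<longrightarrow>
      (\<forall>\<xi>. (\<integral>\<^sup>+y. ennreal (w y powr q) * indicator (ball \<xi> 1) y \<partial>lborel) \<le> ennreal \<sigma>) \<longrightarrow>
      (\<forall>x. ennreal (w x powr (2 + 2 * s * q / 3)) \<le> ennreal (C * \<sigma> powr (2 * s / 3)) *
         ((\<integral>\<^sup>+y. ennreal ((w x - w y)\<^sup>2 * kern (x - y)) \<partial>lborel) + ennreal ((w x)\<^sup>2)))"
proof -
  obtain c where c: "c > 0" "\<And>z. z \<noteq> 0 \<Longrightarrow> norm z \<le> 1 \<Longrightarrow> c * norm z powr (- (3 + 2 * s)) \<le> kern z"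
    using kern_lower by auto
  define v where "v = 4 / 3 * pi"
  have v: "v > 0" by (simp add: v_def)
  define D where "D = 2 * 2 powr q / v"
  have D: "D > 0" using v by (simp add: D_def)
  define K where "K = max 1 (8 / (c * v))"
  have K: "K \<ge> 1" "K \<ge> 8 / (c * v)" by (auto simp: K_def)
  define C where "C = K * D powr (2 * s / 3)"
  have C: "C > 0" using K D by (simp add: C_def)
  show ?thesis
  proof (intro exI[of _ C] conjI allI impI C)
    fix w :: "real^3 \<Rightarrow> real" and \<sigma> :: real and x :: "real^3"
    assume [measurable]: "w \<in> borel_measurable borel" and w0: "\<forall>x. 0 \<le> w x" and \<sigma>: "0 < \<sigma>"
      and loc: "\<forall>\<xi>. (\<integral>\<^sup>+y. ennreal (w y powr q) * indicator (ball \<xi> 1) y \<partial>lborel) \<le> ennreal \<sigma>"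
    define G where "G = (\<integral>\<^sup>+y. ennreal ((w x - w y)\<^sup>2 * kern (x - y)) \<partial>lborel)"
    define a where "a = w x"
    \<comment> \<open>\<open>F\<close> is the cube of the radius; if \<open>F > 1\<close>, then \<open>a\<close> is so small that the claim is immediate.\<close>
    define F where "F = D * \<sigma> / a powr q"
    have fac: "C * \<sigma> powr (2 * s / 3) > 0" using C \<sigma> by simp
    have sp: "a powr (2 + 2 * s * q / 3) = a\<^sup>2 * (a powr q) powr (2 * s / 3)" if "a > 0"
    proof -
      have "a powr (2 + 2 * s * q / 3) = a powr 2 * a powr (q * (2 * s / 3))"
        unfolding powr_add[symmetric] by (simp add: mult.commute)
      then show ?thesis using that by (simp add: powr_powr)
    qed
    consider "a = 0" | "G = \<infinity>" | "a > 0" "F > 1" | g where "a > 0" "F \<le> 1" "G = ennreal g" "g \<ge> 0"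
      using w0 by (cases G) (force simp: a_def order.order_iff_strict)+
    then have "ennreal (a powr (2 + 2 * s * q / 3)) \<le> ennreal (C * \<sigma> powr (2 * s / 3)) * (G + ennreal (a\<^sup>2))"
    proof cases
      case 2
      have "ennreal (C * \<sigma> powr (2 * s / 3)) * (G + ennreal (a\<^sup>2)) = top"
        using 2 C \<sigma> by (simp add: ennreal_mult_eq_top_iff)
      then show ?thesis by simp
    next
      case 3
      have "a powr q \<le> D * \<sigma>" using 3 by (simp add: F_def field_simps)
      then have "(a powr q) powr (2 * s / 3) \<le> (D * \<sigma>) powr (2 * s / 3)"
        using s_pos by (intro powr_mono2) auto
      also have "\<dots> = 1 * (D powr (2 * s / 3) * \<sigma> powr (2 * s / 3))" by (simp add: powr_mult)
      also have "\<dots> \<le> C * \<sigma> powr (2 * s / 3)"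
        unfolding C_def mult.assoc using K by (intro mult_right_mono) auto
      finally have "a powr (2 + 2 * s * q / 3) \<le> (C * \<sigma> powr (2 * s / 3)) * a\<^sup>2"
        using sp 3 by (simp add: mult.commute mult_left_mono)
      then have "ennreal (a powr (2 + 2 * s * q / 3)) \<le> ennreal (C * \<sigma> powr (2 * s / 3)) * ennreal (a\<^sup>2)"
        using fac by (simp add: ennreal_leI flip: ennreal_mult')
      also have "\<dots> \<le> ennreal (C * \<sigma> powr (2 * s / 3)) * (G + ennreal (a\<^sup>2))"
        by (intro mult_left_mono) auto
      finally show ?thesis .
    next
      case (4 g)
      define r where "r = F powr (1 / 3)"
      have F0: "F > 0" using D \<sigma> 4 by (simp add: F_def)
      have r: "r > 0" "r \<le> 1" using F0 4 powr_mono2[of "1/3" F 1] by (auto simp: r_def)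
      have r3: "r ^ 3 = F" using F0 by (simp add: r_def powr_powr flip: powr_numeral)
      define b1 where "b1 = (2 / a) powr q"
      define b2 where "b2 = 4 / a\<^sup>2 * (r powr (3 + 2 * s) / c)"
      have b: "b1 \<ge> 0" "b2 > 0" using 4 c r by (auto simp: b1_def b2_def)
      have pt: "indicator (ball x r) y \<le> b1 * (w y powr q * indicator (ball x 1) y) + b2 * ((a - w y)\<^sup>2 * kern (x - y))" for y
      proof (cases "y \<in> ball x r")
        case True
        then have n: "norm (x - y) < r" by (simp add: dist_norm)
        show ?thesis
        proof (cases "w y \<ge> a / 2")
          case True
          then have "1 \<le> 2 / a * w y" using 4 by (simp add: field_simps)
          then have "1 \<le> (2 / a * w y) powr q" using q by (simp add: ge_one_powr_ge_zero)
          also have "\<dots> = b1 * w y powr q" unfolding b1_def by (rule powr_mult)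
          finally show ?thesis using n r b by (simp add: indicator_def dist_norm add_increasing2)
        next
          case False
          then have xy: "x \<noteq> y" using 4 by (auto simp: a_def)
          have "r powr (- (3 + 2 * s)) \<le> norm (x - y) powr (- (3 + 2 * s))"
            using n xy s_pos by (intro powr_mono2') auto
          then have "c * r powr (- (3 + 2 * s)) \<le> c * norm (x - y) powr (- (3 + 2 * s))" using c by simp
          also have "\<dots> \<le> kern (x - y)" using c(2)[of "x - y"] xy n r by simp
          finally have "c / r powr (3 + 2 * s) \<le> kern (x - y)"
            by (simp only: powr_minus_divide) simp
          then have "1 \<le> (r powr (3 + 2 * s) / c) * kern (x - y)"
            using c(1) r by (simp add: field_simps)
          moreover have "1 \<le> 4 / a\<^sup>2 * (a - w y)\<^sup>2"
          proof -
            have "(a / 2)\<^sup>2 \<le> (a - w y)\<^sup>2" using False 4 by (intro power_mono) auto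
            then show ?thesis using 4 by (simp add: field_simps power2_eq_square)
          qed
          ultimately have "1 * 1 \<le> (4 / a\<^sup>2 * (a - w y)\<^sup>2) * ((r powr (3 + 2 * s) / c) * kern (x - y))"
            by (intro mult_mono) auto
          also have "\<dots> = b2 * ((a - w y)\<^sup>2 * kern (x - y))" by (simp add: b2_def)
          finally show ?thesis using True b by (simp add: add_increasing)
        qed
      qed (use b in auto)
      have "ennreal (v * r ^ 3) = emeasure lborel (ball x r)"
        using emeasure_ball[of r x] r by (simp add: unit_ball_vol_3 v_def)
      also have "\<dots> = (\<integral>\<^sup>+y. ennreal (indicator (ball x r) y) \<partial>lborel)"
        by (simp add: ennreal_indicator)
      also have "\<dots> \<le> (\<integral>\<^sup>+y. ennreal b1 * (ennreal (w y powr q) * indicator (ball x 1) y) + ennreal b2 * ennreal ((a - w y)\<^sup>2 * kern (x - y)) \<partial>lborel)"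
      proof (intro nn_integral_mono)
        fix y
        show "ennreal (indicator (ball x r) y) \<le> ennreal b1 * (ennreal (w y powr q) * indicator (ball x 1) y) + ennreal b2 * ennreal ((a - w y)\<^sup>2 * kern (x - y))"
          using ennreal_leI[OF pt[of y]] b by (simp add: ennreal_mult' ennreal_indicator ennreal_mult'')
      qed
      also have "\<dots> = ennreal b1 * (\<integral>\<^sup>+y. ennreal (w y powr q) * indicator (ball x 1) y \<partial>lborel) + ennreal b2 * G"
      proof -
        have [measurable]: "ball x 1 \<in> sets borel" by simp
        show ?thesis unfolding G_def a_def by (subst nn_integral_add) (simp_all add: nn_integral_cmult)
      qed
      also have "\<dots> \<le> ennreal b1 * ennreal \<sigma> + ennreal b2 * ennreal g"
        using loc 4 by (intro add_mono mult_left_mono) auto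
      also have "\<dots> = ennreal (b1 * \<sigma> + b2 * g)" using b \<sigma> 4 by (simp add: ennreal_mult')
      finally have "v * r ^ 3 \<le> b1 * \<sigma> + b2 * g" using b \<sigma> 4 by (subst (asm) ennreal_le_iff) auto
      moreover have "b1 * \<sigma> = v * r ^ 3 / 2"
        unfolding r3 F_def D_def b1_def using v 4 by (simp add: powr_divide)
      ultimately have "v * r ^ 3 / 2 \<le> 4 / a\<^sup>2 * (r powr (3 + 2 * s) / c) * g" by (simp add: b2_def)
      also have "r powr (3 + 2 * s) = r ^ 3 * F powr (2 * s / 3)"
      proof -
        have "r powr (3 + 2 * s) = r powr 3 * r powr (2 * s)" by (rule powr_add)
        moreover have "r powr 3 = r ^ 3" using r by simp
        moreover have "r powr (2 * s) = F powr (2 * s / 3)" by (simp add: r_def powr_powr)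
        ultimately show ?thesis by simp
      qed
      finally have "a\<^sup>2 \<le> 8 / (c * v) * F powr (2 * s / 3) * g"
        using 4 c(1) v r by (simp add: field_simps)
      also have "\<dots> \<le> K * F powr (2 * s / 3) * g" using K 4 by (intro mult_right_mono) auto
      finally have "a\<^sup>2 * (a powr q) powr (2 * s / 3) \<le> K * F powr (2 * s / 3) * g * (a powr q) powr (2 * s / 3)"
        by (intro mult_right_mono) auto
      also have "\<dots> = K * (F * a powr q) powr (2 * s / 3) * g" by (simp add: powr_mult)
      also have "F * a powr q = D * \<sigma>" using 4 by (simp add: F_def)
      also have "K * (D * \<sigma>) powr (2 * s / 3) * g = C * \<sigma> powr (2 * s / 3) * g" by (simp add: C_def powr_mult)
      finally have "ennreal (a powr (2 + 2 * s * q / 3)) \<le> ennreal (C * \<sigma> powr (2 * s / 3)) * G"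
        using sp 4 fac by (simp add: ennreal_leI flip: ennreal_mult')
      also have "\<dots> \<le> ennreal (C * \<sigma> powr (2 * s / 3)) * (G + ennreal (a\<^sup>2))"
        by (intro mult_left_mono) auto
      finally show ?thesis .
    qed (use q s_pos in auto)
    then show "ennreal (w x powr (2 + 2 * s * q / 3)) \<le> ennreal (C * \<sigma> powr (2 * s / 3)) *
         ((\<integral>\<^sup>+y. ennreal ((w x - w y)\<^sup>2 * kern (x - y)) \<partial>lborel) + ennreal ((w x)\<^sup>2))"
      by (simp add: a_def G_def)
  qed
qed

definition small_mass :: "real \<Rightarrow> real \<Rightarrow> (real^3 \<Rightarrow> real) \<Rightarrow> bool" where
  "small_mass B \<sigma> w \<longleftrightarrow> w \<in> borel_measurable borel \<and> (\<forall>x. 0 \<le> w x)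
     \<and> kinetic0 w + (\<integral>\<^sup>+x. ennreal ((w x)\<^sup>2) \<partial>lborel) \<le> ennreal B
     \<and> (\<forall>\<xi>. (\<integral>\<^sup>+y. ennreal ((w y)\<^sup>2) * indicator (ball \<xi> 1) y \<partial>lborel) \<le> ennreal \<sigma>)"

text \<open>
  The quantifiers express, without sequences, that functions of bounded energy whose \<open>L\<^sup>2\<close>
  mass in unit balls tends to \<open>0\<close> uniformly tend to \<open>0\<close> in \<open>L\<^sup>q\<close>.
\<close>

definition vanishing_exponent :: "real \<Rightarrow> bool" where
  "vanishing_exponent q \<longleftrightarrow> (\<forall>B>0. \<forall>\<epsilon>>0. \<exists>\<sigma>>0. \<forall>w. small_mass B \<sigma> w \<longrightarrow>
      (\<integral>\<^sup>+x. ennreal (w x powr q) \<partial>lborel) \<le> ennreal \<epsilon>)"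

definition locally_vanishing_exponent :: "real \<Rightarrow> bool" where
  "locally_vanishing_exponent q \<longleftrightarrow> (\<forall>B>0. \<forall>\<epsilon>>0. \<exists>\<sigma>>0. \<forall>w. small_mass B \<sigma> w \<longrightarrow>
      (\<forall>\<xi>. (\<integral>\<^sup>+y. ennreal (w y powr q) * indicator (ball \<xi> 1) y \<partial>lborel) \<le> ennreal \<epsilon>))"

lemma locally_vanishing_exponent_2: "locally_vanishing_exponent 2"
  unfolding locally_vanishing_exponent_def
proof (intro allI impI)
  fix B \<epsilon> :: real assume "0 < B" "0 < \<epsilon>"
  then show "\<exists>\<sigma>>0. \<forall>w. small_mass B \<sigma> w \<longrightarrow>
      (\<forall>\<xi>. (\<integral>\<^sup>+y. ennreal (w y powr 2) * indicator (ball \<xi> 1) y \<partial>lborel) \<le> ennreal \<epsilon>)"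
    by (intro exI[of _ \<epsilon>]) (simp add: small_mass_def)
qed

lemma vanishing_exponent_imp_local: "vanishing_exponent q \<Longrightarrow> locally_vanishing_exponent q"
  unfolding locally_vanishing_exponent_def
proof (intro allI impI)
  fix B \<epsilon> :: real assume V: "vanishing_exponent q" and "0 < B" "0 < \<epsilon>"
  then obtain \<sigma> where \<sigma>: "\<sigma> > 0" "\<And>w. small_mass B \<sigma> w \<Longrightarrow>
      (\<integral>\<^sup>+x. ennreal (w x powr q) \<partial>lborel) \<le> ennreal \<epsilon>"
    unfolding vanishing_exponent_def by blast
  have le: "(\<integral>\<^sup>+y. ennreal (w y powr q) * indicator (ball \<xi> 1) y \<partial>lborel) \<le> (\<integral>\<^sup>+x. ennreal (w x powr q) \<partial>lborel)"
    for w :: "real^3 \<Rightarrow> real" and \<xi>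
    by (intro nn_integral_mono) (auto simp: indicator_def)
  show "\<exists>\<sigma>>0. \<forall>w. small_mass B \<sigma> w \<longrightarrow>
      (\<forall>\<xi>. (\<integral>\<^sup>+y. ennreal (w y powr q) * indicator (ball \<xi> 1) y \<partial>lborel) \<le> ennreal \<epsilon>)"
    by (intro exI[of _ \<sigma>] conjI \<sigma>(1) allI impI order_trans[OF le \<sigma>(2)]) auto
qed

text \<open>
  Smallness of local \<open>q\<close>-masses improves to smallness of the global mass for the larger
  exponent \<open>2 + 2 * s * q / 3\<close>, by integrating \<open>higher_power_pointwise\<close>.
\<close>

lemma vanishing_exponent_step:
  assumes q: "2 \<le> q" and V: "locally_vanishing_exponent q"
  shows "vanishing_exponent (2 + 2 * s * q / 3)"
  unfolding vanishing_exponent_def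
proof (intro allI impI)
  fix B \<epsilon> :: real assume B: "0 < B" and \<epsilon>: "0 < \<epsilon>"
  obtain C where C: "C > 0" "\<And>w \<sigma> x. w \<in> borel_measurable borel \<Longrightarrow> (\<forall>x. 0 \<le> w x) \<Longrightarrow> 0 < \<sigma> \<Longrightarrow>
      (\<forall>\<xi>. (\<integral>\<^sup>+y. ennreal (w y powr q) * indicator (ball \<xi> 1) y \<partial>lborel) \<le> ennreal \<sigma>) \<Longrightarrow>
      ennreal (w x powr (2 + 2 * s * q / 3)) \<le> ennreal (C * \<sigma> powr (2 * s / 3)) *
         ((\<integral>\<^sup>+y. ennreal ((w x - w y)\<^sup>2 * kern (x - y)) \<partial>lborel) + ennreal ((w x)\<^sup>2))"
    using higher_power_pointwise[OF q] by blast
  define \<eta> where "\<eta> = (\<epsilon> / (C * B)) powr (3 / (2 * s))"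
  have \<eta>: "\<eta> > 0" using C B \<epsilon> by (simp add: \<eta>_def)
  have \<eta>': "C * \<eta> powr (2 * s / 3) * B = \<epsilon>" using C B \<epsilon> s_pos by (simp add: \<eta>_def powr_powr)
  obtain \<sigma> where \<sigma>: "\<sigma> > 0" "\<And>w. small_mass B \<sigma> w \<Longrightarrow>
      (\<forall>\<xi>. (\<integral>\<^sup>+y. ennreal (w y powr q) * indicator (ball \<xi> 1) y \<partial>lborel) \<le> ennreal \<eta>)"
    using V B \<eta> unfolding locally_vanishing_exponent_def by blast
  show "\<exists>\<sigma>>0. \<forall>w. small_mass B \<sigma> w \<longrightarrow>
      (\<integral>\<^sup>+x. ennreal (w x powr (2 + 2 * s * q / 3)) \<partial>lborel) \<le> ennreal \<epsilon>"
  proof (intro exI[of _ \<sigma>] conjI \<sigma>(1) allI impI)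
    fix w :: "real^3 \<Rightarrow> real"
    assume sm: "small_mass B \<sigma> w"
    then have w: "w \<in> borel_measurable borel" "\<forall>x. 0 \<le> w x"
      "kinetic0 w + (\<integral>\<^sup>+x. ennreal ((w x)\<^sup>2) \<partial>lborel) \<le> ennreal B"
      unfolding small_mass_def by auto
    note [measurable] = w(1)
    define G where "G x = (\<integral>\<^sup>+y. ennreal ((w x - w y)\<^sup>2 * kern (x - y)) \<partial>lborel)" for x
    have [measurable]: "G \<in> borel_measurable borel" unfolding G_def by measurable
    have EG: "kinetic0 w = (\<integral>\<^sup>+x. G x \<partial>lborel)"
      unfolding kinetic0_def G_def by (subst nn_integral_pair_lborel) auto
    have "(\<integral>\<^sup>+x. ennreal (w x powr (2 + 2 * s * q / 3)) \<partial>lborel)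
       \<le> (\<integral>\<^sup>+x. ennreal (C * \<eta> powr (2 * s / 3)) * (G x + ennreal ((w x)\<^sup>2)) \<partial>lborel)"
      unfolding G_def by (intro nn_integral_mono C(2) w \<eta> \<sigma>(2)[OF sm])
    also have "\<dots> = ennreal (C * \<eta> powr (2 * s / 3)) * (kinetic0 w + (\<integral>\<^sup>+x. ennreal ((w x)\<^sup>2) \<partial>lborel))"
      unfolding EG by (subst nn_integral_cmult) (auto simp: nn_integral_add)
    also have "\<dots> \<le> ennreal (C * \<eta> powr (2 * s / 3)) * ennreal B"
      by (intro mult_left_mono w) simp
    also have "\<dots> = ennreal \<epsilon>" using \<eta>' C(1) B by (simp flip: ennreal_mult')
    finally show "(\<integral>\<^sup>+x. ennreal (w x powr (2 + 2 * s * q / 3)) \<partial>lborel) \<le> ennreal \<epsilon>" .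
  qed
qed

text \<open>
  Values below \<open>\<eta>\<close> are controlled by the squares and values above \<open>\<eta>\<close> by the powers of
  exponent \<open>q\<close>.
\<close>

lemma vanishing_exponent_interpolate:
  assumes q: "2 < q'" "q' < q" and V: "vanishing_exponent q"
  shows "vanishing_exponent q'"
  unfolding vanishing_exponent_def
proof (intro allI impI)
  fix B \<epsilon> :: real assume B: "0 < B" and \<epsilon>: "0 < \<epsilon>"
  define \<eta> where "\<eta> = (\<epsilon> / (2 * B)) powr (1 / (q' - 2))"
  have \<eta>: "\<eta> > 0" using B \<epsilon> by (simp add: \<eta>_def)
  have \<eta>': "\<eta> powr (q' - 2) * B = \<epsilon> / 2" using B \<epsilon> q by (simp add: \<eta>_def powr_powr)
  define \<delta> where "\<delta> = \<epsilon> / 2 / \<eta> powr (q' - q)"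
  have \<delta>: "\<delta> > 0" "\<eta> powr (q' - q) * \<delta> = \<epsilon> / 2" using \<eta> \<epsilon> by (auto simp: \<delta>_def)
  obtain \<sigma> where \<sigma>: "\<sigma> > 0" "\<And>w. small_mass B \<sigma> w \<Longrightarrow>
      (\<integral>\<^sup>+x. ennreal (w x powr q) \<partial>lborel) \<le> ennreal \<delta>"
    using V B \<delta> unfolding vanishing_exponent_def by blast
  show "\<exists>\<sigma>>0. \<forall>w. small_mass B \<sigma> w \<longrightarrow>
      (\<integral>\<^sup>+x. ennreal (w x powr q') \<partial>lborel) \<le> ennreal \<epsilon>"
  proof (intro exI[of _ \<sigma>] conjI \<sigma>(1) allI impI)
    fix w :: "real^3 \<Rightarrow> real"
    assume sm: "small_mass B \<sigma> w"
    then have w: "w \<in> borel_measurable borel" "\<forall>x. 0 \<le> w x"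
      "kinetic0 w + (\<integral>\<^sup>+x. ennreal ((w x)\<^sup>2) \<partial>lborel) \<le> ennreal B"
      unfolding small_mass_def by auto
    note [measurable] = w(1)
    have "w x powr q' \<le> \<eta> powr (q' - 2) * (w x)\<^sup>2 + \<eta> powr (q' - q) * w x powr q" for x
    proof (cases "w x = 0")
      case False
      then have x: "w x > 0" using w(2) by (metis less_eq_real_def)
      show ?thesis
      proof (cases "w x \<le> \<eta>")
        case True
        have "w x powr q' = w x powr (q' - 2) * w x powr 2" by (simp flip: powr_add)
        also have "\<dots> \<le> \<eta> powr (q' - 2) * w x powr 2" using True x q by (intro mult_right_mono powr_mono2) auto
        finally show ?thesis using x by (simp add: add_increasing2)
      next
        case False
        have "w x powr q' = w x powr (q' - q) * w x powr q" by (simp flip: powr_add)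
        also have "\<dots> \<le> \<eta> powr (q' - q) * w x powr q" using False \<eta> x q by (intro mult_right_mono powr_mono2') auto
        finally show ?thesis by (simp add: add_increasing)
      qed
    qed (use q in auto)
    then have "(\<integral>\<^sup>+x. ennreal (w x powr q') \<partial>lborel) \<le> (\<integral>\<^sup>+x. ennreal (\<eta> powr (q' - 2)) * ennreal ((w x)\<^sup>2)
        + ennreal (\<eta> powr (q' - q)) * ennreal (w x powr q) \<partial>lborel)"
      by (intro nn_integral_mono) (simp add: ennreal_leI flip: ennreal_mult' ennreal_plus)
    also have "\<dots> = ennreal (\<eta> powr (q' - 2)) * (\<integral>\<^sup>+x. ennreal ((w x)\<^sup>2) \<partial>lborel)
        + ennreal (\<eta> powr (q' - q)) * (\<integral>\<^sup>+x. ennreal (w x powr q) \<partial>lborel)"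
      by (subst nn_integral_add) (auto simp: nn_integral_cmult)
    also have "\<dots> \<le> ennreal (\<eta> powr (q' - 2)) * ennreal B + ennreal (\<eta> powr (q' - q)) * ennreal \<delta>"
      using w(3) by (intro add_mono mult_left_mono \<sigma>(2)[OF sm]) (auto elim: order_trans[rotated])
    also have "\<dots> = ennreal (\<epsilon> / 2) + ennreal (\<epsilon> / 2)"
      by (simp add: \<eta>' \<delta>(2) flip: ennreal_mult')
    also have "\<dots> = ennreal (\<epsilon> / 2 + \<epsilon> / 2)" using \<epsilon> by (intro ennreal_plus[symmetric]) auto
    finally show "(\<integral>\<^sup>+x. ennreal (w x powr q') \<partial>lborel) \<le> ennreal \<epsilon>" by simp
  qed
qed

text \<open>
  The map \<open>q \<mapsto> 2 + 2 * s * q / 3\<close> is a contraction whose fixed point is the critical exponent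
  \<open>6 / (3 - 2 * s)\<close>. Its iterates from \<open>2\<close> therefore pass every subcritical \<open>p\<close>.
\<close>

lemma vanishing_exponent_p: "vanishing_exponent p"
proof -
  define t where "t = 2 * s / 3"
  have t: "0 < t" "t < 1" using s_pos s_less by (auto simp: t_def)
  define Q where "Q = 2 / (1 - t)"
  have Q2: "Q \<ge> 2" using t by (simp add: Q_def field_simps)
  have Qfix: "2 + t * Q = Q" using t by (simp add: Q_def field_simps)
  have "6 / (3 - 2 * s) = Q" using s_less by (simp add: Q_def t_def field_simps)
  then have pQ: "p < Q" using p_less by simp
  \<comment> \<open>The iterates of \<open>q \<mapsto> 2 + t * q\<close> from \<open>2\<close>, in closed form.\<close>
  define q where "q k = Q - (Q - 2) * t ^ k" for k
  have q_step: "q (Suc k) = 2 + 2 * s * q k / 3" for k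
  proof -
    have "2 + 2 * s * q k / 3 = 2 + t * q k" by (simp add: t_def)
    also have "\<dots> = (2 + t * Q) - (Q - 2) * t ^ Suc k" by (simp add: q_def algebra_simps)
    also have "\<dots> = q (Suc k)" by (simp only: Qfix q_def)
    finally show ?thesis by simp
  qed
  have q2: "2 \<le> q k" for k
  proof -
    have "(Q - 2) * t ^ k \<le> (Q - 2) * 1" using t Q2 by (intro mult_left_mono) (auto simp: power_le_one)
    then show ?thesis by (simp add: q_def)
  qed
  have loc: "locally_vanishing_exponent (q k)" for k
  proof (induction k)
    case 0
    then show ?case using locally_vanishing_exponent_2 by (simp add: q_def)
  next
    case (Suc k)
    then show ?case using vanishing_exponent_step[OF q2 Suc] vanishing_exponent_imp_local q_step by simp
  qed
  have "(\<lambda>k. q (Suc k)) \<longlonglongrightarrow> Q - (Q - 2) * 0"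
    unfolding q_def using t by (intro tendsto_intros LIMSEQ_Suc LIMSEQ_realpow_zero) auto
  then have "eventually (\<lambda>k. p < q (Suc k)) sequentially" using pQ by (intro order_tendstoD(1)) auto
  then obtain k where "p < q (Suc k)" by (auto simp: eventually_sequentially)
  then show ?thesis
    using vanishing_exponent_interpolate[OF p_gt, of "q (Suc k)"] vanishing_exponent_step[OF q2 loc] q_step by simp
qed

text \<open>
  The diamagnetic inequality: a phase does not affect the modulus.
\<close>

lemma kinetic0_le_kinetic: "kinetic0 (\<lambda>x. cmod (u x)) \<le> kinetic A u"
  unfolding kinetic0_def kinetic_def
proof (intro nn_integral_mono ennreal_leI mult_right_mono)
  fix z :: "(real^3) \<times> (real^3)"
  have "\<bar>cmod (phase A (fst z) (snd z) * u (fst z)) - cmod (u (snd z))\<bar>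
     \<le> cmod (mag_diff A u (fst z) (snd z))"
    unfolding mag_diff_def by (rule norm_triangle_ineq3)
  then have "\<bar>cmod (u (fst z)) - cmod (u (snd z))\<bar> \<le> cmod (mag_diff A u (fst z) (snd z))"
    by (simp add: norm_mult)
  from power_mono[OF this, of 2]
  show "(cmod (u (fst z)) - cmod (u (snd z)))\<^sup>2 \<le> (cmod (mag_diff A u (fst z) (snd z)))\<^sup>2" by simp
qed simp

text \<open>
  \<open>\<sigma>\<close> depends on the energy bound only, not on the field. This uniformity is what allows one
  to compare different fields later on.
\<close>

lemma vanishing:
  assumes B: "0 < B" and \<epsilon>: "0 < \<epsilon>"
  shows "\<exists>\<sigma>>0. \<forall>A u. A \<in> borel_measurable borel \<longrightarrow> u \<in> borel_measurable borel \<longrightarrow> energy A u \<le> ennreal B \<longrightarrow>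
    (\<forall>\<xi>. mass2 (ball \<xi> 1) u \<le> ennreal \<sigma>) \<longrightarrow> pmass u \<le> ennreal \<epsilon>"
proof -
  define B' where "B' = B / c1 + B / c2"
  have B': "B' > 0" using B c1_pos c2_pos by (simp add: B'_def add_pos_pos)
  obtain \<sigma> where \<sigma>: "\<sigma> > 0" "\<And>w. small_mass B' \<sigma> w \<Longrightarrow>
      (\<integral>\<^sup>+x. ennreal (w x powr p) \<partial>lborel) \<le> ennreal \<epsilon>"
    using vanishing_exponent_p B' \<epsilon> unfolding vanishing_exponent_def by blast
  show ?thesis
  proof (intro exI[of _ \<sigma>] conjI \<sigma>(1) allI impI)
    fix A :: "real^3 \<Rightarrow> real^3" and u :: "real^3 \<Rightarrow> complex"
    assume [measurable]: "A \<in> borel_measurable borel" "u \<in> borel_measurable borel" and N: "energy A u \<le> ennreal B"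
      and loc: "\<forall>\<xi>. mass2 (ball \<xi> 1) u \<le> ennreal \<sigma>"
    note 1 = energy_parts_le(2)[OF N] and 2 = energy_parts_le(1)[OF N]
    have "kinetic0 (\<lambda>x. cmod (u x)) + (\<integral>\<^sup>+x. ennreal ((cmod (u x))\<^sup>2) \<partial>lborel) \<le> ennreal (B / c1) + ennreal (B / c2)"
      using order_trans[OF kinetic0_le_kinetic 1] 2 B by (intro add_mono) (auto simp: sqmass_def)
    also have "\<dots> = ennreal B'" using B c1_pos c2_pos by (simp add: B'_def ennreal_plus)
    finally show "pmass u \<le> ennreal \<epsilon>" unfolding pmass_def using loc by (intro \<sigma>(2)) (auto simp: small_mass_def)
  qed
qed

text \<open>
  If the energy is small enough, so is the whole \<open>L\<^sup>2\<close> mass, and \<open>vanishing\<close> applies.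
  Homogeneity gives the general case.
\<close>

lemma sobolev:
  "\<exists>K>0. \<forall>A u B. A \<in> borel_measurable borel \<longrightarrow> u \<in> borel_measurable borel \<longrightarrow> 0 < B \<longrightarrow> energy A u \<le> ennreal B \<longrightarrow>
     pmass u \<le> ennreal (K * B powr (p / 2))"
proof -
  obtain \<sigma> where \<sigma>: "\<sigma> > 0" "\<And>A u. A \<in> borel_measurable borel \<Longrightarrow> u \<in> borel_measurable borel \<Longrightarrow> energy A u \<le> ennreal 1 \<Longrightarrow>
    (\<forall>\<xi>. mass2 (ball \<xi> 1) u \<le> ennreal \<sigma>) \<Longrightarrow> pmass u \<le> ennreal 1"
    using vanishing[of 1 1] by auto
  define \<tau> where "\<tau> = min 1 (c2 * \<sigma>)"
  have \<tau>: "\<tau> > 0" using \<sigma>(1) c2_pos by (simp add: \<tau>_def)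
  have unit: "pmass u \<le> 1" if [measurable]: "A \<in> borel_measurable borel" "u \<in> borel_measurable borel" and N: "energy A u \<le> ennreal \<tau>" for A u
  proof -
    have "energy A u \<le> ennreal 1" using N by (rule order_trans) (intro ennreal_leI; simp add: \<tau>_def)
    moreover have "ennreal c2 * sqmass u \<le> ennreal c2 * ennreal \<sigma>"
    proof -
      have "ennreal c2 * sqmass u \<le> ennreal \<tau>" using sqmass_le_energy N by (rule order_trans)
      also have "\<dots> \<le> ennreal (c2 * \<sigma>)" by (intro ennreal_leI) (simp add: \<tau>_def)
      finally show ?thesis using c2_pos by (simp add: ennreal_mult')
    qed
    then have "sqmass u \<le> ennreal \<sigma>" using c2_pos by (subst (asm) ennreal_mult_le_mult_iff) auto
    moreover have "mass2 (ball \<xi> 1) u \<le> sqmass u" for \<xi>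
      unfolding sqmass_def by (intro nn_integral_mono) (auto simp: indicator_def)
    ultimately show ?thesis using \<sigma>(2)[OF that(1,2)] by (auto intro: order_trans)
  qed
  define K where "K = \<tau> powr (- (p / 2))"
  have "pmass u \<le> ennreal (K * B powr (p / 2))"
    if [measurable]: "A \<in> borel_measurable borel" "u \<in> borel_measurable borel" and B: "0 < B" and N: "energy A u \<le> ennreal B" for A u B
  proof -
    define \<mu> where "\<mu> = sqrt (\<tau> / B)"
    have \<mu>: "\<mu> > 0" "\<mu>\<^sup>2 = \<tau> / B" using \<tau> B by (auto simp: \<mu>_def)
    have "energy A (\<lambda>x. of_real \<mu> * u x) = ennreal (\<mu>\<^sup>2) * energy A u" by (simp add: energy_scale)
    also have "\<dots> \<le> ennreal (\<mu>\<^sup>2) * ennreal B" by (intro mult_left_mono N) simp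
    also have "\<dots> = ennreal \<tau>" using \<mu> B \<tau> by (simp flip: ennreal_mult')
    finally have "pmass (\<lambda>x. of_real \<mu> * u x) \<le> 1" by (rule unit[rotated 2]) auto
    then have "ennreal (\<mu> powr p) * pmass u \<le> 1" using \<mu> by (simp add: pmass_scale)
    then have "ennreal (\<mu> powr (- p)) * (ennreal (\<mu> powr p) * pmass u) \<le> ennreal (\<mu> powr (- p)) * 1"
      by (intro mult_left_mono) auto
    moreover have "ennreal (\<mu> powr (- p)) * (ennreal (\<mu> powr p) * pmass u) = pmass u"
      using \<mu> by (simp flip: mult.assoc ennreal_mult' powr_add)
    moreover have "\<mu> powr (- p) = K * B powr (p / 2)"
    proof -
      have "\<mu> = (\<tau> / B) powr (1 / 2)" using \<mu> \<tau> B by (simp add: \<mu>_def powr_half_sqrt)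
      then have "\<mu> powr (- p) = (\<tau> / B) powr (- (p / 2))" using \<tau> B by (simp add: powr_powr)
      also have "\<dots> = K * B powr (p / 2)" using \<tau> B by (simp add: K_def powr_divide powr_minus divide_simps)
      finally show ?thesis .
    qed
    ultimately show ?thesis by simp
  qed
  then show ?thesis using \<tau> by (intro exI[of _ K]) (auto simp: K_def)
qed

end

section \<open>Smooth functions and test functions\<close>

lemma C_k_SucI:
  assumes "\<And>x. (f has_derivative f' x) (at x)" "\<And>b. b \<in> Basis \<Longrightarrow> C_k k (\<lambda>x. f' x b)"
  shows "C_k (Suc k) f"
proof -
  have "frechet_derivative f (at x) = f' x" for x
    using frechet_derivative_at[OF assms(1)[of x]] by simp
  then show ?thesis using assms by (auto simp: differentiable_def)
qed

lemma C_k_SucD: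
  assumes "C_k (Suc k) f"
  shows "(f has_derivative frechet_derivative f (at x)) (at x)" "b \<in> Basis \<Longrightarrow> C_k k (\<lambda>x. frechet_derivative f (at x) b)"
  using assms by (auto simp: frechet_derivative_works)

lemma C_k_Suc_imp: "C_k (Suc k) f \<Longrightarrow> C_k k f"
proof (induction k arbitrary: f)
  case 0
  then show ?case by (auto intro!: continuous_at_imp_continuous_on differentiable_imp_continuous_within)
next
  case (Suc k)
  then show ?case by (metis C_k.simps(2))
qed

lemma C_k_const: "C_k k (\<lambda>x. c)"
proof (induction k arbitrary: c)
  case (Suc k)
  show ?case by (rule C_k_SucI[where f' = "\<lambda>x b. 0"]) (auto simp: Suc)
qed simp

lemma C_k_add: "C_k k f \<Longrightarrow> C_k k g \<Longrightarrow> C_k k (\<lambda>x. f x + g x)"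
proof (induction k arbitrary: f g)
  case (Suc k)
  show ?case
    by (rule C_k_SucI[OF has_derivative_add[OF C_k_SucD(1)[OF Suc.prems(1)] C_k_SucD(1)[OF Suc.prems(2)]]])
      (intro Suc.IH C_k_SucD Suc.prems)
qed (auto intro: continuous_intros)

lemma C_k_mult: "C_k k f \<Longrightarrow> C_k k g \<Longrightarrow> C_k k (\<lambda>x. f x * g x)"
proof (induction k arbitrary: f g)
  case (Suc k)
  show ?case
    by (rule C_k_SucI[OF has_derivative_mult[OF C_k_SucD(1)[OF Suc.prems(1)] C_k_SucD(1)[OF Suc.prems(2)]]])
      (intro C_k_add Suc.IH C_k_SucD(2)[OF Suc.prems(1)] C_k_SucD(2)[OF Suc.prems(2)]
        C_k_Suc_imp[OF Suc.prems(1)] C_k_Suc_imp[OF Suc.prems(2)])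
qed (auto intro: continuous_intros)

lemma C_k_uminus: "C_k k f \<Longrightarrow> C_k k (\<lambda>x. - f x)"
  using C_k_mult[OF C_k_const[of k "-1"], of f] by simp

text \<open>
  The second premise lets the induction express the outer derivative through the outer
  function: it holds for \<open>exp\<close>, whose derivative is itself, and for \<open>inverse\<close>, whose
  derivative is a polynomial in it.
\<close>

lemma C_k_chain:
  assumes "\<And>z. z \<in> S \<Longrightarrow> (h has_field_derivative h' z) (at z)"
    and "\<And>k f. (\<And>x. f x \<in> S) \<Longrightarrow> C_k k f \<Longrightarrow> C_k k (\<lambda>x. h (f x)) \<Longrightarrow> C_k k (\<lambda>x. h' (f x))"
    and "\<And>x. f x \<in> S" and "C_k k f"
  shows "C_k k (\<lambda>x. h (f x))"
  using assms(3,4)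
proof (induction k arbitrary: f)
  case 0
  have "continuous_on S h" using assms(1) by (blast intro: continuous_at_imp_continuous_on DERIV_isCont)
  moreover have "continuous_on UNIV f" using 0 by simp
  ultimately have "continuous_on UNIV (\<lambda>x. h (f x))"
    by (rule continuous_on_compose2) (use 0 in auto)
  then show ?case by simp
next
  case (Suc k)
  show ?case
  proof (rule C_k_SucI)
    show "((\<lambda>x. h (f x)) has_derivative (\<lambda>b. h' (f x) * frechet_derivative f (at x) b)) (at x)" for x
      using has_derivative_compose[OF C_k_SucD(1)[OF Suc.prems(2)] assms(1)[OF Suc.prems(1), unfolded has_field_derivative_def]] .
    show "C_k k (\<lambda>x. h' (f x) * frechet_derivative f (at x) b)" if "b \<in> Basis" for b
      using C_k_SucD(2)[OF Suc.prems(2) that] C_k_Suc_imp[OF Suc.prems(2)] Suc.prems(1)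
      by (intro C_k_mult assms(2) Suc.IH) auto
  qed
qed

lemma C_k_exp: "C_k k f \<Longrightarrow> C_k k (\<lambda>x. exp (f x))"
  by (rule C_k_chain[where h = exp and h' = exp and S = UNIV]) (auto intro: DERIV_exp)

lemma C_k_inverse: "C_k k f \<Longrightarrow> (\<And>x. f x \<noteq> 0) \<Longrightarrow> C_k k (\<lambda>x. inverse (f x))"
proof (rule C_k_chain[where h = inverse and h' = "\<lambda>z. (-1) * (inverse z * inverse z)" and S = "- {0}"])
  fix z :: complex assume "z \<in> - {0}"
  then show "(inverse has_field_derivative (-1) * (inverse z * inverse z)) (at z)"
    by (auto intro!: derivative_eq_intros)
qed (auto intro!: C_k_uminus C_k_mult)

lemma C_k_bounded_linear:
  assumes "bounded_linear f"
  shows "C_k k f"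
proof (cases k)
  case 0
  then show ?thesis using linear_continuous_on[OF assms] by simp
next
  case (Suc j)
  show ?thesis unfolding Suc
    by (rule C_k_SucI[where f' = "\<lambda>x. f"]) (auto intro: bounded_linear_imp_has_derivative assms C_k_const)
qed

lemma C_k_affine:
  assumes "C_k k f"
  shows "C_k k (\<lambda>x. f (c *\<^sub>R x + \<xi>))"
  using assms
proof (induction k arbitrary: f)
  case 0
  then have "continuous_on UNIV f" by simp
  moreover have "continuous_on UNIV (\<lambda>x::real^3. c *\<^sub>R x + \<xi>)" by (intro continuous_intros)
  ultimately have "continuous_on UNIV (\<lambda>x. f (c *\<^sub>R x + \<xi>))" by (rule continuous_on_compose2) simp
  then show ?case by simp
next
  case (Suc k)
  let ?F = "\<lambda>x. frechet_derivative f (at x)"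
  have d: "((\<lambda>x. f (c *\<^sub>R x + \<xi>)) has_derivative (\<lambda>b. ?F (c *\<^sub>R x + \<xi>) (c *\<^sub>R b))) (at x)" for x
    by (rule has_derivative_compose[OF _ C_k_SucD(1)[OF Suc.prems]]) (auto intro!: derivative_eq_intros)
  have e: "?F y (c *\<^sub>R b) = of_real c * ?F y b" for y b
    using linear_scale[OF has_derivative_linear[OF C_k_SucD(1)[OF Suc.prems]]] by (simp add: scaleR_conv_of_real)
  show ?case
    by (rule C_k_SucI[OF d]) (simp only: e, intro C_k_mult C_k_const Suc.IH C_k_SucD(2)[OF Suc.prems])
qed

definition smooth :: "(real^3 \<Rightarrow> complex) \<Rightarrow> bool" where
  "smooth f \<longleftrightarrow> (\<forall>k. C_k k f)"

lemma smooth_const: "smooth (\<lambda>x. c)" by (simp add: smooth_def C_k_const)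
lemma smooth_add: "smooth f \<Longrightarrow> smooth g \<Longrightarrow> smooth (\<lambda>x. f x + g x)" by (simp add: smooth_def C_k_add)
lemma smooth_mult: "smooth f \<Longrightarrow> smooth g \<Longrightarrow> smooth (\<lambda>x. f x * g x)" by (simp add: smooth_def C_k_mult)
lemma smooth_diff: "smooth f \<Longrightarrow> smooth g \<Longrightarrow> smooth (\<lambda>x. f x - g x)"
  using smooth_add[of f "\<lambda>x. (-1) * g x"] smooth_mult[of "\<lambda>x. -1" g] smooth_const[of "-1"] by simp
lemma smooth_uminus: "smooth f \<Longrightarrow> smooth (\<lambda>x. - f x)"
  using smooth_mult[OF smooth_const[of "-1"], of f] by simp
lemma smooth_exp: "smooth f \<Longrightarrow> smooth (\<lambda>x. exp (f x))" by (simp add: smooth_def C_k_exp)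
lemma smooth_inverse: "smooth f \<Longrightarrow> (\<And>x. f x \<noteq> 0) \<Longrightarrow> smooth (\<lambda>x. inverse (f x))" by (simp add: smooth_def C_k_inverse)
lemma smooth_divide: "smooth f \<Longrightarrow> smooth g \<Longrightarrow> (\<And>x. g x \<noteq> 0) \<Longrightarrow> smooth (\<lambda>x. f x / g x)"
  unfolding divide_inverse by (intro smooth_mult smooth_inverse)
lemma smooth_bounded_linear: "bounded_linear f \<Longrightarrow> smooth f" by (simp add: smooth_def C_k_bounded_linear)
lemma smooth_affine: "smooth f \<Longrightarrow> smooth (\<lambda>x. f (c *\<^sub>R x + \<xi>))" by (simp add: smooth_def C_k_affine)
lemma smooth_inner: "smooth (\<lambda>x. of_real (x \<bullet> a))"
  by (intro smooth_bounded_linear bounded_linear_compose[OF bounded_linear_of_real] bounded_linear_inner_left)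
lemma smooth_continuous: "smooth f \<Longrightarrow> continuous_on UNIV f" unfolding smooth_def using C_k.simps(1) by blast

lemma smooth_sin: "smooth f \<Longrightarrow> smooth (\<lambda>x. sin (f x))"
  unfolding sin_exp_eq
  by (intro smooth_divide smooth_diff smooth_exp smooth_uminus smooth_mult smooth_const) auto

lemma smooth_cos: "smooth f \<Longrightarrow> smooth (\<lambda>x. cos (f x))"
  unfolding cos_exp_eq
  by (intro smooth_divide smooth_add smooth_exp smooth_uminus smooth_mult smooth_const) auto

text \<open>
  The functions \<open>e\<^bsup>-1/t\<^esup> / t\<^sup>i\<close>, extended by \<open>0\<close>. The powers of \<open>1/t\<close> are included because the
  family, unlike the single function \<open>e\<^bsup>-1/t\<^esup>\<close>, is closed under differentiation up to linear
  combinations.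
\<close>

definition flat :: "nat \<Rightarrow> real \<Rightarrow> real" where
  "flat i t = (if t \<le> 0 then 0 else exp (- (1 / t)) / t ^ i)"

lemma flat_bound: "0 < t \<Longrightarrow> flat i t \<le> real (Suc i) powr real (Suc i) * t"
proof -
  assume t: "0 < t"
  have "(1 / t) powr real (Suc i) \<le> real (Suc i) powr real (Suc i) * exp (1 / t)"
    using t by (intro powr_le_exp) auto
  then have "1 / t ^ Suc i \<le> real (Suc i) powr real (Suc i) * exp (1 / t)"
    using t by (simp only: powr_realpow zero_less_divide_1_iff power_one_over)
  then show ?thesis using t by (simp add: flat_def exp_minus field_simps del: of_nat_Suc)
qed

lemma flat_nonneg: "0 \<le> flat i t" by (simp add: flat_def)

lemma flat_pos_iff: "0 < flat i t \<longleftrightarrow> 0 < t" by (simp add: flat_def)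

lemma flat_deriv: "(flat i has_real_derivative flat (i + 2) t - real i * flat (i + 1) t) (at t)"
proof -
  consider "t < 0" | "t > 0" | "t = 0" by linarith
  then show ?thesis
  proof cases
    case 1
    have "((\<lambda>t. 0) has_real_derivative 0) (at t)" by simp
    then have "(flat i has_real_derivative 0) (at t)"
      by (rule has_field_derivative_transform_within_open[of _ _ _ "{..<0}"]) (use 1 in \<open>auto simp: flat_def\<close>)
    then show ?thesis using 1 by (simp add: flat_def)
  next
    case 2
    have "((\<lambda>t. exp (- (1 / t)) / t ^ i) has_real_derivative
        ((exp (- (1 / t)) * (1 / t\<^sup>2)) * t ^ i - exp (- (1 / t)) * (real i * t ^ (i - 1))) / (t ^ i * t ^ i)) (at t)"
      using 2 by (auto intro!: derivative_eq_intros simp: power2_eq_square field_simps)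
    also have "((exp (- (1 / t)) * (1 / t\<^sup>2)) * t ^ i - exp (- (1 / t)) * (real i * t ^ (i - 1))) / (t ^ i * t ^ i)
       = flat (i + 2) t - real i * flat (i + 1) t"
      using 2 by (cases i) (auto simp: flat_def field_simps power2_eq_square power_add)
    finally show ?thesis
      by (rule has_field_derivative_transform_within_open[of _ _ _ "{0<..}"]) (use 2 in \<open>auto simp: flat_def\<close>)
  next
    case 3
    have "((\<lambda>h. flat i h / h) \<longlongrightarrow> 0) (at 0)"
    proof (rule Lim_null_comparison)
      show "\<forall>\<^sub>F h in at 0. norm (flat i h / h) \<le> real (Suc (Suc i)) powr real (Suc (Suc i)) * \<bar>h\<bar>"
      proof (rule always_eventually, rule allI)
        fix h :: real
        show "norm (flat i h / h) \<le> real (Suc (Suc i)) powr real (Suc (Suc i)) * \<bar>h\<bar>"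
        proof (cases "h > 0")
          case True
          have "flat i h / h = flat (Suc i) h" using True by (simp add: flat_def field_simps)
          then show ?thesis using flat_bound[OF True, of "Suc i"] True flat_nonneg[of "Suc i" h]
            by (simp del: of_nat_Suc)
        next
          case False
          then have z: "norm (flat i h / h) = 0" by (simp add: flat_def)
          show ?thesis unfolding z by simp
        qed
      qed
      show "((\<lambda>h::real. real (Suc (Suc i)) powr real (Suc (Suc i)) * \<bar>h\<bar>) \<longlongrightarrow> 0) (at 0)"
        by (auto intro!: tendsto_eq_intros)
    qed
    then show ?thesis unfolding 3 DERIV_def by (simp add: flat_def)
  qed
qed

lemma C_k_flat: "C_k k (\<lambda>x. of_real (flat i (\<alpha> + \<beta> * (x \<bullet> x))))"
proof (induction k arbitrary: i)
  case 0
  have "continuous_on UNIV (flat i)"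
    using flat_deriv by (blast intro: continuous_at_imp_continuous_on DERIV_isCont)
  then have "continuous_on UNIV (\<lambda>x::real^3. flat i (\<alpha> + \<beta> * (x \<bullet> x)))"
    by (rule continuous_on_compose2) (auto intro!: continuous_intros)
  then show ?case by (auto intro: continuous_intros)
next
  case (Suc k)
  let ?q = "\<lambda>x::real^3. \<alpha> + \<beta> * (x \<bullet> x)"
  show ?case
  proof (rule C_k_SucI)
    fix x :: "real^3"
    have "(?q has_derivative (\<lambda>b. \<beta> * (2 * (x \<bullet> b)))) (at x)"
      by (auto intro!: derivative_eq_intros simp: inner_commute)
    from has_derivative_compose[OF this flat_deriv[unfolded has_field_derivative_def]]
    have "((\<lambda>x. flat i (?q x)) has_derivative (\<lambda>b. (flat (i + 2) (?q x) - real i * flat (i + 1) (?q x)) * (\<beta> * (2 * (x \<bullet> b))))) (at x)" .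
    note D = has_derivative_of_real[OF this]
    show "((\<lambda>x. complex_of_real (flat i (?q x))) has_derivative
       (\<lambda>b. (of_real (flat (i + 2) (?q x)) + (- of_real (real i)) * of_real (flat (i + 1) (?q x))) * (of_real (2 * \<beta>) * of_real (x \<bullet> b)))) (at x)"
      by (rule has_derivative_eq_rhs[OF D]) (auto simp: algebra_simps)
  next
    fix b :: "real^3"
    show "C_k k (\<lambda>x. (of_real (flat (i + 2) (?q x)) + (- of_real (real i)) * of_real (flat (i + 1) (?q x))) * (of_real (2 * \<beta>) * of_real (x \<bullet> b)))"
      using smooth_inner[of b] by (intro C_k_mult C_k_add C_k_const Suc) (auto simp: smooth_def)
  qed
qed

lemma smooth_flat: "smooth (\<lambda>x. of_real (flat i (\<alpha> + \<beta> * (x \<bullet> x))))"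
  by (simp add: smooth_def C_k_flat)

lemma test_functions_iff:
  "\<phi> \<in> test_functions \<longleftrightarrow> smooth \<phi> \<and> (\<exists>R. \<forall>x. R \<le> norm x \<longrightarrow> \<phi> x = 0)"
proof -
  have "bounded {x. \<phi> x \<noteq> 0} \<longleftrightarrow> (\<exists>R. \<forall>x. R \<le> norm x \<longrightarrow> \<phi> x = 0)"
  proof
    assume "bounded {x. \<phi> x \<noteq> 0}"
    then obtain B where "\<And>x. \<phi> x \<noteq> 0 \<Longrightarrow> norm x \<le> B" by (auto simp: bounded_iff)
    then show "\<exists>R. \<forall>x. R \<le> norm x \<longrightarrow> \<phi> x = 0" by (intro exI[of _ "B + 1"]) force
  next
    assume "\<exists>R. \<forall>x. R \<le> norm x \<longrightarrow> \<phi> x = 0"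
    then show "bounded {x. \<phi> x \<noteq> 0}" unfolding bounded_iff by (metis (mono_tags) linorder_le_cases mem_Collect_eq)
  qed
  then show ?thesis by (simp add: test_functions_def smooth_def compact_closure)
qed

lemma test_mult: "smooth f \<Longrightarrow> \<phi> \<in> test_functions \<Longrightarrow> (\<lambda>x. f x * \<phi> x) \<in> test_functions"
  unfolding test_functions_iff by (auto intro: smooth_mult)

lemma test_scale: "\<phi> \<in> test_functions \<Longrightarrow> (\<lambda>x. c * \<phi> x) \<in> test_functions"
  by (rule test_mult[OF smooth_const])

lemma test_add: "\<phi> \<in> test_functions \<Longrightarrow> \<psi> \<in> test_functions \<Longrightarrow> (\<lambda>x. \<phi> x + \<psi> x) \<in> test_functions"
proof -
  assume a: "\<phi> \<in> test_functions" "\<psi> \<in> test_functions"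
  then obtain R S where "\<forall>x. R \<le> norm x \<longrightarrow> \<phi> x = 0" "\<forall>x. S \<le> norm x \<longrightarrow> \<psi> x = 0"
    unfolding test_functions_iff by blast
  then have "\<forall>x. max R S \<le> norm x \<longrightarrow> \<phi> x + \<psi> x = 0" by simp
  then show ?thesis using a unfolding test_functions_iff by (blast intro: smooth_add)
qed

lemma test_diff: "\<phi> \<in> test_functions \<Longrightarrow> \<psi> \<in> test_functions \<Longrightarrow> (\<lambda>x. \<phi> x - \<psi> x) \<in> test_functions"
  using test_add[of \<phi> "\<lambda>x. (-1) * \<psi> x"] test_scale[of \<psi> "-1"] by simp

lemma test_translate:
  assumes "\<phi> \<in> test_functions"
  shows "(\<lambda>x. exp (\<i> * of_real (x \<bullet> h)) * \<phi> (x + \<xi>)) \<in> test_functions"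
proof -
  obtain R where R: "\<forall>x. R \<le> norm x \<longrightarrow> \<phi> x = 0" and sm: "smooth \<phi>"
    using assms unfolding test_functions_iff by blast
  have "\<forall>x. R + norm \<xi> \<le> norm x \<longrightarrow> \<phi> (x + \<xi>) = 0"
  proof (intro allI impI)
    fix x :: "real^3" assume "R + norm \<xi> \<le> norm x"
    then have "R \<le> norm (x + \<xi>)" using norm_triangle_ineq4[of "x + \<xi>" \<xi>] by simp
    then show "\<phi> (x + \<xi>) = 0" using R by blast
  qed
  moreover have "smooth (\<lambda>x. exp (\<i> * of_real (x \<bullet> h)) * \<phi> (x + \<xi>))"
    using smooth_affine[OF sm, of 1 \<xi>] by (intro smooth_mult smooth_exp smooth_const smooth_inner) auto
  ultimately show ?thesis unfolding test_functions_iff by (metis mult_zero_right)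
qed

lemma test_measurable: "\<phi> \<in> test_functions \<Longrightarrow> \<phi> \<in> borel_measurable borel"
  unfolding test_functions_iff by (intro borel_measurable_continuous_onI smooth_continuous) simp

lemma test_bounded:
  assumes "\<phi> \<in> test_functions"
  shows "\<exists>M>0. \<forall>x. cmod (\<phi> x) \<le> M"
proof -
  obtain R where R: "\<forall>x. R \<le> norm x \<longrightarrow> \<phi> x = 0" and sm: "smooth \<phi>"
    using assms unfolding test_functions_iff by blast
  have "compact (\<phi> ` cball 0 R)"
    using smooth_continuous[OF sm] by (intro compact_continuous_image) (auto intro: continuous_on_subset)
  then obtain M where M: "M > 0" "\<forall>y\<in>\<phi> ` cball 0 R. cmod y \<le> M" using compact_imp_bounded bounded_pos by metis
  have "cmod (\<phi> x) \<le> M" for x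
  proof (cases "norm x \<le> R")
    case False
    then have "\<phi> x = 0" using R by simp
    then show ?thesis using M by simp
  qed (use M in auto)
  then show ?thesis using M by blast
qed

lemma test_lipschitz:
  assumes "\<phi> \<in> test_functions"
  shows "\<exists>L>0. \<forall>x y. cmod (\<phi> x - \<phi> y) \<le> L * norm (x - y)"
proof -
  obtain R where R: "\<forall>x. R \<le> norm x \<longrightarrow> \<phi> x = 0" and sm: "smooth \<phi>"
    using assms unfolding test_functions_iff by blast
  let ?F = "\<lambda>x. frechet_derivative \<phi> (at x)"
  have C1: "C_k (Suc 0) \<phi>" using sm unfolding smooth_def by blast
  have der: "(\<phi> has_derivative ?F x) (at x)" for x by (rule C_k_SucD(1)[OF C1])
  have "\<exists>M>0. \<forall>x. cmod (?F x b) \<le> M" if b: "b \<in> Basis" for b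
  proof -
    have "continuous_on UNIV (\<lambda>x. ?F x b)" using C_k_SucD(2)[OF C1 b] by simp
    then have "compact ((\<lambda>x. ?F x b) ` cball 0 R)"
      by (intro compact_continuous_image) (auto intro: continuous_on_subset)
    then obtain M where M: "M > 0" "\<forall>y\<in>(\<lambda>x. ?F x b) ` cball 0 R. cmod y \<le> M" using compact_imp_bounded bounded_pos by metis
    have "cmod (?F x b) \<le> M" for x
    proof (cases "norm x \<le> R")
      case False
      have "(\<phi> has_derivative (\<lambda>h. 0)) (at x)"
      proof (rule has_derivative_transform_within_open[of "\<lambda>x. 0" _ _ _ "{x. R < norm x}"])
        show "open {x::real^3. R < norm x}" by (intro open_Collect_less continuous_intros)
      qed (use False R in auto)
      then have "?F x = (\<lambda>h. 0)" using frechet_derivative_at by metis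
      then show ?thesis using M by simp
    qed (use M in auto)
    then show ?thesis using M by blast
  qed
  then obtain M where M: "\<And>b. b \<in> Basis \<Longrightarrow> M b > 0" "\<And>b x. b \<in> Basis \<Longrightarrow> cmod (?F x b) \<le> M b" by metis
  define L where "L = (\<Sum>b\<in>(Basis::(real^3) set). M b)"
  have "L > 0" unfolding L_def using M by (intro sum_pos) auto
  moreover have "cmod (\<phi> x - \<phi> y) \<le> L * norm (x - y)" for x y
  proof (rule differentiable_bound[of UNIV \<phi> ?F L x y])
    show "onorm (?F x) \<le> L" for x
    proof (rule onorm_le)
      fix h :: "real^3"
      have lin: "linear (?F x)" using der has_derivative_linear by blast
      have "?F x h = ?F x (\<Sum>b\<in>Basis. (h \<bullet> b) *\<^sub>R b)" by (simp add: euclidean_representation)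
      also have "\<dots> = (\<Sum>b\<in>Basis. (h \<bullet> b) *\<^sub>R ?F x b)" by (simp add: linear_sum[OF lin] linear_scale[OF lin])
      also have "cmod \<dots> \<le> (\<Sum>b\<in>Basis. norm h * M b)"
        by (intro order_trans[OF norm_sum] sum_mono) (auto intro!: mult_mono M(2) Basis_le_norm)
      finally show "cmod (?F x h) \<le> L * norm h" by (simp add: L_def sum_distrib_left mult.commute)
    qed
  qed (use der in auto)
  ultimately show ?thesis by blast
qed

section \<open>Cutoffs\<close>

text \<open>
  A quotient of flat functions gives a smooth \<open>b\<close> that is \<open>1\<close> on the unit ball and \<open>0\<close> outside
  the ball of radius \<open>2\<close>. The square root of \<open>1 - b\<^sup>2\<close> need not be smooth, so \<open>sin (\<pi> b / 2)\<close>
  and \<open>cos (\<pi> b / 2)\<close> are taken.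
\<close>

lemma cutoff_pair:
  obtains \<theta> \<eta> :: "real^3 \<Rightarrow> real" and L where
    "smooth (\<lambda>x. of_real (\<theta> x))" "smooth (\<lambda>x. of_real (\<eta> x))"
    "\<And>x. (\<theta> x)\<^sup>2 + (\<eta> x)\<^sup>2 = 1" "\<And>x. 0 \<le> \<theta> x" "\<And>x. 0 \<le> \<eta> x"
    "\<And>x. norm x \<le> 1 \<Longrightarrow> \<theta> x = 1" "\<And>x. 2 \<le> norm x \<Longrightarrow> \<theta> x = 0"
    "0 < L" "\<And>x y. \<bar>\<theta> x - \<theta> y\<bar> \<le> L * norm (x - y)" "\<And>x y. \<bar>\<eta> x - \<eta> y\<bar> \<le> L * norm (x - y)"
proof -
  define f1 where "f1 x = flat 0 (4 + (-1) * (x \<bullet> x))" for x :: "real^3"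
  define f2 where "f2 x = flat 0 (-1 + 1 * (x \<bullet> x))" for x :: "real^3"
  have xx: "x \<bullet> x = (norm x)\<^sup>2" for x :: "real^3" by (simp add: power2_norm_eq_inner)
  have f0: "f1 x \<ge> 0" "f2 x \<ge> 0" for x by (auto simp: f1_def f2_def flat_nonneg)
  have f1p: "0 < f1 x \<longleftrightarrow> norm x < 2" for x
    unfolding f1_def flat_pos_iff xx using abs_square_less_1[of "norm x / 2"] by (simp add: power_divide)
  have f2p: "0 < f2 x \<longleftrightarrow> norm x > 1" for x
    unfolding f2_def flat_pos_iff xx using abs_square_le_1[of "norm x"] by (auto simp: not_le[symmetric])
  have fp: "f1 x + f2 x > 0" for x using f0[of x] f1p[of x] f2p[of x] by (cases "norm x < 2") (auto intro: add_pos_nonneg add_nonneg_pos)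
  define b where "b x = f1 x / (f1 x + f2 x)" for x
  have b: "0 \<le> b x" "b x \<le> 1" for x using f0[of x] fp[of x] by (auto simp: b_def field_simps)
  have b1: "b x = 1" if "norm x \<le> 1" for x
  proof -
    have "f2 x = 0" using f2p[of x] f0[of x] that by auto
    then show ?thesis using fp[of x] by (simp add: b_def)
  qed
  have b2: "b x = 0" if "2 \<le> norm x" for x
  proof -
    have "f1 x = 0" using f1p[of x] f0[of x] that by auto
    then show ?thesis by (simp add: b_def)
  qed
  have sb: "smooth (\<lambda>x. of_real (pi / 2 * b x))"
  proof -
    have s1: "smooth (\<lambda>x. of_real (f1 x))" unfolding f1_def by (rule smooth_flat)
    have s2: "smooth (\<lambda>x. of_real (f2 x))" unfolding f2_def by (rule smooth_flat)
    have ne: "complex_of_real (f1 x) + of_real (f2 x) \<noteq> 0" for x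
      using fp[of x] by (metis of_real_add of_real_eq_0_iff less_irrefl)
    have "smooth (\<lambda>x. of_real (pi / 2) * (of_real (f1 x) / (of_real (f1 x) + of_real (f2 x))))"
      by (intro smooth_mult smooth_divide smooth_add smooth_const s1 s2 ne)
    then show ?thesis by (simp add: b_def)
  qed
  define \<theta> where "\<theta> x = sin (pi / 2 * b x)" for x
  define \<eta> where "\<eta> x = cos (pi / 2 * b x)" for x
  have s\<theta>: "smooth (\<lambda>x. of_real (\<theta> x))" using smooth_sin[OF sb] by (simp only: \<theta>_def sin_of_real)
  have s\<eta>: "smooth (\<lambda>x. of_real (\<eta> x))" using smooth_cos[OF sb] by (simp only: \<eta>_def cos_of_real)
  have rng: "0 \<le> pi / 2 * b x" "pi / 2 * b x \<le> pi / 2" for x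
    using b[of x] by (auto simp: mult_left_le)
  have t\<theta>: "(\<lambda>x. of_real (\<theta> x)) \<in> test_functions"
    unfolding test_functions_iff using s\<theta> b2 by (auto simp: \<theta>_def intro!: exI[of _ 2])
  have t\<eta>: "(\<lambda>x. of_real (\<eta> x) - 1) \<in> test_functions"
    unfolding test_functions_iff using smooth_diff[OF s\<eta> smooth_const[of 1]] b2 by (auto simp: \<eta>_def intro!: exI[of _ 2])
  obtain L1 where L1: "L1 > 0" "\<And>x y. \<bar>\<theta> x - \<theta> y\<bar> \<le> L1 * norm (x - y)"
    using test_lipschitz[OF t\<theta>] by (auto simp flip: of_real_diff)
  obtain L2 where L2: "L2 > 0" "\<And>x y. \<bar>\<eta> x - \<eta> y\<bar> \<le> L2 * norm (x - y)"
    using test_lipschitz[OF t\<eta>] by (auto simp flip: of_real_diff)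
  show ?thesis
  proof (rule that[of \<theta> \<eta> "L1 + L2"])
    show "\<bar>\<theta> x - \<theta> y\<bar> \<le> (L1 + L2) * norm (x - y)" for x y
      using L1(2)[of x y] L2(1) by (simp add: distrib_right add_increasing2)
    show "\<bar>\<eta> x - \<eta> y\<bar> \<le> (L1 + L2) * norm (x - y)" for x y
      using L2(2)[of x y] L1(1) by (simp add: distrib_right add_increasing)
    show "(\<theta> x)\<^sup>2 + (\<eta> x)\<^sup>2 = 1" for x by (simp add: \<theta>_def \<eta>_def)
    show "0 \<le> \<theta> x" for x unfolding \<theta>_def using rng[of x] pi_gt_zero by (intro sin_ge_zero) linarith+
    show "0 \<le> \<eta> x" for x unfolding \<eta>_def using rng[of x] pi_gt_zero by (intro cos_ge_zero) linarith+
    show "\<theta> x = 1" if "norm x \<le> 1" for x using b1[OF that] by (simp add: \<theta>_def)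
    show "\<theta> x = 0" if "2 \<le> norm x" for x using b2[OF that] by (simp add: \<theta>_def)
  qed (use s\<theta> s\<eta> L1 L2 in auto)
qed

text \<open>
  The squares, not the functions, add up to \<open>1\<close>, because then splitting a function preserves
  its \<open>L\<^sup>2\<close> mass and, up to an error governed by \<open>\<Lambda>\<close>, its energy.
\<close>

definition cutoff :: "real \<Rightarrow> (real^3 \<Rightarrow> real) \<Rightarrow> (real^3 \<Rightarrow> real) \<Rightarrow> bool" where
  "cutoff \<Lambda> \<theta> \<eta> \<longleftrightarrow> smooth (\<lambda>x. of_real (\<theta> x)) \<and> smooth (\<lambda>x. of_real (\<eta> x))
     \<and> (\<forall>x. (\<theta> x)\<^sup>2 + (\<eta> x)\<^sup>2 = 1 \<and> 0 \<le> \<theta> x \<and> 0 \<le> \<eta> x)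
     \<and> (\<forall>x y. \<bar>\<theta> x - \<theta> y\<bar> \<le> \<Lambda> * norm (x - y) \<and> \<bar>\<eta> x - \<eta> y\<bar> \<le> \<Lambda> * norm (x - y))"

lemma borel_measurable_Re: "Re \<in> borel_measurable borel"
  by (intro borel_measurable_continuous_onI continuous_intros)

lemma cutoffD:
  assumes "cutoff \<Lambda> \<theta> \<eta>"
  shows "smooth (\<lambda>x. of_real (\<theta> x))" "smooth (\<lambda>x. of_real (\<eta> x))"
    "\<theta> \<in> borel_measurable borel" "\<eta> \<in> borel_measurable borel"
    "(\<theta> x)\<^sup>2 + (\<eta> x)\<^sup>2 = 1" "0 \<le> \<theta> x" "0 \<le> \<eta> x" "\<theta> x \<le> 1" "\<eta> x \<le> 1"
    "\<bar>\<theta> x - \<theta> y\<bar> \<le> \<Lambda> * norm (x - y)" "\<bar>\<eta> x - \<eta> y\<bar> \<le> \<Lambda> * norm (x - y)"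
proof -
  show s: "smooth (\<lambda>x. of_real (\<theta> x))" "smooth (\<lambda>x. of_real (\<eta> x))" using assms by (auto simp: cutoff_def)
  show "\<theta> \<in> borel_measurable borel" "\<eta> \<in> borel_measurable borel"
    using s[THEN smooth_continuous, THEN borel_measurable_continuous_onI, THEN measurable_compose, OF borel_measurable_Re]
    by simp_all
  show p: "(\<theta> x)\<^sup>2 + (\<eta> x)\<^sup>2 = 1" "0 \<le> \<theta> x" "0 \<le> \<eta> x" using assms by (auto simp: cutoff_def)
  have "(\<theta> x)\<^sup>2 \<le> 1\<^sup>2" "(\<eta> x)\<^sup>2 \<le> 1\<^sup>2" using p(1) by (smt (verit) one_power2 zero_le_power2)+
  then show "\<theta> x \<le> 1" "\<eta> x \<le> 1" by (auto intro: power2_le_imp_le)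
  show "\<bar>\<theta> x - \<theta> y\<bar> \<le> \<Lambda> * norm (x - y)" "\<bar>\<eta> x - \<eta> y\<bar> \<le> \<Lambda> * norm (x - y)"
    using assms by (auto simp: cutoff_def)
qed

text \<open>
  Dilating a fixed pair by \<open>R\<close> divides its Lipschitz constant by \<open>R\<close>.
\<close>

lemma cutoff_at_scale:
  assumes \<Lambda>: "0 < \<Lambda>"
  obtains R0 where "1 \<le> R0" "\<And>R \<xi>. R0 \<le> R \<Longrightarrow> \<exists>\<theta> \<eta>. cutoff \<Lambda> \<theta> \<eta> \<and> (\<forall>x\<in>ball \<xi> R. \<theta> x = 1) \<and> (\<forall>x. x \<notin> ball \<xi> (2 * R) \<longrightarrow> \<theta> x = 0)"
proof -
  obtain \<theta> \<eta> :: "real^3 \<Rightarrow> real" and L where cut: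
    "smooth (\<lambda>x. of_real (\<theta> x))" "smooth (\<lambda>x. of_real (\<eta> x))"
    "\<And>x. (\<theta> x)\<^sup>2 + (\<eta> x)\<^sup>2 = 1" "\<And>x. 0 \<le> \<theta> x" "\<And>x. 0 \<le> \<eta> x"
    "\<And>x. norm x \<le> 1 \<Longrightarrow> \<theta> x = 1" "\<And>x. 2 \<le> norm x \<Longrightarrow> \<theta> x = 0"
    "0 < L" "\<And>x y. \<bar>\<theta> x - \<theta> y\<bar> \<le> L * norm (x - y)" "\<And>x y. \<bar>\<eta> x - \<eta> y\<bar> \<le> L * norm (x - y)"
    by (rule cutoff_pair) blast
  have "\<exists>\<theta> \<eta>. cutoff \<Lambda> \<theta> \<eta> \<and> (\<forall>x\<in>ball \<xi> R. \<theta> x = 1) \<and> (\<forall>x. x \<notin> ball \<xi> (2 * R) \<longrightarrow> \<theta> x = 0)"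
    if R: "max 1 (L / \<Lambda>) \<le> R" for R \<xi>
  proof -
    have R1: "R \<ge> 1" and RL: "L / R \<le> \<Lambda>" using R \<Lambda> by (auto simp: field_simps)
    define f where "f x = (1 / R) *\<^sub>R x + (- (1 / R)) *\<^sub>R \<xi>" for x
    have arg: "norm (f x) = norm (x - \<xi>) / R" for x
      using R1 norm_scaleR[of "1 / R" "x - \<xi>"] by (simp add: f_def scaleR_diff_right)
    have diff: "norm (f x - f y) = norm (x - y) / R" for x y
      using R1 norm_scaleR[of "1 / R" "x - y"] by (simp add: f_def scaleR_diff_right)
    have "L * (norm (x - y) / R) \<le> \<Lambda> * norm (x - y)" for x y :: "real^3"
      using mult_right_mono[OF RL, of "norm (x - y)"] by simp
    then have lip: "\<bar>\<theta> (f x) - \<theta> (f y)\<bar> \<le> \<Lambda> * norm (x - y)" "\<bar>\<eta> (f x) - \<eta> (f y)\<bar> \<le> \<Lambda> * norm (x - y)" for x y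
      using cut(9)[of "f x" "f y"] cut(10)[of "f x" "f y"] unfolding diff by (metis order_trans)+
    have "smooth (\<lambda>x. of_real (\<theta> (f x)))" "smooth (\<lambda>x. of_real (\<eta> (f x)))"
      unfolding f_def by (rule smooth_affine[OF cut(1)] smooth_affine[OF cut(2)])+
    then have "cutoff \<Lambda> (\<lambda>x. \<theta> (f x)) (\<lambda>x. \<eta> (f x))"
      unfolding cutoff_def using cut(3-5) lip by simp
    moreover have "\<theta> (f x) = 1" if "x \<in> ball \<xi> R" for x
      using that R1 by (intro cut(6)) (simp add: arg dist_norm norm_minus_commute)
    moreover have "\<theta> (f x) = 0" if "x \<notin> ball \<xi> (2 * R)" for x
      using that R1 by (intro cut(7)) (simp add: arg dist_norm norm_minus_commute field_simps)
    ultimately show ?thesis by blast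
  qed
  then show ?thesis by (intro that[of "max 1 (L / \<Lambda>)"]) auto
qed

section \<open>Phases of locally bounded fields\<close>

lemma phase_diff_le:
  "cmod (exp (- (\<i> * of_real a)) - exp (- (\<i> * of_real b))) \<le> min 2 \<bar>a - b\<bar>"
proof -
  have e: "exp (- (\<i> * of_real t)) = cis (- t)" for t by (simp add: cis_conv_exp)
  have 2: "cmod (cis (- a) - cis (- b)) \<le> 2" using norm_triangle_ineq4[of "cis (- a)" "cis (- b)"] by simp
  have "(cmod (cis (- a) - cis (- b)))\<^sup>2 = (cos a - cos b)\<^sup>2 + (sin b - sin a)\<^sup>2" by (simp add: cmod_power2)
  also have "\<dots> = 2 - 2 * cos (a - b)"
    by (simp add: power2_diff cos_diff algebra_simps)
  also have "\<dots> = 4 * (sin ((a - b) / 2))\<^sup>2"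
  proof -
    have h: "2 * ((a - b) / 2) = a - b" by simp
    show ?thesis using cos_double_sin[of "(a - b) / 2"] unfolding h by simp
  qed
  also have "\<dots> \<le> 4 * ((a - b) / 2)\<^sup>2"
    using abs_le_square_iff[THEN iffD1, OF abs_sin_x_le_abs_x[of "(a - b) / 2"]] by simp
  also have "\<dots> = \<bar>a - b\<bar>\<^sup>2" by (simp add: power2_eq_square)
  finally have "cmod (cis (- a) - cis (- b)) \<le> \<bar>a - b\<bar>" by (rule power2_le_imp_le) simp
  then show ?thesis using 2 by (simp add: e)
qed

definition locally_bounded :: "(real^3 \<Rightarrow> real^3) \<Rightarrow> bool" where
  "locally_bounded A \<longleftrightarrow> (\<forall>R. \<exists>C. \<forall>x. norm x \<le> R \<longrightarrow> norm (A x) \<le> C)"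

lemma locally_bounded_pos:
  assumes "locally_bounded A"
  obtains C where "C > 0" "\<And>x. norm x \<le> R \<Longrightarrow> norm (A x) \<le> C"
proof -
  obtain C where "\<forall>x. norm x \<le> R \<longrightarrow> norm (A x) \<le> C" using assms unfolding locally_bounded_def by blast
  then show ?thesis by (intro that[of "max C 1"]) (auto intro: le_max_iff_disj[THEN iffD2])
qed

lemma continuous_locally_bounded:
  assumes "continuous_on UNIV A" shows "locally_bounded A"
  unfolding locally_bounded_def
proof
  fix R
  have "compact (A ` cball 0 R)" using assms by (intro compact_continuous_image) (auto intro: continuous_on_subset)
  then obtain C where "\<forall>y\<in>A ` cball 0 R. norm y \<le> C" using compact_imp_bounded bounded_iff by metis
  then show "\<exists>C. \<forall>x. norm x \<le> R \<longrightarrow> norm (A x) \<le> C" by (intro exI[of _ C]) auto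
qed

lemma midpoint_norm_le: "norm ((x + y) /\<^sub>R 2) \<le> norm x + norm (x - y) / 2" for x y :: "'a::real_normed_vector"
proof -
  have "(x + y) /\<^sub>R 2 = x - (x - y) /\<^sub>R 2" by (simp add: algebra_simps) (metis scaleR_half_double scaleR_right_distrib)
  then show ?thesis using norm_triangle_ineq4[of x "(x - y) /\<^sub>R 2"] by simp
qed

section \<open>Localization of the energy\<close>

context mag_setting begin

text \<open>
  For \<open>|x - y| \<le> 1\<close> the magnetic difference is at most a multiple of \<open>|x - y|\<close>, since a test
  function is Lipschitz and the phase differs from \<open>1\<close> by at most \<open>|x - y|\<close> times a local
  bound of the field. Beyond distance \<open>1\<close> it is bounded. So \<open>truncated_kern_finite\<close> applies.
\<close>

lemma test_in_energy:
  assumes [measurable]: "A \<in> borel_measurable borel" and lb: "locally_bounded A" and \<phi>: "\<phi> \<in> test_functions"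
  shows "energy A \<phi> < \<infinity>"
proof -
  note [measurable] = test_measurable[OF \<phi>]
  obtain M where M: "M > 0" "\<And>x. cmod (\<phi> x) \<le> M" using test_bounded[OF \<phi>] by auto
  obtain L where L: "L > 0" "\<And>x y. cmod (\<phi> x - \<phi> y) \<le> L * norm (x - y)" using test_lipschitz[OF \<phi>] by auto
  obtain R where R: "\<And>x. R \<le> norm x \<Longrightarrow> \<phi> x = 0" using \<phi> unfolding test_functions_iff by auto
  obtain C where C: "C > 0" "\<And>x. norm x \<le> R + 1 \<Longrightarrow> norm (A x) \<le> C" by (rule locally_bounded_pos[OF lb, of "R+1"]) blast
  define K where "K = C * M + L + 2 * M"
  have K: "K > 0" using C M L by (simp add: K_def add_pos_pos)
  have md: "cmod (mag_diff A \<phi> x y) \<le> K * min 1 (norm (x - y))" for x y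
  proof (cases "norm (x - y) \<ge> 1")
    case True
    have "cmod (mag_diff A \<phi> x y) \<le> cmod (\<phi> x) + cmod (\<phi> y)"
      unfolding mag_diff_def by (rule order_trans[OF norm_triangle_ineq4]) (simp add: norm_mult)
    also have "\<dots> \<le> 2 * M" using M(2)[of x] M(2)[of y] by simp
    also have "\<dots> \<le> K" using C M L by (simp add: K_def)
    finally show ?thesis using True by simp
  next
    case False
    define t where "t = (x - y) \<bullet> A ((x + y) /\<^sub>R 2)"
    have e: "cmod (exp (- (\<i> * of_real t)) - 1) \<le> \<bar>t\<bar>" using phase_diff_le[of t 0] by simp
    have "mag_diff A \<phi> x y = (exp (- (\<i> * of_real t)) - 1) * \<phi> x + (\<phi> x - \<phi> y)"
      by (simp add: mag_diff_def t_def algebra_simps)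
    also have "cmod \<dots> \<le> cmod ((exp (- (\<i> * of_real t)) - 1) * \<phi> x) + L * norm (x - y)"
      by (intro order_trans[OF norm_triangle_ineq] add_mono L) auto
    also have "cmod ((exp (- (\<i> * of_real t)) - 1) * \<phi> x) \<le> C * M * norm (x - y)"
    proof (cases "norm x < R")
      case True
      have "norm ((x + y) /\<^sub>R 2) \<le> R + 1" using midpoint_norm_le[of x y] True False by linarith
      then have "\<bar>t\<bar> \<le> norm (x - y) * C"
        unfolding t_def by (intro order_trans[OF Cauchy_Schwarz_ineq2] mult_left_mono C) auto
      then have "cmod (exp (- (\<i> * of_real t)) - 1) * cmod (\<phi> x) \<le> (norm (x - y) * C) * M"
        using e M(2)[of x] C by (intro mult_mono) auto
      then show ?thesis by (simp add: norm_mult mult_ac)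
    qed (use R C M in auto)
    also have "C * M * norm (x - y) + L * norm (x - y) \<le> K * norm (x - y)"
      using M by (simp add: K_def distrib_right)
    finally show ?thesis using False by simp
  qed
  define I :: "real^3 \<Rightarrow> ennreal" where "I = indicator (ball 0 R)"
  have [measurable]: "I \<in> borel_measurable borel" unfolding I_def by (intro borel_measurable_indicator) simp
  have Ifin: "(\<integral>\<^sup>+x. I x \<partial>lborel) < \<infinity>" using emeasure_lborel_ball_finite[of "0::real^3" R] by (simp add: I_def)
  have pt: "ennreal ((cmod (mag_diff A \<phi> x y))\<^sup>2 * kern (x - y))
     \<le> ennreal (K\<^sup>2) * (I x * ennreal (min 1 ((1 * norm (x - y))\<^sup>2) * kern (x - y)) + I y * ennreal (min 1 ((1 * norm (x - y))\<^sup>2) * kern (x - y)))" for x y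
  proof (cases "\<phi> x = 0 \<and> \<phi> y = 0")
    case False
    have "(cmod (mag_diff A \<phi> x y))\<^sup>2 * kern (x - y) \<le> (K * min 1 (norm (x - y)))\<^sup>2 * kern (x - y)"
      by (intro mult_right_mono power_mono md) auto
    also have "(min 1 (norm (x - y)))\<^sup>2 = min 1 ((norm (x - y))\<^sup>2)"
    proof (cases "norm (x - y) \<le> 1")
      case True
      then show ?thesis using power_le_one[OF norm_ge_zero True, of 2] by simp
    next
      case False
      then show ?thesis using one_le_power[of "norm (x - y)" 2] by simp
    qed
    then have "(K * min 1 (norm (x - y)))\<^sup>2 * kern (x - y) = K\<^sup>2 * (min 1 ((1 * norm (x - y))\<^sup>2) * kern (x - y))"
      by (simp add: power_mult_distrib)
    finally have "ennreal ((cmod (mag_diff A \<phi> x y))\<^sup>2 * kern (x - y)) \<le> ennreal (K\<^sup>2) * (1 * ennreal (min 1 ((1 * norm (x - y))\<^sup>2) * kern (x - y)))"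
      by (simp add: ennreal_leI flip: ennreal_mult')
    also have "\<dots> \<le> ennreal (K\<^sup>2) * ((I x + I y) * ennreal (min 1 ((1 * norm (x - y))\<^sup>2) * kern (x - y)))"
    proof (intro mult_left_mono mult_right_mono)
      have "norm x < R \<or> norm y < R" using False R[of x] R[of y] by force
      then show "1 \<le> I x + I y" by (auto simp: I_def add_increasing add_increasing2)
    qed auto
    finally show ?thesis by (simp add: distrib_right)
  qed (simp add: mag_diff_def)
  have "kinetic A \<phi> \<le> (\<integral>\<^sup>+z. ennreal (K\<^sup>2) * (I (fst z) * ennreal (min 1 ((1 * norm (fst z - snd z))\<^sup>2) * kern (fst z - snd z))
       + I (snd z) * ennreal (min 1 ((1 * norm (fst z - snd z))\<^sup>2) * kern (fst z - snd z))) \<partial>lborel)"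
    unfolding kinetic_def by (intro nn_integral_mono pt)
  also have "\<dots> = ennreal (K\<^sup>2) * ((\<integral>\<^sup>+x. I x \<partial>lborel) * truncated_kern 1 + (\<integral>\<^sup>+x. I x \<partial>lborel) * truncated_kern 1)"
    using nn_integral_convolution_fst[of I "\<lambda>w. ennreal (min 1 ((1 * norm w)\<^sup>2) * kern w)"]
      nn_integral_convolution_snd[of I "\<lambda>w. ennreal (min 1 ((1 * norm w)\<^sup>2) * kern w)"]
    unfolding truncated_kern_def by (subst nn_integral_cmult, measurable) (subst nn_integral_add, auto)
  also have "\<dots> < \<infinity>" using Ifin truncated_kern_finite by (auto simp: ennreal_mult_less_top)
  finally have E: "kinetic A \<phi> < \<infinity>" .
  have "sqmass \<phi> \<le> (\<integral>\<^sup>+x. ennreal (M\<^sup>2) * I x \<partial>lborel)" unfolding sqmass_def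
  proof (intro nn_integral_mono)
    fix x show "ennreal ((cmod (\<phi> x))\<^sup>2) \<le> ennreal (M\<^sup>2) * I x"
      using R[of x] power_mono[OF M(2)[of x], of 2] by (cases "norm x < R") (auto simp: I_def intro!: ennreal_leI)
  qed
  also have "\<dots> = ennreal (M\<^sup>2) * (\<integral>\<^sup>+x. I x \<partial>lborel)" by (rule nn_integral_cmult) measurable
  also have "\<dots> < \<infinity>" using Ifin by (simp add: ennreal_mult_less_top)
  finally have "sqmass \<phi> < \<infinity>" .
  then show ?thesis using E by (simp add: energy_def ennreal_mult_less_top)
qed

text \<open>
  Let \<open>a\<close> be \<open>u x\<close> times the phase and \<open>b = u y\<close>. Since \<open>\<theta>\<^sup>2 + \<eta>\<^sup>2 = 1\<close>, the two localized
  differences satisfy an exact identity: the sum of their squares is \<open>|a - b|\<^sup>2\<close> plus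
  \<open>(\<theta> x - \<theta> y)\<^sup>2 + (\<eta> x - \<eta> y)\<^sup>2\<close> times the real part of \<open>a\<close> times the conjugate of \<open>b\<close>. The
  error is a convolution of \<open>|u|\<^sup>2\<close> with the truncated kernel.
\<close>

lemma energy_localization:
  assumes [measurable]: "A \<in> borel_measurable borel" "u \<in> borel_measurable borel" and cut: "cutoff \<Lambda> \<theta> \<eta>"
  shows "energy A (\<lambda>x. of_real (\<theta> x) * u x) + energy A (\<lambda>x. of_real (\<eta> x) * u x)
     \<le> energy A u + ennreal (2 * c1) * (truncated_kern \<Lambda> * sqmass u)"
proof -
  note [measurable] = cutoffD(3,4)[OF cut]
  note part = cutoffD(5)[OF cut] and nonneg = cutoffD(6,7)[OF cut] and le1 = cutoffD(8,9)[OF cut] and lip = cutoffD(10,11)[OF cut]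
  have dsq: "(f x - f y)\<^sup>2 \<le> min 1 ((\<Lambda> * norm (x - y))\<^sup>2)"
    if "\<And>x. 0 \<le> f x" "\<And>x. f x \<le> 1" "\<And>x y. \<bar>f x - f y\<bar> \<le> \<Lambda> * norm (x - y)" for f :: "real^3 \<Rightarrow> real" and x y
  proof -
    have "\<bar>f x - f y\<bar> \<le> 1" using that(1)[of x] that(1)[of y] that(2)[of x] that(2)[of y] by linarith
    then have "(f x - f y)\<^sup>2 \<le> 1" by (simp add: abs_square_le_1)
    moreover have "(f x - f y)\<^sup>2 \<le> (\<Lambda> * norm (x - y))\<^sup>2" using power_mono[OF that(3)[of x y], of 2] by simp
    ultimately show ?thesis by simp
  qed
  have alg: "(cmod (of_real t1 * a - of_real t2 * b))\<^sup>2 + (cmod (of_real e1 * a - of_real e2 * b))\<^sup>2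
      \<le> (cmod (a - b))\<^sup>2 + h * (cmod a)\<^sup>2 + h * (cmod b)\<^sup>2"
    if "t1\<^sup>2 + e1\<^sup>2 = 1" "t2\<^sup>2 + e2\<^sup>2 = 1" "(t1 - t2)\<^sup>2 \<le> h" "(e1 - e2)\<^sup>2 \<le> h" for t1 t2 e1 e2 h :: real and a b :: complex
  proof -
    define r where "r = Re a * Re b + Im a * Im b"
    have r: "2 * \<bar>r\<bar> \<le> (cmod a)\<^sup>2 + (cmod b)\<^sup>2"
    proof -
      have "0 \<le> (Re a - Re b)\<^sup>2 + (Im a - Im b)\<^sup>2" "0 \<le> (Re a + Re b)\<^sup>2 + (Im a + Im b)\<^sup>2" by auto
      then have "2 * r \<le> (cmod a)\<^sup>2 + (cmod b)\<^sup>2" "- 2 * r \<le> (cmod a)\<^sup>2 + (cmod b)\<^sup>2"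
        unfolding r_def cmod_power2 by (auto simp: power2_eq_square algebra_simps)
      then show ?thesis by linarith
    qed
    have "(cmod (of_real t1 * a - of_real t2 * b))\<^sup>2 + (cmod (of_real e1 * a - of_real e2 * b))\<^sup>2
      = (t1\<^sup>2 + e1\<^sup>2) * (cmod a)\<^sup>2 + (t2\<^sup>2 + e2\<^sup>2) * (cmod b)\<^sup>2 - (2 * (t1 * t2) + 2 * (e1 * e2)) * r"
      unfolding cmod_power2 r_def by (simp add: power2_eq_square algebra_simps)
    also have "2 * (t1 * t2) + 2 * (e1 * e2) = (t1\<^sup>2 + e1\<^sup>2) + (t2\<^sup>2 + e2\<^sup>2) - ((t1 - t2)\<^sup>2 + (e1 - e2)\<^sup>2)"
      by (simp add: power2_eq_square algebra_simps)
    also have "(t1\<^sup>2 + e1\<^sup>2) * (cmod a)\<^sup>2 + (t2\<^sup>2 + e2\<^sup>2) * (cmod b)\<^sup>2 - ((t1\<^sup>2 + e1\<^sup>2) + (t2\<^sup>2 + e2\<^sup>2) - ((t1 - t2)\<^sup>2 + (e1 - e2)\<^sup>2)) * r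
       = (cmod (a - b))\<^sup>2 + ((t1 - t2)\<^sup>2 + (e1 - e2)\<^sup>2) * r"
      unfolding that(1,2) unfolding cmod_power2 r_def by (simp add: power2_eq_square algebra_simps)
    also have "((t1 - t2)\<^sup>2 + (e1 - e2)\<^sup>2) * r \<le> ((t1 - t2)\<^sup>2 + (e1 - e2)\<^sup>2) * \<bar>r\<bar>"
      by (intro mult_left_mono) auto
    also have "\<dots> \<le> (2 * h) * \<bar>r\<bar>" using that by (intro mult_right_mono) auto
    also have "\<dots> = h * (2 * \<bar>r\<bar>)" by simp
    also have "\<dots> \<le> h * ((cmod a)\<^sup>2 + (cmod b)\<^sup>2)"
      using r that(3) zero_le_power2[of "t1 - t2"] by (intro mult_left_mono) linarith+
    finally show ?thesis by (simp add: algebra_simps)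
  qed
  define H where "H w = min 1 ((\<Lambda> * norm w)\<^sup>2) * kern w" for w :: "real^3"
  have [measurable]: "H \<in> borel_measurable borel" unfolding H_def by measurable
  have H0: "H w \<ge> 0" for w by (simp add: H_def)
  have pt: "ennreal ((cmod (mag_diff A (\<lambda>x. of_real (\<theta> x) * u x) x y))\<^sup>2 * kern (x - y))
     + ennreal ((cmod (mag_diff A (\<lambda>x. of_real (\<eta> x) * u x) x y))\<^sup>2 * kern (x - y))
     \<le> ennreal ((cmod (mag_diff A u x y))\<^sup>2 * kern (x - y)) + (ennreal ((cmod (u x))\<^sup>2) * ennreal (H (x - y)) + ennreal ((cmod (u y))\<^sup>2) * ennreal (H (x - y)))" for x y
  proof -
    define e where "e = phase A x y"
    have e1: "cmod e = 1" by (simp add: e_def)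
    define h where "h = min 1 ((\<Lambda> * norm (x - y))\<^sup>2)"
    have "(cmod (of_real (\<theta> x) * (e * u x) - of_real (\<theta> y) * u y))\<^sup>2 + (cmod (of_real (\<eta> x) * (e * u x) - of_real (\<eta> y) * u y))\<^sup>2
       \<le> (cmod (e * u x - u y))\<^sup>2 + h * (cmod (e * u x))\<^sup>2 + h * (cmod (u y))\<^sup>2"
      unfolding h_def by (intro alg part dsq nonneg le1 lip)
    then have "((cmod (mag_diff A (\<lambda>x. of_real (\<theta> x) * u x) x y))\<^sup>2 + (cmod (mag_diff A (\<lambda>x. of_real (\<eta> x) * u x) x y))\<^sup>2) * kern (x - y)
       \<le> ((cmod (mag_diff A u x y))\<^sup>2 + h * (cmod (u x))\<^sup>2 + h * (cmod (u y))\<^sup>2) * kern (x - y)"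
    proof (intro mult_right_mono)
      have d: "mag_diff A (\<lambda>x. of_real (f x) * u x) x y = of_real (f x) * (e * u x) - of_real (f y) * u y" for f
        by (simp add: mag_diff_def e_def)
      assume "(cmod (of_real (\<theta> x) * (e * u x) - of_real (\<theta> y) * u y))\<^sup>2 + (cmod (of_real (\<eta> x) * (e * u x) - of_real (\<eta> y) * u y))\<^sup>2
       \<le> (cmod (e * u x - u y))\<^sup>2 + h * (cmod (e * u x))\<^sup>2 + h * (cmod (u y))\<^sup>2"
      then show "(cmod (mag_diff A (\<lambda>x. of_real (\<theta> x) * u x) x y))\<^sup>2 + (cmod (mag_diff A (\<lambda>x. of_real (\<eta> x) * u x) x y))\<^sup>2
        \<le> (cmod (mag_diff A u x y))\<^sup>2 + h * (cmod (u x))\<^sup>2 + h * (cmod (u y))\<^sup>2"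
        unfolding d by (simp add: norm_mult e1) (simp add: mag_diff_def e_def)
    qed simp
    then have "(cmod (mag_diff A (\<lambda>x. of_real (\<theta> x) * u x) x y))\<^sup>2 * kern (x - y) + (cmod (mag_diff A (\<lambda>x. of_real (\<eta> x) * u x) x y))\<^sup>2 * kern (x - y)
       \<le> (cmod (mag_diff A u x y))\<^sup>2 * kern (x - y) + ((cmod (u x))\<^sup>2 * H (x - y) + (cmod (u y))\<^sup>2 * H (x - y))"
      unfolding H_def h_def by (simp add: algebra_simps)
    from ennreal_leI[OF this] show ?thesis using H0 by (simp add: ennreal_mult)
  qed
  have "kinetic A (\<lambda>x. of_real (\<theta> x) * u x) + kinetic A (\<lambda>x. of_real (\<eta> x) * u x)
     \<le> kinetic A u + (sqmass u * truncated_kern \<Lambda> + sqmass u * truncated_kern \<Lambda>)"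
  proof -
    have "kinetic A (\<lambda>x. of_real (\<theta> x) * u x) + kinetic A (\<lambda>x. of_real (\<eta> x) * u x)
      = (\<integral>\<^sup>+z. ennreal (edens A (\<lambda>x. of_real (\<theta> x) * u x) z)
     + ennreal (edens A (\<lambda>x. of_real (\<eta> x) * u x) z) \<partial>lborel)"
      unfolding kinetic_def by (subst nn_integral_add) auto
    also have "\<dots> \<le> (\<integral>\<^sup>+z. ennreal (edens A u z)
       + (ennreal ((cmod (u (fst z)))\<^sup>2) * ennreal (H (fst z - snd z)) + ennreal ((cmod (u (snd z)))\<^sup>2) * ennreal (H (fst z - snd z))) \<partial>lborel)"
      by (intro nn_integral_mono pt)
    also have "\<dots> = kinetic A u + (sqmass u * truncated_kern \<Lambda> + sqmass u * truncated_kern \<Lambda>)"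
      using nn_integral_convolution_fst[of "\<lambda>x. ennreal ((cmod (u x))\<^sup>2)" "\<lambda>w. ennreal (H w)"]
        nn_integral_convolution_snd[of "\<lambda>x. ennreal ((cmod (u x))\<^sup>2)" "\<lambda>w. ennreal (H w)"]
      unfolding kinetic_def sqmass_def truncated_kern_def H_def[symmetric]
      by (subst nn_integral_add, measurable, subst nn_integral_add, auto)
    finally show ?thesis .
  qed
  moreover have "sqmass (\<lambda>x. of_real (\<theta> x) * u x) + sqmass (\<lambda>x. of_real (\<eta> x) * u x) = sqmass u"
  proof -
    have "sqmass (\<lambda>x. of_real (\<theta> x) * u x) + sqmass (\<lambda>x. of_real (\<eta> x) * u x)
      = (\<integral>\<^sup>+x. ennreal ((cmod (of_real (\<theta> x) * u x))\<^sup>2) + ennreal ((cmod (of_real (\<eta> x) * u x))\<^sup>2) \<partial>lborel)"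
      unfolding sqmass_def by (subst nn_integral_add) auto
    also have "\<dots> = sqmass u" unfolding sqmass_def
    proof (intro nn_integral_cong)
      fix x
      have "(\<theta> x)\<^sup>2 * (cmod (u x))\<^sup>2 + (\<eta> x)\<^sup>2 * (cmod (u x))\<^sup>2 = (cmod (u x))\<^sup>2"
        using part[of x] by (simp flip: distrib_right)
      then show "ennreal ((cmod (of_real (\<theta> x) * u x))\<^sup>2) + ennreal ((cmod (of_real (\<eta> x) * u x))\<^sup>2) = ennreal ((cmod (u x))\<^sup>2)"
        by (simp add: norm_mult power_mult_distrib flip: ennreal_plus)
    qed
    finally show ?thesis .
  qed
  moreover have "energy A (\<lambda>x. of_real (\<theta> x) * u x) + energy A (\<lambda>x. of_real (\<eta> x) * u x)
    = ennreal c1 * (kinetic A (\<lambda>x. of_real (\<theta> x) * u x) + kinetic A (\<lambda>x. of_real (\<eta> x) * u x))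
      + ennreal c2 * (sqmass (\<lambda>x. of_real (\<theta> x) * u x) + sqmass (\<lambda>x. of_real (\<eta> x) * u x))"
    unfolding energy_def by (simp add: algebra_simps)
  ultimately have "energy A (\<lambda>x. of_real (\<theta> x) * u x) + energy A (\<lambda>x. of_real (\<eta> x) * u x)
     \<le> ennreal c1 * (kinetic A u + (sqmass u * truncated_kern \<Lambda> + sqmass u * truncated_kern \<Lambda>)) + ennreal c2 * sqmass u"
    by (simp add: mult_left_mono)
  also have "\<dots> = energy A u + ennreal (2 * c1) * (truncated_kern \<Lambda> * sqmass u)"
    using c1_pos unfolding energy_def by (simp add: ennreal_mult' algebra_simps flip: mult_2)
  finally show ?thesis .
qed

section \<open>The magnetic Sobolev space and the minimal level\<close>

abbreviation level :: "(real^3 \<Rightarrow> real^3) \<Rightarrow> real" where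
  "level A \<equiv> min_level s m p A"

text \<open>
  Approximation in the seminorm, expressed by the extended energy, so that the arguments below
  need no membership conditions for differences.
\<close>

lemma mag_sobolev_iff:
  assumes [measurable]: "A \<in> borel_measurable borel"
  shows "u \<in> mag_sobolev s m A \<longleftrightarrow> u \<in> borel_measurable borel \<and> energy A u < \<infinity> \<and>
    (\<forall>\<epsilon>>0. \<exists>\<phi>\<in>test_functions. energy A \<phi> < \<infinity> \<and> energy A (\<lambda>x. u x - \<phi> x) \<le> ennreal \<epsilon>)" (is "?l \<longleftrightarrow> ?r")
proof -
  have fin: "energy A (\<lambda>x. u x - \<phi> x) < \<infinity>" and mea: "\<phi> \<in> borel_measurable borel" "(\<lambda>x. u x - \<phi> x) \<in> energy_space s m A"
    if "u \<in> borel_measurable borel" "energy A u < \<infinity>" "energy A \<phi> < \<infinity>" "\<phi> \<in> test_functions" for \<phi>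
  proof -
    note [measurable] = that(1) test_measurable[OF that(4)]
    show "\<phi> \<in> borel_measurable borel" by measurable
    have "energy A (\<lambda>x. u x + (-1) * \<phi> x) \<le> ennreal (1 / (1 - 1/2)) * energy A u + ennreal (1 / (1/2)) * energy A (\<lambda>x. (-1) * \<phi> x)"
      by (rule energy_add_le) auto
    also have "\<dots> < \<infinity>" using that energy_scale[of A \<phi> "-1"] by (simp add: ennreal_mult_less_top)
    finally show "energy A (\<lambda>x. u x - \<phi> x) < \<infinity>" by simp
    then show "(\<lambda>x. u x - \<phi> x) \<in> energy_space s m A" by (simp add: energy_space_iff)
  qed
  have le: "mag_norm s m A w < \<epsilon> \<longleftrightarrow> energy A w < ennreal (\<epsilon>\<^sup>2)" if "w \<in> energy_space s m A" "\<epsilon> > 0" for w \<epsilon>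
  proof -
    have "mag_norm s m A w < \<epsilon> \<longleftrightarrow> mag_inner s m A w w < \<epsilon>\<^sup>2"
      using that mag_inner_self(1)[OF assms that(1)] unfolding mag_norm_def
      by (metis less_eq_real_def real_less_lsqrt real_sqrt_less_iff real_sqrt_unique)
    also have "\<dots> \<longleftrightarrow> energy A w < ennreal (\<epsilon>\<^sup>2)"
      using mag_inner_self[OF assms that(1)] by (metis ennreal_less_iff)
    finally show ?thesis .
  qed
  show ?thesis
  proof
    assume l: ?l
    then have u: "u \<in> energy_space s m A" by (simp add: mag_sobolev_def)
    have "\<exists>\<phi>\<in>test_functions. energy A \<phi> < \<infinity> \<and> energy A (\<lambda>x. u x - \<phi> x) \<le> ennreal \<epsilon>" if "\<epsilon> > 0" for \<epsilon>
    proof -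
      have "sqrt \<epsilon> > 0" using that by simp
      then obtain \<phi> where \<phi>: "\<phi> \<in> test_functions" "\<phi> \<in> energy_space s m A" "mag_norm s m A (\<lambda>x. u x - \<phi> x) < sqrt \<epsilon>"
        using l unfolding mag_sobolev_def by blast
      have um: "u \<in> borel_measurable borel" "energy A u < \<infinity>" and \<phi>N: "energy A \<phi> < \<infinity>"
        using u \<phi>(2) by (auto simp: energy_space_iff)
      have "energy A (\<lambda>x. u x - \<phi> x) < ennreal ((sqrt \<epsilon>)\<^sup>2)"
        using le[OF mea(2)[OF um \<phi>N \<phi>(1)] \<open>sqrt \<epsilon> > 0\<close>] \<phi>(3) by blast
      then have "energy A (\<lambda>x. u x - \<phi> x) \<le> ennreal \<epsilon>" using that by simp
      then show ?thesis using \<phi>(1) \<phi>N by blast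
    qed
    then show ?r using u by (auto simp: energy_space_iff)
  next
    assume r: ?r
    have "\<exists>\<phi>\<in>test_functions \<inter> energy_space s m A. mag_norm s m A (\<lambda>x. u x - \<phi> x) < \<epsilon>" if "\<epsilon> > 0" for \<epsilon>
    proof -
      have "\<epsilon>\<^sup>2 / 2 > 0" using that by simp
      then obtain \<phi> where \<phi>: "\<phi> \<in> test_functions" "energy A \<phi> < \<infinity>" "energy A (\<lambda>x. u x - \<phi> x) \<le> ennreal (\<epsilon>\<^sup>2 / 2)"
        using r by blast
      have "energy A (\<lambda>x. u x - \<phi> x) < ennreal (\<epsilon>\<^sup>2)" using \<phi>(3) that
        by (rule_tac le_less_trans) (auto simp: ennreal_less_iff)
      moreover have um: "u \<in> borel_measurable borel" "energy A u < \<infinity>" using r by auto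
      ultimately have "mag_norm s m A (\<lambda>x. u x - \<phi> x) < \<epsilon>"
        using le[OF mea(2)[OF um \<phi>(2,1)] that] by blast
      moreover have "\<phi> \<in> energy_space s m A"
        using \<phi>(2) mea(1)[OF um \<phi>(2,1)] by (simp add: energy_space_iff)
      ultimately show ?thesis using \<phi>(1) by blast
    qed
    then show ?l using r by (auto simp: mag_sobolev_def energy_space_iff)
  qed
qed

lemma sobolev_approx:
  assumes "A \<in> borel_measurable borel" "u \<in> mag_sobolev s m A" "\<epsilon> > 0"
  obtains \<phi> where "\<phi> \<in> test_functions" "energy A \<phi> < \<infinity>" "energy A (\<lambda>x. u x - \<phi> x) \<le> ennreal \<epsilon>"
  using assms mag_sobolev_iff by meson

lemma sobolevD:
  assumes "u \<in> mag_sobolev s m A"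
  shows "u \<in> borel_measurable borel" "u \<in> energy_space s m A"
  using assms by (auto simp: mag_sobolev_def energy_space_def)

lemma test_in_sobolev:
  assumes "A \<in> borel_measurable borel" "locally_bounded A" "\<phi> \<in> test_functions"
  shows "\<phi> \<in> mag_sobolev s m A"
proof -
  have "energy A (\<lambda>x. \<phi> x - \<phi> x) = 0"
    by (simp add: energy_def kinetic_def sqmass_def mag_diff_def)
  then show ?thesis using test_in_energy[OF assms] test_measurable assms
    by (auto simp: mag_sobolev_iff intro!: bexI[of _ \<phi>])
qed

lemma Lp_norm_1_iff:
  assumes [measurable]: "u \<in> borel_measurable borel"
  shows "Lp_norm p u = 1 \<longleftrightarrow> pmass u = 1"
proof
  assume a: "Lp_norm p u = 1"
  define I where "I = (LINT x|lborel. norm (u x) powr p)"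
  have "I \<ge> 0" unfolding I_def by (intro integral_nonneg_AE) auto
  moreover have "I powr (1 / p) = 1" using a by (simp add: Lp_norm_def I_def)
  ultimately have I: "I = 1" using p_gt powr_eq_one_iff_gen[of I "1/p"] by (cases "I = 0") (auto simp: powr_eq_one_iff_gen)
  then have "integrable lborel (\<lambda>x. norm (u x) powr p)" using not_integrable_integral_eq I_def by fastforce
  then have "pmass u = ennreal I" unfolding pmass_def I_def by (intro nn_integral_eq_integral) auto
  then show "pmass u = 1" using I by simp
next
  assume a: "pmass u = 1"
  have "integrable lborel (\<lambda>x. norm (u x) powr p)"
    using a unfolding pmass_def by (intro integrableI_nonneg) auto
  then have "pmass u = ennreal (LINT x|lborel. norm (u x) powr p)" unfolding pmass_def by (intro nn_integral_eq_integral) auto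
  then have "(LINT x|lborel. norm (u x) powr p) = 1" using a by (simp add: ennreal_eq_1)
  then show "Lp_norm p u = 1" by (simp add: Lp_norm_def)
qed

lemma energy_diff:
  assumes [measurable]: "A \<in> borel_measurable borel" "u \<in> borel_measurable borel" "v \<in> borel_measurable borel"
    and l: "0 < l" "l < 1"
  shows "energy A (\<lambda>x. u x - v x) \<le> ennreal (1 / (1 - l)) * energy A u + ennreal (1 / l) * energy A v"
  using energy_add_le[OF assms(1,2) _ l, of "\<lambda>x. (-1) * v x"] energy_scale[of A v "-1"] by simp

lemma sobolev_scale:
  assumes [measurable]: "A \<in> borel_measurable borel" and u: "u \<in> mag_sobolev s m A"
  shows "(\<lambda>x. c * u x) \<in> mag_sobolev s m A"
proof (cases "c = 0")
  case True
  have "energy A (\<lambda>x. 0) = 0" by (simp add: energy_def kinetic_def sqmass_def mag_diff_def)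
  moreover have "(\<lambda>x. 0) \<in> test_functions" by (auto simp: test_functions_iff smooth_const)
  ultimately show ?thesis using True by (auto simp: mag_sobolev_iff intro!: bexI[of _ "\<lambda>x. 0"])
next
  case False
  have [measurable]: "u \<in> borel_measurable borel" using u by (simp add: mag_sobolev_iff)
  have "\<exists>\<psi>\<in>test_functions. energy A \<psi> < \<infinity> \<and> energy A (\<lambda>x. c * u x - \<psi> x) \<le> ennreal \<epsilon>" if "\<epsilon> > 0" for \<epsilon>
  proof -
    have "\<epsilon> / (cmod c)\<^sup>2 > 0" using that False by simp
    then obtain \<phi> where \<phi>: "\<phi> \<in> test_functions" "energy A \<phi> < \<infinity>" "energy A (\<lambda>x. u x - \<phi> x) \<le> ennreal (\<epsilon> / (cmod c)\<^sup>2)"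
      using sobolev_approx[OF assms] by blast
    note [measurable] = test_measurable[OF \<phi>(1)]
    have "energy A (\<lambda>x. c * u x - c * \<phi> x) = ennreal ((cmod c)\<^sup>2) * energy A (\<lambda>x. u x - \<phi> x)"
      using energy_scale[of A "\<lambda>x. u x - \<phi> x" c] by (simp add: right_diff_distrib)
    also have "\<dots> \<le> ennreal ((cmod c)\<^sup>2) * ennreal (\<epsilon> / (cmod c)\<^sup>2)" by (intro mult_left_mono \<phi>) simp
    also have "\<dots> = ennreal \<epsilon>" using False by (simp flip: ennreal_mult')
    finally show ?thesis using \<phi> by (intro bexI[of _ "\<lambda>x. c * \<phi> x"]) (auto simp: energy_scale ennreal_mult_less_top test_scale)
  qed
  then show ?thesis using u by (auto simp: mag_sobolev_iff energy_scale ennreal_mult_less_top)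
qed

lemma sobolev_add:
  assumes [measurable]: "A \<in> borel_measurable borel" and u: "u \<in> mag_sobolev s m A" and v: "v \<in> mag_sobolev s m A"
  shows "(\<lambda>x. u x + v x) \<in> mag_sobolev s m A"
proof -
  have [measurable]: "u \<in> borel_measurable borel" "v \<in> borel_measurable borel" using u v by (auto simp: mag_sobolev_iff)
  have add2: "energy A (\<lambda>x. f x + g x) \<le> 2 * energy A f + 2 * energy A g" if "f \<in> borel_measurable borel" "g \<in> borel_measurable borel" for f g
    using energy_add_le[OF assms(1) that, of "1/2"] by simp
  have "energy A (\<lambda>x. u x + v x) < \<infinity>"
    using u v by (intro le_less_trans[OF add2]) (auto simp: mag_sobolev_iff ennreal_mult_less_top)
  moreover have "\<exists>\<psi>\<in>test_functions. energy A \<psi> < \<infinity> \<and> energy A (\<lambda>x. u x + v x - \<psi> x) \<le> ennreal \<epsilon>" if "\<epsilon> > 0" for \<epsilon>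
  proof -
    have e: "\<epsilon> / 4 > 0" using that by simp
    obtain \<phi> where \<phi>: "\<phi> \<in> test_functions" "energy A \<phi> < \<infinity>" "energy A (\<lambda>x. u x - \<phi> x) \<le> ennreal (\<epsilon> / 4)"
      using sobolev_approx[OF assms(1) u e] by blast
    obtain \<psi> where \<psi>: "\<psi> \<in> test_functions" "energy A \<psi> < \<infinity>" "energy A (\<lambda>x. v x - \<psi> x) \<le> ennreal (\<epsilon> / 4)"
      using sobolev_approx[OF assms(1) v e] by blast
    note [measurable] = test_measurable[OF \<phi>(1)] test_measurable[OF \<psi>(1)]
    have "energy A (\<lambda>x. u x + v x - (\<phi> x + \<psi> x)) = energy A (\<lambda>x. (u x - \<phi> x) + (v x - \<psi> x))" by (simp add: algebra_simps)
    also have "\<dots> \<le> 2 * energy A (\<lambda>x. u x - \<phi> x) + 2 * energy A (\<lambda>x. v x - \<psi> x)" by (rule add2) auto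
    also have "\<dots> \<le> 2 * ennreal (\<epsilon> / 4) + 2 * ennreal (\<epsilon> / 4)" by (intro add_mono mult_left_mono \<phi> \<psi>) auto
    also have "\<dots> = ennreal (2 * (\<epsilon> / 4) + 2 * (\<epsilon> / 4))" using that by (simp only: ennreal_plus ennreal_mult' ennreal_numeral)
    also have "\<dots> = ennreal \<epsilon>" by simp
    finally show ?thesis using \<phi> \<psi> le_less_trans[OF add2[of \<phi> \<psi>]]
      by (intro bexI[of _ "\<lambda>x. \<phi> x + \<psi> x"]) (auto intro: test_add simp: ennreal_mult_less_top)
  qed
  ultimately show ?thesis by (auto simp: mag_sobolev_iff)
qed

lemma level_set_lower:
  "bdd_below {(mag_norm s m A u)\<^sup>2 | u. u \<in> mag_sobolev s m A \<and> Lp_norm p u = 1}"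
  by (rule bdd_belowI[of _ 0]) auto

text \<open>
  The variational characterization for functions that are not normalized, by homogeneity.
\<close>

lemma level_le:
  assumes [measurable]: "A \<in> borel_measurable borel" and u: "u \<in> mag_sobolev s m A" and P: "pmass u = ennreal P" "0 \<le> P"
  shows "ennreal (level A * P powr (2 / p)) \<le> energy A u"
proof (cases "P = 0")
  case False
  then have P0: "P > 0" using P by simp
  have [measurable]: "u \<in> borel_measurable borel" using u by (simp add: mag_sobolev_iff)
  define c where "c = P powr (- (1 / p))"
  have c: "c > 0" using P0 by (simp add: c_def)
  have cp: "c powr p = 1 / P"
  proof -
    have "c powr p = P powr (- (1 / p) * p)" unfolding c_def by (rule powr_powr)
    also have "- (1 / p) * p = -1" using p_gt by simp
    finally show ?thesis using P0 by (simp add: powr_minus_divide)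
  qed
  have c2: "c\<^sup>2 * P powr (2 / p) = 1"
  proof -
    have "c\<^sup>2 = P powr (- (2 / p))" using c unfolding c_def by (simp add: powr_powr flip: powr_numeral)
    then show ?thesis using P0 by (simp flip: powr_add)
  qed
  define w where "w x = of_real c * u x" for x
  have w: "w \<in> mag_sobolev s m A" unfolding w_def by (rule sobolev_scale[OF assms(1) u])
  note [measurable] = sobolevD(1)[OF w] and we = sobolevD(2)[OF w]
  have "pmass w = ennreal (c powr p) * ennreal P" unfolding w_def using c P by (simp add: pmass_scale)
  also have "\<dots> = 1" using cp P0 by (simp flip: ennreal_mult')
  finally have "Lp_norm p w = 1" by (simp add: Lp_norm_1_iff)
  then have "level A \<le> (mag_norm s m A w)\<^sup>2"
    unfolding min_level_def using w by (intro cInf_lower level_set_lower) auto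
  then have "ennreal (level A) \<le> energy A w"
    using mag_norm_square[OF assms(1) we] mag_inner_self[OF assms(1) we] by (metis ennreal_leI)
  also have "energy A w = ennreal (c\<^sup>2) * energy A u" unfolding w_def using c by (simp add: energy_scale)
  finally have "ennreal (P powr (2 / p)) * ennreal (level A) \<le> ennreal (P powr (2 / p)) * (ennreal (c\<^sup>2) * energy A u)"
    by (intro mult_left_mono) auto
  also have "\<dots> = ennreal (P powr (2/p) * c\<^sup>2) * energy A u" by (simp add: ennreal_mult mult.assoc)
  also have "\<dots> = energy A u" using c2 by (simp add: mult.commute)
  finally show ?thesis by (simp add: ennreal_mult'' mult.commute)
qed simp

lemma nonzero_test:
  obtains \<phi> where "\<phi> \<in> test_functions" "pmass \<phi> > 0"
proof -
  obtain R0 where R0: "1 \<le> R0" "\<And>R \<xi>. R0 \<le> R \<Longrightarrow> \<exists>\<theta> \<eta>. cutoff 1 \<theta> \<eta> \<and> (\<forall>x\<in>ball \<xi> R. \<theta> x = 1) \<and> (\<forall>x. x \<notin> ball \<xi> (2 * R) \<longrightarrow> \<theta> x = 0)"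
    by (rule cutoff_at_scale[of 1]) auto
  then obtain \<theta> \<eta> where *: "cutoff 1 \<theta> \<eta>" "\<And>x. x \<in> ball 0 R0 \<Longrightarrow> \<theta> x = 1" "\<And>x. x \<notin> ball 0 (2 * R0) \<Longrightarrow> \<theta> x = 0"
    by blast
  have t: "(\<lambda>x. of_real (\<theta> x)) \<in> test_functions"
    unfolding test_functions_iff using cutoffD(1)[OF *(1)] *(3) by (auto intro!: exI[of _ "2 * R0"])
  have "0 < emeasure lborel (ball (0::real^3) 1)" by (simp add: emeasure_ball unit_ball_vol_3)
  also have "\<dots> = (\<integral>\<^sup>+x. indicator (ball (0::real^3) 1) x \<partial>lborel)" by simp
  also have "\<dots> \<le> pmass (\<lambda>x. of_real (\<theta> x))" unfolding pmass_def
    using R0(1) by (intro nn_integral_mono) (auto simp: indicator_def *(2))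
  finally show ?thesis using t that by blast
qed

lemma pmass_finite:
  assumes [measurable]: "A \<in> borel_measurable borel" "u \<in> borel_measurable borel" and "energy A u < \<infinity>"
  shows "pmass u < \<infinity>"
proof -
  obtain K where K: "\<And>A u B. A \<in> borel_measurable borel \<Longrightarrow> u \<in> borel_measurable borel \<Longrightarrow> 0 < B \<Longrightarrow> energy A u \<le> ennreal B \<Longrightarrow>
     pmass u \<le> ennreal (K * B powr (p / 2))" using sobolev by metis
  obtain B where "energy A u = ennreal B" "B \<ge> 0" using assms(3) by (cases "energy A u") auto
  then have "energy A u \<le> ennreal (B + 1)" "B + 1 > 0" by (auto intro: ennreal_leI)
  from K[OF assms(1,2) this(2,1)] show ?thesis by (rule le_less_trans) simp
qed

lemma admissible_test:
  assumes [measurable]: "A \<in> borel_measurable borel" and lb: "locally_bounded A" and \<phi>: "\<phi> \<in> test_functions" "pmass \<phi> > 0"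
  obtains c where "c > 0" "pmass \<phi> = ennreal (c powr (- p))" "pmass (\<lambda>x. of_real c * \<phi> x) = 1"
proof -
  note [measurable] = test_measurable[OF \<phi>(1)]
  obtain P where P: "pmass \<phi> = ennreal P" "P > 0"
    using pmass_finite[OF assms(1) test_measurable[OF \<phi>(1)] test_in_energy[OF assms(1) lb \<phi>(1)]] \<phi>(2)
    by (cases "pmass \<phi>") auto
  define c where "c = P powr (- (1 / p))"
  have c: "c > 0" "c powr (- p) = P" using P p_gt by (auto simp: c_def powr_powr)
  have "pmass (\<lambda>x. of_real c * \<phi> x) = ennreal (c powr p) * ennreal P" using c P by (simp add: pmass_scale)
  also have "\<dots> = 1"
  proof -
    have "c powr p * P = 1" using c by (simp flip: c(2) powr_add)
    then show ?thesis by (simp flip: ennreal_mult')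
  qed
  finally show ?thesis using that[of c] c P by simp
qed

text \<open>
  Positivity also uses that the admissible set is nonempty, because the infimum of the empty
  set is unspecified.
\<close>

lemma level_pos:
  assumes [measurable]: "A \<in> borel_measurable borel" and lb: "locally_bounded A"
  shows "level A > 0"
proof -
  obtain K where K: "K > 0" "\<And>A u B. A \<in> borel_measurable borel \<Longrightarrow> u \<in> borel_measurable borel \<Longrightarrow> 0 < B \<Longrightarrow> energy A u \<le> ennreal B \<Longrightarrow>
     pmass u \<le> ennreal (K * B powr (p / 2))" using sobolev by metis
  define B where "B = (1 / (2 * K)) powr (2 / p)"
  have B: "B > 0" "K * B powr (p / 2) = 1 / 2" using K p_gt by (auto simp: B_def powr_powr)
  obtain \<phi> where \<phi>: "\<phi> \<in> test_functions" "pmass \<phi> > 0" by (rule nonzero_test)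
  obtain c where c: "c > 0" "pmass (\<lambda>x. of_real c * \<phi> x) = 1" using admissible_test[OF assms(1) lb \<phi>] by metis
  have w: "(\<lambda>x. of_real c * \<phi> x) \<in> test_functions" by (rule test_scale[OF \<phi>(1)])
  have "B \<le> level A" unfolding min_level_def
  proof (rule cInf_greatest)
    show "{(mag_norm s m A u)\<^sup>2 |u. u \<in> mag_sobolev s m A \<and> Lp_norm p u = 1} \<noteq> {}"
      using test_in_sobolev[OF assms(1) lb w] Lp_norm_1_iff[OF test_measurable[OF w]] c by blast
  next
    fix x assume "x \<in> {(mag_norm s m A u)\<^sup>2 |u. u \<in> mag_sobolev s m A \<and> Lp_norm p u = 1}"
    then obtain u where u: "x = (mag_norm s m A u)\<^sup>2" "u \<in> mag_sobolev s m A" "Lp_norm p u = 1" by blast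
    note um = sobolevD(1)[OF u(2)] and ue = sobolevD(2)[OF u(2)]
    have P: "pmass u = 1" using u Lp_norm_1_iff[OF um] by simp
    show "B \<le> x"
    proof (rule ccontr)
      assume "\<not> B \<le> x"
      then have "energy A u \<le> ennreal B" using u mag_norm_square[OF assms(1) ue] mag_inner_self[OF assms(1) ue]
        by (metis ennreal_leI linear)
      from K(2)[OF assms(1) um B(1) this] have "pmass u \<le> ennreal (1 / 2)" using B by simp
      then have "1 \<le> (1 / 2 :: real)" unfolding P by (simp only: ennreal_ge_1)
      then show False by simp
    qed
  qed
  then show ?thesis using B by simp
qed

text \<open>
  An almost minimizer is approximated by a test function \<open>\<phi>\<close> in energy, hence by \<open>sobolev\<close>
  also in \<open>L\<^sup>p\<close>, and \<open>\<phi>\<close> is normalized. With error \<open>l\<^sup>3\<close> and weight \<open>l\<close>, the resulting bound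
  \<open>F l\<close> converges as \<open>l\<close> tends to \<open>0\<close>.
\<close>

lemma almost_minimizing_test:
  assumes [measurable]: "A \<in> borel_measurable borel" and lb: "locally_bounded A" and \<tau>: "\<tau> > 0"
  obtains \<phi> where "\<phi> \<in> test_functions" "pmass \<phi> = 1" "energy A \<phi> \<le> ennreal (level A + \<tau>)"
proof -
  obtain K where K: "K > 0" "\<And>A u B. A \<in> borel_measurable borel \<Longrightarrow> u \<in> borel_measurable borel \<Longrightarrow> 0 < B \<Longrightarrow> energy A u \<le> ennreal B \<Longrightarrow>
     pmass u \<le> ennreal (K * B powr (p / 2))" using sobolev by metis
  obtain \<phi>0 where \<phi>0: "\<phi>0 \<in> test_functions" "pmass \<phi>0 > 0" by (rule nonzero_test)
  obtain c0 where c0: "c0 > 0" "pmass (\<lambda>x. of_real c0 * \<phi>0 x) = 1" using admissible_test[OF assms(1) lb \<phi>0] by metis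
  have w0: "(\<lambda>x. of_real c0 * \<phi>0 x) \<in> test_functions" by (rule test_scale[OF \<phi>0(1)])
  have "{(mag_norm s m A u)\<^sup>2 |u. u \<in> mag_sobolev s m A \<and> Lp_norm p u = 1} \<noteq> {}"
    using test_in_sobolev[OF assms(1) lb w0] Lp_norm_1_iff[OF test_measurable[OF w0]] c0 by blast
  from cInf_lessD[OF this, of "level A + \<tau> / 2"] \<tau> obtain u where
    u: "(mag_norm s m A u)\<^sup>2 < level A + \<tau> / 2" "u \<in> mag_sobolev s m A" "Lp_norm p u = 1"
    by (auto simp: min_level_def)
  note um[measurable] = sobolevD(1)[OF u(2)] and ue = sobolevD(2)[OF u(2)]
  have P: "pmass u = 1" using u Lp_norm_1_iff[OF um] by simp
  define N where "N = level A + \<tau> / 2"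
  have N0: "N > 0" using level_pos[OF assms(1) lb] \<tau> by (simp add: N_def)
  have energy: "energy A u \<le> ennreal N" using u mag_norm_square[OF assms(1) ue] mag_inner_self[OF assms(1) ue]
    unfolding N_def by (metis ennreal_leI less_imp_le)
  define F where "F l = (N / (1 - l) + l\<^sup>2) / ((1 - l) powr (p - 1) * (1 - K * l\<^sup>2)) powr (2 / p)" for l
  have "(F \<longlongrightarrow> (N / (1 - 0) + 0\<^sup>2) / ((1 - 0) powr (p - 1) * (1 - K * 0\<^sup>2)) powr (2 / p)) (at_right 0)"
    unfolding F_def by (intro tendsto_intros) auto
  then have "(F \<longlongrightarrow> N) (at_right 0)" by simp
  then have "\<forall>\<^sub>F l in at_right 0. F l < level A + \<tau>" using \<tau> by (intro order_tendstoD(2)) (auto simp: N_def)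
  moreover have "((\<lambda>l. 1 - K * l\<^sup>2) \<longlongrightarrow> 1 - K * 0\<^sup>2) (at_right 0)" by (intro tendsto_intros)
  then have "\<forall>\<^sub>F l in at_right 0. 0 < 1 - K * l\<^sup>2" by (intro order_tendstoD(1)) auto
  moreover have "\<forall>\<^sub>F l in at_right 0. 0 < (l::real) \<and> l < 1" by (subst eventually_at_right[of 0 1]) (auto intro: exI[of _ 1])
  ultimately have "\<forall>\<^sub>F l in at_right 0. F l < level A + \<tau> \<and> 0 < 1 - K * l\<^sup>2 \<and> 0 < (l::real) \<and> l < 1"
    by eventually_elim auto
  then obtain l where l: "F l < level A + \<tau>" "0 < 1 - K * l\<^sup>2" "0 < l" "l < 1"
    using eventually_happens[of _ "at_right (0::real)"] trivial_limit_at_right_real by blast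
  obtain \<phi> where \<phi>: "\<phi> \<in> test_functions" "energy A \<phi> < \<infinity>" "energy A (\<lambda>x. u x - \<phi> x) \<le> ennreal (l ^ 3)"
    using sobolev_approx[OF assms(1) u(2), of "l ^ 3"] l by auto
  note [measurable] = test_measurable[OF \<phi>(1)]
  have small: "pmass (\<lambda>x. u x - \<phi> x) \<le> ennreal (K * (l ^ 3) powr (p / 2))" using \<phi> l by (intro K) auto
  have "energy A \<phi> = energy A (\<lambda>x. u x - (u x - \<phi> x))" by simp
  also have "\<dots> \<le> ennreal (1 / (1 - l)) * energy A u + ennreal (1 / l) * energy A (\<lambda>x. u x - \<phi> x)" by (rule energy_diff) (use l in auto)
  also have "\<dots> \<le> ennreal (1 / (1 - l)) * ennreal N + ennreal (1 / l) * ennreal (l ^ 3)" by (intro add_mono mult_left_mono energy \<phi>) auto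
  also have "\<dots> = ennreal (N / (1 - l) + l\<^sup>2)" using l N0 by (simp add: ennreal_plus power2_eq_square power3_eq_cube flip: ennreal_mult')
  finally have N\<phi>: "energy A \<phi> \<le> ennreal (N / (1 - l) + l\<^sup>2)" .
  obtain P\<phi> where P\<phi>: "pmass \<phi> = ennreal P\<phi>" "P\<phi> \<ge> 0"
    using pmass_finite[OF assms(1) test_measurable[OF \<phi>(1)] \<phi>(2)] by (cases "pmass \<phi>") auto
  have "1 = pmass (\<lambda>x. \<phi> x + (u x - \<phi> x))" using P by simp
  also have "\<dots> \<le> ennreal ((1 - l) powr (1 - p)) * pmass \<phi> + ennreal (l powr (1 - p)) * pmass (\<lambda>x. u x - \<phi> x)"
    by (rule pmass_add_le) (use l in auto)
  also have "\<dots> \<le> ennreal ((1 - l) powr (1 - p)) * ennreal P\<phi> + ennreal (l powr (1 - p)) * ennreal (K * (l ^ 3) powr (p / 2))"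
    using P\<phi> by (intro add_mono mult_left_mono small) auto
  also have "\<dots> = ennreal ((1 - l) powr (1 - p) * P\<phi> + l powr (1 - p) * (K * (l ^ 3) powr (p / 2)))"
    using P\<phi> K(1) by (simp add: ennreal_plus flip: ennreal_mult')
  finally have "1 \<le> (1 - l) powr (1 - p) * P\<phi> + l powr (1 - p) * (K * (l ^ 3) powr (p / 2))"
    by (simp add: ennreal_ge_1)
  also have "l powr (1 - p) * (K * (l ^ 3) powr (p / 2)) = K * l powr (1 + p / 2)"
  proof -
    have "(l ^ 3) powr (p / 2) = l powr (3 * (p / 2))" using l by (simp add: powr_powr flip: powr_numeral)
    moreover have "l powr (1 - p) * l powr (3 * (p / 2)) = l powr (1 + p / 2)"
      unfolding powr_add[symmetric] by (rule arg_cong[where f = "\<lambda>e. l powr e"]) simp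
    ultimately show ?thesis by (metis mult.left_commute)
  qed
  also have "K * l powr (1 + p / 2) \<le> K * l powr 2" using l p_gt K(1) by (intro mult_left_mono powr_mono') auto
  finally have "1 - K * l\<^sup>2 \<le> (1 - l) powr (1 - p) * P\<phi>" using l by simp
  then have "(1 - l) powr (p - 1) * (1 - K * l\<^sup>2) \<le> (1 - l) powr (p - 1) * ((1 - l) powr (1 - p) * P\<phi>)"
    by (intro mult_left_mono) auto
  also have "\<dots> = P\<phi>" using l by (simp flip: mult.assoc powr_add)
  finally have low: "(1 - l) powr (p - 1) * (1 - K * l\<^sup>2) \<le> P\<phi>" .
  have lowpos: "0 < (1 - l) powr (p - 1) * (1 - K * l\<^sup>2)" using l by simp
  then have P\<phi>0: "P\<phi> > 0" using low by linarith
  obtain c where c: "c > 0" "pmass \<phi> = ennreal (c powr (- p))" "pmass (\<lambda>x. of_real c * \<phi> x) = 1"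
    using admissible_test[OF assms(1) lb \<phi>(1)] P\<phi> P\<phi>0 by auto
  have cP: "c powr (- p) = P\<phi>" using c P\<phi> by simp
  have "c\<^sup>2 = (c powr (- p)) powr (- (2 / p))" using c p_gt by (simp add: powr_powr)
  also have "\<dots> = P\<phi> powr (- (2 / p))" by (simp add: cP)
  finally have c2: "c\<^sup>2 = P\<phi> powr (- (2 / p))" .
  have "energy A (\<lambda>x. of_real c * \<phi> x) = ennreal (c\<^sup>2) * energy A \<phi>" by (simp add: energy_scale)
  also have "\<dots> \<le> ennreal (c\<^sup>2) * ennreal (N / (1 - l) + l\<^sup>2)" by (intro mult_left_mono N\<phi>) auto
  also have "\<dots> = ennreal (c\<^sup>2 * (N / (1 - l) + l\<^sup>2))" by (rule ennreal_mult'[symmetric]) simp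
  also have "c\<^sup>2 * (N / (1 - l) + l\<^sup>2) = (N / (1 - l) + l\<^sup>2) / P\<phi> powr (2 / p)"
    by (simp add: c2 powr_minus_divide)
  also have "ennreal ((N / (1 - l) + l\<^sup>2) / P\<phi> powr (2 / p)) \<le> ennreal (F l)" unfolding F_def using N0 l low lowpos p_gt P\<phi>0
    by (intro ennreal_leI divide_left_mono powr_mono2 mult_pos_pos) auto
  also have "\<dots> \<le> ennreal (level A + \<tau>)" using l by (intro ennreal_leI) simp
  finally show ?thesis using c test_scale[OF \<phi>(1)] that by blast
qed

end

section \<open>Tightness of almost minimizers\<close>

lemma divide_mult_cancel: "d \<noteq> 0 \<Longrightarrow> x / d * d = (x::real)"
  by simp

context mag_setting begin

text \<open>
  A form of Hoelder's inequality on a unit ball: \<open>t\<^sup>2 \<le> z + z\<^bsup>-(p-2)/2\<^esup> t\<^sup>p\<close>, with \<open>z\<close> such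
  that the first term integrates to \<open>\<delta> / 2\<close>.
\<close>

lemma mass_lower_bound:
  fixes u :: "real^3 \<Rightarrow> complex"
  assumes [measurable]: "u \<in> borel_measurable borel" and \<delta>: "0 < \<delta>"
    and mass: "ennreal \<delta> \<le> mass2 (ball \<xi> 1) u"
  shows "ennreal (\<delta> / 2 * (\<delta> / (8 / 3 * pi)) powr ((p - 2) / 2))
    \<le> massp (ball \<xi> 1) u"
proof -
  define v where "v = 4 / 3 * pi"
  have v: "v > 0" by (simp add: v_def)
  define z where "z = \<delta> / (2 * v)"
  have z: "z > 0" using \<delta> v by (simp add: z_def)
  have pt: "t\<^sup>2 \<le> z + z powr (- ((p - 2) / 2)) * t powr p" if "t \<ge> 0" for t
  proof (cases "t\<^sup>2 \<le> z")
    case True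
    then show ?thesis by (simp add: add_increasing2)
  next
    case False
    then have t: "t > 0" using that z by (cases "t = 0") auto
    have "z powr ((p - 2) / 2) \<le> (t\<^sup>2) powr ((p - 2) / 2)" using False z p_gt by (intro powr_mono2) auto
    also have "(t\<^sup>2) powr ((p - 2) / 2) = (t powr 2) powr ((p - 2) / 2)" using t by simp
    also have "\<dots> = t powr (2 * ((p - 2) / 2))" by (rule powr_powr)
    also have "2 * ((p - 2) / 2) = p - 2" by simp
    finally have "t powr 2 * z powr ((p - 2) / 2) \<le> t powr 2 * t powr (p - 2)" by (intro mult_left_mono) auto
    also have "\<dots> = t powr p" by (simp flip: powr_add)
    finally have "t\<^sup>2 * z powr ((p - 2) / 2) \<le> t powr p" using t by simp
    then have "t\<^sup>2 \<le> z powr (- ((p - 2) / 2)) * t powr p" using z by (simp add: powr_minus_divide field_simps)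
    then show ?thesis using z by simp
  qed
  define X where "X = massp (ball \<xi> 1) u"
  have b[measurable]: "ball \<xi> 1 \<in> sets borel" by simp
  have "ennreal \<delta> \<le> (\<integral>\<^sup>+y. (ennreal z * indicator (ball \<xi> 1) y) + ennreal (z powr (- ((p - 2) / 2))) * (ennreal (cmod (u y) powr p) * indicator (ball \<xi> 1) y) \<partial>lborel)"
    using z by (intro order_trans[OF mass] nn_integral_mono)
      (auto simp: indicator_def intro!: ennreal_leI pt simp flip: ennreal_mult' ennreal_plus)
  also have "\<dots> = ennreal z * emeasure lborel (ball \<xi> 1) + ennreal (z powr (- ((p - 2) / 2))) * X"
    unfolding X_def by (subst nn_integral_add) (simp_all add: nn_integral_cmult nn_integral_cmult_indicator)
  also have "ennreal z * emeasure lborel (ball \<xi> 1) = ennreal (\<delta> / 2)"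
    using emeasure_ball[of 1 \<xi>] \<delta> v by (simp add: unit_ball_vol_3 z_def v_def flip: ennreal_mult')
  finally have le: "ennreal \<delta> \<le> ennreal (\<delta> / 2) + ennreal (z powr (- ((p - 2) / 2))) * X" .
  show ?thesis
  proof (cases X)
    case (real x)
    have "ennreal \<delta> \<le> ennreal (\<delta> / 2 + z powr (- ((p - 2) / 2)) * x)"
      using le real \<delta> by (simp add: ennreal_plus ennreal_mult')
    then have "\<delta> \<le> \<delta> / 2 + z powr (- ((p - 2) / 2)) * x" using real \<delta> by (subst (asm) ennreal_le_iff) auto
    then have "\<delta> / 2 * z powr ((p - 2) / 2) \<le> x" using z by (simp add: powr_minus_divide field_simps)
    then have "ennreal (\<delta> / 2 * z powr ((p - 2) / 2)) \<le> X" using real by (simp add: ennreal_leI)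
    then show ?thesis unfolding X_def[symmetric] by (simp add: z_def v_def)
  qed (simp add: X_def)
qed

text \<open>
  Quantitative strict concavity of \<open>t\<^sup>\<theta>\<close>: as \<open>a \<le> 1 - e\<close> and \<open>b \<le> 1 - a0\<close>, one has
  \<open>a\<^sup>\<theta> \<ge> l * a\<close> and \<open>b\<^sup>\<theta> \<ge> l * b\<close> for some \<open>l > 1\<close>. So it suffices that \<open>a + b\<close> is close to
  \<open>1\<close>.
\<close>

lemma sum_powr_less_1_gap:
  assumes "0 < \<theta>" "\<theta> < 1" "0 < a0" "a0 < 1" "0 < e" "e < 1"
  obtains \<kappa> \<sigma> where "\<kappa> > 0" "\<sigma> > 0"
    "\<And>a b. a0 \<le> a \<Longrightarrow> e \<le> b \<Longrightarrow> 1 - \<sigma> \<le> a + b \<Longrightarrow> a + b \<le> 1 \<Longrightarrow> 1 + \<kappa> \<le> a powr \<theta> + b powr (\<theta>::real)"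
proof -
  define l where "l = min ((1 - e) powr (\<theta> - 1)) ((1 - a0) powr (\<theta> - 1))"
  have gt: "1 < x powr (\<theta> - 1)" if "0 < x" "x < 1" for x
    using powr_less_mono'[of x "\<theta> - 1" 0] that assms by simp
  have l: "l > 1" unfolding l_def using gt[of "1 - e"] gt[of "1 - a0"] assms by simp
  define \<sigma> where "\<sigma> = (l - 1) / (2 * l)"
  define \<kappa> where "\<kappa> = (l - 1) / 2"
  have "1 + \<kappa> \<le> a powr \<theta> + b powr \<theta>" if ab: "a0 \<le> a" "e \<le> b" "1 - \<sigma> \<le> a + b" "a + b \<le> 1" for a b
  proof -
    have up: "x * y powr (\<theta> - 1) \<le> x powr \<theta>" if "0 < x" "x \<le> y" for x y
    proof -
      have "y powr (\<theta> - 1) \<le> x powr (\<theta> - 1)" using that assms by (intro powr_mono2') auto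
      then have "x * y powr (\<theta> - 1) \<le> x * x powr (\<theta> - 1)" using that by (intro mult_left_mono) auto
      then show ?thesis using that by (simp add: powr_mult_base)
    qed
    have "l \<le> (1 - e) powr (\<theta> - 1)" "l \<le> (1 - a0) powr (\<theta> - 1)" by (auto simp: l_def)
    then have "a * l \<le> a * (1 - e) powr (\<theta> - 1)" "b * l \<le> b * (1 - a0) powr (\<theta> - 1)"
      using ab assms by (auto intro!: mult_left_mono)
    moreover have "a * (1 - e) powr (\<theta> - 1) \<le> a powr \<theta>" "b * (1 - a0) powr (\<theta> - 1) \<le> b powr \<theta>"
      using up[of a "1 - e"] up[of b "1 - a0"] ab assms by auto
    ultimately have 1: "a * l \<le> a powr \<theta>" and 2: "b * l \<le> b powr \<theta>" by linarith+
    have "1 + \<kappa> = l * (1 - \<sigma>)" using l by (simp add: \<kappa>_def \<sigma>_def field_simps)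
    also have "\<dots> \<le> l * (a + b)" using l ab by (intro mult_left_mono) auto
    finally show ?thesis using 1 2 by (simp add: algebra_simps)
  qed
  then show ?thesis using l by (intro that[of \<kappa> \<sigma>]) (auto simp: \<kappa>_def \<sigma>_def)
qed

text \<open>
  Among \<open>J\<close> disjoint dyadic annuli about \<open>\<xi>\<close> one has \<open>L\<^sup>p\<close> mass at most \<open>1 / J\<close>. A partition
  of unity that varies only there splits \<open>u\<close> into an inner part of mass \<open>a\<close> and an outer part
  of mass \<open>b\<close> with \<open>a + b\<close> close to \<open>1\<close>. The inner part has mass at least \<open>a0\<close> because of
  \<open>mass_lower_bound\<close>. If the outer one had mass above \<open>e\<close>, \<open>sum_powr_less_1_gap\<close> would make
  the energy of \<open>u\<close> exceed the level by a fixed amount. For a given field the radius depends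
  on \<open>\<delta>\<close> and \<open>\<epsilon>\<close> only, so it serves a whole sequence of functions, with centres depending on
  the function.
\<close>

lemma energy_tight:
  assumes [measurable]: "A \<in> borel_measurable borel" and lb: "locally_bounded A" and \<delta>: "0 < \<delta>" and \<epsilon>: "0 < \<epsilon>"
  obtains R \<tau> where "R > 0" "\<tau> > 0" "\<And>u \<xi>. u \<in> test_functions \<Longrightarrow> pmass u = 1 \<Longrightarrow> energy A u \<le> ennreal (level A + \<tau>) \<Longrightarrow>
     ennreal \<delta> \<le> mass2 (ball \<xi> 1) u \<Longrightarrow>
     massp (- ball \<xi> R) u \<le> ennreal \<epsilon>"
proof -
  define M where "M = level A"
  have M: "M > 0" unfolding M_def by (rule level_pos[OF assms(1) lb])
  define e where "e = min \<epsilon> (1 / 2)"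
  have e: "0 < e" "e < 1" "e \<le> \<epsilon>" using \<epsilon> by (auto simp: e_def)
  define a0 where "a0 = min (1 / 2) (\<delta> / 2 * (\<delta> / (8 / 3 * pi)) powr ((p - 2) / 2))"
  have a0: "0 < a0" "a0 < 1" using \<delta> by (auto simp: a0_def)
  have \<theta>p: "0 < 2 / p" "2 / p < 1" using p_gt by auto
  obtain \<kappa> \<sigma> where gap: "\<kappa> > 0" "\<sigma> > 0"
    "\<And>a b. a0 \<le> a \<Longrightarrow> e \<le> b \<Longrightarrow> 1 - \<sigma> \<le> a + b \<Longrightarrow> a + b \<le> 1 \<Longrightarrow> 1 + \<kappa> \<le> a powr (2 / p) + b powr (2 / p)"
    using sum_powr_less_1_gap[OF \<theta>p a0 e(1,2)] by blast
  obtain J :: nat where J: "J > 0" "1 / real J \<le> \<sigma>"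
    using reals_Archimedean[OF gap(2)] by (metis inverse_eq_divide less_imp_le zero_less_Suc)
  define \<tau> where "\<tau> = min 1 (M * \<kappa> / 4)"
  have \<tau>: "\<tau> > 0" "\<tau> \<le> 1" "\<tau> \<le> M * \<kappa> / 4" using M gap by (auto simp: \<tau>_def)
  \<comment> \<open>Chosen so that the localization error is at most \<open>M * \<kappa> / 4\<close>.\<close>
  define e0 where "e0 = M * \<kappa> / 4 * c2 / (2 * c1 * (M + 1))"
  have e0: "e0 > 0" using M gap c1_pos c2_pos by (simp add: e0_def)
  obtain \<Lambda> where \<Lambda>: "\<Lambda> > 0" "truncated_kern \<Lambda> \<le> ennreal e0" using truncated_kern_small[OF e0] by auto
  obtain R0 where R0: "1 \<le> R0" "\<And>R \<xi>. R0 \<le> R \<Longrightarrow> \<exists>\<theta> \<eta>. cutoff \<Lambda> \<theta> \<eta> \<and> (\<forall>x\<in>ball \<xi> R. \<theta> x = 1) \<and> (\<forall>x. x \<notin> ball \<xi> (2 * R) \<longrightarrow> \<theta> x = 0)"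
    by (rule cutoff_at_scale[OF \<Lambda>(1)]) blast
  define r where "r j = R0 * 2 ^ j" for j :: nat
  have r: "r j \<ge> R0" "r j > 0" for j
  proof -
    show "r j \<ge> R0" using R0 mult_left_mono[of 1 "2 ^ j" R0] by (simp add: r_def)
    then show "r j > 0" using R0 by simp
  qed
  have main: "massp (- ball \<xi> (r J)) u \<le> ennreal \<epsilon>"
    if u: "u \<in> test_functions" and P: "pmass u = 1" and N: "energy A u \<le> ennreal (level A + \<tau>)"
     and mass: "ennreal \<delta> \<le> mass2 (ball \<xi> 1) u" for u \<xi>
  proof -
    note um[measurable] = test_measurable[OF u]
    define D where "D = density lborel (\<lambda>y. ennreal (cmod (u y) powr p))"
    have sD[simp]: "sets D = sets borel" "space D = UNIV" by (auto simp: D_def)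
    have eD: "emeasure D S = massp S u" if "S \<in> sets borel" for S
      unfolding D_def using that by (subst emeasure_density) auto
    interpret D: prob_space D
      by (rule prob_spaceI) (use P in \<open>simp add: eD pmass_def\<close>)
    define f where "f j = D.prob (ball \<xi> (r j))" for j
    have fm: "f 0 \<le> f j" for j unfolding f_def using r(1)[of j] by (intro D.finite_measure_mono) (auto simp: r_def)
    have f1: "f j \<le> 1" "0 \<le> f j" for j unfolding f_def by auto
    have fa0: "a0 \<le> f j" for j
    proof -
      have "ennreal (\<delta> / 2 * (\<delta> / (8 / 3 * pi)) powr ((p - 2) / 2)) \<le> emeasure D (ball \<xi> 1)"
        using mass_lower_bound[OF um \<delta> mass] by (simp add: eD)
      also have "\<dots> = ennreal (D.prob (ball \<xi> 1))" by (rule D.emeasure_eq_measure)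
      finally have "\<delta> / 2 * (\<delta> / (8 / 3 * pi)) powr ((p - 2) / 2) \<le> D.prob (ball \<xi> 1)"
        by (subst (asm) ennreal_le_iff) auto
      also have "\<dots> \<le> f j" unfolding f_def using r(1)[of j] R0 by (intro D.finite_measure_mono) auto
      finally show ?thesis by (simp add: a0_def)
    qed
    \<comment> \<open>Pigeonhole principle: the masses of the annuli add up to at most \<open>1\<close>.\<close>
    have "\<exists>j<J. f (Suc j) - f j \<le> 1 / real J"
    proof (rule ccontr)
      assume "\<not> ?thesis"
      then have "\<And>j. j < J \<Longrightarrow> 1 / real J < f (Suc j) - f j" by force
      then have "(\<Sum>j<J. 1 / real J) < (\<Sum>j<J. f (Suc j) - f j)" using J by (intro sum_strict_mono) auto
      also have "\<dots> = f J - f 0" by (rule sum_lessThan_telescope)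
      also have "\<dots> \<le> 1" using f1[of J] f1[of 0] by linarith
      finally show False using J by simp
    qed
    then obtain j where j: "j < J" "f (Suc j) - f j \<le> 1 / real J" by blast
    obtain \<theta> \<eta> where cut: "cutoff \<Lambda> \<theta> \<eta>" and in1: "\<And>x. x \<in> ball \<xi> (r j) \<Longrightarrow> \<theta> x = 1"
      and out: "\<And>x. x \<notin> ball \<xi> (r (Suc j)) \<Longrightarrow> \<theta> x = 0"
      using R0(2)[OF r(1)[of j]] by (force simp: r_def mult.left_commute)
    note s\<theta> = cutoffD(1)[OF cut] and s\<eta> = cutoffD(2)[OF cut] and [measurable] = cutoffD(3,4)[OF cut]
      and part = cutoffD(5-7)[OF cut] and le1 = cutoffD(8,9)[OF cut]
    have out1: "\<eta> x = 1" if "x \<notin> ball \<xi> (r (Suc j))" for x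
      using part[of x] out[OF that] by (simp add: power2_eq_1_iff)
    define a where "a = enn2real (pmass (\<lambda>x. of_real (\<theta> x) * u x))"
    define b where "b = enn2real (pmass (\<lambda>x. of_real (\<eta> x) * u x))"
    have t\<theta>: "(\<lambda>x. of_real (\<theta> x) * u x) \<in> test_functions" by (rule test_mult[OF s\<theta> u])
    have t\<eta>: "(\<lambda>x. of_real (\<eta> x) * u x) \<in> test_functions" by (rule test_mult[OF s\<eta> u])
    have a: "pmass (\<lambda>x. of_real (\<theta> x) * u x) = ennreal a" "a \<ge> 0"
      unfolding a_def using pmass_finite[OF assms(1) test_measurable[OF t\<theta>] test_in_energy[OF assms(1) lb t\<theta>]] by auto
    have b: "pmass (\<lambda>x. of_real (\<eta> x) * u x) = ennreal b" "b \<ge> 0"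
      unfolding b_def using pmass_finite[OF assms(1) test_measurable[OF t\<eta>] test_in_energy[OF assms(1) lb t\<eta>]] by auto
    have sum1: "a + b \<le> 1"
    proof -
      have "ennreal a + ennreal b = (\<integral>\<^sup>+x. ennreal (cmod (of_real (\<theta> x) * u x) powr p) + ennreal (cmod (of_real (\<eta> x) * u x) powr p) \<partial>lborel)"
        unfolding a(1)[symmetric] b(1)[symmetric] pmass_def by (subst nn_integral_add) auto
      also have "\<dots> \<le> pmass u" unfolding pmass_def
      proof (intro nn_integral_mono)
        fix x
        have "\<theta> x powr p \<le> (\<theta> x)\<^sup>2" "\<eta> x powr p \<le> (\<eta> x)\<^sup>2"
          using powr_mono'[of 2 p "\<theta> x"] powr_mono'[of 2 p "\<eta> x"] le1 part p_gt by auto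
        then have "\<theta> x powr p + \<eta> x powr p \<le> 1" using part[of x] by linarith
        then have "(\<theta> x powr p + \<eta> x powr p) * cmod (u x) powr p \<le> 1 * cmod (u x) powr p" by (intro mult_right_mono) auto
        then have "cmod (of_real (\<theta> x) * u x) powr p + cmod (of_real (\<eta> x) * u x) powr p \<le> cmod (u x) powr p"
          using part by (simp add: norm_mult powr_mult distrib_right)
        then show "ennreal (cmod (of_real (\<theta> x) * u x) powr p) + ennreal (cmod (of_real (\<eta> x) * u x) powr p) \<le> ennreal (cmod (u x) powr p)"
          by (simp add: ennreal_leI flip: ennreal_plus)
      qed
      finally have "ennreal (a + b) \<le> ennreal 1" using P a b by (simp add: ennreal_plus)
      then show ?thesis by (subst (asm) ennreal_le_iff) auto
    qed
    have alow: "f j \<le> a"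
    proof -
      have "emeasure D (ball \<xi> (r j)) \<le> pmass (\<lambda>x. of_real (\<theta> x) * u x)"
        by (simp add: eD pmass_def) (auto intro!: nn_integral_mono simp: in1 indicator_def)
      then show ?thesis using a by (simp add: f_def D.emeasure_eq_measure)
    qed
    have blow: "D.prob (- ball \<xi> (r (Suc j))) \<le> b"
    proof -
      have "emeasure D (- ball \<xi> (r (Suc j))) \<le> pmass (\<lambda>x. of_real (\<eta> x) * u x)"
        by (simp add: eD pmass_def) (auto intro!: nn_integral_mono simp: out1 indicator_def)
      then show ?thesis using b by (simp add: D.emeasure_eq_measure)
    qed
    have compl: "D.prob (- ball \<xi> (r i)) = 1 - f i" for i
      unfolding f_def using D.prob_compl[of "ball \<xi> (r i)"] by (simp add: Compl_eq_Diff_UNIV)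
    have sum2: "1 - \<sigma> \<le> a + b" using alow blow compl[of "Suc j"] j J by linarith
    have "b \<le> e"
    proof (rule ccontr)
      assume "\<not> b \<le> e"
      then have "1 + \<kappa> \<le> a powr (2 / p) + b powr (2 / p)"
        using gap(3)[of a b] sum1 sum2 alow fa0[of j] by simp
      then have "M * (1 + \<kappa>) \<le> M * (a powr (2 / p) + b powr (2 / p))" using M by simp
      have "energy A u \<le> ennreal (M + 1)" using N \<tau> by (elim order_trans) (auto intro: ennreal_leI simp: M_def)
      then have mass_u: "sqmass u \<le> ennreal ((M + 1) / c2)" using M by (intro energy_parts_le) auto
      have "ennreal (M * a powr (2 / p)) + ennreal (M * b powr (2 / p))
          \<le> energy A (\<lambda>x. of_real (\<theta> x) * u x) + energy A (\<lambda>x. of_real (\<eta> x) * u x)"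
        unfolding M_def by (intro add_mono level_le[OF assms(1)] test_in_sobolev assms lb t\<theta> t\<eta> a b)
      also have "\<dots> \<le> energy A u + ennreal (2 * c1) * (truncated_kern \<Lambda> * sqmass u)"
        by (rule energy_localization[OF _ _ cut]) auto
      also have "\<dots> \<le> ennreal (level A + \<tau>) + ennreal (2 * c1) * (ennreal e0 * ennreal ((M + 1) / c2))"
        by (intro add_mono mult_mono N \<Lambda>(2) mass_u) auto
      also have "\<dots> = ennreal (level A + \<tau> + 2 * c1 * (e0 * ((M + 1) / c2)))"
        using M \<tau> c1_pos c2_pos e0 by (simp add: M_def ennreal_plus flip: ennreal_mult')
      also have "2 * c1 * (e0 * ((M + 1) / c2)) = M * \<kappa> / 4"
      proof -
        have "2 * c1 * (M + 1) \<noteq> 0" using c1_pos M by simp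
        then have e: "e0 * (2 * c1 * (M + 1)) = M * \<kappa> / 4 * c2"
          unfolding e0_def by (rule divide_mult_cancel)
        have "2 * c1 * (e0 * ((M + 1) / c2)) = e0 * (2 * c1 * (M + 1)) / c2" by simp
        also have "\<dots> = M * \<kappa> / 4 * c2 / c2" by (simp only: e)
        also have "\<dots> = M * \<kappa> / 4" using c2_pos by simp
        finally show ?thesis .
      qed
      finally have "ennreal (M * a powr (2 / p) + M * b powr (2 / p)) \<le> ennreal (M + \<tau> + M * \<kappa> / 4)"
        using M by (simp add: ennreal_plus M_def)
      then have "M * a powr (2 / p) + M * b powr (2 / p) \<le> M + \<tau> + M * \<kappa> / 4"
        using M \<tau> gap by (subst (asm) ennreal_le_iff) auto
      moreover have "0 < M * \<kappa>" using M gap by simp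
      ultimately show False using \<open>M * (1 + \<kappa>) \<le> M * (a powr (2 / p) + b powr (2 / p))\<close> \<tau>(3)
        by (simp add: algebra_simps)
    qed
    have "D.prob (- ball \<xi> (r J)) \<le> D.prob (- ball \<xi> (r (Suc j)))"
    proof (intro D.finite_measure_mono)
      have "r (Suc j) \<le> r J" unfolding r_def using j R0 by (intro mult_left_mono power_increasing) auto
      then show "- ball \<xi> (r J) \<subseteq> - ball \<xi> (r (Suc j))" by auto
    qed simp
    then have "D.prob (- ball \<xi> (r J)) \<le> \<epsilon>" using blow \<open>b \<le> e\<close> e by linarith
    then have "emeasure D (- ball \<xi> (r J)) \<le> ennreal \<epsilon>" by (simp add: D.emeasure_eq_measure ennreal_leI)
    then show ?thesis by (subst (asm) eD) auto
  qed
  show ?thesis by (rule that[OF r(2)[of J] \<tau>(1) main])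
qed

end

section \<open>Convergent magnetic fields\<close>

lemma ennreal_lincomb:
  assumes "0 \<le> a" "0 \<le> b" "0 \<le> x" "0 \<le> y"
  shows "ennreal (a * x + b * y) = ennreal a * ennreal x + ennreal b * ennreal y"
  using assms by (simp add: ennreal_plus ennreal_mult')

context mag_setting begin

text \<open>
  For functions supported in a fixed ball, replacing \<open>A n\<close> by its limit \<open>B\<close> increases the
  energy by at most a factor close to \<open>1\<close> and a small error, uniformly in the function. The
  error involves the squared difference \<open>g n\<close> of the two phases times \<open>|w|\<^sup>2\<close> and the kernel.
  By dominated convergence \<open>g n\<close> times the kernel has small integral over the support, but \<open>w\<close>
  is not bounded; so \<open>|w|\<^sup>2\<close> is first estimated by \<open>\<zeta> * |w|\<^sup>p + T\<^sup>2\<close>.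
\<close>

lemma field_change:
  assumes [measurable]: "\<And>n. A n \<in> borel_measurable borel" "B \<in> borel_measurable borel"
    and bd: "\<And>n x. norm x \<le> R + 1 \<Longrightarrow> norm (A n x) \<le> C" "\<And>x. norm x \<le> R + 1 \<Longrightarrow> norm (B x) \<le> C"
    and lim: "\<And>x. (\<lambda>n. A n x) \<longlonglongrightarrow> B x" and \<epsilon>: "\<epsilon> > 0" and C: "C > 0"
  shows "\<exists>n0. \<forall>n w. n0 \<le> n \<longrightarrow> w \<in> borel_measurable borel \<longrightarrow> (\<forall>x. R \<le> norm x \<longrightarrow> w x = 0) \<longrightarrow> pmass w \<le> 1 \<longrightarrow>
     energy B w \<le> ennreal (1 + \<epsilon>) * energy (A n) w + ennreal \<epsilon>"
proof -
  define g where "g n z = (cmod (phase B (fst z) (snd z)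
     - phase (A n) (fst z) (snd z)))\<^sup>2" for n and z :: "(real^3) \<times> (real^3)"
  have gm[measurable]: "g n \<in> borel_measurable borel" for n unfolding g_def by measurable
  define H where "H w = min 1 ((1 * norm w)\<^sup>2) * kern w" for w :: "real^3"
  have [measurable]: "H \<in> borel_measurable borel" unfolding H_def by measurable
  have H0: "H w \<ge> 0" for w by (simp add: H_def)
  define K0 where "K0 = 4 + 4 * C\<^sup>2"
  have K0: "K0 > 0" using C by (simp add: K0_def add_pos_nonneg)
  have gb: "g n z * kern (fst z - snd z) \<le> K0 * H (fst z - snd z)" if "norm (fst z) < R" for n z
  proof -
    define x y where "x = fst z" and "y = snd z"
    have "g n z \<le> K0 * min 1 ((norm (x - y))\<^sup>2)"
    proof (cases "norm (x - y) \<le> 1")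
      case False
      have "g n z \<le> 2\<^sup>2" unfolding g_def
        using phase_diff_le[of "(x - y) \<bullet> B ((x + y) /\<^sub>R 2)" "(x - y) \<bullet> A n ((x + y) /\<^sub>R 2)"]
        by (intro power_mono) (auto simp: x_def y_def)
      also have "\<dots> \<le> K0" by (simp add: K0_def)
      finally show ?thesis using False one_le_power[of "norm (x - y)" 2] by simp
    next
      case True
      have mid: "norm ((x + y) /\<^sub>R 2) \<le> R + 1" using midpoint_norm_le[of x y] that True by (simp add: x_def[symmetric])
      have "g n z \<le> (norm (x - y) * (2 * C))\<^sup>2" unfolding g_def x_def[symmetric] y_def[symmetric]
      proof (intro power_mono)
        have "cmod (phase B x y - phase (A n) x y)
           \<le> \<bar>(x - y) \<bullet> B ((x + y) /\<^sub>R 2) - (x - y) \<bullet> A n ((x + y) /\<^sub>R 2)\<bar>"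
          using phase_diff_le by (rule order_trans) simp
        also have "\<dots> = \<bar>(x - y) \<bullet> (B ((x + y) /\<^sub>R 2) - A n ((x + y) /\<^sub>R 2))\<bar>" by (simp add: inner_diff_right)
        also have "\<dots> \<le> norm (x - y) * norm (B ((x + y) /\<^sub>R 2) - A n ((x + y) /\<^sub>R 2))" by (rule Cauchy_Schwarz_ineq2)
        also have "\<dots> \<le> norm (x - y) * (2 * C)"
          using norm_triangle_ineq4[of "B ((x + y) /\<^sub>R 2)" "A n ((x + y) /\<^sub>R 2)"] bd(1)[OF mid, of n] bd(2)[OF mid]
          by (intro mult_left_mono) auto
        finally show "cmod (phase B x y - phase (A n) x y)
            \<le> norm (x - y) * (2 * C)" .
      qed auto
      also have "\<dots> = 4 * C\<^sup>2 * (norm (x - y))\<^sup>2" by (simp add: power_mult_distrib)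
      also have "\<dots> \<le> K0 * (norm (x - y))\<^sup>2" by (intro mult_right_mono) (auto simp: K0_def)
      finally show ?thesis using power_le_one[OF norm_ge_zero True, of 2] by simp
    qed
    then have "g n z * kern (x - y) \<le> K0 * min 1 ((norm (x - y))\<^sup>2) * kern (x - y)" by (intro mult_right_mono) auto
    then show ?thesis by (simp add: H_def x_def y_def mult.assoc)
  qed
  define I :: "real^3 \<Rightarrow> ennreal" where "I = indicator (ball 0 R)"
  have [measurable]: "I \<in> borel_measurable borel" unfolding I_def by (intro borel_measurable_indicator) simp
  have Ifin: "(\<integral>\<^sup>+x. I x \<partial>lborel) < \<infinity>" using emeasure_lborel_ball_finite[of "0::real^3" R] by (simp add: I_def)
  define G where "G n = (\<integral>\<^sup>+z. I (fst z) * ennreal (g n z * kern (fst z - snd z)) \<partial>lborel)" for n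
  have "G \<longlonglongrightarrow> (\<integral>\<^sup>+z. 0 \<partial>(lborel :: ((real^3) \<times> (real^3)) measure))"
    unfolding G_def
  proof (rule nn_integral_dominated_convergence[where w = "\<lambda>z. ennreal K0 * (I (fst z) * ennreal (H (fst z - snd z)))"])
    show "AE z in (lborel :: ((real^3) \<times> (real^3)) measure). I (fst z) * ennreal (g n z * kern (fst z - snd z)) \<le> ennreal K0 * (I (fst z) * ennreal (H (fst z - snd z)))" for n
    proof (rule AE_I2)
      fix z :: "(real^3) \<times> (real^3)"
      show "I (fst z) * ennreal (g n z * kern (fst z - snd z)) \<le> ennreal K0 * (I (fst z) * ennreal (H (fst z - snd z)))"
        using ennreal_leI[OF gb[of z n]] K0 by (auto simp: I_def indicator_def ennreal_mult')
    qed
    have "(\<integral>\<^sup>+z. ennreal K0 * (I (fst z) * ennreal (H (fst z - snd z))) \<partial>lborel) = ennreal K0 * ((\<integral>\<^sup>+x. I x \<partial>lborel) * truncated_kern 1)"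
      using nn_integral_convolution_fst[of I "\<lambda>w. ennreal (H w)"] by (subst nn_integral_cmult) (auto simp: truncated_kern_def H_def)
    also have "\<dots> < \<infinity>" using Ifin truncated_kern_finite by (simp add: ennreal_mult_less_top)
    finally show "(\<integral>\<^sup>+z. ennreal K0 * (I (fst z) * ennreal (H (fst z - snd z))) \<partial>lborel) < \<infinity>" .
    show "AE z in (lborel :: ((real^3) \<times> (real^3)) measure). (\<lambda>n. I (fst z) * ennreal (g n z * kern (fst z - snd z))) \<longlonglongrightarrow> 0"
    proof (rule AE_I2)
      fix z :: "(real^3) \<times> (real^3)"
      define x y where "x = fst z" and "y = snd z"
      have "(\<lambda>n. g n z * kern (x - y)) \<longlonglongrightarrow> (cmod (phase B x y - phase B x y))\<^sup>2 * kern (x - y)"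
        unfolding g_def x_def[symmetric] y_def[symmetric] by (intro tendsto_intros lim)
      then have "(\<lambda>n. ennreal (g n z * kern (x - y))) \<longlonglongrightarrow> 0" by (auto dest: tendsto_ennrealI)
      then show "(\<lambda>n. I (fst z) * ennreal (g n z * kern (fst z - snd z))) \<longlonglongrightarrow> 0"
        by (cases "x \<in> ball 0 R") (auto simp: I_def x_def y_def)
    qed
  qed auto
  then have G: "G \<longlonglongrightarrow> 0" by simp
  define \<kappa> where "\<kappa> = enn2real (truncated_kern 1)"
  have \<kappa>: "truncated_kern 1 = ennreal \<kappa>" "\<kappa> \<ge> 0" using truncated_kern_finite by (auto simp: \<kappa>_def)
  define l where "l = \<epsilon> / (1 + \<epsilon>)"
  have l: "0 < l" "l < 1" "1 / (1 - l) = 1 + \<epsilon>" using \<epsilon> by (auto simp: l_def field_simps)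
  define e where "e = \<epsilon> * l / c1"
  have e: "e > 0" "c1 * (1 / l * e) = \<epsilon>" using \<epsilon> l c1_pos by (auto simp: e_def)
  define \<zeta> where "\<zeta> = e / 2 / (K0 * (\<kappa> + 1))"
  have \<zeta>: "\<zeta> > 0" using e K0 \<kappa> by (simp add: \<zeta>_def add_nonneg_pos)
  have \<zeta>2: "\<zeta> * K0 * \<kappa> \<le> e / 2"
  proof -
    have "K0 * (\<kappa> + 1) > 0" using K0 \<kappa> by (simp add: add_nonneg_pos)
    then have "\<zeta> * (K0 * (\<kappa> + 1)) = e / 2" unfolding \<zeta>_def by (rule divide_mult_cancel[OF less_imp_neq[symmetric]])
    moreover have "\<zeta> * (K0 * \<kappa>) \<le> \<zeta> * (K0 * (\<kappa> + 1))" using \<zeta> K0 by (intro mult_left_mono) auto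
    moreover have "\<zeta> * K0 * \<kappa> = \<zeta> * (K0 * \<kappa>)" by (rule mult.assoc)
    ultimately show ?thesis by linarith
  qed
  \<comment> \<open>Beyond \<open>T\<close> the power \<open>\<zeta> * t\<^sup>p\<close> dominates \<open>t\<^sup>2\<close>.\<close>
  define T where "T = (1 / \<zeta>) powr (1 / (p - 2))"
  have T: "T > 0" using \<zeta> by (simp add: T_def)
  have young: "t\<^sup>2 \<le> \<zeta> * t powr p + T\<^sup>2" if "t \<ge> 0" for t
  proof (cases "t \<le> T")
    case True
    then have "t\<^sup>2 \<le> T\<^sup>2" using that by (intro power_mono)
    then show ?thesis using \<zeta> by (simp add: add_increasing)
  next
    case False
    then have t: "t > 0" using T by simp
    have "1 / \<zeta> = T powr (p - 2)" using p_gt \<zeta> by (simp add: T_def powr_powr)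
    also have "\<dots> \<le> t powr (p - 2)" using False T p_gt by (intro powr_mono2) auto
    finally have "t powr 2 * (1 / \<zeta>) \<le> t powr 2 * t powr (p - 2)" by (intro mult_left_mono) auto
    also have "\<dots> = t powr p" by (simp flip: powr_add)
    finally have "t\<^sup>2 \<le> \<zeta> * t powr p" using t \<zeta> by (simp add: field_simps)
    then show ?thesis by (simp add: add_increasing2)
  qed
  have "\<forall>\<^sub>F n in sequentially. G n < ennreal (e / 2 / T\<^sup>2)" using e T by (intro order_tendstoD(2)[OF G]) auto
  then obtain n0 where n0: "\<And>n. n0 \<le> n \<Longrightarrow> G n < ennreal (e / 2 / T\<^sup>2)" by (auto simp: eventually_sequentially)
  show ?thesis
  proof (intro exI[of _ n0] allI impI)
    fix n and w :: "real^3 \<Rightarrow> complex"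
    assume n: "n0 \<le> n" and wm[measurable]: "w \<in> borel_measurable borel" and supp: "\<forall>x. R \<le> norm x \<longrightarrow> w x = 0" and P: "pmass w \<le> 1"
    have "(\<integral>\<^sup>+z. ennreal (g n z * (cmod (w (fst z)))\<^sup>2 * kern (fst z - snd z)) \<partial>lborel)
      \<le> (\<integral>\<^sup>+z. ennreal (\<zeta> * K0) * (ennreal (cmod (w (fst z)) powr p) * ennreal (H (fst z - snd z)))
          + ennreal (T\<^sup>2) * (I (fst z) * ennreal (g n z * kern (fst z - snd z))) \<partial>lborel)"
    proof (intro nn_integral_mono)
      fix z :: "(real^3) \<times> (real^3)"
      show "ennreal (g n z * (cmod (w (fst z)))\<^sup>2 * kern (fst z - snd z)) \<le> ennreal (\<zeta> * K0) * (ennreal (cmod (w (fst z)) powr p) * ennreal (H (fst z - snd z)))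
          + ennreal (T\<^sup>2) * (I (fst z) * ennreal (g n z * kern (fst z - snd z)))"
      proof (cases "norm (fst z) < R")
        case True
        define q where "q = g n z * kern (fst z - snd z)"
        have q: "q \<ge> 0" "q \<le> K0 * H (fst z - snd z)" using gb[OF True, of n] by (auto simp: q_def g_def)
        have "g n z * (cmod (w (fst z)))\<^sup>2 * kern (fst z - snd z) = (cmod (w (fst z)))\<^sup>2 * q" by (simp add: q_def)
        also have "\<dots> \<le> (\<zeta> * cmod (w (fst z)) powr p + T\<^sup>2) * q" using q by (intro mult_right_mono young) auto
        also have "\<dots> = \<zeta> * cmod (w (fst z)) powr p * q + T\<^sup>2 * q" by (simp add: distrib_right)
        also have "\<dots> \<le> \<zeta> * cmod (w (fst z)) powr p * (K0 * H (fst z - snd z)) + T\<^sup>2 * q"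
          using q \<zeta> by (intro add_right_mono mult_left_mono) auto
        also have "\<dots> = \<zeta> * K0 * (cmod (w (fst z)) powr p * H (fst z - snd z)) + T\<^sup>2 * q" by simp
        finally have "ennreal (g n z * (cmod (w (fst z)))\<^sup>2 * kern (fst z - snd z)) \<le> ennreal (\<zeta> * K0 * (cmod (w (fst z)) powr p * H (fst z - snd z)) + T\<^sup>2 * q)"
          by (rule ennreal_leI)
        also have "\<dots> = ennreal (\<zeta> * K0) * (ennreal (cmod (w (fst z)) powr p) * ennreal (H (fst z - snd z))) + ennreal (T\<^sup>2) * ennreal q"
          using q \<zeta> K0 H0 by (simp add: ennreal_plus ennreal_mult' ennreal_mult)
        finally show ?thesis using True by (simp add: I_def q_def)
      qed (use supp in auto)
    qed
    also have "\<dots> = ennreal (\<zeta> * K0) * (pmass w * truncated_kern 1) + ennreal (T\<^sup>2) * G n"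
      using nn_integral_convolution_fst[of "\<lambda>x. ennreal (cmod (w x) powr p)" "\<lambda>w. ennreal (H w)"]
      unfolding G_def pmass_def truncated_kern_def H_def[symmetric]
      by (subst nn_integral_add, measurable, subst nn_integral_cmult, measurable, subst nn_integral_cmult, auto)
    also have "\<dots> \<le> ennreal (\<zeta> * K0) * (1 * ennreal \<kappa>) + ennreal (T\<^sup>2) * ennreal (e / 2 / T\<^sup>2)"
      using n0[OF n] unfolding \<kappa>(1) by (intro add_mono mult_left_mono mult_right_mono P) auto
    also have "\<dots> = ennreal (\<zeta> * K0 * \<kappa>) + ennreal (e / 2)"
      using \<zeta> K0 \<kappa> e T by (simp flip: ennreal_mult')
    also have "\<dots> \<le> ennreal (e / 2) + ennreal (e / 2)" by (intro add_mono ennreal_leI \<zeta>2) auto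
    also have "\<dots> = ennreal (e / 2 + e / 2)" using e by (intro ennreal_plus[symmetric]) auto
    finally have err: "(\<integral>\<^sup>+z. ennreal (g n z * (cmod (w (fst z)))\<^sup>2 * kern (fst z - snd z)) \<partial>lborel) \<le> ennreal e" by simp
    have "kinetic B w \<le> (\<integral>\<^sup>+z. ennreal (1 + \<epsilon>) * ennreal (edens (A n) w z)
       + ennreal (1 / l) * ennreal (g n z * (cmod (w (fst z)))\<^sup>2 * kern (fst z - snd z)) \<partial>lborel)"
      unfolding kinetic_def
    proof (intro nn_integral_mono)
      fix z :: "(real^3) \<times> (real^3)"
      define D where "D = (phase B (fst z) (snd z)
          - phase (A n) (fst z) (snd z)) * w (fst z)"
      have "mag_diff B w (fst z) (snd z) = mag_diff (A n) w (fst z) (snd z) + D"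
        by (simp add: mag_diff_def D_def algebra_simps)
      then have "(cmod (mag_diff B w (fst z) (snd z)))\<^sup>2 \<le> (cmod (mag_diff (A n) w (fst z) (snd z)))\<^sup>2 / (1 - l) + (cmod D)\<^sup>2 / l"
        using cmod_add_square_le_weighted[OF l(1,2)] by simp
      also have "\<dots> = (1 + \<epsilon>) * (cmod (mag_diff (A n) w (fst z) (snd z)))\<^sup>2 + 1 / l * (g n z * (cmod (w (fst z)))\<^sup>2)"
        unfolding l(3)[symmetric] by (simp add: D_def g_def norm_mult power_mult_distrib)
      finally have "edens B w z
         \<le> ((1 + \<epsilon>) * (cmod (mag_diff (A n) w (fst z) (snd z)))\<^sup>2 + 1 / l * (g n z * (cmod (w (fst z)))\<^sup>2)) * kern (fst z - snd z)"
        by (intro mult_right_mono) auto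
      also have "\<dots> = (1 + \<epsilon>) * (edens (A n) w z)
          + 1 / l * (g n z * (cmod (w (fst z)))\<^sup>2 * kern (fst z - snd z))" by (simp only: distrib_right mult.assoc)
      finally have "ennreal (edens B w z) \<le> ennreal ((1 + \<epsilon>) * (edens (A n) w z)
          + 1 / l * (g n z * (cmod (w (fst z)))\<^sup>2 * kern (fst z - snd z)))" by (rule ennreal_leI)
      also have "\<dots> = ennreal (1 + \<epsilon>) * ennreal (edens (A n) w z)
       + ennreal (1 / l) * ennreal (g n z * (cmod (w (fst z)))\<^sup>2 * kern (fst z - snd z))"
        by (rule ennreal_lincomb) (use \<epsilon> l(1) in \<open>auto simp: g_def\<close>)
      finally show "ennreal (edens B w z) \<le> \<dots>" .
    qed
    also have "\<dots> = ennreal (1 + \<epsilon>) * kinetic (A n) w + ennreal (1 / l) * (\<integral>\<^sup>+z. ennreal (g n z * (cmod (w (fst z)))\<^sup>2 * kern (fst z - snd z)) \<partial>lborel)"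
      unfolding kinetic_def by (subst nn_integral_add, measurable, subst nn_integral_cmult, measurable, subst nn_integral_cmult, auto)
    also have "\<dots> \<le> ennreal (1 + \<epsilon>) * kinetic (A n) w + ennreal (1 / l) * ennreal e"
      by (intro add_left_mono mult_left_mono err) auto
    finally have E: "kinetic B w \<le> ennreal (1 + \<epsilon>) * kinetic (A n) w + ennreal (1 / l) * ennreal e" .
    have "energy B w \<le> ennreal c1 * (ennreal (1 + \<epsilon>) * kinetic (A n) w + ennreal (1 / l) * ennreal e) + ennreal c2 * (ennreal (1 + \<epsilon>) * sqmass w)"
      unfolding energy_def
    proof (intro add_mono mult_left_mono E)
      have "1 * sqmass w \<le> ennreal (1 + \<epsilon>) * sqmass w" using \<epsilon> by (intro mult_right_mono) auto
      then show "sqmass w \<le> ennreal (1 + \<epsilon>) * sqmass w" by simp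
    qed auto
    also have "\<dots> = ennreal (1 + \<epsilon>) * energy (A n) w + ennreal c1 * (ennreal (1 / l) * ennreal e)"
      unfolding energy_def by (simp only: distrib_left mult_ac add_ac)
    also have "ennreal c1 * (ennreal (1 / l) * ennreal e) = ennreal (c1 * (1 / l * e))"
      using c1_pos l by (subst ennreal_mult', simp, subst ennreal_mult', auto)
    finally show "energy B w \<le> ennreal (1 + \<epsilon>) * energy (A n) w + ennreal \<epsilon>" by (simp only: e(2))
  qed
qed

end

section \<open>Averages over dyadic cells\<close>

definition avg :: "(real^3) set \<Rightarrow> (real^3 \<Rightarrow> complex) \<Rightarrow> complex" where
  "avg Q u = (LINT y|lborel. indicator Q y *\<^sub>R u y) /\<^sub>R measure lborel Q"

text \<open>
  Jensen's inequality for the square, through the Cauchy-Schwarz inequality.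
\<close>

lemma avg_dist:
  assumes Q[measurable]: "Q \<in> sets borel" and fin: "emeasure lborel Q < \<infinity>" and pos: "0 < measure lborel Q"
    and [measurable]: "u \<in> borel_measurable borel"
  shows "ennreal ((cmod (b - avg Q u))\<^sup>2)
    \<le> ennreal (1 / measure lborel Q) * (\<integral>\<^sup>+y. indicator Q y * ennreal ((cmod (b - u y))\<^sup>2) \<partial>lborel)"
proof -
  define \<mu> where "\<mu> = measure lborel Q"
  define I where "I = (\<integral>\<^sup>+y. indicator Q y * ennreal ((cmod (b - u y))\<^sup>2) \<partial>lborel)"
  define f where "f y = indicator Q y *\<^sub>R (b - u y)" for y
  have [measurable]: "f \<in> borel_measurable borel" unfolding f_def by measurable
  have \<mu>: "emeasure lborel Q = ennreal \<mu>" "\<mu> > 0" using fin pos by (auto simp: \<mu>_def emeasure_eq_ennreal_measure)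
  show ?thesis
  proof (cases "I = \<infinity>")
    case True
    then show ?thesis using \<mu> by (simp add: I_def[symmetric] \<mu>_def[symmetric] ennreal_mult_top)
  next
    case False
    have "(\<integral>\<^sup>+y. ennreal (cmod (f y)) * indicator Q y \<partial>lborel)\<^sup>2 \<le> (\<integral>\<^sup>+y. (ennreal (cmod (f y)))\<^sup>2 \<partial>lborel) * (\<integral>\<^sup>+y. (indicator Q y)\<^sup>2 \<partial>lborel)"
      by (rule Cauchy_Schwarz_nn_integral) auto
    also have "(\<lambda>y. ennreal (cmod (f y)) * indicator Q y) = (\<lambda>y. ennreal (cmod (f y)))"
      by (auto simp: f_def indicator_def fun_eq_iff)
    also have "(\<integral>\<^sup>+y. (ennreal (cmod (f y)))\<^sup>2 \<partial>lborel) = I"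
      unfolding I_def by (intro nn_integral_cong) (auto simp: f_def indicator_def ennreal_power)
    also have "(\<integral>\<^sup>+y. (indicator Q y)\<^sup>2 \<partial>lborel) = ennreal \<mu>"
    proof -
      have "(\<integral>\<^sup>+y. (indicator Q y)\<^sup>2 \<partial>lborel) = (\<integral>\<^sup>+y. indicator Q y \<partial>lborel)"
        by (intro nn_integral_cong) (auto simp: indicator_def)
      then show ?thesis using \<mu> by simp
    qed
    finally have CS: "(\<integral>\<^sup>+y. ennreal (cmod (f y)) \<partial>lborel)\<^sup>2 \<le> I * ennreal \<mu>" .
    also have "\<dots> < \<infinity>" using False by (simp add: ennreal_mult_less_top less_top)
    finally have "(\<integral>\<^sup>+y. ennreal (cmod (f y)) \<partial>lborel) < \<infinity>" by (simp add: power_less_top_ennreal)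
    then have intf: "integrable lborel f" by (intro integrableI_bounded) auto
    have ib: "integrable lborel (\<lambda>y. indicator Q y *\<^sub>R b)" using fin by (intro integrable_scaleR_left) auto
    have "integrable lborel (\<lambda>y. indicator Q y *\<^sub>R b - f y)" by (intro Bochner_Integration.integrable_diff ib intf)
    then have iu: "integrable lborel (\<lambda>y. indicator Q y *\<^sub>R u y)" by (simp add: f_def algebra_simps)
    have "(LINT y|lborel. f y) = (LINT y|lborel. indicator Q y *\<^sub>R b) - (LINT y|lborel. indicator Q y *\<^sub>R u y)"
      unfolding f_def scaleR_diff_right by (rule Bochner_Integration.integral_diff[OF ib iu])
    also have "(LINT y|lborel. indicator Q y *\<^sub>R b) = \<mu> *\<^sub>R b" using fin by (simp add: \<mu>_def)
    finally have "b - avg Q u = (LINT y|lborel. f y) /\<^sub>R \<mu>"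
      using \<mu> by (simp add: avg_def \<mu>_def[symmetric] scaleR_diff_right)
    then have "cmod (b - avg Q u) = cmod (LINT y|lborel. f y) / \<mu>" using \<mu> by (simp add: divide_inverse mult.commute)
    then have "ennreal ((cmod (b - avg Q u))\<^sup>2) = ennreal (1 / \<mu>\<^sup>2) * (ennreal (cmod (LINT y|lborel. f y)))\<^sup>2"
      by (simp add: power_divide ennreal_power flip: ennreal_mult')
    also have "\<dots> \<le> ennreal (1 / \<mu>\<^sup>2) * (\<integral>\<^sup>+y. ennreal (cmod (f y)) \<partial>lborel)\<^sup>2"
      by (intro mult_left_mono power_mono integral_norm_bound_ennreal intf) auto
    also have "\<dots> \<le> ennreal (1 / \<mu>\<^sup>2) * (I * ennreal \<mu>)" by (intro mult_left_mono CS) auto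
    also have "\<dots> = (ennreal (1 / \<mu>\<^sup>2) * ennreal \<mu>) * I" by (simp only: mult_ac)
    also have "ennreal (1 / \<mu>\<^sup>2) * ennreal \<mu> = ennreal (1 / \<mu>\<^sup>2 * \<mu>)" by (rule ennreal_mult'[symmetric]) simp
    also have "1 / \<mu>\<^sup>2 * \<mu> = 1 / \<mu>" using \<mu> by (simp add: power2_eq_square)
    finally show ?thesis by (simp add: \<mu>_def I_def)
  qed
qed

text \<open>
  Half-open cubes of side length \<open>2\<^bsup>-j\<^esup>\<close>, indexed by integers, so that each family of averages
  is countable.
\<close>

definition cell :: "nat \<Rightarrow> int \<Rightarrow> int \<Rightarrow> int \<Rightarrow> (real^3) set" where
  "cell j a b c = {y. \<lfloor>2 ^ j * y $ 1\<rfloor> = a \<and> \<lfloor>2 ^ j * y $ 2\<rfloor> = b \<and> \<lfloor>2 ^ j * y $ 3\<rfloor> = c}"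

abbreviation cell_of :: "nat \<Rightarrow> real^3 \<Rightarrow> (real^3) set" where
  "cell_of j x \<equiv> cell j \<lfloor>2 ^ j * x $ 1\<rfloor> \<lfloor>2 ^ j * x $ 2\<rfloor> \<lfloor>2 ^ j * x $ 3\<rfloor>"

lemma cell_borel [measurable]: "cell j a b c \<in> sets borel"
proof -
  have "Measurable.pred borel (\<lambda>y::real^3. \<lfloor>2 ^ j * y $ 1\<rfloor> = a \<and> \<lfloor>2 ^ j * y $ 2\<rfloor> = b \<and> \<lfloor>2 ^ j * y $ 3\<rfloor> = c)"
    by measurable
  then show ?thesis unfolding cell_def pred_def by simp
qed

lemma cell_of_dist: "y \<in> cell_of j x \<Longrightarrow> norm (x - y) \<le> 3 / 2 ^ j"
proof -
  assume y: "y \<in> cell_of j x"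
  have c: "\<bar>(x - y) $ i\<bar> \<le> 1 / 2 ^ j" if "\<lfloor>2 ^ j * y $ i\<rfloor> = \<lfloor>2 ^ j * x $ i\<rfloor>" for i
  proof -
    have "\<bar>2 ^ j * x $ i - 2 ^ j * y $ i\<bar> \<le> 1" using that by linarith
    then have "2 ^ j * \<bar>(x - y) $ i\<bar> \<le> 1" by (simp add: abs_mult flip: right_diff_distrib)
    then show ?thesis by (simp add: field_simps)
  qed
  have "norm (x - y) \<le> (\<Sum>i\<in>UNIV. \<bar>(x - y) $ i\<bar>)" by (rule norm_le_l1_cart)
  also have "\<dots> = \<bar>(x - y) $ 1\<bar> + \<bar>(x - y) $ 2\<bar> + \<bar>(x - y) $ 3\<bar>" by (simp add: sum_3)
  also have "\<dots> \<le> 3 / 2 ^ j" using c[of 1] c[of 2] c[of 3] y by (simp add: cell_def)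
  finally show ?thesis .
qed

lemma cell_measure:
  shows "emeasure lborel (cell j a b c) < \<infinity>" "1 / 8 ^ j \<le> measure lborel (cell j a b c)"
proof -
  define l :: "real^3" where "l = vector [of_int a / 2 ^ j, of_int b / 2 ^ j, of_int c / 2 ^ j]"
  define r :: "real^3" where "r = vector [(of_int a + 1) / 2 ^ j, (of_int b + 1) / 2 ^ j, (of_int c + 1) / 2 ^ j]"
  have inbox: "2 ^ j * t \<in> {of_int q..of_int q + 1} \<longleftrightarrow> of_int q / 2 ^ j \<le> t \<and> t \<le> (of_int q + 1) / 2 ^ j" for t :: real and q :: int
    by (auto simp: field_simps)
  have "cell j a b c \<subseteq> cbox l r"
  proof
    fix y assume y: "y \<in> cell j a b c"
    then have "2 ^ j * y $ 1 \<in> {of_int a..of_int a + 1}" "2 ^ j * y $ 2 \<in> {of_int b..of_int b + 1}" "2 ^ j * y $ 3 \<in> {of_int c..of_int c + 1}"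
      unfolding cell_def by (auto simp: floor_eq_iff)
    then show "y \<in> cbox l r" unfolding inbox by (simp add: mem_box_cart forall_3 l_def r_def)
  qed
  then have "emeasure lborel (cell j a b c) \<le> emeasure lborel (cbox l r)" by (intro emeasure_mono) auto
  also have "\<dots> < \<infinity>" by (rule emeasure_lborel_cbox_finite)
  finally show fin: "emeasure lborel (cell j a b c) < \<infinity>" .
  have sub: "box l r \<subseteq> cell j a b c"
  proof
    fix y assume "y \<in> box l r"
    then show "y \<in> cell j a b c" by (simp add: mem_box_cart forall_3 l_def r_def cell_def floor_eq_iff field_simps)
  qed
  have le: "l $ i \<le> r $ i" for i using exhaust_3[of i] by (auto simp: l_def r_def divide_right_mono)
  have "measure lborel (box l r) = measure lborel (cbox l r)" by (simp add: measure_lborel_box_eq measure_lborel_cbox_eq)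
  also have "\<dots> = (\<Prod>i\<in>UNIV. r $ i - l $ i)" using le by (intro content_cbox_cart) (auto simp: interval_ne_empty_cart)
  also have "\<dots> = 1 / 8 ^ j"
  proof -
    have "r $ i - l $ i = 1 / 2 ^ j" for i
      using exhaust_3[of i] by (auto simp: l_def r_def add_divide_distrib)
    then have "(\<Prod>i\<in>UNIV. r $ i - l $ i) = (1 / 2 ^ j) ^ 3" by simp
    also have "\<dots> = 1 / (2 ^ 3) ^ j" by (simp only: power_one_over power_mult[symmetric] mult.commute)
    finally show ?thesis by simp
  qed
  finally have "1 / 8 ^ j = measure lborel (box l r)" by simp
  also have "\<dots> \<le> measure lborel (cell j a b c)"
    using sub fin by (intro measure_mono_fmeasurable) (auto simp: fmeasurable_def)
  finally show "1 / 8 ^ j \<le> measure lborel (cell j a b c)" .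
qed

section \<open>Local compactness\<close>

lemma countable_family_convergent_subsequence:
  fixes f :: "nat \<Rightarrow> 'i::countable \<Rightarrow> complex"
  assumes bd: "\<And>i. bounded (range (\<lambda>n. f n i))"
  obtains r where "strict_mono (r :: nat \<Rightarrow> nat)" "\<And>i. convergent (\<lambda>n. f (r n) i)"
proof -
  interpret subseqs "\<lambda>k r. convergent (\<lambda>n. f (r n) (from_nat k))"
  proof
    fix k and t :: "nat \<Rightarrow> nat" assume "strict_mono t"
    have "bounded (range (\<lambda>n. f (t n) (from_nat k)))" by (rule bounded_subset[OF bd[of "from_nat k"]]) auto
    then obtain l r where "strict_mono r" "((\<lambda>n. f (t n) (from_nat k)) \<circ> r) \<longlonglongrightarrow> l"
      using bounded_imp_convergent_subsequence by blast
    then show "\<exists>r'. strict_mono r' \<and> convergent (\<lambda>n. f ((t \<circ> r') n) (from_nat k))"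
      by (auto simp: convergent_def o_def)
  qed
  have "convergent (\<lambda>n. f (diagseq n) i)" for i
  proof -
    have "convergent (\<lambda>n. f ((diagseq \<circ> ((+) (Suc (to_nat i)))) n) (from_nat (to_nat i)))"
    proof (rule diagseq_holds)
      fix r t :: "nat \<Rightarrow> nat" and k assume "strict_mono r" "convergent (\<lambda>n. f (t n) (from_nat k))"
      then show "convergent (\<lambda>n. f ((t \<circ> r) n) (from_nat k))"
        using convergent_subseq_convergent[of "\<lambda>n. f (t n) (from_nat k)" r] by (simp add: o_def)
    qed
    then have "convergent (\<lambda>n. f (diagseq (n + Suc (to_nat i))) i)" by (simp add: o_def add.commute)
    then show ?thesis using convergent_ignore_initial_segment[of "\<lambda>n. f (diagseq n) i" "Suc (to_nat i)"] by simp
  qed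
  then show ?thesis using subseq_diagseq that by blast
qed

context mag_setting begin

lemma cell_average_measurable [measurable]: "(\<lambda>x. avg (cell_of j x) u) \<in> borel_measurable borel"
proof -
  have "(\<lambda>x::real^3. avg (cell j a b \<lfloor>2 ^ j * x $ 3\<rfloor>) u) \<in> borel_measurable borel" for a b
    by (rule measurable_compose_countable[of "\<lambda>c x. avg (cell j a b c) u"]) measurable
  then have "(\<lambda>x::real^3. avg (cell j a \<lfloor>2 ^ j * x $ 2\<rfloor> \<lfloor>2 ^ j * x $ 3\<rfloor>) u) \<in> borel_measurable borel" for a
    by (rule measurable_compose_countable[of "\<lambda>b x. avg (cell j a b \<lfloor>2 ^ j * x $ 3\<rfloor>) u"]) measurable
  then show ?thesis
    by (rule measurable_compose_countable[of "\<lambda>a x. avg (cell j a \<lfloor>2 ^ j * x $ 2\<rfloor> \<lfloor>2 ^ j * x $ 3\<rfloor>) u"]) measurable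
qed

text \<open>
  Points of one cell have distance at most \<open>3 * h\<close> for \<open>h = 2\<^bsup>-j\<^esup>\<close>, where the kernel is at
  least a multiple of \<open>h\<^bsup>-3-2s\<^esup>\<close>. The mean of \<open>|u x - u y|\<^sup>2\<close> over a cell of volume \<open>h\<^sup>3\<close> is
  therefore at most \<open>h\<^bsup>2s\<^esup>\<close> times the Gagliardo density. On a bounded set, replacing the plain
  difference by the magnetic one costs a term bounded by the \<open>L\<^sup>2\<close> mass.
\<close>

lemma cell_average_close:
  assumes [measurable]: "A \<in> borel_measurable borel" and lb: "locally_bounded A"
  obtains K where "K > 0" "\<And>u B j. u \<in> borel_measurable borel \<Longrightarrow> 0 \<le> B \<Longrightarrow> energy A u \<le> ennreal B \<Longrightarrow> 2 \<le> j \<Longrightarrow>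
    mass2 (ball 0 \<rho>) (\<lambda>x. u x - avg (cell_of j x) u) \<le> ennreal (K * B * (1 / 2 ^ j) powr (2 * s))"
proof -
  obtain c where c: "c > 0" "\<And>z. z \<noteq> 0 \<Longrightarrow> norm z \<le> 1 \<Longrightarrow> c * norm z powr (- (3 + 2 * s)) \<le> kern z"
    using kern_lower by auto
  obtain C where C: "C > 0" "\<And>x. norm x \<le> \<rho> + 1 \<Longrightarrow> norm (A x) \<le> C" by (rule locally_bounded_pos[OF lb, of "\<rho>+1"]) blast
  define \<kappa> where "\<kappa> = enn2real (truncated_kern 1)"
  have \<kappa>: "truncated_kern 1 = ennreal \<kappa>" "\<kappa> \<ge> 0" using truncated_kern_finite by (auto simp: \<kappa>_def)
  define K1 where "K1 = 3 powr (3 + 2 * s) / c"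
  have K1: "K1 > 0" using c by (simp add: K1_def)
  define K2 where "K2 = 2 / c1 + 2 * C\<^sup>2 * \<kappa> / c2"
  have K2: "K2 > 0" using c1_pos c2_pos \<kappa> by (simp add: K2_def add_pos_nonneg)
  have "mass2 (ball 0 \<rho>) (\<lambda>x. u x - avg (cell_of j x) u) \<le> ennreal (K1 * K2 * B * (1 / 2 ^ j) powr (2 * s))"
    if um[measurable]: "u \<in> borel_measurable borel" and B: "0 \<le> B" and N: "energy A u \<le> ennreal B" and j: "2 \<le> j" for u B j
  proof -
    define h :: real where "h = 1 / 2 ^ j"
    have h: "0 < h" "3 * h \<le> 1"
    proof -
      have "(2::real) ^ 2 \<le> 2 ^ j" using j by (intro power_increasing) auto
      then show "3 * h \<le> 1" by (simp add: h_def field_simps)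
    qed (simp add: h_def)
    \<comment> \<open>Pairs for which the midpoint stays in a ball where the field is bounded.\<close>
    define near :: "(real^3) \<times> (real^3) \<Rightarrow> ennreal" where "near = indicator {z. norm (fst z) < \<rho> \<and> norm (fst z - snd z) \<le> 1}"
    have [measurable]: "near \<in> borel_measurable borel"
      unfolding near_def by (intro borel_measurable_indicator) (measurable, auto simp flip: borel_prod)
    define W where "W z = near z * ennreal ((cmod (u (fst z) - u (snd z)))\<^sup>2 * kern (fst z - snd z))" for z
    have [measurable]: "W \<in> borel_measurable borel" unfolding W_def by measurable
    have pt: "ennreal ((cmod (u x - avg (cell_of j x) u))\<^sup>2) * indicator (ball 0 \<rho>) x
       \<le> ennreal (K1 * h powr (2 * s)) * (\<integral>\<^sup>+y. W (x, y) \<partial>lborel)" for x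
    proof (cases "x \<in> ball 0 \<rho>")
      case True
      let ?Q = "cell_of j x"
      have Q: "emeasure lborel ?Q < \<infinity>" "h ^ 3 \<le> measure lborel ?Q"
      proof -
        have "h ^ 3 = 1 / (2 ^ 3) ^ j" unfolding h_def by (simp only: power_one_over power_mult[symmetric] mult.commute)
        then show "h ^ 3 \<le> measure lborel ?Q" using cell_measure(2)[of j] by simp
      qed (rule cell_measure)
      have Qp: "0 < measure lborel ?Q" using Q(2) h zero_less_power[of h 3] by linarith
      have "ennreal ((cmod (u x - avg ?Q u))\<^sup>2) \<le> ennreal (1 / measure lborel ?Q) * (\<integral>\<^sup>+y. indicator ?Q y * ennreal ((cmod (u x - u y))\<^sup>2) \<partial>lborel)"
        by (rule avg_dist[OF cell_borel Q(1) Qp um])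
      also have "\<dots> \<le> ennreal (1 / h ^ 3) * (\<integral>\<^sup>+y. ennreal ((3 * h) powr (3 + 2 * s) / c) * W (x, y) \<partial>lborel)"
      proof (rule mult_mono[OF _ nn_integral_mono])
        show "ennreal (1 / measure lborel ?Q) \<le> ennreal (1 / h ^ 3)"
          using Q(2) h Qp by (intro ennreal_leI divide_left_mono) auto
      next
        fix y
        show "indicator ?Q y * ennreal ((cmod (u x - u y))\<^sup>2) \<le> ennreal ((3 * h) powr (3 + 2 * s) / c) * W (x, y)"
        proof (cases "y \<in> ?Q \<and> x \<noteq> y")
          case T: True
          have d: "norm (x - y) \<le> 3 * h" using cell_of_dist[of y j x] T by (simp add: h_def)
          then have d1: "norm (x - y) \<le> 1" using h by simp
          have "(3 * h) powr (- (3 + 2 * s)) \<le> norm (x - y) powr (- (3 + 2 * s))"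
            using T d s_pos by (intro powr_mono2') auto
          then have "c * (3 * h) powr (- (3 + 2 * s)) \<le> c * norm (x - y) powr (- (3 + 2 * s))" using c by simp
          also have "\<dots> \<le> kern (x - y)" using T d1 by (intro c) auto
          finally have "c / (3 * h) powr (3 + 2 * s) \<le> kern (x - y)" by (simp only: powr_minus_divide) simp
          then have "1 \<le> (3 * h) powr (3 + 2 * s) / c * kern (x - y)" using c(1) h by (simp add: field_simps)
          then have "(cmod (u x - u y))\<^sup>2 * 1 \<le> (cmod (u x - u y))\<^sup>2 * ((3 * h) powr (3 + 2 * s) / c * kern (x - y))"
            by (intro mult_left_mono) auto
          then have "(cmod (u x - u y))\<^sup>2 \<le> (3 * h) powr (3 + 2 * s) / c * ((cmod (u x - u y))\<^sup>2 * kern (x - y))"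
            by (simp add: mult_ac)
          then have "ennreal ((cmod (u x - u y))\<^sup>2) \<le> ennreal ((3 * h) powr (3 + 2 * s) / c * ((cmod (u x - u y))\<^sup>2 * kern (x - y)))"
            by (rule ennreal_leI)
          also have "\<dots> = ennreal ((3 * h) powr (3 + 2 * s) / c) * ennreal ((cmod (u x - u y))\<^sup>2 * kern (x - y))"
            using c(1) by (intro ennreal_mult') simp
          finally show ?thesis using T d1 True by (simp add: W_def near_def)
        qed (auto simp: indicator_def)
      qed auto
      also have "\<dots> = ennreal (1 / h ^ 3) * (ennreal ((3 * h) powr (3 + 2 * s) / c) * (\<integral>\<^sup>+y. W (x, y) \<partial>lborel))"
        by (subst nn_integral_cmult) auto
      also have "\<dots> = ennreal (1 / h ^ 3 * ((3 * h) powr (3 + 2 * s) / c)) * (\<integral>\<^sup>+y. W (x, y) \<partial>lborel)"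
        using h by (subst ennreal_mult') (auto simp: mult.assoc)
      also have "1 / h ^ 3 * ((3 * h) powr (3 + 2 * s) / c) = K1 * h powr (2 * s)"
      proof -
        have "(3 * h) powr (3 + 2 * s) = 3 powr (3 + 2 * s) * (h powr 3 * h powr (2 * s))"
          by (simp only: powr_mult powr_add mult_ac)
        also have "h powr 3 = h ^ 3" using h by simp
        finally show ?thesis using h by (simp add: K1_def)
      qed
      finally show ?thesis using True by simp
    qed simp
    have "mass2 (ball 0 \<rho>) (\<lambda>x. u x - avg (cell_of j x) u)
       \<le> (\<integral>\<^sup>+x. ennreal (K1 * h powr (2 * s)) * (\<integral>\<^sup>+y. W (x, y) \<partial>lborel) \<partial>lborel)" by (intro nn_integral_mono pt)
    also have "\<dots> = ennreal (K1 * h powr (2 * s)) * (\<integral>\<^sup>+z. W z \<partial>lborel)"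
      by (subst nn_integral_cmult) (auto simp: nn_integral_pair_lborel)
    also have "(\<integral>\<^sup>+z. W z \<partial>lborel) \<le> ennreal (K2 * B)"
    proof -
      have "(\<integral>\<^sup>+z. W z \<partial>lborel) \<le> (\<integral>\<^sup>+z. 2 * ennreal (edens A u z)
           + ennreal (2 * C\<^sup>2) * (ennreal ((cmod (u (fst z)))\<^sup>2) * ennreal (min 1 ((1 * norm (fst z - snd z))\<^sup>2) * kern (fst z - snd z))) \<partial>lborel)"
      proof (intro nn_integral_mono)
        fix z :: "(real^3) \<times> (real^3)"
        define x y where "x = fst z" and "y = snd z"
        show "W z \<le> 2 * ennreal (edens A u z)
           + ennreal (2 * C\<^sup>2) * (ennreal ((cmod (u (fst z)))\<^sup>2) * ennreal (min 1 ((1 * norm (fst z - snd z))\<^sup>2) * kern (fst z - snd z)))"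
        proof (cases "norm x < \<rho> \<and> norm (x - y) \<le> 1")
          case True
          define t where "t = (x - y) \<bullet> A ((x + y) /\<^sub>R 2)"
          have "norm ((x + y) /\<^sub>R 2) \<le> \<rho> + 1" using midpoint_norm_le[of x y] True by linarith
          then have "\<bar>t\<bar> \<le> norm (x - y) * C"
            unfolding t_def by (intro order_trans[OF Cauchy_Schwarz_ineq2] mult_left_mono C) auto
          moreover have "cmod (exp (- (\<i> * of_real t)) - 1) \<le> \<bar>t\<bar>" using phase_diff_le[of t 0] by simp
          ultimately have "cmod (1 - exp (- (\<i> * of_real t))) \<le> norm (x - y) * C" by (metis norm_minus_commute order_trans)
          then have "(cmod (1 - exp (- (\<i> * of_real t))))\<^sup>2 \<le> (norm (x - y) * C)\<^sup>2" by (intro power_mono) auto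
          then have e: "(cmod ((1 - exp (- (\<i> * of_real t))) * u x))\<^sup>2 \<le> (norm (x - y) * C)\<^sup>2 * (cmod (u x))\<^sup>2"
            unfolding norm_mult power_mult_distrib by (intro mult_right_mono) auto
          have m1: "min 1 ((norm (x - y))\<^sup>2) = (norm (x - y))\<^sup>2" using power_le_one[of "norm (x - y)" 2] True by simp
          have "u x - u y = mag_diff A u x y + (1 - exp (- (\<i> * of_real t))) * u x"
            by (simp add: mag_diff_def t_def algebra_simps)
          then have "(cmod (u x - u y))\<^sup>2 \<le> (cmod (mag_diff A u x y))\<^sup>2 / (1 - 1/2) + (cmod ((1 - exp (- (\<i> * of_real t))) * u x))\<^sup>2 / (1/2)"
            using cmod_add_square_le_weighted[of "1/2" "mag_diff A u x y" "(1 - exp (- (\<i> * of_real t))) * u x"] by simp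
          also have "\<dots> \<le> 2 * (cmod (mag_diff A u x y))\<^sup>2 + 2 * C\<^sup>2 * ((cmod (u x))\<^sup>2 * min 1 ((norm (x - y))\<^sup>2))"
            using e unfolding m1 by (simp add: power_mult_distrib mult_ac)
          finally have "(cmod (u x - u y))\<^sup>2 * kern (x - y) \<le> (2 * (cmod (mag_diff A u x y))\<^sup>2 + 2 * C\<^sup>2 * ((cmod (u x))\<^sup>2 * min 1 ((norm (x - y))\<^sup>2))) * kern (x - y)"
            by (intro mult_right_mono) auto
          also have "\<dots> = 2 * ((cmod (mag_diff A u x y))\<^sup>2 * kern (x - y)) + 2 * C\<^sup>2 * ((cmod (u x))\<^sup>2 * (min 1 ((1 * norm (x - y))\<^sup>2) * kern (x - y)))"
            by (simp add: algebra_simps)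
          finally have "ennreal ((cmod (u x - u y))\<^sup>2 * kern (x - y)) \<le> \<dots>" by (rule ennreal_leI)
          also have "\<dots> = ennreal 2 * ennreal ((cmod (mag_diff A u x y))\<^sup>2 * kern (x - y)) + ennreal (2 * C\<^sup>2) * ennreal ((cmod (u x))\<^sup>2 * (min 1 ((1 * norm (x - y))\<^sup>2) * kern (x - y)))"
            by (rule ennreal_lincomb) auto
          finally show ?thesis using True by (simp add: W_def near_def x_def y_def ennreal_mult)
        qed (simp add: W_def near_def x_def y_def)
      qed
      also have "\<dots> = ennreal 2 * kinetic A u + ennreal (2 * C\<^sup>2) * (sqmass u * truncated_kern 1)"
        using nn_integral_convolution_fst[of "\<lambda>x. ennreal ((cmod (u x))\<^sup>2)" "\<lambda>w. ennreal (min 1 ((1 * norm w)\<^sup>2) * kern w)"]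
        unfolding kinetic_def sqmass_def truncated_kern_def by (subst nn_integral_add, measurable, subst nn_integral_cmult, measurable, subst nn_integral_cmult, auto)
      also have "\<dots> \<le> ennreal 2 * ennreal (B / c1) + ennreal (2 * C\<^sup>2) * (ennreal (B / c2) * ennreal \<kappa>)"
        unfolding \<kappa>(1) using energy_parts_le[OF N B] by (intro add_mono mult_left_mono mult_right_mono) auto
      also have "\<dots> = ennreal 2 * ennreal (B / c1) + ennreal (2 * C\<^sup>2) * ennreal (B / c2 * \<kappa>)"
        using B c2_pos by (subst ennreal_mult') auto
      also have "\<dots> = ennreal (2 * (B / c1) + 2 * C\<^sup>2 * (B / c2 * \<kappa>))"
        using B c1_pos c2_pos \<kappa> by (intro ennreal_lincomb[symmetric]) auto
      also have "2 * (B / c1) + 2 * C\<^sup>2 * (B / c2 * \<kappa>) = K2 * B" by (simp add: K2_def algebra_simps)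
      finally show ?thesis .
    qed
    then have "ennreal (K1 * h powr (2 * s)) * (\<integral>\<^sup>+z. W z \<partial>lborel) \<le> ennreal (K1 * h powr (2 * s)) * ennreal (K2 * B)"
      by (intro mult_left_mono) auto
    also have "\<dots> = ennreal (K1 * h powr (2 * s) * (K2 * B))" using K1 by (intro ennreal_mult'[symmetric]) auto
    also have "K1 * h powr (2 * s) * (K2 * B) = K1 * K2 * B * (1 / 2 ^ j) powr (2 * s)" by (simp add: h_def)
    finally show ?thesis .
  qed
  then show ?thesis using K1 K2 by (intro that[of "K1 * K2"]) auto
qed

lemma square_sum_le: "(cmod (a + b))\<^sup>2 \<le> 2 * (cmod a)\<^sup>2 + 2 * (cmod b)\<^sup>2"
  using cmod_add_square_le_weighted[of "1/2" a b] by simp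

lemma local_L2_triangle:
  assumes [measurable]: "f \<in> borel_measurable borel" "g \<in> borel_measurable borel" "h \<in> borel_measurable borel" "S \<in> sets borel"
  shows "mass2 S (\<lambda>x. f x - h x)
    \<le> 2 * mass2 S (\<lambda>x. f x - g x) + 2 * mass2 S (\<lambda>x. g x - h x)"
proof -
  have "mass2 S (\<lambda>x. f x - h x)
    \<le> (\<integral>\<^sup>+x. 2 * (ennreal ((cmod (f x - g x))\<^sup>2) * indicator S x) + 2 * (ennreal ((cmod (g x - h x))\<^sup>2) * indicator S x) \<partial>lborel)"
  proof (intro nn_integral_mono)
    fix x
    have "(cmod (f x - h x))\<^sup>2 \<le> 2 * (cmod (f x - g x))\<^sup>2 + 2 * (cmod (g x - h x))\<^sup>2"
      using square_sum_le[of "f x - g x" "g x - h x"] by simp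
    then have "ennreal ((cmod (f x - h x))\<^sup>2) \<le> ennreal (2 * (cmod (f x - g x))\<^sup>2 + 2 * (cmod (g x - h x))\<^sup>2)" by (rule ennreal_leI)
    also have "\<dots> = ennreal 2 * ennreal ((cmod (f x - g x))\<^sup>2) + ennreal 2 * ennreal ((cmod (g x - h x))\<^sup>2)"
      by (rule ennreal_lincomb) auto
    finally show "ennreal ((cmod (f x - h x))\<^sup>2) * indicator S x
        \<le> 2 * (ennreal ((cmod (f x - g x))\<^sup>2) * indicator S x) + 2 * (ennreal ((cmod (g x - h x))\<^sup>2) * indicator S x)"
      by (auto simp: indicator_def)
  qed
  also have "\<dots> = 2 * mass2 S (\<lambda>x. f x - g x) + 2 * mass2 S (\<lambda>x. g x - h x)"
    by (subst nn_integral_add) (auto simp: nn_integral_cmult)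
  finally show ?thesis .
qed

text \<open>
  A Rellich theorem without Fourier analysis. By \<open>cell_average_close\<close> the functions are
  uniformly close to their averages over small cells; the averages over each cell are bounded,
  and a diagonal subsequence makes all of them converge.
\<close>

lemma local_compactness:
  assumes [measurable]: "A \<in> borel_measurable borel" and lb: "locally_bounded A"
    and um[measurable]: "\<And>n. u n \<in> borel_measurable borel" and N: "\<And>n. energy A (u n) \<le> ennreal B" and B: "0 \<le> B"
  obtains r where "strict_mono (r :: nat \<Rightarrow> nat)"
    "\<And>\<rho> \<epsilon>. 0 < \<epsilon> \<Longrightarrow> \<exists>n0. \<forall>n\<ge>n0. \<forall>k\<ge>n0. mass2 (ball 0 \<rho>) (\<lambda>x. u (r n) x - u (r k) x) \<le> ennreal \<epsilon>"
proof -
  define a where "a n q = avg (cell (fst q) (fst (snd q)) (fst (snd (snd q))) (snd (snd (snd q)))) (u n)" for n and q :: "nat \<times> int \<times> int \<times> int"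
  have abd: "(cmod (avg (cell j b c d) (u n)))\<^sup>2 \<le> 8 ^ j * (B / c2)" for n j b c d
  proof -
    let ?Q = "cell j b c d"
    have Qp: "0 < measure lborel ?Q" using cell_measure(2)[of j b c d] by (smt (verit) divide_pos_pos zero_less_power)
    have "ennreal ((cmod (0 - avg ?Q (u n)))\<^sup>2) \<le> ennreal (1 / measure lborel ?Q) * (\<integral>\<^sup>+y. indicator ?Q y * ennreal ((cmod (0 - u n y))\<^sup>2) \<partial>lborel)"
      by (rule avg_dist[OF cell_borel cell_measure(1) Qp um])
    also have "\<dots> \<le> ennreal (8 ^ j) * sqmass (u n)" unfolding sqmass_def
    proof (intro mult_mono nn_integral_mono)
      show "ennreal (1 / measure lborel ?Q) \<le> ennreal (8 ^ j)"
        using cell_measure(2)[of j b c d] Qp by (intro ennreal_leI) (simp add: field_simps)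
    qed (auto simp: indicator_def)
    also have "\<dots> \<le> ennreal (8 ^ j) * ennreal (B / c2)" by (intro mult_left_mono energy_parts_le[OF N B]) auto
    also have "\<dots> = ennreal (8 ^ j * (B / c2))" by (rule ennreal_mult'[symmetric]) simp
    finally show ?thesis using B c2_pos by (subst (asm) ennreal_le_iff) auto
  qed
  have "bounded (range (\<lambda>n. a n q))" for q
  proof -
    have "cmod (a n q) \<le> sqrt (8 ^ fst q * (B / c2))" for n
      using abd[of "fst q" _ _ _ n] by (intro real_le_rsqrt) (simp add: a_def)
    then show ?thesis by (auto simp: bounded_iff)
  qed
  then obtain r where r: "strict_mono r" "\<And>q. convergent (\<lambda>n. a (r n) q)"
    using countable_family_convergent_subsequence[of a] by blast
  define v where "v j x = lim (\<lambda>n. avg (cell_of j x) (u (r n)))" for j x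
  have vlim: "(\<lambda>n. avg (cell_of j x) (u (r n))) \<longlonglongrightarrow> v j x" for j x
    using r(2)[of "(j, \<lfloor>2 ^ j * x $ 1\<rfloor>, \<lfloor>2 ^ j * x $ 2\<rfloor>, \<lfloor>2 ^ j * x $ 3\<rfloor>)"]
    by (simp add: v_def a_def convergent_LIMSEQ_iff)
  have vm[measurable]: "v j \<in> borel_measurable borel" for j
    by (rule borel_measurable_LIMSEQ_metric[OF _ vlim]) measurable
  show ?thesis
  proof (rule that[OF r(1)])
    fix \<rho> \<epsilon> :: real assume \<epsilon>: "0 < \<epsilon>"
    obtain K where K: "K > 0" "\<And>u B j. u \<in> borel_measurable borel \<Longrightarrow> 0 \<le> B \<Longrightarrow> energy A u \<le> ennreal B \<Longrightarrow> 2 \<le> j \<Longrightarrow>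
      mass2 (ball 0 \<rho>) (\<lambda>x. u x - avg (cell_of j x) u) \<le> ennreal (K * B * (1 / 2 ^ j) powr (2 * s))"
      by (rule cell_average_close[OF assms(1) lb, of \<rho>]) blast
    have "(\<lambda>j. K * B * ((1 / 2) ^ j) powr (2 * s)) \<longlonglongrightarrow> K * B * 0"
      using s_pos by (intro tendsto_mult tendsto_const tendsto_zero_powrI[where b = "2 * s"] LIMSEQ_realpow_zero) auto
    then have "\<forall>\<^sub>F j in sequentially. K * B * ((1 / 2) ^ j) powr (2 * s) < \<epsilon> / 16" using \<epsilon> by (intro order_tendstoD(2)) auto
    then have "\<forall>\<^sub>F j in sequentially. K * B * ((1 / 2) ^ j) powr (2 * s) < \<epsilon> / 16 \<and> 2 \<le> j"
      by (intro eventually_conj eventually_ge_at_top)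
    then obtain j where j: "K * B * (1 / 2 ^ j) powr (2 * s) < \<epsilon> / 16" "2 \<le> j"
      by (auto simp: eventually_sequentially power_one_over)
    let ?S = "ball (0::real^3) \<rho>"
    have [measurable]: "?S \<in> sets borel" by simp
    have "(\<lambda>n. \<integral>\<^sup>+x. ennreal ((cmod (avg (cell_of j x) (u (r n)) - v j x))\<^sup>2) * indicator ?S x \<partial>lborel) \<longlonglongrightarrow> (\<integral>\<^sup>+x. 0 \<partial>(lborel :: (real^3) measure))"
    proof (rule nn_integral_dominated_convergence[where w = "\<lambda>x. ennreal (4 * (8 ^ j * (B / c2))) * indicator ?S x"])
      have vb: "(cmod (v j x))\<^sup>2 \<le> 8 ^ j * (B / c2)" for x
      proof (rule tendsto_upperbound[OF tendsto_power[OF tendsto_norm[OF vlim]]])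
        show "\<forall>\<^sub>F n in sequentially. (cmod (avg (cell_of j x) (u (r n))))\<^sup>2 \<le> 8 ^ j * (B / c2)"
          by (intro always_eventually allI abd)
      qed simp
      show "AE x in lborel. ennreal ((cmod (avg (cell_of j x) (u (r n)) - v j x))\<^sup>2) * indicator ?S x \<le> ennreal (4 * (8 ^ j * (B / c2))) * indicator ?S x" for n
      proof (intro AE_I2 mult_right_mono ennreal_leI)
        fix x
        have "(cmod (avg (cell_of j x) (u (r n)) + (- v j x)))\<^sup>2 \<le> 2 * (cmod (avg (cell_of j x) (u (r n))))\<^sup>2 + 2 * (cmod (- v j x))\<^sup>2"
          by (rule square_sum_le)
        also have "\<dots> \<le> 4 * (8 ^ j * (B / c2))"
        proof -
          have "2 * a + 2 * b \<le> 4 * X" if "a \<le> X" "b \<le> X" for a b X :: real using that by simp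
          then show ?thesis using abd vb[of x] unfolding norm_minus_cancel by blast
        qed
        finally show "(cmod (avg (cell_of j x) (u (r n)) - v j x))\<^sup>2 \<le> 4 * (8 ^ j * (B / c2))" by simp
      qed auto
      have "(\<integral>\<^sup>+x. ennreal (4 * (8 ^ j * (B / c2))) * indicator ?S x \<partial>lborel) = ennreal (4 * (8 ^ j * (B / c2))) * emeasure lborel ?S"
        by (rule nn_integral_cmult_indicator) auto
      also have "\<dots> < \<infinity>" using emeasure_lborel_ball_finite[of "0::real^3" \<rho>] by (simp add: ennreal_mult_less_top)
      finally show "(\<integral>\<^sup>+x. ennreal (4 * (8 ^ j * (B / c2))) * indicator ?S x \<partial>lborel) < \<infinity>" .
      show "AE x in lborel. (\<lambda>n. ennreal ((cmod (avg (cell_of j x) (u (r n)) - v j x))\<^sup>2) * indicator ?S x) \<longlonglongrightarrow> 0"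
      proof (rule AE_I2)
        fix x
        have "(\<lambda>n. (cmod (avg (cell_of j x) (u (r n)) - v j x))\<^sup>2) \<longlonglongrightarrow> (cmod (v j x - v j x))\<^sup>2"
          by (intro tendsto_intros vlim)
        from tendsto_ennrealI[OF this] have "(\<lambda>n. ennreal ((cmod (avg (cell_of j x) (u (r n)) - v j x))\<^sup>2)) \<longlonglongrightarrow> 0" by simp
        then show "(\<lambda>n. ennreal ((cmod (avg (cell_of j x) (u (r n)) - v j x))\<^sup>2) * indicator ?S x) \<longlonglongrightarrow> 0"
          by (cases "x \<in> ?S") auto
      qed
    qed auto
    then have "\<forall>\<^sub>F n in sequentially. mass2 ?S (\<lambda>x. avg (cell_of j x) (u (r n)) - v j x) < ennreal (\<epsilon> / 16)"
      using \<epsilon> by (intro order_tendstoD(2)) auto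
    then obtain n0 where n0: "\<And>n. n0 \<le> n \<Longrightarrow> mass2 ?S (\<lambda>x. avg (cell_of j x) (u (r n)) - v j x) < ennreal (\<epsilon> / 16)"
      by (auto simp: eventually_sequentially)
    have near: "mass2 ?S (\<lambda>x. u (r n) x - v j x) \<le> ennreal (\<epsilon> / 4)" if "n0 \<le> n" for n
    proof -
      have "mass2 ?S (\<lambda>x. u (r n) x - v j x)
         \<le> 2 * mass2 ?S (\<lambda>x. u (r n) x - avg (cell_of j x) (u (r n)))
          + 2 * mass2 ?S (\<lambda>x. avg (cell_of j x) (u (r n)) - v j x)"
        by (rule local_L2_triangle) auto
      also have "\<dots> \<le> ennreal 2 * ennreal (\<epsilon> / 16) + ennreal 2 * ennreal (\<epsilon> / 16)"
      proof (intro add_mono mult_mono)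
        show "mass2 ?S (\<lambda>x. u (r n) x - avg (cell_of j x) (u (r n))) \<le> ennreal (\<epsilon> / 16)"
          using j(1) by (intro order_trans[OF K(2)[OF um B N j(2), of "r n"]] ennreal_leI) simp
        show "mass2 ?S (\<lambda>x. avg (cell_of j x) (u (r n)) - v j x) \<le> ennreal (\<epsilon> / 16)"
          using n0[OF that] by simp
      qed auto
      also have "\<dots> = ennreal (2 * (\<epsilon> / 16) + 2 * (\<epsilon> / 16))" using \<epsilon> by (intro ennreal_lincomb[symmetric]) auto
      finally show ?thesis by simp
    qed
    show "\<exists>n0. \<forall>n\<ge>n0. \<forall>k\<ge>n0. mass2 ?S (\<lambda>x. u (r n) x - u (r k) x) \<le> ennreal \<epsilon>"
    proof (intro exI[of _ n0] allI impI)
      fix n k assume nk: "n0 \<le> n" "n0 \<le> k"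
      have "mass2 ?S (\<lambda>x. u (r n) x - u (r k) x)
         \<le> 2 * mass2 ?S (\<lambda>x. u (r n) x - v j x)
          + 2 * mass2 ?S (\<lambda>x. v j x - u (r k) x)"
        by (rule local_L2_triangle) auto
      also have "\<dots> \<le> ennreal 2 * ennreal (\<epsilon> / 4) + ennreal 2 * ennreal (\<epsilon> / 4)"
        using near[OF nk(1)] near[OF nk(2)] by (intro add_mono mult_mono) (auto simp: norm_minus_commute)
      also have "\<dots> = ennreal (2 * (\<epsilon> / 4) + 2 * (\<epsilon> / 4))" using \<epsilon> by (intro ennreal_lincomb[symmetric]) auto
      finally show "mass2 ?S (\<lambda>x. u (r n) x - u (r k) x) \<le> ennreal \<epsilon>" by simp
    qed
  qed
qed

end

section \<open>Completeness of the energy space\<close>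

text \<open>
  With weights \<open>4\<^sup>k\<close> the squared increments still have a summable integral, so almost
  everywhere the increments are at most a multiple of \<open>2\<^bsup>-k\<^esup>\<close>.
\<close>

lemma fast_Cauchy_imp_AE_convergent:
  fixes w :: "nat \<Rightarrow> real^3 \<Rightarrow> complex"
  assumes [measurable]: "\<And>n. w n \<in> borel_measurable borel"
    and fast: "\<And>k. (\<integral>\<^sup>+x. ennreal ((cmod (w (Suc k) x - w k x))\<^sup>2) \<partial>lborel) \<le> ennreal ((1 / 16) ^ k)"
  shows "AE x in lborel. convergent (\<lambda>n. w n x)"
proof -
  define S where "S x = (\<Sum>k. ennreal (4 ^ k) * ennreal ((cmod (w (Suc k) x - w k x))\<^sup>2))" for x
  have "(\<integral>\<^sup>+x. S x \<partial>lborel) = (\<Sum>k. ennreal (4 ^ k) * (\<integral>\<^sup>+x. ennreal ((cmod (w (Suc k) x - w k x))\<^sup>2) \<partial>lborel))"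
    unfolding S_def by (subst nn_integral_suminf) (auto simp: nn_integral_cmult)
  also have "\<dots> \<le> (\<Sum>k. ennreal ((1 / 4) ^ k))"
  proof (intro suminf_le)
    fix k
    have "ennreal (4 ^ k) * (\<integral>\<^sup>+x. ennreal ((cmod (w (Suc k) x - w k x))\<^sup>2) \<partial>lborel) \<le> ennreal (4 ^ k) * ennreal ((1 / 16) ^ k)"
      by (intro mult_left_mono fast) auto
    also have "\<dots> = ennreal (4 ^ k * (1 / 16) ^ k)" by (rule ennreal_mult'[symmetric]) simp
    also have "(4::real) ^ k * (1 / 16) ^ k = (1 / 4) ^ k"
      by (simp only: power_mult_distrib[symmetric]) simp
    finally show "ennreal (4 ^ k) * (\<integral>\<^sup>+x. ennreal ((cmod (w (Suc k) x - w k x))\<^sup>2) \<partial>lborel) \<le> ennreal ((1 / 4) ^ k)" .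
  qed auto
  also have "\<dots> < \<infinity>"
  proof -
    have "(\<Sum>k. ennreal ((1 / 4) ^ k)) \<noteq> top"
      by (rule ennreal_suminf_neq_top) (auto intro!: summable_geometric)
    then show ?thesis unfolding infinity_ennreal_def by (rule top.not_eq_extremum[THEN iffD1])
  qed
  finally have fin: "(\<integral>\<^sup>+x. S x \<partial>lborel) < \<infinity>" .
  have "S \<in> borel_measurable lborel" unfolding S_def by measurable
  then have "AE x in lborel. S x \<noteq> \<infinity>" using fin by (intro nn_integral_PInf_AE) auto
  then show ?thesis
  proof (rule AE_mp, intro AE_I2 impI)
    have four: "(2 ^ k)\<^sup>2 = (4::real) ^ k" for k :: nat
    proof -
      have "(2 ^ k)\<^sup>2 = ((2::real)\<^sup>2) ^ k" by (simp only: power_mult[symmetric] mult.commute)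
      then show ?thesis by simp
    qed
    fix x assume "S x \<noteq> \<infinity>"
    then obtain C where C: "S x = ennreal C" "C \<ge> 0" by (cases "S x") auto
    have "cmod (w (Suc k) x - w k x) \<le> sqrt C * (1 / 2) ^ k" for k
    proof -
      have "ennreal (4 ^ k) * ennreal ((cmod (w (Suc k) x - w k x))\<^sup>2) \<le> S x"
        unfolding S_def using sum_le_suminf[of "\<lambda>k. ennreal (4 ^ k) * ennreal ((cmod (w (Suc k) x - w k x))\<^sup>2)" "{k}"] by simp
      then have "ennreal (4 ^ k * (cmod (w (Suc k) x - w k x))\<^sup>2) \<le> ennreal C" unfolding C(1) by (simp add: ennreal_mult')
      then have "4 ^ k * (cmod (w (Suc k) x - w k x))\<^sup>2 \<le> C" using C by (subst (asm) ennreal_le_iff) auto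
      then have "(2 ^ k * cmod (w (Suc k) x - w k x))\<^sup>2 \<le> C"
      by (simp only: power_mult_distrib four)
      then have "2 ^ k * cmod (w (Suc k) x - w k x) \<le> sqrt C" by (rule real_le_rsqrt)
      then show ?thesis by (simp add: field_simps power_one_over)
    qed
    then have "summable (\<lambda>k. w (Suc k) x - w k x)"
      by (intro summable_comparison_test[OF _ summable_mult[OF summable_geometric[of "1/2 :: real"], of "sqrt C"]]) auto
    then have "convergent (\<lambda>n. \<Sum>k<n. w (Suc k) x - w k x)" by (simp add: summable_iff_convergent)
    moreover have "(\<Sum>k<n. w (Suc k) x - w k x) = w n x - w 0 x" for n
      using sum_lessThan_telescope[of "\<lambda>k. w k x" n] by simp
    ultimately have "convergent (\<lambda>n. w n x - w 0 x)" by simp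
    then have "convergent (\<lambda>n. (w n x - w 0 x) + w 0 x)" by (intro convergent_add convergent_const)
    then show "convergent (\<lambda>n. w n x)" by simp
  qed
qed

lemma AE_lborel_fst_snd:
  fixes Q :: "real^3 \<Rightarrow> bool"
  assumes "AE x in lborel. Q x"
  shows "AE z in lborel. Q (fst z) \<and> Q (snd z)"
proof -
  obtain N where N: "{x. \<not> Q x} \<subseteq> N" "N \<in> sets borel" "emeasure lborel N = 0"
    using assms by (auto elim: AE_E)
  have z: "AE x in lborel. x \<notin> N" using N by (intro AE_not_in) (auto simp: null_sets_def)
  have [measurable]: "N \<in> sets borel" by fact
  have "AE z in (lborel \<Otimes>\<^sub>M lborel). fst z \<notin> N \<and> snd z \<notin> N"
  proof (rule lborel_pair.AE_pair_measure)
    show "{z \<in> space (lborel \<Otimes>\<^sub>M lborel). fst z \<notin> N \<and> snd z \<notin> N} \<in> sets (lborel \<Otimes>\<^sub>M lborel)"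
      by measurable
    show "AE x in lborel. AE y in lborel. fst (x, y) \<notin> N \<and> snd (x, y) \<notin> N"
      using z by eventually_elim (use z in auto)
  qed
  then have "AE z in lborel. fst z \<notin> N \<and> snd z \<notin> N" unfolding lborel_prod .
  then show ?thesis by eventually_elim (use N in auto)
qed

lemma nn_integral_fatou_bound:
  assumes "\<And>n. f n \<in> borel_measurable M" "AE x in M. (\<lambda>n. f n x) \<longlonglongrightarrow> g x"
    and "\<And>n. n0 \<le> n \<Longrightarrow> (\<integral>\<^sup>+x. f n x \<partial>M) \<le> C"
  shows "(\<integral>\<^sup>+x. g x \<partial>M) \<le> (C :: ennreal)"
proof -
  have "(\<integral>\<^sup>+x. g x \<partial>M) = (\<integral>\<^sup>+x. liminf (\<lambda>n. f n x) \<partial>M)"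
    using assms(2) by (intro nn_integral_cong_AE, eventually_elim) (metis lim_imp_Liminf sequentially_bot)
  also have "\<dots> \<le> liminf (\<lambda>n. \<integral>\<^sup>+x. f n x \<partial>M)" by (rule nn_integral_liminf) fact
  also have "\<dots> \<le> liminf (\<lambda>n. C)" using assms(3) by (intro Liminf_mono) (auto simp: eventually_sequentially)
  also have "\<dots> = C" by (simp add: Liminf_const)
  finally show ?thesis .
qed

context mag_setting begin

text \<open>
  The factor \<open>2\<close> comes from estimating the two parts of the energy separately; it does no harm
  where the right-hand side is small.
\<close>

lemma energy_fatou:
  assumes [measurable]: "A \<in> borel_measurable borel" "\<And>n. w n \<in> borel_measurable borel" "U \<in> borel_measurable borel"
    and ae: "AE x in lborel. (\<lambda>n. w n x) \<longlonglongrightarrow> U x" and N: "\<And>n. n0 \<le> n \<Longrightarrow> energy A (w n) \<le> ennreal C" and C: "0 \<le> C"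
  shows "energy A U \<le> ennreal (2 * C)"
proof -
  have "kinetic A U \<le> ennreal (C / c1)" unfolding kinetic_def
  proof (rule nn_integral_fatou_bound[where f = "\<lambda>n z. ennreal (edens A (w n) z)" and ?n0.0 = n0])
    show "AE z in lborel. (\<lambda>n. ennreal (edens A (w n) z))
       \<longlonglongrightarrow> ennreal (edens A U z)"
      using AE_lborel_fst_snd[OF ae] unfolding mag_diff_def
      by eventually_elim (intro tendsto_ennrealI tendsto_intros; simp)
  qed (use energy_parts_le(2)[OF N C] in \<open>auto simp: kinetic_def\<close>)
  moreover have "sqmass U \<le> ennreal (C / c2)" unfolding sqmass_def
  proof (rule nn_integral_fatou_bound[where f = "\<lambda>n x. ennreal ((cmod (w n x))\<^sup>2)" and ?n0.0 = n0])
    show "AE x in lborel. (\<lambda>n. ennreal ((cmod (w n x))\<^sup>2)) \<longlonglongrightarrow> ennreal ((cmod (U x))\<^sup>2)"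
      using ae by eventually_elim (intro tendsto_ennrealI tendsto_intros; simp)
  qed (use energy_parts_le(1)[OF N C] in \<open>auto simp: sqmass_def\<close>)
  ultimately have "energy A U \<le> ennreal c1 * ennreal (C / c1) + ennreal c2 * ennreal (C / c2)"
    unfolding energy_def by (intro add_mono mult_left_mono) auto
  also have "\<dots> = ennreal (c1 * (C / c1) + c2 * (C / c2))" using c1_pos c2_pos C by (intro ennreal_lincomb[symmetric]) auto
  also have "c1 * (C / c1) + c2 * (C / c2) = 2 * C" using c1_pos c2_pos by simp
  finally show ?thesis .
qed

text \<open>
  A subsequence converges almost everywhere, as the energy controls the \<open>L\<^sup>2\<close> norm;
  \<open>energy_fatou\<close>, applied to differences, shows that the limit is one in energy.
\<close>

lemma energy_complete:
  fixes w :: "nat \<Rightarrow> real^3 \<Rightarrow> complex"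
  assumes [measurable]: "A \<in> borel_measurable borel" "\<And>n. w n \<in> borel_measurable borel"
    and cau: "\<And>\<epsilon>. 0 < \<epsilon> \<Longrightarrow> \<exists>n0. \<forall>n\<ge>n0. \<forall>k\<ge>n0. energy A (\<lambda>x. w n x - w k x) \<le> ennreal \<epsilon>"
  obtains U where "U \<in> borel_measurable borel" "\<And>\<epsilon>. 0 < \<epsilon> \<Longrightarrow> \<exists>n0. \<forall>n\<ge>n0. energy A (\<lambda>x. U x - w n x) \<le> ennreal \<epsilon>"
proof -
  have "\<exists>n0. \<forall>n\<ge>n0. \<forall>k\<ge>n0. energy A (\<lambda>x. w n x - w k x) \<le> ennreal (c2 * (1 / 16) ^ j)" for j :: nat
    using c2_pos by (intro cau) simp
  then obtain q :: "nat \<Rightarrow> nat" where q: "\<And>j n k. q j \<le> n \<Longrightarrow> q j \<le> k \<Longrightarrow> energy A (\<lambda>x. w n x - w k x) \<le> ennreal (c2 * (1 / 16) ^ j)"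
    by metis
  \<comment> \<open>A sum instead of \<open>q j\<close>, to have monotone indices.\<close>
  define r where "r j = (\<Sum>i\<le>j. q i) + j" for j
  have rq: "q j \<le> r j" for j unfolding r_def by (simp add: member_le_sum trans_le_add1)
  have rS: "r j \<le> r (Suc j)" for j by (simp add: r_def)
  have rj: "j \<le> r j" for j by (simp add: r_def)
  have "AE x in lborel. convergent (\<lambda>n. w (r n) x)"
  proof (rule fast_Cauchy_imp_AE_convergent)
    fix k
    have "energy A (\<lambda>x. w (r (Suc k)) x - w (r k) x) \<le> ennreal (c2 * (1 / 16) ^ k)"
      using rq[of k] rS[of k] by (intro q) auto
    then have "sqmass (\<lambda>x. w (r (Suc k)) x - w (r k) x) \<le> ennreal (c2 * (1 / 16) ^ k / c2)"
      using c2_pos by (intro energy_parts_le) auto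
    then show "(\<integral>\<^sup>+x. ennreal ((cmod (w (r (Suc k)) x - w (r k) x))\<^sup>2) \<partial>lborel) \<le> ennreal ((1 / 16) ^ k)"
      using c2_pos by (simp add: sqmass_def)
  qed measurable
  moreover define U where "U x = lim (\<lambda>n. w (r n) x)" for x
  ultimately have ae: "AE x in lborel. (\<lambda>n. w (r n) x) \<longlonglongrightarrow> U x"
    by (simp add: convergent_LIMSEQ_iff)
  have [measurable]: "U \<in> borel_measurable borel" unfolding U_def by measurable
  have "\<exists>n0. \<forall>n\<ge>n0. energy A (\<lambda>x. U x - w n x) \<le> ennreal \<epsilon>" if \<epsilon>: "0 < \<epsilon>" for \<epsilon>
  proof -
    obtain n0 where n0: "\<And>n k. n0 \<le> n \<Longrightarrow> n0 \<le> k \<Longrightarrow> energy A (\<lambda>x. w n x - w k x) \<le> ennreal (\<epsilon> / 2)"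
      using cau[of "\<epsilon> / 2"] \<epsilon> by auto
    have "energy A (\<lambda>x. U x - w k x) \<le> ennreal (2 * (\<epsilon> / 2))" if k: "n0 \<le> k" for k
    proof (rule energy_fatou[where w = "\<lambda>n x. w (r n) x - w k x" and ?n0.0 = n0])
      show "AE x in lborel. (\<lambda>n. w (r n) x - w k x) \<longlonglongrightarrow> U x - w k x"
        using ae by eventually_elim (intro tendsto_intros)
      show "energy A (\<lambda>x. w (r n) x - w k x) \<le> ennreal (\<epsilon> / 2)" if "n0 \<le> n" for n
        using that rj[of n] k by (intro n0) auto
    qed (use \<epsilon> in auto)
    then show ?thesis by auto
  qed
  then show ?thesis by (intro that[of U]) auto
qed

section \<open>Limits of tight minimizing sequences\<close>

text \<open>
  The limit \<open>l \<rightarrow> 0\<close> that turns weighted inequalities into the continuity usually obtained from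
  the triangle inequality.
\<close>

lemma le_of_weighted_bounds:
  fixes X Y :: real
  assumes "\<And>l \<eta>. 0 < l \<Longrightarrow> l < 1 \<Longrightarrow> 0 < \<eta> \<Longrightarrow> X \<le> (1 - l) powr (- a) * Y + \<eta>"
  shows "X \<le> Y"
proof (rule field_le_epsilon)
  fix \<eta> :: real assume \<eta>: "0 < \<eta>"
  have "((\<lambda>l. (1 - l) powr (- a) * Y + \<eta>) \<longlongrightarrow> (1 - 0) powr (- a) * Y + \<eta>) (at_right 0)"
    by (intro tendsto_intros) auto
  moreover have "\<forall>\<^sub>F l in at_right 0. X \<le> (1 - l) powr (- a) * Y + \<eta>"
    by (subst eventually_at_right[of 0 1]) (auto intro!: exI[of _ 1] assms \<eta>)
  ultimately have "X \<le> (1 - 0) powr (- a) * Y + \<eta>" by (rule tendsto_lowerbound) simp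
  then show "X \<le> Y + \<eta>" by simp
qed

lemma pmass_limit:
  assumes [measurable]: "U \<in> borel_measurable borel" "\<And>n. v n \<in> borel_measurable borel" and one: "\<And>n. pmass (v n) = 1"
    and lim: "\<And>\<epsilon>. 0 < \<epsilon> \<Longrightarrow> \<exists>n. pmass (\<lambda>x. U x - v n x) \<le> ennreal \<epsilon>"
  shows "pmass U = 1"
proof -
  have sym: "pmass (\<lambda>x. v n x - U x) = pmass (\<lambda>x. U x - v n x)" for n by (simp add: pmass_def norm_minus_commute)
  have up: "pmass U \<le> ennreal ((1 - l) powr (- (p - 1)) * 1 + \<eta>)" if l: "0 < l" "l < 1" "0 < \<eta>" for l \<eta>
  proof -
    obtain n where n: "pmass (\<lambda>x. U x - v n x) \<le> ennreal (\<eta> / l powr (1 - p))" using lim[of "\<eta> / l powr (1 - p)"] l by auto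
    have "pmass U = pmass (\<lambda>x. v n x + (U x - v n x))" by simp
    also have "\<dots> \<le> ennreal ((1 - l) powr (1 - p)) * pmass (v n) + ennreal (l powr (1 - p)) * pmass (\<lambda>x. U x - v n x)"
      by (rule pmass_add_le) (use l in auto)
    also have "\<dots> \<le> ennreal ((1 - l) powr (1 - p)) * ennreal 1 + ennreal (l powr (1 - p)) * ennreal (\<eta> / l powr (1 - p))"
      using n one by (intro add_mono mult_left_mono) auto
    also have "\<dots> = ennreal ((1 - l) powr (1 - p) * 1 + l powr (1 - p) * (\<eta> / l powr (1 - p)))"
      using l by (intro ennreal_lincomb[symmetric]) auto
    finally show ?thesis using l by simp
  qed
  then obtain P where P: "pmass U = ennreal P" "P \<ge> 0"
    using up[of "1/2" 1] by (cases "pmass U") (auto simp: top_unique)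
  have "P \<le> 1"
  proof (rule le_of_weighted_bounds)
    fix l \<eta> :: real assume l: "0 < l" "l < 1" "0 < \<eta>"
    show "P \<le> (1 - l) powr (- (p - 1)) * 1 + \<eta>" using up[OF l] l unfolding P(1) by (subst (asm) ennreal_le_iff) auto
  qed
  moreover have "1 \<le> P"
  proof (rule le_of_weighted_bounds)
    fix l \<eta> :: real assume l: "0 < l" "l < 1" "0 < \<eta>"
    obtain n where n: "pmass (\<lambda>x. U x - v n x) \<le> ennreal (\<eta> / l powr (1 - p))" using lim[of "\<eta> / l powr (1 - p)"] l by auto
    have "1 = pmass (\<lambda>x. U x + (v n x - U x))" using one by simp
    also have "\<dots> \<le> ennreal ((1 - l) powr (1 - p)) * pmass U + ennreal (l powr (1 - p)) * pmass (\<lambda>x. v n x - U x)"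
      by (rule pmass_add_le) (use l in auto)
    also have "\<dots> \<le> ennreal ((1 - l) powr (1 - p)) * ennreal P + ennreal (l powr (1 - p)) * ennreal (\<eta> / l powr (1 - p))"
      using n P sym by (intro add_mono mult_left_mono) auto
    also have "\<dots> = ennreal ((1 - l) powr (1 - p) * P + l powr (1 - p) * (\<eta> / l powr (1 - p)))"
      using l P by (intro ennreal_lincomb[symmetric]) auto
    finally show "1 \<le> (1 - l) powr (- (p - 1)) * P + \<eta>" using l by (simp add: ennreal_ge_1)
  qed
  ultimately show ?thesis using P by simp
qed

lemma energy_limit:
  assumes [measurable]: "A \<in> borel_measurable borel" "U \<in> borel_measurable borel" "\<And>n. v n \<in> borel_measurable borel"
    and bd: "\<And>\<epsilon> \<delta>. 0 < \<epsilon> \<Longrightarrow> 0 < \<delta> \<Longrightarrow> \<exists>n. energy A (\<lambda>x. U x - v n x) \<le> ennreal \<epsilon> \<and> energy A (v n) \<le> ennreal (M + \<delta>)" and M: "0 \<le> M"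
  shows "energy A U \<le> ennreal M"
proof -
  have up: "energy A U \<le> ennreal ((1 - l) powr (- 1) * M + \<eta>)" if l: "0 < l" "l < 1" "0 < \<eta>" for l \<eta>
  proof -
    obtain n where n: "energy A (\<lambda>x. U x - v n x) \<le> ennreal (\<eta> / 2 * l)" "energy A (v n) \<le> ennreal (M + \<eta> / 2 * (1 - l))"
      using bd[of "\<eta> / 2 * l" "\<eta> / 2 * (1 - l)"] l by auto
    have "energy A U = energy A (\<lambda>x. v n x + (U x - v n x))" by simp
    also have "\<dots> \<le> ennreal (1 / (1 - l)) * energy A (v n) + ennreal (1 / l) * energy A (\<lambda>x. U x - v n x)"
      by (rule energy_add_le) (use l in auto)
    also have "\<dots> \<le> ennreal (1 / (1 - l)) * ennreal (M + \<eta> / 2 * (1 - l)) + ennreal (1 / l) * ennreal (\<eta> / 2 * l)"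
      using n by (intro add_mono mult_left_mono) auto
    also have "\<dots> = ennreal (1 / (1 - l) * (M + \<eta> / 2 * (1 - l)) + 1 / l * (\<eta> / 2 * l))"
      using l M by (intro ennreal_lincomb[symmetric]) auto
    also have "1 / (1 - l) * (M + \<eta> / 2 * (1 - l)) + 1 / l * (\<eta> / 2 * l) = (1 - l) powr (- 1) * M + \<eta>"
      using l by (simp add: powr_minus_divide field_simps)
    finally show ?thesis .
  qed
  then obtain N where N: "energy A U = ennreal N" "N \<ge> 0"
    using up[of "1/2" 1] by (cases "energy A U") (auto simp: top_unique)
  have "N \<le> M"
  proof (rule le_of_weighted_bounds)
    fix l \<eta> :: real assume l: "0 < l" "l < 1" "0 < \<eta>"
    show "N \<le> (1 - l) powr (- 1) * M + \<eta>" using up[OF l] l M unfolding N(1) by (subst (asm) ennreal_le_iff) auto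
  qed
  then show ?thesis using N by (simp add: ennreal_leI)
qed

text \<open>
  By the parallelogram identity the energy of \<open>f - g\<close> is at most \<open>4 * level A + 4 * \<tau>\<close> minus
  the energy of \<open>f + g\<close>. As \<open>f + g = 2 f - (f - g)\<close> has \<open>L\<^sup>p\<close> norm close to \<open>2\<close>, its energy is
  at least nearly \<open>4 * level A\<close>.
\<close>

lemma Lp_close_imp_energy_close:
  assumes [measurable]: "A \<in> borel_measurable borel" and lb: "locally_bounded A" and \<epsilon>: "0 < \<epsilon>"
  obtains \<tau> \<eta> where "\<tau> > 0" "\<eta> > 0" "\<And>f g. f \<in> test_functions \<Longrightarrow> g \<in> test_functions \<Longrightarrow> pmass f = 1 \<Longrightarrow>
    energy A f \<le> ennreal (level A + \<tau>) \<Longrightarrow> energy A g \<le> ennreal (level A + \<tau>) \<Longrightarrow> pmass (\<lambda>x. f x - g x) \<le> ennreal \<eta> \<Longrightarrow>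
    energy A (\<lambda>x. f x - g x) \<le> ennreal \<epsilon>"
proof -
  define M where "M = level A"
  have M: "M > 0" unfolding M_def by (rule level_pos[OF assms(1) lb])
  \<comment> \<open>A lower bound for the squared \<open>L\<^sup>p\<close> norm of \<open>f + g\<close> if the \<open>p\<close>-mass of \<open>f - g\<close> is at most \<open>l\<^sup>p\<close>; it tends to \<open>4\<close>.\<close>
  define F where "F l = ((1 - l) powr (p - 1) * (2 powr p - l)) powr (2 / p)" for l :: real
  have "(F \<longlongrightarrow> ((1 - 0) powr (p - 1) * (2 powr p - 0)) powr (2 / p)) (at_right 0)"
    unfolding F_def by (intro tendsto_intros) auto
  moreover have "((1 - 0) powr (p - 1) * (2 powr p - 0)) powr (2 / p) = (4 :: real)" using p_gt by (simp add: powr_powr)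
  ultimately have "(F \<longlongrightarrow> 4) (at_right 0)" by simp
  then have "\<forall>\<^sub>F l in at_right 0. 4 - \<epsilon> / (2 * M) < F l" using \<epsilon> M by (intro order_tendstoD(1)) auto
  moreover have "\<forall>\<^sub>F l in at_right 0. 0 < (l::real) \<and> l < 1" by (subst eventually_at_right[of 0 1]) (auto intro: exI[of _ 1])
  ultimately have "\<forall>\<^sub>F l in at_right 0. 4 - \<epsilon> / (2 * M) < F l \<and> 0 < (l::real) \<and> l < 1" by eventually_elim auto
  then obtain l where l: "4 - \<epsilon> / (2 * M) < F l" "0 < l" "l < 1"
    using eventually_happens[of _ "at_right (0::real)"] trivial_limit_at_right_real by blast
  have pp: "l \<le> 2 powr p"
  proof -
    have "1 \<le> (2::real) powr p" using p_gt by (intro ge_one_powr_ge_zero) auto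
    then show ?thesis using l by linarith
  qed
  show ?thesis
  proof (rule that[of "\<epsilon> / 8" "l powr p"])
    fix f g assume f: "f \<in> test_functions" and g: "g \<in> test_functions" and P: "pmass f = 1"
      and N: "energy A f \<le> ennreal (level A + \<epsilon> / 8)" "energy A g \<le> ennreal (level A + \<epsilon> / 8)" and d: "pmass (\<lambda>x. f x - g x) \<le> ennreal (l powr p)"
    note [measurable] = test_measurable[OF f] test_measurable[OF g]
    have t: "(\<lambda>x. f x + g x) \<in> test_functions" "(\<lambda>x. f x - g x) \<in> test_functions" by (auto intro: test_add test_diff f g)
    obtain Q where Q: "pmass (\<lambda>x. f x + g x) = ennreal Q" "Q \<ge> 0"
      using pmass_finite[OF assms(1) test_measurable[OF t(1)] test_in_energy[OF assms(1) lb t(1)]] by (cases "pmass (\<lambda>x. f x + g x)") auto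
    have "ennreal (2 powr p) = pmass (\<lambda>x. 2 * f x)" using pmass_scale[of f 2] P by simp
    also have "\<dots> = pmass (\<lambda>x. (f x + g x) + (f x - g x))" by simp
    also have "\<dots> \<le> ennreal ((1 - l) powr (1 - p)) * pmass (\<lambda>x. f x + g x) + ennreal (l powr (1 - p)) * pmass (\<lambda>x. f x - g x)"
      by (rule pmass_add_le) (use l in auto)
    also have "\<dots> \<le> ennreal ((1 - l) powr (1 - p)) * ennreal Q + ennreal (l powr (1 - p)) * ennreal (l powr p)"
      using Q d by (intro add_mono mult_left_mono) auto
    also have "\<dots> = ennreal ((1 - l) powr (1 - p) * Q + l powr (1 - p) * l powr p)"
      using Q by (intro ennreal_lincomb[symmetric]) auto
    also have "l powr (1 - p) * l powr p = l" using l by (simp flip: powr_add)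
    finally have "2 powr p \<le> (1 - l) powr (1 - p) * Q + l" using Q l by (subst (asm) ennreal_le_iff) auto
    then have "(1 - l) powr (p - 1) * (2 powr p - l) \<le> (1 - l) powr (p - 1) * ((1 - l) powr (1 - p) * Q)"
      by (intro mult_left_mono) auto
    also have "\<dots> = Q" using l by (simp flip: mult.assoc powr_add)
    finally have "F l \<le> Q powr (2 / p)" unfolding F_def using l pp p_gt by (intro powr_mono2 mult_nonneg_nonneg) auto
    then have Q4: "4 - \<epsilon> / (2 * M) \<le> Q powr (2 / p)" using l by simp
    have lev: "ennreal (M * Q powr (2 / p)) \<le> energy A (\<lambda>x. f x + g x)"
      unfolding M_def by (intro level_le assms test_in_sobolev lb t Q)
    obtain X where X: "energy A (\<lambda>x. f x + g x) = ennreal X" "X \<ge> 0"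
      using test_in_energy[OF assms(1) lb t(1)] by (cases "energy A (\<lambda>x. f x + g x)") auto
    obtain Y where Y: "energy A (\<lambda>x. f x - g x) = ennreal Y" "Y \<ge> 0"
      using test_in_energy[OF assms(1) lb t(2)] by (cases "energy A (\<lambda>x. f x - g x)") auto
    have "M * Q powr (2 / p) \<le> X" using lev X by (subst (asm) X(1), subst (asm) ennreal_le_iff) auto
    moreover have "M * (4 - \<epsilon> / (2 * M)) \<le> M * Q powr (2 / p)" using M Q4 by (intro mult_left_mono) auto
    moreover have "M * (4 - \<epsilon> / (2 * M)) = 4 * M - \<epsilon> / 2" using M by (simp add: algebra_simps)
    ultimately have Xlow: "4 * M - \<epsilon> / 2 \<le> X" by linarith
    have "ennreal (X + Y) = 2 * energy A f + 2 * energy A g"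
      using energy_parallelogram[of A f g] X Y by (simp add: ennreal_plus)
    also have "\<dots> \<le> 2 * ennreal (M + \<epsilon> / 8) + 2 * ennreal (M + \<epsilon> / 8)" unfolding M_def by (intro add_mono mult_left_mono N) auto
    also have "\<dots> = ennreal 2 * ennreal (M + \<epsilon> / 8) + ennreal 2 * ennreal (M + \<epsilon> / 8)" by simp
    also have "\<dots> = ennreal (2 * (M + \<epsilon> / 8) + 2 * (M + \<epsilon> / 8))" using M \<epsilon> by (intro ennreal_lincomb[symmetric]) auto
    finally have "X + Y \<le> 2 * (M + \<epsilon> / 8) + 2 * (M + \<epsilon> / 8)" using M \<epsilon> by (subst (asm) ennreal_le_iff) auto
    then have "Y \<le> \<epsilon>" using Xlow by simp
    then show "energy A (\<lambda>x. f x - g x) \<le> ennreal \<epsilon>" using Y by (simp add: ennreal_leI)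
  qed (use \<epsilon> l in auto)
qed

lemma pmass_on_add_le:
  assumes [measurable]: "u \<in> borel_measurable borel" "v \<in> borel_measurable borel" "S \<in> sets borel"
  shows "massp S (\<lambda>x. u x - v x)
    \<le> ennreal (2 powr (p - 1)) * (massp S u + massp S v)"
proof -
  have "massp S (\<lambda>x. u x - v x)
    \<le> (\<integral>\<^sup>+x. ennreal (2 powr (p - 1)) * (ennreal (cmod (u x) powr p) * indicator S x + ennreal (cmod (v x) powr p) * indicator S x) \<partial>lborel)"
  proof (intro nn_integral_mono)
    fix x
    have "cmod (u x - v x) powr p \<le> (cmod (u x) + cmod (v x)) powr p"
      using p_gt by (intro powr_mono2 norm_triangle_ineq4) auto
    also have "\<dots> \<le> (1 - 1/2) powr (1 - p) * cmod (u x) powr p + (1/2) powr (1 - p) * cmod (v x) powr p"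
      using p_gt by (intro powr_add_le_weighted) auto
    also have "\<dots> = 2 powr (p - 1) * (cmod (u x) powr p + cmod (v x) powr p)"
      by (simp add: powr_divide powr_diff distrib_left)
    finally have "ennreal (cmod (u x - v x) powr p) \<le> ennreal (2 powr (p - 1) * (cmod (u x) powr p + cmod (v x) powr p))" by (rule ennreal_leI)
    then show "ennreal (cmod (u x - v x) powr p) * indicator S x \<le> ennreal (2 powr (p - 1)) * (ennreal (cmod (u x) powr p) * indicator S x + ennreal (cmod (v x) powr p) * indicator S x)"
      by (simp add: indicator_def ennreal_mult' ennreal_plus)
  qed
  also have "\<dots> = ennreal (2 powr (p - 1)) * (massp S u + massp S v)"
    by (subst nn_integral_cmult) (auto simp: nn_integral_add)
  finally show ?thesis .
qed

text \<open>
  Differences of late members of a locally convergent subsequence have small \<open>L\<^sup>2\<close> mass in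
  unit balls: near the origin by local convergence, and far away because a ball with small
  \<open>L\<^sup>p\<close> mass has small \<open>L\<^sup>2\<close> mass (\<open>mass_lower_bound\<close>). So \<open>vanishing\<close> makes the subsequence
  Cauchy in \<open>L\<^sup>p\<close>, \<open>Lp_close_imp_energy_close\<close> in energy, and \<open>energy_complete\<close> yields the
  limit.
\<close>

lemma tight_minimizing_sequence:
  fixes u :: "nat \<Rightarrow> real^3 \<Rightarrow> complex"
  assumes [measurable]: "A \<in> borel_measurable borel" and lb: "locally_bounded A"
    and ut: "\<And>n. u n \<in> test_functions" and P: "\<And>n. pmass (u n) = 1"
    and mini: "\<And>\<tau>. 0 < \<tau> \<Longrightarrow> \<exists>n0. \<forall>n\<ge>n0. energy A (u n) \<le> ennreal (level A + \<tau>)"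
    and tight: "\<And>\<epsilon>. 0 < \<epsilon> \<Longrightarrow> \<exists>R n0. \<forall>n\<ge>n0. massp (- ball 0 R) (u n) \<le> ennreal \<epsilon>"
  obtains U where "U \<in> mag_sobolev s m A" "pmass U = 1" "energy A U \<le> ennreal (level A)"
proof -
  define M where "M = level A"
  have M: "M > 0" unfolding M_def by (rule level_pos[OF assms(1) lb])
  obtain n1 :: nat where n1: "\<And>n. n1 \<le> n \<Longrightarrow> energy A (u n) \<le> ennreal (M + 1)" using mini[of 1] by (auto simp: M_def)
  have um[measurable]: "u n \<in> borel_measurable borel" for n by (rule test_measurable[OF ut])
  obtain r where r: "strict_mono (r :: nat \<Rightarrow> nat)"
    "\<And>\<rho> \<epsilon>. 0 < \<epsilon> \<Longrightarrow> \<exists>n0. \<forall>n\<ge>n0. \<forall>k\<ge>n0. mass2 (ball 0 \<rho>) (\<lambda>x. u (r n + n1) x - u (r k + n1) x) \<le> ennreal \<epsilon>"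
    by (rule local_compactness[OF assms(1) lb, of "\<lambda>n. u (n + n1)" "M + 1"]) (use n1 M in auto)
  define w where "w n = u (r n + n1)" for n
  have rn: "n \<le> r n + n1" for n using seq_suble[OF r(1), of n] by simp
  have wt: "w n \<in> test_functions" and wm[measurable]: "w n \<in> borel_measurable borel" and wP: "pmass (w n) = 1"
    and wN: "energy A (w n) \<le> ennreal (M + 1)" for n
    unfolding w_def by (auto intro: ut P n1)
  have Lp: "\<exists>n0. \<forall>n\<ge>n0. \<forall>k\<ge>n0. pmass (\<lambda>x. w n x - w k x) \<le> ennreal \<eta>" if \<eta>: "0 < \<eta>" for \<eta>
  proof -
    have M4: "4 * (M + 1) > 0" using M by simp
    obtain \<sigma> where \<sigma>: "\<sigma> > 0" "\<And>A u. A \<in> borel_measurable borel \<Longrightarrow> u \<in> borel_measurable borel \<Longrightarrow> energy A u \<le> ennreal (4 * (M + 1)) \<Longrightarrow>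
      (\<forall>\<xi>. mass2 (ball \<xi> 1) u \<le> ennreal \<sigma>) \<Longrightarrow> pmass u \<le> ennreal \<eta>"
      using vanishing[OF M4 \<eta>] by blast
    define a where "a = \<sigma> / 2 * (\<sigma> / (8 / 3 * pi)) powr ((p - 2) / 2)"
    have a: "a > 0" using \<sigma>(1) by (simp add: a_def)
    define e where "e = a / 4 / 2 powr (p - 1)"
    have e: "e > 0" "2 powr (p - 1) * (e + e) < a" using a by (auto simp: e_def field_simps)
    obtain R n2 where R: "\<And>n. n2 \<le> n \<Longrightarrow> massp (- ball 0 R) (u n) \<le> ennreal e"
      using tight[OF e(1)] by blast
    obtain n3 where n3: "\<And>n k. n3 \<le> n \<Longrightarrow> n3 \<le> k \<Longrightarrow> mass2 (ball 0 (R + 2)) (\<lambda>x. w n x - w k x) \<le> ennreal \<sigma>"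
      using r(2)[OF \<sigma>(1), of "R + 2"] unfolding w_def by blast
    show ?thesis
    proof (intro exI[of _ "max n2 n3"] allI impI)
      fix n k assume nk: "max n2 n3 \<le> n" "max n2 n3 \<le> k"
      show "pmass (\<lambda>x. w n x - w k x) \<le> ennreal \<eta>"
      proof (rule \<sigma>(2)[OF assms(1)])
        show "(\<lambda>x. w n x - w k x) \<in> borel_measurable borel" by measurable
        have "energy A (\<lambda>x. w n x - w k x) \<le> ennreal (1 / (1 - 1/2)) * energy A (w n) + ennreal (1 / (1/2)) * energy A (w k)"
          by (rule energy_diff) auto
        also have "\<dots> \<le> ennreal (1 / (1 - 1/2)) * ennreal (M + 1) + ennreal (1 / (1/2)) * ennreal (M + 1)"
          by (intro add_mono mult_left_mono wN) auto
        also have "\<dots> = ennreal (1 / (1 - 1/2) * (M + 1) + 1 / (1/2) * (M + 1))" using M by (intro ennreal_lincomb[symmetric]) auto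
        finally show "energy A (\<lambda>x. w n x - w k x) \<le> ennreal (4 * (M + 1))" by simp
        show "\<forall>\<xi>. mass2 (ball \<xi> 1) (\<lambda>y. w n y - w k y) \<le> ennreal \<sigma>"
        proof
          fix \<xi> :: "real^3"
          show "mass2 (ball \<xi> 1) (\<lambda>y. w n y - w k y) \<le> ennreal \<sigma>"
          proof (cases "norm \<xi> < R + 1")
            case True
            have "ball \<xi> 1 \<subseteq> ball 0 (R + 2)"
            proof
              fix y assume "y \<in> ball \<xi> 1"
              then show "y \<in> ball 0 (R + 2)" using True norm_triangle_ineq[of \<xi> "y - \<xi>"] by (simp add: dist_norm norm_minus_commute)
            qed
            then have "mass2 (ball \<xi> 1) (\<lambda>y. w n y - w k y)
              \<le> mass2 (ball 0 (R + 2)) (\<lambda>y. w n y - w k y)"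
              by (intro nn_integral_mono) (auto simp: indicator_def)
            also have "\<dots> \<le> ennreal \<sigma>" using nk by (intro n3) auto
            finally show ?thesis .
          next
            case False
            have sub: "ball \<xi> 1 \<subseteq> - ball 0 R"
            proof
              fix y assume "y \<in> ball \<xi> 1"
              then show "y \<in> - ball 0 R" using False norm_triangle_ineq[of y "\<xi> - y"] by (simp add: dist_norm)
            qed
            have tail: "massp (ball \<xi> 1) (w i) \<le> ennreal e" if "n2 \<le> i" for i
            proof -
              have "massp (ball \<xi> 1) (w i)
                \<le> massp (- ball 0 R) (w i)"
                using sub by (intro nn_integral_mono) (auto simp: indicator_def)
              also have "\<dots> \<le> ennreal e" unfolding w_def using that rn[of i] by (intro R) auto
              finally show ?thesis .
            qed
            have "massp (ball \<xi> 1) (\<lambda>y. w n y - w k y)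
              \<le> ennreal (2 powr (p - 1)) * (massp (ball \<xi> 1) (w n) + massp (ball \<xi> 1) (w k))"
              by (rule pmass_on_add_le) auto
            also have "\<dots> \<le> ennreal (2 powr (p - 1)) * (ennreal e + ennreal e)" using nk by (intro mult_left_mono add_mono tail) auto
            also have "ennreal e + ennreal e = ennreal (e + e)" using e(1) by (intro ennreal_plus[symmetric]) auto
            also have "ennreal (2 powr (p - 1)) * ennreal (e + e) = ennreal (2 powr (p - 1) * (e + e))"
              by (rule ennreal_mult'[symmetric]) simp
            also have "\<dots> < ennreal a" using e a by (simp add: ennreal_less_iff)
            finally have small: "massp (ball \<xi> 1) (\<lambda>y. w n y - w k y) < ennreal a" .
            show ?thesis
            proof (rule ccontr)
              assume "\<not> ?thesis"
              then have "ennreal a \<le> massp (ball \<xi> 1) (\<lambda>y. w n y - w k y)"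
                unfolding a_def using \<sigma>(1) by (intro mass_lower_bound) auto
              then show False using small by simp
            qed
          qed
        qed
      qed
    qed
  qed
  have cau: "\<exists>n0. \<forall>n\<ge>n0. \<forall>k\<ge>n0. energy A (\<lambda>x. w n x - w k x) \<le> ennreal \<epsilon>" if \<epsilon>: "0 < \<epsilon>" for \<epsilon>
  proof -
    obtain \<tau> \<eta> where h: "\<tau> > 0" "\<eta> > 0" "\<And>f g. f \<in> test_functions \<Longrightarrow> g \<in> test_functions \<Longrightarrow> pmass f = 1 \<Longrightarrow>
      energy A f \<le> ennreal (level A + \<tau>) \<Longrightarrow> energy A g \<le> ennreal (level A + \<tau>) \<Longrightarrow> pmass (\<lambda>x. f x - g x) \<le> ennreal \<eta> \<Longrightarrow>
      energy A (\<lambda>x. f x - g x) \<le> ennreal \<epsilon>"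
      by (rule Lp_close_imp_energy_close[OF assms(1) lb \<epsilon>]) blast
    obtain n2 where n2: "\<And>n. n2 \<le> n \<Longrightarrow> energy A (u n) \<le> ennreal (level A + \<tau>)" using mini[OF h(1)] by blast
    obtain n3 where n3: "\<And>n k. n3 \<le> n \<Longrightarrow> n3 \<le> k \<Longrightarrow> pmass (\<lambda>x. w n x - w k x) \<le> ennreal \<eta>" using Lp[OF h(2)] by blast
    have "energy A (w n) \<le> ennreal (level A + \<tau>)" if "n2 \<le> n" for n
      unfolding w_def using that rn[of n] by (intro n2) auto
    then show ?thesis using n3 by (intro exI[of _ "max n2 n3"]) (auto intro!: h(3) wt wP)
  qed
  obtain U where U[measurable]: "U \<in> borel_measurable borel" and Ulim: "\<And>\<epsilon>. 0 < \<epsilon> \<Longrightarrow> \<exists>n0. \<forall>n\<ge>n0. energy A (\<lambda>x. U x - w n x) \<le> ennreal \<epsilon>"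
    using energy_complete[OF assms(1) wm cau] by blast
  have "energy A U \<le> ennreal (level A)"
  proof (rule energy_limit[where v = w])
    fix \<epsilon> \<delta> :: real assume \<epsilon>: "0 < \<epsilon>" and \<delta>: "0 < \<delta>"
    obtain n2 where n2: "\<And>n. n2 \<le> n \<Longrightarrow> energy A (u n) \<le> ennreal (level A + \<delta>)" using mini[OF \<delta>] by blast
    obtain n3 where n3: "\<And>n. n3 \<le> n \<Longrightarrow> energy A (\<lambda>x. U x - w n x) \<le> ennreal \<epsilon>" using Ulim[OF \<epsilon>] by blast
    have "energy A (w (max n2 n3)) \<le> ennreal (level A + \<delta>)"
      unfolding w_def using rn[of "max n2 n3"] by (intro n2) auto
    then show "\<exists>n. energy A (\<lambda>x. U x - w n x) \<le> ennreal \<epsilon> \<and> energy A (w n) \<le> ennreal (level A + \<delta>)"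
      using n3 by (intro exI[of _ "max n2 n3"]) auto
  qed (use M in \<open>auto simp: M_def\<close>)
  moreover have "pmass U = 1"
  proof (rule pmass_limit[where v = w])
    obtain K where K: "K > 0" "\<And>A u B. A \<in> borel_measurable borel \<Longrightarrow> u \<in> borel_measurable borel \<Longrightarrow> 0 < B \<Longrightarrow> energy A u \<le> ennreal B \<Longrightarrow>
     pmass u \<le> ennreal (K * B powr (p / 2))" using sobolev by metis
    fix \<epsilon> :: real assume \<epsilon>: "0 < \<epsilon>"
    define B where "B = (\<epsilon> / K) powr (2 / p)"
    have B: "B > 0" "K * B powr (p / 2) = \<epsilon>" using K(1) \<epsilon> p_gt by (auto simp: B_def powr_powr)
    obtain n where "energy A (\<lambda>x. U x - w n x) \<le> ennreal B" using Ulim[OF B(1)] by blast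
    from K(2)[OF assms(1) _ B(1) this] show "\<exists>n. pmass (\<lambda>x. U x - w n x) \<le> ennreal \<epsilon>" unfolding B(2) by auto
  qed (auto intro: wP)
  moreover have "U \<in> mag_sobolev s m A"
    unfolding mag_sobolev_iff[OF assms(1)]
  proof (intro conjI allI impI)
    show "energy A U < \<infinity>" using calculation(1) by (rule le_less_trans) simp
    fix \<epsilon> :: real assume "0 < \<epsilon>"
    then obtain n where "energy A (\<lambda>x. U x - w n x) \<le> ennreal \<epsilon>" using Ulim by blast
    then show "\<exists>\<phi>\<in>test_functions. energy A \<phi> < \<infinity> \<and> energy A (\<lambda>x. U x - \<phi> x) \<le> ennreal \<epsilon>"
      using test_in_energy[OF assms(1) lb wt] wt by blast
  qed fact
  ultimately show ?thesis by (intro that)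
qed

end

section \<open>Weak solutions from minimizers\<close>

text \<open>
  The convex function \<open>|z|\<^sup>p\<close> lies above its tangent planes; Young's inequality gives this
  without derivatives. This lower bound replaces the differentiation of \<open>\<integral>|U + t v|\<^sup>p\<close> under
  the integral.
\<close>

lemma norm_powr_ge_tangent:
  fixes a b :: complex and p :: real
  assumes p: "1 < p"
  shows "cmod a powr p + p * (cmod a powr (p - 2) * Re (a * cnj b)) \<le> cmod (a + b) powr p"
proof (cases "a = 0")
  case False
  define x y where "x = cmod a" and "y = cmod (a + b)"
  have x: "x > 0" using False by (simp add: x_def)
  have y: "y \<ge> 0" by (simp add: y_def)
  have "x powr (p - 1) * y \<le> (x powr (p - 1)) powr (p / (p - 1)) / (p / (p - 1)) + y powr p / p"
    using p x y by (intro Youngs_inequality) (auto simp: field_simps)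
  also have "(x powr (p - 1)) powr (p / (p - 1)) = x powr p" using p by (simp add: powr_powr)
  finally have "p * (x powr (p - 1) * y) \<le> p * (x powr p / (p / (p - 1)) + y powr p / p)"
    using p by (intro mult_left_mono) auto
  also have "\<dots> = (p - 1) * x powr p + y powr p" using p by (simp add: field_simps)
  finally have young: "p * (x powr (p - 1) * y) \<le> (p - 1) * x powr p + y powr p" .
  have "Re (cnj a * (a + b)) \<le> x * y"
    using complex_Re_le_cmod[of "cnj a * (a + b)"] by (simp add: norm_mult x_def y_def)
  moreover have "Re (cnj a * (a + b)) = x\<^sup>2 + Re (a * cnj b)"
    unfolding x_def cmod_power2 by (simp add: power2_eq_square algebra_simps)
  ultimately have "x powr (p - 2) * (x\<^sup>2 + Re (a * cnj b)) \<le> x powr (p - 2) * (x * y)"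
    by (intro mult_left_mono) auto
  moreover have "x powr (p - 2) * (x * y) = x powr (p - 1) * y"
  proof -
    have "x powr (p - 2) * x powr 1 = x powr (p - 1)" unfolding powr_add[symmetric] by simp
    then show ?thesis using x by (simp flip: mult.assoc)
  qed
  moreover have "x powr (p - 2) * x\<^sup>2 = x powr p"
  proof -
    have "x powr (p - 2) * x powr 2 = x powr p" unfolding powr_add[symmetric] by simp
    then show ?thesis using x by simp
  qed
  ultimately have "x powr p + x powr (p - 2) * Re (a * cnj b) \<le> x powr (p - 1) * y" by (simp add: distrib_left)
  then have "p * (x powr p + x powr (p - 2) * Re (a * cnj b)) \<le> p * (x powr (p - 1) * y)" using p by (intro mult_left_mono) auto
  then show ?thesis using young unfolding x_def[symmetric] y_def[symmetric] by (simp add: algebra_simps)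
qed (use p in simp)

context mag_setting begin

lemma mag_inner_expand:
  assumes [measurable]: "A \<in> borel_measurable borel" and u: "u \<in> energy_space s m A" and v: "v \<in> energy_space s m A"
  shows "mag_inner s m A (\<lambda>x. u x + of_real t * v x) (\<lambda>x. u x + of_real t * v x)
    = mag_inner s m A u u + 2 * t * mag_inner s m A u v + t\<^sup>2 * mag_inner s m A v v"
proof -
  have [measurable]: "u \<in> borel_measurable borel" "v \<in> borel_measurable borel" using u v by (auto simp: energy_space_def)
  have uu: "integrable lborel (form_density s m A u u)" "integrable lborel (\<lambda>x. u x * cnj (u x))"
    and vv: "integrable lborel (form_density s m A v v)" "integrable lborel (\<lambda>x. v x * cnj (v x))"
    using u v by (auto simp: energy_space_def)
  have prod: "a * b \<le> a * a + b * b" for a b :: real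
    using sum_squares_ge_zero[of a b] sum_squares_bound[of a b] unfolding power2_eq_square by linarith
  have uv1: "integrable lborel (form_density s m A u v)"
  proof (rule Bochner_Integration.integrable_bound[OF Bochner_Integration.integrable_add[OF integrable_norm[OF uu(1)] integrable_norm[OF vv(1)]]])
    show "AE z in lborel. norm (form_density s m A u v z) \<le> norm (norm (form_density s m A u u z) + norm (form_density s m A v v z))"
      unfolding norm_form_density
    proof (intro AE_I2)
      fix z :: "(real^3) \<times> (real^3)"
      let ?a = "cmod (mag_diff A u (fst z) (snd z))" and ?b = "cmod (mag_diff A v (fst z) (snd z))" and ?k = "kern (fst z - snd z)"
      have "?a * ?b * ?k \<le> (?a * ?a + ?b * ?b) * ?k" by (intro mult_right_mono prod) simp
      then show "?a * ?b * ?k \<le> norm (?a * ?a * ?k + ?b * ?b * ?k)" by (simp add: distrib_right)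
    qed
  qed simp
  have uv2: "integrable lborel (\<lambda>x. u x * cnj (v x))"
  proof (rule Bochner_Integration.integrable_bound[OF Bochner_Integration.integrable_add[OF integrable_norm[OF uu(2)] integrable_norm[OF vv(2)]]])
    show "AE x in lborel. norm (u x * cnj (v x)) \<le> norm (norm (u x * cnj (u x)) + norm (v x * cnj (v x)))"
      using prod by (intro AE_I2) (simp add: norm_mult)
  qed simp
  have "Re (form_density s m A (\<lambda>x. u x + of_real t * v x) (\<lambda>x. u x + of_real t * v x) z)
     = Re (form_density s m A u u z) + 2 * t * Re (form_density s m A u v z) + t\<^sup>2 * Re (form_density s m A v v z)" for z
    unfolding form_density_alt mag_diff_add mag_diff_scale by (simp add: algebra_simps power2_eq_square)
  moreover have i: "integrable lborel (\<lambda>z. Re (form_density s m A u u z))" "integrable lborel (\<lambda>z. Re (form_density s m A u v z))"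
      "integrable lborel (\<lambda>z. Re (form_density s m A v v z))"
    by (intro integrable_Re uu vv uv1)+
  ultimately have int1: "(LINT z|lborel. Re (form_density s m A (\<lambda>x. u x + of_real t * v x) (\<lambda>x. u x + of_real t * v x) z))
     = (LINT z|lborel. Re (form_density s m A u u z)) + 2 * t * (LINT z|lborel. Re (form_density s m A u v z)) + t\<^sup>2 * (LINT z|lborel. Re (form_density s m A v v z))"
    by simp
  have w1: "integrable lborel (form_density s m A (\<lambda>x. u x + of_real t * v x) (\<lambda>x. u x + of_real t * v x))"
    and w2: "integrable lborel (\<lambda>x. (u x + of_real t * v x) * cnj (u x + of_real t * v x))"
  proof -
    have "energy A (\<lambda>x. u x + of_real t * v x) \<le> ennreal (1 / (1 - 1/2)) * energy A u + ennreal (1 / (1/2)) * energy A (\<lambda>x. of_real t * v x)"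
      by (rule energy_add_le) auto
    also have "\<dots> < \<infinity>" using u v by (simp add: energy_space_iff energy_scale ennreal_mult_less_top)
    finally have "(\<lambda>x. u x + of_real t * v x) \<in> energy_space s m A" by (simp add: energy_space_iff)
    then show "integrable lborel (form_density s m A (\<lambda>x. u x + of_real t * v x) (\<lambda>x. u x + of_real t * v x))"
      "integrable lborel (\<lambda>x. (u x + of_real t * v x) * cnj (u x + of_real t * v x))" by (auto simp: energy_space_def)
  qed
  have form: "mag_form s m A (\<lambda>x. u x + of_real t * v x) (\<lambda>x. u x + of_real t * v x)
     = mag_form s m A u u + 2 * t * mag_form s m A u v + t\<^sup>2 * mag_form s m A v v"
    unfolding mag_form_def using int1 by (simp only: integral_Re[OF w1] integral_Re[OF uu(1)] integral_Re[OF uv1] integral_Re[OF vv(1)])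
  have "Re ((u x + of_real t * v x) * cnj (u x + of_real t * v x)) = Re (u x * cnj (u x)) + 2 * t * Re (u x * cnj (v x)) + t\<^sup>2 * Re (v x * cnj (v x))" for x
    by (simp add: algebra_simps power2_eq_square)
  moreover have "integrable lborel (\<lambda>x. Re (u x * cnj (u x)))" "integrable lborel (\<lambda>x. Re (u x * cnj (v x)))" "integrable lborel (\<lambda>x. Re (v x * cnj (v x)))"
    by (intro integrable_Re uu vv uv2)+
  ultimately have "(LINT x|lborel. Re ((u x + of_real t * v x) * cnj (u x + of_real t * v x)))
     = (LINT x|lborel. Re (u x * cnj (u x))) + 2 * t * (LINT x|lborel. Re (u x * cnj (v x))) + t\<^sup>2 * (LINT x|lborel. Re (v x * cnj (v x)))"
    by simp
  then have L: "Re (LINT x|lborel. (u x + of_real t * v x) * cnj (u x + of_real t * v x))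
     = Re (LINT x|lborel. u x * cnj (u x)) + 2 * t * Re (LINT x|lborel. u x * cnj (v x)) + t\<^sup>2 * Re (LINT x|lborel. v x * cnj (v x))"
    by (simp only: integral_Re[OF w2] integral_Re[OF uu(2)] integral_Re[OF uv2] integral_Re[OF vv(2)])
  show ?thesis unfolding mag_inner_def form L by (simp add: algebra_simps)
qed

lemma mag_inner_scale:
  "mag_inner s m A (\<lambda>x. of_real c * u x) v = c * mag_inner s m A u v"
proof -
  have "form_density s m A (\<lambda>x. of_real c * u x) v = (\<lambda>z. of_real c * form_density s m A u v z)"
    by (auto simp: fun_eq_iff form_density_alt mag_diff_scale mult.assoc)
  then have "mag_form s m A (\<lambda>x. of_real c * u x) v = c * mag_form s m A u v" by (simp add: mag_form_def)
  moreover have "(LINT x|lborel. of_real c * u x * cnj (v x)) = of_real c * (LINT x|lborel. u x * cnj (v x))"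
    by (simp add: mult.assoc)
  ultimately show ?thesis unfolding mag_inner_def by (simp add: algebra_simps)
qed

definition nonlin :: "(real^3 \<Rightarrow> complex) \<Rightarrow> (real^3 \<Rightarrow> complex) \<Rightarrow> real" where
  "nonlin u v = Re (LINT x|lborel. of_real (norm (u x) powr (p - 2)) * u x * cnj (v x))"

lemma nonlin_scale: "0 < c \<Longrightarrow> nonlin (\<lambda>x. of_real c * u x) v = c powr (p - 1) * nonlin u v"
proof -
  assume c: "0 < c"
  have cc: "c powr (p - 2) * c = c powr (p - 1)"
  proof -
    have "c powr (p - 2) * c powr 1 = c powr (p - 1)" unfolding powr_add[symmetric] by simp
    then show ?thesis using c by simp
  qed
  have "of_real (norm (of_real c * u x) powr (p - 2)) * (of_real c * u x) * cnj (v x)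
     = of_real (c powr (p - 1)) * (of_real (norm (u x) powr (p - 2)) * u x * cnj (v x))" for x
    using c by (simp add: norm_mult powr_mult flip: cc)
  then have "(LINT x|lborel. of_real (norm (of_real c * u x) powr (p - 2)) * (of_real c * u x) * cnj (v x))
     = of_real (c powr (p - 1)) * (LINT x|lborel. of_real (norm (u x) powr (p - 2)) * u x * cnj (v x))"
    by (simp only: integral_mult_right_zero)
  then show ?thesis by (simp add: nonlin_def)
qed

lemma nonlin_integrable:
  assumes [measurable]: "u \<in> borel_measurable borel" "v \<in> borel_measurable borel" and P: "pmass u < \<infinity>" "pmass v < \<infinity>"
  shows "integrable lborel (\<lambda>x. of_real (norm (u x) powr (p - 2)) * u x * cnj (v x))"
proof (rule integrableI_bounded)
  have "(\<integral>\<^sup>+x. ennreal (norm (of_real (norm (u x) powr (p - 2)) * u x * cnj (v x))) \<partial>lborel)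
     \<le> (\<integral>\<^sup>+x. ennreal (cmod (u x) powr p) + ennreal (cmod (v x) powr p) \<partial>lborel)"
  proof (intro nn_integral_mono)
    fix x
    define a b where "a = cmod (u x)" and "b = cmod (v x)"
    have ab: "a \<ge> 0" "b \<ge> 0" by (auto simp: a_def b_def)
    have "a powr (p - 2) * a * b \<le> max a b powr p"
    proof -
      have "a powr (p - 2) * a * b \<le> max a b powr (p - 2) * max a b * max a b"
        using ab p_gt by (intro mult_mono powr_mono2) auto
      also have "\<dots> = max a b powr (p - 2) * max a b powr 2" using ab by (simp add: power2_eq_square)
      also have "\<dots> = max a b powr p" unfolding powr_add[symmetric] by simp
      finally show ?thesis .
    qed
    also have "\<dots> \<le> a powr p + b powr p" by (cases "a \<le> b") (auto simp: max_def)
    finally show "ennreal (norm (of_real (norm (u x) powr (p - 2)) * u x * cnj (v x))) \<le> ennreal (cmod (u x) powr p) + ennreal (cmod (v x) powr p)"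
      by (simp add: norm_mult a_def b_def ennreal_leI flip: ennreal_plus)
  qed
  also have "\<dots> = pmass u + pmass v" unfolding pmass_def by (subst nn_integral_add) auto
  also have "\<dots> < \<infinity>" using P by simp
  finally show "(\<integral>\<^sup>+x. ennreal (norm (of_real (norm (u x) powr (p - 2)) * u x * cnj (v x))) \<partial>lborel) < \<infinity>" .
qed measurable

lemma pmass_eq_integral:
  assumes [measurable]: "u \<in> borel_measurable borel" and "pmass u < \<infinity>"
  shows "integrable lborel (\<lambda>x. cmod (u x) powr p)" "pmass u = ennreal (LINT x|lborel. cmod (u x) powr p)" "0 \<le> (LINT x|lborel. cmod (u x) powr p)"
proof -
  show i: "integrable lborel (\<lambda>x. cmod (u x) powr p)" using assms unfolding pmass_def by (intro integrableI_nonneg) auto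
  show "pmass u = ennreal (LINT x|lborel. cmod (u x) powr p)" unfolding pmass_def using i by (intro nn_integral_eq_integral) auto
  show "0 \<le> (LINT x|lborel. cmod (u x) powr p)" by (intro integral_nonneg_AE) auto
qed

text \<open>
  The energy of \<open>U + t v\<close> is a quadratic polynomial in \<open>t\<close>. By \<open>norm_powr_ge_tangent\<close> and
  \<open>level_le\<close> it lies above \<open>level A * (1 + p * t * J)\<^bsup>2/p\<^esup>\<close>, for small \<open>t\<close>, where
  \<open>J = nonlin U v\<close>, with equality at \<open>t = 0\<close>. So the derivatives agree there.
\<close>

lemma minimizer_euler_lagrange:
  assumes Am[measurable]: "A \<in> borel_measurable borel" and U: "U \<in> mag_sobolev s m A" and P: "pmass U = 1" and N: "energy A U \<le> ennreal (level A)"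
    and M: "0 < level A" and v: "v \<in> mag_sobolev s m A"
  shows "mag_inner s m A U v = level A * nonlin U v"
proof -
  note [measurable] = sobolevD(1)[OF U] sobolevD(1)[OF v]
  have Pv: "pmass v < \<infinity>" using v pmass_finite[OF Am sobolevD(1)[OF v]] by (simp add: mag_sobolev_iff)
  have PU: "pmass U < \<infinity>" using P by simp
  define J where "J = nonlin U v"
  define a b c where "a = mag_inner s m A U U" and "b = mag_inner s m A U v" and "c = mag_inner s m A v v"
  have a: "a \<le> level A"
  proof -
    have "ennreal a \<le> ennreal (level A)" using mag_inner_self(2)[OF Am sobolevD(2)[OF U]] N by (simp add: a_def)
    then show ?thesis using M by (subst (asm) ennreal_le_iff) auto
  qed
  have low: "level A * (1 + p * t * J) powr (2 / p) \<le> a + 2 * t * b + t\<^sup>2 * c" if pos: "0 \<le> 1 + p * t * J" for t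
  proof -
    define w where "w x = U x + of_real t * v x" for x
    have w: "w \<in> mag_sobolev s m A" unfolding w_def by (intro sobolev_add sobolev_scale Am U v)
    note [measurable] = sobolevD(1)[OF w]
    have Pw: "pmass w < \<infinity>" using w pmass_finite[OF Am sobolevD(1)[OF w]] by (simp add: mag_sobolev_iff)
    define Q where "Q = (LINT x|lborel. cmod (w x) powr p)"
    have "(LINT x|lborel. cmod (U x) powr p + p * t * Re (of_real (norm (U x) powr (p - 2)) * U x * cnj (v x))) \<le> Q"
      unfolding Q_def
    proof (rule integral_mono)
      show "integrable lborel (\<lambda>x. cmod (U x) powr p + p * t * Re (of_real (norm (U x) powr (p - 2)) * U x * cnj (v x)))"
        using pmass_eq_integral(1)[OF _ PU] integrable_Re[OF nonlin_integrable[OF _ _ PU Pv]] by simp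
      show "integrable lborel (\<lambda>x. cmod (w x) powr p)" by (rule pmass_eq_integral(1)[OF _ Pw]) simp
      fix x
      have "Re (U x * cnj (of_real t * v x)) = t * Re (U x * cnj (v x))" by (simp add: algebra_simps)
      moreover have "Re (of_real (norm (U x) powr (p - 2)) * U x * cnj (v x)) = norm (U x) powr (p - 2) * Re (U x * cnj (v x))"
        by (simp add: algebra_simps)
      ultimately show "cmod (U x) powr p + p * t * Re (of_real (norm (U x) powr (p - 2)) * U x * cnj (v x)) \<le> cmod (w x) powr p"
        using norm_powr_ge_tangent[of p "U x" "of_real t * v x"] p_gt by (simp add: w_def mult_ac)
    qed
    also have "(LINT x|lborel. cmod (U x) powr p + p * t * Re (of_real (norm (U x) powr (p - 2)) * U x * cnj (v x)))
       = (LINT x|lborel. cmod (U x) powr p) + p * t * J"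
      using pmass_eq_integral(1)[OF _ PU] integrable_Re[OF nonlin_integrable[OF _ _ PU Pv]]
      by (simp add: J_def nonlin_def integral_Re[OF nonlin_integrable[OF _ _ PU Pv], symmetric])
    also have "(LINT x|lborel. cmod (U x) powr p) = 1"
      using pmass_eq_integral(2)[OF _ PU] P by (simp add: ennreal_eq_1)
    finally have Q: "1 + p * t * J \<le> Q" .
    have "pmass w = ennreal Q" unfolding Q_def by (rule pmass_eq_integral(2)[OF _ Pw]) simp
    then have "ennreal (level A * Q powr (2 / p)) \<le> energy A w" using Q pos by (intro level_le[OF Am w]) auto
    also have "energy A w = ennreal (mag_inner s m A w w)" using mag_inner_self(2)[OF Am sobolevD(2)[OF w]] by simp
    finally have "level A * Q powr (2 / p) \<le> mag_inner s m A w w"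
      using mag_inner_self(1)[OF Am sobolevD(2)[OF w]] by (subst (asm) ennreal_le_iff) auto
    moreover have "level A * (1 + p * t * J) powr (2 / p) \<le> level A * Q powr (2 / p)"
      using Q pos M p_gt by (intro mult_left_mono powr_mono2) auto
    moreover have "mag_inner s m A w w = a + 2 * t * b + t\<^sup>2 * c"
      unfolding w_def a_def b_def c_def by (rule mag_inner_expand[OF Am sobolevD(2)[OF U] sobolevD(2)[OF v]])
    ultimately show ?thesis by linarith
  qed
  have a_eq: "a = level A" using low[of 0] a by simp
  define g where "g t = a + 2 * t * b + t\<^sup>2 * c - level A * (1 + p * t * J) powr (2 / p)" for t
  have "(g has_real_derivative (2 * b - level A * (2 * J))) (at 0)"
    unfolding g_def using p_gt by (auto intro!: derivative_eq_intros)
  moreover have "0 < 1 / (p * \<bar>J\<bar> + 1)" using p_gt by (intro divide_pos_pos add_nonneg_pos) auto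
  moreover have "\<forall>y. \<bar>0 - y\<bar> < 1 / (p * \<bar>J\<bar> + 1) \<longrightarrow> g 0 \<le> g y"
  proof (intro allI impI)
    fix y assume y: "\<bar>0 - y\<bar> < 1 / (p * \<bar>J\<bar> + 1)"
    have pJ: "0 < p * \<bar>J\<bar> + 1" using p_gt by (intro add_nonneg_pos) auto
    have "\<bar>y\<bar> * (p * \<bar>J\<bar> + 1) < 1" using y pJ by (simp add: field_simps)
    then have "\<bar>y\<bar> * (p * \<bar>J\<bar>) \<le> 1" by (simp add: distrib_left)
    moreover have "\<bar>p * y * J\<bar> = \<bar>y\<bar> * (p * \<bar>J\<bar>)" using p_gt by (simp add: abs_mult)
    ultimately have "0 \<le> 1 + p * y * J" by linarith
    from low[OF this] show "g 0 \<le> g y" by (simp add: g_def a_eq)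
  qed
  ultimately have "2 * b - level A * (2 * J) = 0" by (rule DERIV_local_min)
  then show ?thesis by (simp add: b_def J_def)
qed

text \<open>
  The two sides of the Euler-Lagrange equation have degrees \<open>1\<close> and \<open>p - 1\<close> in \<open>U\<close>, so a
  multiple of \<open>U\<close> absorbs the factor \<open>level A\<close>.
\<close>

lemma minimizer_gives_weak_solution:
  assumes Am: "A \<in> borel_measurable borel" and U: "U \<in> mag_sobolev s m A" and P: "pmass U = 1" and N: "energy A U \<le> ennreal (level A)"
    and M: "0 < level A"
  shows "\<exists>u. weak_solution s m p A u \<and> \<not> (AE x in lborel. u x = 0)"
proof (intro exI conjI)
  define c where "c = level A powr (1 / (p - 2))"
  have c: "c > 0" "c powr (p - 2) = level A" using M p_gt by (auto simp: c_def powr_powr)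
  have cc: "c powr (p - 1) = c * level A"
  proof -
    have "c powr (p - 1) = c powr 1 * c powr (p - 2)" unfolding powr_add[symmetric] by simp
    then show ?thesis using c by simp
  qed
  show "weak_solution s m p A (\<lambda>x. of_real c * U x)"
    unfolding weak_solution_def
  proof (intro conjI ballI)
    show "(\<lambda>x. of_real c * U x) \<in> mag_sobolev s m A" by (rule sobolev_scale[OF Am U])
    fix v assume v: "v \<in> mag_sobolev s m A"
    have "mag_inner s m A (\<lambda>x. of_real c * U x) v = c * (level A * nonlin U v)"
      using minimizer_euler_lagrange[OF Am U P N M v] by (simp add: mag_inner_scale)
    also have "\<dots> = nonlin (\<lambda>x. of_real c * U x) v" using c cc by (simp add: nonlin_scale)
    finally show "mag_inner s m A (\<lambda>x. of_real c * U x) v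
      = Re (LINT x|lborel. of_real (norm (of_real c * U x) powr (p - 2)) * (of_real c * U x) * cnj (v x))"
      by (simp only: nonlin_def)
  qed
  show "\<not> (AE x in lborel. of_real c * U x = 0)"
  proof
    assume "AE x in lborel. of_real c * U x = 0"
    then have "AE x in lborel. ennreal (cmod (U x) powr p) = 0" by eventually_elim (use c in auto)
    then have "pmass U = (\<integral>\<^sup>+x. 0 \<partial>(lborel :: (real^3) measure))" unfolding pmass_def by (rule nn_integral_cong_AE)
    then show False using P by simp
  qed
qed

section \<open>Translations combined with gauge transformations\<close>

text \<open>
  The phase \<open>e\<^bsup>i x \<bullet> h\<^esup>\<close> compensates the addition of the constant \<open>h\<close> to the field.
\<close>

definition gauge :: "real^3 \<Rightarrow> real^3 \<Rightarrow> (real^3 \<Rightarrow> complex) \<Rightarrow> real^3 \<Rightarrow> complex" where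
  "gauge \<xi> h u x = exp (\<i> * of_real (x \<bullet> h)) * u (x + \<xi>)"

lemma gauge_test: "u \<in> test_functions \<Longrightarrow> gauge \<xi> h u \<in> test_functions"
  unfolding gauge_def[abs_def] by (rule test_translate)

lemma cmod_gauge: "cmod (gauge \<xi> h u x) = cmod (u (x + \<xi>))"
  by (simp add: gauge_def norm_mult)

lemma gauge_local_integral:
  assumes [measurable]: "f \<in> borel_measurable borel" "u \<in> borel_measurable borel" "S \<in> sets borel"
  shows "(\<integral>\<^sup>+y. f (cmod (gauge \<xi> h u y)) * indicator S (y + \<xi>) \<partial>lborel) = (\<integral>\<^sup>+y. f (cmod (u y)) * indicator S y \<partial>lborel)"
  using nn_integral_translate[of "\<lambda>y. f (cmod (u y)) * indicator S y" \<xi>] by (simp add: cmod_gauge)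

lemma pmass_gauge: "u \<in> borel_measurable borel \<Longrightarrow> pmass (gauge \<xi> h u) = pmass u"
  using gauge_local_integral[of "\<lambda>t. ennreal (t powr p)" u UNIV \<xi> h] by (simp add: pmass_def)

lemma sqmass_gauge: "u \<in> borel_measurable borel \<Longrightarrow> sqmass (gauge \<xi> h u) = sqmass u"
  using gauge_local_integral[of "\<lambda>t. ennreal (t\<^sup>2)" u UNIV \<xi> h] by (simp add: sqmass_def)

lemma energy_gauge:
  assumes [measurable]: "A \<in> borel_measurable borel" "u \<in> borel_measurable borel"
  shows "energy (\<lambda>x. A (x + \<xi>) + h) (gauge \<xi> h u) = energy A u"
proof -
  have mid: "((x + \<xi>) + (y + \<xi>)) /\<^sub>R 2 = (x + y) /\<^sub>R 2 + \<xi>" for x y :: "real^3"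
    by (simp add: vec_eq_iff field_simps)
  have "mag_diff (\<lambda>x. A (x + \<xi>) + h) (gauge \<xi> h u) x y = exp (\<i> * of_real (y \<bullet> h)) * mag_diff A u (x + \<xi>) (y + \<xi>)" for x y
  proof -
    have "exp (- (\<i> * of_real ((x - y) \<bullet> (A ((x + y) /\<^sub>R 2 + \<xi>) + h)))) * exp (\<i> * of_real (x \<bullet> h))
       = exp (\<i> * of_real (y \<bullet> h)) * exp (- (\<i> * of_real ((x - y) \<bullet> A ((x + y) /\<^sub>R 2 + \<xi>))))"
      unfolding exp_add[symmetric] by (simp add: inner_add_right inner_diff_left algebra_simps)
    then show ?thesis unfolding mag_diff_def gauge_def mid by (simp add: algebra_simps)
  qed
  then have eq: "cmod (mag_diff (\<lambda>x. A (x + \<xi>) + h) (gauge \<xi> h u) x y) = cmod (mag_diff A u (x + \<xi>) (y + \<xi>))" for x y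
    by (simp add: norm_mult)
  define F where "F z = ennreal (edens A u z)" for z
  have [measurable]: "F \<in> borel_measurable borel" unfolding F_def by measurable
  have "kinetic (\<lambda>x. A (x + \<xi>) + h) (gauge \<xi> h u) = (\<integral>\<^sup>+z. F (z + (\<xi>, \<xi>)) \<partial>lborel)"
    unfolding kinetic_def eq by (simp add: F_def)
  also have "\<dots> = kinetic A u" unfolding kinetic_def F_def[symmetric] by (rule nn_integral_translate) measurable
  finally show ?thesis using sqmass_gauge[OF assms(2)] by (simp add: energy_def)
qed

text \<open>
  Where a continuous function exceeds a bound, it does so on an open set, which is not a null
  set.
\<close>

lemma esssup_bound_everywhere:
  fixes f :: "nat \<Rightarrow> real^3 \<Rightarrow> real^3"
  assumes cont: "\<And>n. continuous_on UNIV (f n)"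
    and sup: "(SUP n. esssup (restrict_space lborel (cball 0 R)) (\<lambda>x. ereal (norm (f n x)))) < \<infinity>"
  obtains C where "C > 0" "\<And>n x. norm x < R \<Longrightarrow> norm (f n x) \<le> C"
proof -
  let ?E = "\<lambda>n. esssup (restrict_space lborel (cball 0 R)) (\<lambda>x. ereal (norm (f n x)))"
  obtain C where C: "(SUP n. ?E n) \<le> ereal C" using sup by (cases "SUP n. ?E n") auto
  have "norm (f n x) \<le> max C 1" if x: "norm x < R" for n x
  proof (rule ccontr)
    assume "\<not> norm (f n x) \<le> max C 1"
    then have "norm (f n x) > C" by simp
    define S where "S = {y. C < norm (f n y)} \<inter> ball 0 R"
    have "open S" unfolding S_def using cont[of n] by (intro open_Int open_Collect_less continuous_intros) auto
    moreover have "x \<in> S" using x \<open>norm (f n x) > C\<close> by (simp add: S_def)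
    ultimately have "\<not> negligible S" using open_not_negligible by blast
    have fm: "f n \<in> borel_measurable borel" using cont by (intro borel_measurable_continuous_onI)
    have "AE y in restrict_space lborel (cball 0 R). ereal (norm (f n y)) \<le> ?E n" by (rule esssup_AE)
    then have "AE y in lborel. y \<in> cball 0 R \<longrightarrow> ereal (norm (f n y)) \<le> ?E n"
      by (subst (asm) AE_restrict_space_iff) auto
    then have "AE y in lborel. y \<notin> S"
    proof (rule AE_mp, intro AE_I2 impI notI)
      fix y assume "y \<in> cball 0 R \<longrightarrow> ereal (norm (f n y)) \<le> ?E n" "y \<in> S"
      then have "ereal (norm (f n y)) \<le> ?E n" by (auto simp: S_def)
      also have "\<dots> \<le> (SUP n. ?E n)" by (rule SUP_upper) simp
      also have "\<dots> \<le> ereal C" by (rule C)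
      finally show False using \<open>y \<in> S\<close> by (simp add: S_def)
    qed
    moreover have "S \<in> sets borel" using \<open>open S\<close> by simp
    ultimately have "S \<in> null_sets lborel" by (subst (asm) AE_iff_null) (auto simp: null_sets_def)
    then have "negligible S" using negligible_iff_null_sets null_sets_completionI by blast
    then show False using \<open>\<not> negligible S\<close> by contradiction
  qed
  then show ?thesis by (intro that[of "max C 1"]) auto
qed

end

section \<open>Existence of minimizers\<close>

context mag_setting begin

text \<open>
  The \<open>L\<^sup>p\<close> norm is \<open>1\<close> along the sequence, so \<open>vanishing\<close> provides a unit ball that carries a
  fixed \<open>L\<^sup>2\<close> mass, and \<open>energy_tight\<close> applies around its centre.
\<close>

lemma concentrating_minimizing_sequence:
  assumes [measurable]: "A \<in> borel_measurable borel" and lb: "locally_bounded A"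
  obtains u :: "nat \<Rightarrow> real^3 \<Rightarrow> complex" and \<xi> where
    "\<And>n. u n \<in> test_functions" "\<And>n. pmass (u n) = 1"
    "\<And>\<tau>. 0 < \<tau> \<Longrightarrow> \<exists>n0. \<forall>n\<ge>n0. energy A (u n) \<le> ennreal (level A + \<tau>)" "\<And>n. energy A (u n) \<le> ennreal (level A + 1)"
    "\<And>\<epsilon>. 0 < \<epsilon> \<Longrightarrow> \<exists>R n0. \<forall>n\<ge>n0. massp (- ball (\<xi> n) R) (u n) \<le> ennreal \<epsilon>"
proof -
  have M: "level A > 0" by (rule level_pos[OF assms(1) lb])
  have M1: "level A + 1 > 0" using M by simp
  have "\<exists>\<phi>\<in>test_functions. pmass \<phi> = 1 \<and> energy A \<phi> \<le> ennreal (level A + 1 / real (Suc n))" for n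
    by (rule almost_minimizing_test[OF assms(1) lb, of "1 / real (Suc n)"]) auto
  then obtain u where u: "\<And>n. u n \<in> test_functions" "\<And>n. pmass (u n) = 1" "\<And>n. energy A (u n) \<le> ennreal (level A + 1 / real (Suc n))"
    by metis
  have mini: "\<exists>n0. \<forall>n\<ge>n0. energy A (u n) \<le> ennreal (level A + \<tau>)" if \<tau>: "0 < \<tau>" for \<tau>
  proof -
    obtain n0 where n0: "1 / real (Suc n0) < \<tau>" using reals_Archimedean[OF \<tau>] by (auto simp: inverse_eq_divide)
    have "energy A (u n) \<le> ennreal (level A + \<tau>)" if "n0 \<le> n" for n
    proof -
      have "1 / real (Suc n) \<le> 1 / real (Suc n0)" using that by (intro divide_left_mono) auto
      then show ?thesis using n0 by (intro order_trans[OF u(3)] ennreal_leI) simp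
    qed
    then show ?thesis by blast
  qed
  have N1: "energy A (u n) \<le> ennreal (level A + 1)" for n
    by (intro order_trans[OF u(3)] ennreal_leI) simp
  obtain \<sigma> where \<sigma>: "\<sigma> > 0" "\<And>A' u. A' \<in> borel_measurable borel \<Longrightarrow> u \<in> borel_measurable borel \<Longrightarrow> energy A' u \<le> ennreal (level A + 1) \<Longrightarrow>
      (\<forall>\<xi>. mass2 (ball \<xi> 1) u \<le> ennreal \<sigma>) \<Longrightarrow> pmass u \<le> ennreal (1 / 2)"
    using vanishing[OF M1, of "1 / 2"] by auto
  have "\<exists>\<xi>. ennreal \<sigma> \<le> mass2 (ball \<xi> 1) (u n)" for n
  proof (rule ccontr)
    assume "\<not> ?thesis"
    then have "\<forall>\<xi>. mass2 (ball \<xi> 1) (u n) \<le> ennreal \<sigma>"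
      by (meson linear)
    from \<sigma>(2)[OF assms(1) test_measurable[OF u(1)] N1 this] have "1 \<le> (1 / 2 :: real)"
      unfolding u(2) by (simp only: ennreal_ge_1)
    then show False by simp
  qed
  then obtain \<xi> where \<xi>: "\<And>n. ennreal \<sigma> \<le> mass2 (ball (\<xi> n) 1) (u n)" by metis
  have tail: "\<exists>R n0. \<forall>n\<ge>n0. massp (- ball (\<xi> n) R) (u n) \<le> ennreal \<epsilon>" if \<epsilon>: "0 < \<epsilon>" for \<epsilon>
  proof -
    obtain R \<tau> where R: "R > 0" "\<tau> > 0" "\<And>u \<xi>. u \<in> test_functions \<Longrightarrow> pmass u = 1 \<Longrightarrow> energy A u \<le> ennreal (level A + \<tau>) \<Longrightarrow>
     ennreal \<sigma> \<le> mass2 (ball \<xi> 1) u \<Longrightarrow>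
     massp (- ball \<xi> R) u \<le> ennreal \<epsilon>"
      by (rule energy_tight[OF assms(1) lb \<sigma>(1) \<epsilon>]) blast
    obtain n0 where "\<And>n. n0 \<le> n \<Longrightarrow> energy A (u n) \<le> ennreal (level A + \<tau>)" using mini[OF R(2)] by blast
    then show ?thesis using R(3)[OF u(1) u(2) _ \<xi>] by blast
  qed
  show ?thesis by (rule that[OF u(1) u(2) mini N1 tail])
qed

lemma gauge_tail:
  assumes "u \<in> borel_measurable borel"
  shows "massp (- ball 0 R) (gauge \<xi> h u) = massp (- ball \<xi> R) u"
proof -
  have "indicator (- ball 0 R) y = (indicator (- ball \<xi> R) (y + \<xi>) :: ennreal)" for y
    by (simp add: indicator_def dist_norm)
  then show ?thesis using gauge_local_integral[of "\<lambda>t. ennreal (t powr p)" u "- ball \<xi> R" \<xi> h] assms by simp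
qed

text \<open>
  Moving every centre to \<open>0\<close> by a gauge transformation changes neither the energy nor, by
  covariance, the field.
\<close>

lemma translation_covariant_minimizer:
  assumes Am[measurable]: "A \<in> borel_measurable borel" and lb: "locally_bounded A"
    and cov: "\<And>\<xi>. \<exists>h. \<forall>x. A (x + \<xi>) + h = A x"
  obtains U where "U \<in> mag_sobolev s m A" "pmass U = 1" "energy A U \<le> ennreal (level A)"
proof -
  obtain u :: "nat \<Rightarrow> real^3 \<Rightarrow> complex" and \<xi> where u:
    "\<And>n. u n \<in> test_functions" "\<And>n. pmass (u n) = 1"
    "\<And>\<tau>. 0 < \<tau> \<Longrightarrow> \<exists>n0. \<forall>n\<ge>n0. energy A (u n) \<le> ennreal (level A + \<tau>)"
    "\<And>\<epsilon>. 0 < \<epsilon> \<Longrightarrow> \<exists>R n0. \<forall>n\<ge>n0. massp (- ball (\<xi> n) R) (u n) \<le> ennreal \<epsilon>"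
    by (rule concentrating_minimizing_sequence[OF Am lb]) blast
  obtain h where h: "\<And>\<xi> x. A (x + \<xi>) + h \<xi> = A x" using cov by metis
  define v where "v n = gauge (\<xi> n) (h (\<xi> n)) (u n)" for n
  have um: "u n \<in> borel_measurable borel" for n by (rule test_measurable[OF u(1)])
  have energy: "energy A (v n) = energy A (u n)" for n
    using energy_gauge[OF Am um, of "\<xi> n" "h (\<xi> n)" n] unfolding h v_def .
  show ?thesis
  proof (rule tight_minimizing_sequence[OF Am lb, of v])
    show "v n \<in> test_functions" for n unfolding v_def by (intro gauge_test u)
    show "pmass (v n) = 1" for n unfolding v_def using u(2) by (simp add: pmass_gauge um)
    show "\<exists>n0. \<forall>n\<ge>n0. energy A (v n) \<le> ennreal (level A + \<tau>)" if "0 < \<tau>" for \<tau> unfolding energy by (rule u(3)[OF that])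
    show "\<exists>R n0. \<forall>n\<ge>n0. massp (- ball 0 R) (v n) \<le> ennreal \<epsilon>" if "0 < \<epsilon>" for \<epsilon>
      unfolding v_def gauge_tail[OF um] by (rule u(4)[OF that])
  qed (rule that)
qed

text \<open>
  Gauge transformed about its centres, the sequence is tight about \<open>0\<close> and almost minimizing
  for the translated fields, with the level of \<open>A\<close>. Cut off at a large radius it loses little
  mass and gains little energy, and then \<open>field_change\<close> passes to the limit field. So the
  level of the limit field is at most that of \<open>A\<close>, up to errors that vanish with \<open>\<epsilon>\<close>.
\<close>

lemma level_le_of_escaping_sequence:
  assumes cont: "continuous_on UNIV A" and lf: "limit_field A \<xi> B"
    and u: "\<And>n. u n \<in> test_functions" "\<And>n. pmass (u n) = 1"
    and mini: "\<And>\<tau>. 0 < \<tau> \<Longrightarrow> \<exists>n0. \<forall>n\<ge>n0. energy A (u n) \<le> ennreal (level A + \<tau>)"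
    and tight: "\<And>\<epsilon>. 0 < \<epsilon> \<Longrightarrow> \<exists>R n0. \<forall>n\<ge>n0. massp (- ball (\<xi> n) R) (u n) \<le> ennreal \<epsilon>"
  shows "level B \<le> level A"
proof -
  have Am[measurable]: "A \<in> borel_measurable borel" using cont by (rule borel_measurable_continuous_onI)
  have lbA: "locally_bounded A" by (rule continuous_locally_bounded[OF cont])
  define M where "M = level A"
  have M: "M > 0" unfolding M_def by (rule level_pos[OF Am lbA])
  have um[measurable]: "u n \<in> borel_measurable borel" for n by (rule test_measurable[OF u(1)])
  obtain H and r :: "nat \<Rightarrow> nat" where r: "strict_mono r" and lim: "\<And>x. (\<lambda>n. A (x + \<xi> (r n)) + H n) \<longlonglongrightarrow> B x"
    and sup: "\<And>K. compact K \<Longrightarrow> (SUP n. esssup (restrict_space lborel K) (\<lambda>x. ereal (norm (A (x + \<xi> (r n)) + H n)))) < \<infinity>"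
    using lf unfolding limit_field_def by blast
  define An where "An n x = A (x + \<xi> (r n)) + H n" for n x
  have contAn: "continuous_on UNIV (An n)" for n
  proof -
    have "continuous_on UNIV (\<lambda>x. A (x + \<xi> (r n)))"
      by (rule continuous_on_compose2[OF cont]) (auto intro!: continuous_intros)
    then show ?thesis unfolding An_def by (intro continuous_intros)
  qed
  have Anm[measurable]: "An n \<in> borel_measurable borel" for n using contAn by (rule borel_measurable_continuous_onI)
  have limAn: "(\<lambda>n. An n x) \<longlonglongrightarrow> B x" for x using lim by (simp add: An_def)
  have Bm[measurable]: "B \<in> borel_measurable borel" by (rule borel_measurable_LIMSEQ_metric[OF Anm limAn])
  have bdA: "\<exists>C>0. \<forall>n x. norm x \<le> R \<longrightarrow> norm (An n x) \<le> C" for R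
  proof -
    have "(SUP n. esssup (restrict_space lborel (cball 0 (R + 1))) (\<lambda>x. ereal (norm (An n x)))) < \<infinity>"
      using sup[of "cball 0 (R + 1)"] by (simp add: An_def)
    then obtain C where "C > 0" "\<And>n x. norm x < R + 1 \<Longrightarrow> norm (An n x) \<le> C"
      using esssup_bound_everywhere[of An, OF contAn] by blast
    then show ?thesis by (intro exI[of _ C]) auto
  qed
  have bdB: "norm (B x) \<le> C" if "\<forall>n x. norm x \<le> R \<longrightarrow> norm (An n x) \<le> C" "norm x \<le> R" for R C x
    by (rule tendsto_upperbound[OF tendsto_norm[OF limAn]]) (use that in \<open>auto intro!: always_eventually\<close>)
  have lbB: "locally_bounded B" unfolding locally_bounded_def using bdA bdB by meson
  have lB: "level B > 0" by (rule level_pos[OF Bm lbB])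
  have bound: "level B * (1 - \<epsilon>) powr (2 / p) \<le> (1 + \<epsilon>) * (M + 2 * \<epsilon>) + \<epsilon>" if \<epsilon>: "0 < \<epsilon>" "\<epsilon> < 1" for \<epsilon>
  proof -
    obtain R1 n1 where R1: "\<And>n. n1 \<le> n \<Longrightarrow> massp (- ball (\<xi> n) R1) (u n) \<le> ennreal \<epsilon>"
      using tight[OF \<epsilon>(1)] by blast
    obtain n2 where n2: "\<And>n. n2 \<le> n \<Longrightarrow> energy A (u n) \<le> ennreal (M + \<epsilon>)" using mini[OF \<epsilon>(1)] unfolding M_def by blast
    define e0 where "e0 = \<epsilon> * c2 / (2 * c1 * (M + 1))"
    have ne: "2 * c1 * (M + 1) > 0" using c1_pos M by simp
    have e0: "e0 > 0" using \<epsilon> ne c2_pos by (simp add: e0_def)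
    obtain \<Lambda> where \<Lambda>: "\<Lambda> > 0" "truncated_kern \<Lambda> \<le> ennreal e0" using truncated_kern_small[OF e0] by auto
    obtain R0 where R0: "1 \<le> R0" "\<And>R \<xi>. R0 \<le> R \<Longrightarrow> \<exists>\<theta> \<eta>. cutoff \<Lambda> \<theta> \<eta> \<and> (\<forall>x\<in>ball \<xi> R. \<theta> x = 1) \<and> (\<forall>x. x \<notin> ball \<xi> (2 * R) \<longrightarrow> \<theta> x = 0)"
      by (rule cutoff_at_scale[OF \<Lambda>(1)]) blast
    define R where "R = max R0 R1"
    have R: "R0 \<le> R" "R1 \<le> R" by (auto simp: R_def)
    obtain \<theta> \<eta> where cut: "cutoff \<Lambda> \<theta> \<eta>" and in1: "\<And>x. x \<in> ball 0 R \<Longrightarrow> \<theta> x = 1" and out0: "\<And>x. x \<notin> ball 0 (2 * R) \<Longrightarrow> \<theta> x = 0"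
      using R0(2)[OF R(1)] by blast
    note s\<theta> = cutoffD(1)[OF cut] and [measurable] = cutoffD(3,4)[OF cut] and part = cutoffD(5-7)[OF cut] and le1 = cutoffD(8)[OF cut]
    obtain C where C: "C > 0" "\<forall>n x. norm x \<le> 2 * R + 1 \<longrightarrow> norm (An n x) \<le> C" using bdA by blast
    have bd1: "norm (An n x) \<le> C" if "norm x \<le> 2 * R + 1" for n x using C(2) that by blast
    obtain n3 where n3: "\<And>n w. n3 \<le> n \<Longrightarrow> w \<in> borel_measurable borel \<Longrightarrow> (\<forall>x. 2 * R \<le> norm x \<longrightarrow> w x = 0) \<Longrightarrow> pmass w \<le> 1 \<Longrightarrow>
       energy B w \<le> ennreal (1 + \<epsilon>) * energy (An n) w + ennreal \<epsilon>"
      using field_change[OF Anm Bm bd1 bdB[OF C(2)] limAn \<epsilon>(1) C(1)] by blast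
    define n where "n = max n1 (max n2 n3)"
    have rn: "n \<le> r n" using seq_suble[OF r] .
    define v where "v = gauge (\<xi> (r n)) (H n) (u (r n))"
    have vt: "v \<in> test_functions" unfolding v_def by (intro gauge_test u)
    note [measurable] = test_measurable[OF vt]
    have Pv: "pmass v = 1" unfolding v_def using u(2) by (simp add: pmass_gauge)
    have Nv: "energy (An n) v \<le> ennreal (M + \<epsilon>)"
    proof -
      have "energy (An n) v = energy A (u (r n))" unfolding An_def v_def by (rule energy_gauge) auto
      also have "\<dots> \<le> ennreal (M + \<epsilon>)" using rn by (intro n2) (simp add: n_def)
      finally show ?thesis .
    qed
    have tail: "massp (- ball 0 R) v \<le> ennreal \<epsilon>"
    proof -
      have "massp (- ball 0 R) v
        \<le> massp (- ball 0 R1) v"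
        using R(2) by (intro nn_integral_mono) (auto simp: indicator_def)
      also have "\<dots> = massp (- ball (\<xi> (r n)) R1) (u (r n))"
        unfolding v_def by (rule gauge_tail) simp
      also have "\<dots> \<le> ennreal \<epsilon>" using rn by (intro R1) (simp add: n_def)
      finally show ?thesis .
    qed
    define w where "w x = of_real (\<theta> x) * v x" for x
    have wt: "w \<in> test_functions" unfolding w_def by (rule test_mult[OF s\<theta> vt])
    note wm[measurable] = test_measurable[OF wt]
    have Pw1: "pmass w \<le> 1"
    proof -
      have "pmass w \<le> pmass v" unfolding pmass_def
      proof (intro nn_integral_mono ennreal_leI powr_mono2)
        show "cmod (w x) \<le> cmod (v x)" for x
          using part[of x] le1[of x] by (simp add: w_def norm_mult mult_left_le_one_le)
      qed (use p_gt in auto)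
      then show ?thesis using Pv by simp
    qed
    obtain P where P: "pmass w = ennreal P" "P \<ge> 0" using Pw1 by (cases "pmass w") (auto simp: top_unique)
    have Plow: "1 - \<epsilon> \<le> P"
    proof -
      have "1 = pmass v" using Pv by simp
      also have "\<dots> \<le> (\<integral>\<^sup>+y. ennreal (cmod (w y) powr p) + ennreal (cmod (v y) powr p) * indicator (- ball 0 R) y \<partial>lborel)"
        unfolding pmass_def
      proof (intro nn_integral_mono)
        show "ennreal (cmod (v y) powr p) \<le> ennreal (cmod (w y) powr p) + ennreal (cmod (v y) powr p) * indicator (- ball 0 R) y" for y
          using in1[of y] by (cases "y \<in> ball 0 R") (auto simp: w_def)
      qed
      also have "\<dots> = pmass w + massp (- ball 0 R) v"
        unfolding pmass_def by (subst nn_integral_add) auto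
      also have "\<dots> \<le> ennreal P + ennreal \<epsilon>" unfolding P(1) by (intro add_left_mono tail)
      also have "\<dots> = ennreal (P + \<epsilon>)" using P \<epsilon> by (intro ennreal_plus[symmetric]) auto
      finally have "1 \<le> P + \<epsilon>" by (simp only: ennreal_ge_1)
      then show ?thesis by simp
    qed
    have Nw: "energy (An n) w \<le> ennreal (M + 2 * \<epsilon>)"
    proof -
      have "energy (An n) w \<le> energy (An n) w + energy (An n) (\<lambda>x. of_real (\<eta> x) * v x)" by simp
      also have "\<dots> \<le> energy (An n) v + ennreal (2 * c1) * (truncated_kern \<Lambda> * sqmass v)"
        unfolding w_def by (rule energy_localization[OF _ _ cut]) auto
      also have "\<dots> \<le> ennreal (M + \<epsilon>) + ennreal (2 * c1) * (ennreal e0 * ennreal ((M + 1) / c2))"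
      proof (intro add_mono mult_mono Nv \<Lambda>(2))
        have "energy (An n) v \<le> ennreal (M + 1)" using \<epsilon> by (intro order_trans[OF Nv] ennreal_leI) simp
        then show "sqmass v \<le> ennreal ((M + 1) / c2)" using M by (intro energy_parts_le(1)) auto
      qed auto
      also have "ennreal (2 * c1) * (ennreal e0 * ennreal ((M + 1) / c2)) = ennreal (2 * c1 * (e0 * ((M + 1) / c2)))"
        using c1_pos e0 by (subst ennreal_mult', simp, subst ennreal_mult', auto)
      also have "2 * c1 * (e0 * ((M + 1) / c2)) = \<epsilon>"
      proof -
        have e: "e0 * (2 * c1 * (M + 1)) = \<epsilon> * c2" unfolding e0_def by (rule divide_mult_cancel[OF less_imp_neq[OF ne, symmetric]])
        have "2 * c1 * (e0 * ((M + 1) / c2)) = e0 * (2 * c1 * (M + 1)) / c2" by simp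
        also have "\<dots> = \<epsilon> * c2 / c2" by (simp only: e)
        finally show ?thesis using c2_pos by simp
      qed
      also have "ennreal (M + \<epsilon>) + ennreal \<epsilon> = ennreal (M + \<epsilon> + \<epsilon>)" using M \<epsilon> by (intro ennreal_plus[symmetric]) auto
      also have "M + \<epsilon> + \<epsilon> = M + 2 * \<epsilon>" by simp
      finally show ?thesis .
    qed
    have "ennreal (level B * P powr (2 / p)) \<le> energy B w"
      by (intro level_le[OF Bm] test_in_sobolev[OF Bm lbB wt] P)
    also have "\<dots> \<le> ennreal (1 + \<epsilon>) * energy (An n) w + ennreal \<epsilon>"
    proof (rule n3)
      show "n3 \<le> n" by (simp add: n_def)
      show "\<forall>x. 2 * R \<le> norm x \<longrightarrow> w x = 0" using out0 by (simp add: w_def)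
    qed (use Pw1 in auto)
    also have "\<dots> \<le> ennreal (1 + \<epsilon>) * ennreal (M + 2 * \<epsilon>) + ennreal 1 * ennreal \<epsilon>"
      using Nw by (intro add_mono mult_left_mono) auto
    also have "\<dots> = ennreal ((1 + \<epsilon>) * (M + 2 * \<epsilon>) + 1 * \<epsilon>)" using M \<epsilon> by (intro ennreal_lincomb[symmetric]) auto
    finally have "level B * P powr (2 / p) \<le> (1 + \<epsilon>) * (M + 2 * \<epsilon>) + \<epsilon>" using M \<epsilon> by (subst (asm) ennreal_le_iff) auto
    moreover have "level B * (1 - \<epsilon>) powr (2 / p) \<le> level B * P powr (2 / p)"
      using lB Plow \<epsilon> p_gt by (intro mult_left_mono powr_mono2) auto
    ultimately show ?thesis by linarith
  qed
  have "((\<lambda>\<epsilon>. level B * (1 - \<epsilon>) powr (2 / p)) \<longlongrightarrow> level B * (1 - 0) powr (2 / p)) (at_right 0)"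
    by (intro tendsto_intros) auto
  moreover have "((\<lambda>\<epsilon>. (1 + \<epsilon>) * (M + 2 * \<epsilon>) + \<epsilon>) \<longlongrightarrow> (1 + 0) * (M + 2 * 0) + 0) (at_right 0)"
    by (intro tendsto_intros)
  moreover have "\<forall>\<^sub>F \<epsilon> in at_right 0. level B * (1 - \<epsilon>) powr (2 / p) \<le> (1 + \<epsilon>) * (M + 2 * \<epsilon>) + \<epsilon>"
    by (subst eventually_at_right[of 0 1]) (auto intro!: exI[of _ 1] bound)
  ultimately have "level B * (1 - 0) powr (2 / p) \<le> (1 + 0) * (M + 2 * 0) + 0"
    by (intro tendsto_le[of "at_right (0::real)"]) auto
  then show ?thesis by (simp add: M_def)
qed

text \<open>
  A bound uniform in the field, so that the infimum of the levels of all limit fields is one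
  of a set bounded below. The term \<open>Inf {}\<close> covers fields without admissible functions.
\<close>

lemma level_lower_bound: "min 0 (Inf {}) \<le> level A"
proof (cases "{(mag_norm s m A u)\<^sup>2 |u. u \<in> mag_sobolev s m A \<and> Lp_norm p u = 1} = {}")
  case True
  then show ?thesis unfolding min_level_def by (simp only:)
next
  case False
  then have "0 \<le> level A" unfolding min_level_def by (intro cInf_greatest) auto
  then show ?thesis by simp
qed

text \<open>
  The concentration points themselves form the sequence \<open>\<Xi>\<close> to which the gap is applied, so
  they must be bounded.
\<close>

lemma energy_gap_minimizer:
  assumes cont: "continuous_on UNIV A" and lf: "\<forall>\<Xi>\<in>unbounded_seqs. limit_field A \<Xi> (B \<Xi>)"
    and gap: "level A < (INF \<Xi>\<in>unbounded_seqs. level (B \<Xi>))"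
  obtains U where "U \<in> mag_sobolev s m A" "pmass U = 1" "energy A U \<le> ennreal (level A)"
proof -
  have Am: "A \<in> borel_measurable borel" using cont by (rule borel_measurable_continuous_onI)
  have lb: "locally_bounded A" by (rule continuous_locally_bounded[OF cont])
  obtain u :: "nat \<Rightarrow> real^3 \<Rightarrow> complex" and \<xi> where u:
    "\<And>n. u n \<in> test_functions" "\<And>n. pmass (u n) = 1"
    "\<And>\<tau>. 0 < \<tau> \<Longrightarrow> \<exists>n0. \<forall>n\<ge>n0. energy A (u n) \<le> ennreal (level A + \<tau>)"
    "\<And>\<epsilon>. 0 < \<epsilon> \<Longrightarrow> \<exists>R n0. \<forall>n\<ge>n0. massp (- ball (\<xi> n) R) (u n) \<le> ennreal \<epsilon>"
    by (rule concentrating_minimizing_sequence[OF Am lb]) blast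
  have "bounded (range \<xi>)"
  proof (rule ccontr)
    assume "\<not> bounded (range \<xi>)"
    then have \<xi>: "\<xi> \<in> unbounded_seqs" by (simp add: unbounded_seqs_def)
    have "bdd_below ((\<lambda>\<Xi>. level (B \<Xi>)) ` unbounded_seqs)"
      by (rule bdd_belowI[of _ "min 0 (Inf {})"]) (use level_lower_bound in auto)
    then have "(INF \<Xi>\<in>unbounded_seqs. level (B \<Xi>)) \<le> level (B \<xi>)" using \<xi> by (rule cINF_lower)
    also have "\<dots> \<le> level A" using lf \<xi> by (intro level_le_of_escaping_sequence[OF cont _ u]) auto
    finally show False using gap by simp
  qed
  then obtain b where b: "\<And>n. norm (\<xi> n) \<le> b" by (auto simp: bounded_iff)
  show ?thesis
  proof (rule tight_minimizing_sequence[OF Am lb u(1) u(2)])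
    show "\<exists>n0. \<forall>n\<ge>n0. energy A (u n) \<le> ennreal (level A + \<tau>)" if "0 < \<tau>" for \<tau> by (rule u(3)[OF that])
  next
    fix \<epsilon> :: real assume "0 < \<epsilon>"
    then obtain R n0 where R: "\<And>n. n0 \<le> n \<Longrightarrow> massp (- ball (\<xi> n) R) (u n) \<le> ennreal \<epsilon>"
      using u(4) by blast
    have "massp (- ball 0 (R + b)) (u n) \<le> ennreal \<epsilon>" if "n0 \<le> n" for n
    proof -
      have "- ball 0 (R + b) \<subseteq> - ball (\<xi> n) R"
      proof (rule subsetI)
        fix y :: "real^3" assume "y \<in> - ball 0 (R + b)"
        then show "y \<in> - ball (\<xi> n) R" using b[of n] norm_triangle_ineq[of "\<xi> n" "y - \<xi> n"]
          by (simp add: dist_norm norm_minus_commute)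
      qed
      then have "massp (- ball 0 (R + b)) (u n)
         \<le> massp (- ball (\<xi> n) R) (u n)"
        by (intro nn_integral_mono mult_left_mono) (auto simp: indicator_def)
      then show ?thesis using R[OF that] by (rule order_trans)
    qed
    then show "\<exists>R n0. \<forall>n\<ge>n0. massp (- ball 0 R) (u n) \<le> ennreal \<epsilon>" by blast
  qed (rule that)
qed

end

section \<open>Existence of a weak solution\<close>

theorem theorem5p4:
  fixes s m p :: real and A :: "real^3 \<Rightarrow> real^3"
  assumes "0 < s" and "s < 1" and "0 < m"
    and "2 < p" and "p < 6 / (3 - 2 * s)"
    and "(\<exists>M :: real^3^3. transpose M = M \<and> (\<forall>x. A x = M *v x))
       \<or> (continuous_on UNIV A \<and> locally_bounded_gradient A \<and> assumption_Ab A
          \<and> (\<exists>A\<^sub>\<Xi> :: (nat \<Rightarrow> real^3) \<Rightarrow> real^3 \<Rightarrow> real^3.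
                (\<forall>\<Xi>\<in>unbounded_seqs. limit_field A \<Xi> (A\<^sub>\<Xi> \<Xi>))
                \<and> min_level s m p A < (INF \<Xi>\<in>unbounded_seqs. min_level s m p (A\<^sub>\<Xi> \<Xi>))))"
  shows "\<exists>u. weak_solution s m p A u \<and> \<not> (AE x in lborel. u x = 0)"
proof -
  interpret mag_setting s m p using assms by unfold_locales
  have cont: "continuous_on UNIV A"
    using assms(6)
  proof
    assume "\<exists>M :: real^3^3. transpose M = M \<and> (\<forall>x. A x = M *v x)"
    then obtain M :: "real^3^3" where "A = (*v) M" by auto
    then show ?thesis by (simp add: matrix_vector_mult_linear_continuous_on)
  qed auto
  have Am: "A \<in> borel_measurable borel" using cont by (rule borel_measurable_continuous_onI)
  have lb: "locally_bounded A" by (rule continuous_locally_bounded[OF cont])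
  obtain U where U: "U \<in> mag_sobolev s m A" "pmass U = 1" "energy A U \<le> ennreal (level A)"
    using assms(6)
  proof
    assume "\<exists>M :: real^3^3. transpose M = M \<and> (\<forall>x. A x = M *v x)"
    then obtain M :: "real^3^3" where M: "\<And>x. A x = M *v x" by auto
    have "\<exists>h. \<forall>x. A (x + \<xi>) + h = A x" for \<xi>
      by (intro exI[of _ "- (M *v \<xi>)"]) (simp add: M matrix_vector_right_distrib)
    then show thesis by (rule translation_covariant_minimizer[OF Am lb]) (rule that)
  next
    assume "continuous_on UNIV A \<and> locally_bounded_gradient A \<and> assumption_Ab A
          \<and> (\<exists>A\<^sub>\<Xi> :: (nat \<Rightarrow> real^3) \<Rightarrow> real^3 \<Rightarrow> real^3.
                (\<forall>\<Xi>\<in>unbounded_seqs. limit_field A \<Xi> (A\<^sub>\<Xi> \<Xi>))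
                \<and> min_level s m p A < (INF \<Xi>\<in>unbounded_seqs. min_level s m p (A\<^sub>\<Xi> \<Xi>)))"
    then obtain B where "\<forall>\<Xi>\<in>unbounded_seqs. limit_field A \<Xi> (B \<Xi>)" "level A < (INF \<Xi>\<in>unbounded_seqs. level (B \<Xi>))"
      by blast
    then show thesis by (rule energy_gap_minimizer[OF cont]) (rule that)
  qed
  show ?thesis by (rule minimizer_gives_weak_solution[OF Am U level_pos[OF Am lb]])
qed

end
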